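(* Let $0<\delta<1$, $\theta_\delta=\min(1/4,\delta/2)$, and $0<T\le1$. Let $C_\delta>0$ be the constant, depending only on $\delta$, of the multilinear estimate recalled in the context. Assume that $V,V'\in L^2_t([0,T];H^{-1/2+\delta}_x(\mathbb{R}))$ (complex-valued) satisfy $$C_\delta T^{\theta_\delta}\max\left(\|V\|_{L^2_t([0,T];H^{-1/2+\delta}_x(\mathbb{R}))},\|V'\|_{L^2_t([0,T];H^{-1/2+\delta}_x(\mathbb{R}))}\right)\le\frac12 .$$ Then for every $\phi\in L^2(\mathbb{R})$, $$\left\||S_V(t)\phi|^2\right\|_{L^2_t([0,T];H^{1/2}_x(\mathbb{R}))}\le4\|\phi\|_{L^2(\mathbb{R})}^2$$ and $$\left\||S_V(t)\phi|^2-|S_{V'}(t)\phi|^2\right\|_{L^2_t([0,T];H^{1/2}_x(\mathbb{R}))}\le16\,C_\delta T^{\theta_\delta}\|V-V'\|_{L^2_t([0,T];H^{-1/2+\delta}_x(\mathbb{R}))}\|\phi\|_{L^2(\mathbb{R})}^2 .$$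
   Context: $S(t)=e^{it\partial_x^2}$ is the free Schrödinger propagator (Fourier multiplier with symbol $e^{-it\xi^2}$). For $s\le t$ and complex-valued $V_1,\dots,V_n$ (acting as multiplication operators), let $W^{(0)}(t,s)=\mathrm{Id}$ and $$W^{(n)}_{V_1,\dots,V_n}(t,s)=(-i)^n\int_s^tdt_1\int_s^{t_1}dt_2\cdots\int_s^{t_{n-1}}dt_n\,S(t_1)^*V_1(t_1)S(t_1)\cdots S(t_n)^*V_n(t_n)S(t_n),$$ $W_V^{(n)}=W^{(n)}_{V,\dots,V}$, $W^{(n)}_{V_1,\dots,V_n}(t)=W^{(n)}_{V_1,\dots,V_n}(t,0)$. For $V_j\in L^2_t([s,t];H^{-1/2+\delta}_x)$ these bounded operators on $L^2(\mathbb{R})$ are understood as the continuous multilinear extension from $V_j\in C_c^\infty([s,t]\times\mathbb{R})$. Constant $C_\delta$: a constant depending only on $\delta$ such that, for all $0<T\le1$, $n,m\ge0$, $V_j,V_k'\in L^2_t([0,T];H^{-1/2+\delta}_x)$ and $f,g\in L^2(\mathbb{R})$, $$\left\|S(t)W^{(n)}_{V_1,\dots,V_n}(t)f\cdot\overline{S(t)W^{(m)}_{V'_1,\dots,V'_m}(t)g}\right\|_{L^2_t([0,T];H^{1/2}_x)}\le C_\delta^{n+m}T^{(n+m)\theta_\delta}\prod_{j=1}^n\|V_j\|_{L^2_t([0,T];H^{-1/2+\delta}_x)}\prod_{k=1}^m\|V'_k\|_{L^2_t([0,T];H^{-1/2+\delta}_x)}\|f\|_{L^2}\|g\|_{L^2}.$$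 Propagator: $S_V(t)=S_V(t,0)$, where $S_V(t,s)$ is formally the propagator of $i\partial_tu+\partial_x^2u-V(t,x)u=0$. On an interval $[a,b]$ of length at most $1$ on which $|b-a|^{\theta_\delta}\|V\|_{L^2_t([a,b];H^{-1/2+\delta}_x)}$ is sufficiently small (depending only on $\delta$), it is given by the series $S_V(t,s)=S(t-s)+S(t)\sum_{n\ge1}W^{(n)}_V(t,s)S(s)^*$, $a\le s\le t\le b$, absolutely convergent in operator norm on $L^2(\mathbb{R})$; in general it is the composition of such operators along a sufficiently fine partition of $[s,t]$ (independent of the partition). *)

theory Defs
  imports "HOL-Analysis.Analysis"
begin

section \<open>The Hilbert space of square-integrable functions on the line\<close>

definition sq_integrable :: "(real \<Rightarrow> complex) \<Rightarrow> bool" where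
  "sq_integrable f \<longleftrightarrow>
     f \<in> borel_measurable borel \<and> integrable lborel (\<lambda>x. (cmod (f x))\<^sup>2)"

lemma sq_integrable_zero: "sq_integrable (\<lambda>x. 0)"
  by (simp add: sq_integrable_def)

lemma sq_integrable_scaleR: "sq_integrable f \<Longrightarrow> sq_integrable (\<lambda>x. r *\<^sub>R f x)"
  by (auto simp: sq_integrable_def power_mult_distrib)

lemma sq_integrable_uminus: "sq_integrable f \<Longrightarrow> sq_integrable (\<lambda>x. - f x)"
  by (auto simp: sq_integrable_def)

lemma sq_integrable_add:
  assumes "sq_integrable f" "sq_integrable g"
  shows "sq_integrable (\<lambda>x. f x + g x)"
proof -
  have [measurable]: "f \<in> borel_measurable borel" "g \<in> borel_measurable borel"
    using assms by (auto simp: sq_integrable_def)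
  have *: "(cmod (f x + g x))\<^sup>2 \<le> 2 * (cmod (f x))\<^sup>2 + 2 * (cmod (g x))\<^sup>2" for x
  proof -
    have "(cmod (f x + g x))\<^sup>2 \<le> (cmod (f x) + cmod (g x))\<^sup>2"
      by (intro power_mono norm_triangle_ineq) auto
    also have "\<dots> \<le> 2 * (cmod (f x))\<^sup>2 + 2 * (cmod (g x))\<^sup>2"
      using sum_squares_ge_zero[of "cmod (f x) - cmod (g x)" 0]
      by (simp add: power2_eq_square algebra_simps)
    finally show ?thesis .
  qed
  have "integrable lborel (\<lambda>x. 2 * (cmod (f x))\<^sup>2 + 2 * (cmod (g x))\<^sup>2)"
    using assms by (auto simp: sq_integrable_def)
  then have "integrable lborel (\<lambda>x. (cmod (f x + g x))\<^sup>2)"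
    by (rule Bochner_Integration.integrable_bound) (use * in auto)
  then show ?thesis by (simp add: sq_integrable_def)
qed

lemma sq_integrable_mult:
  assumes "sq_integrable f" "sq_integrable g"
  shows "integrable lborel (\<lambda>x. f x * cnj (g x))"
proof -
  have [measurable]: "f \<in> borel_measurable borel" "g \<in> borel_measurable borel"
    using assms by (auto simp: sq_integrable_def)
  have *: "cmod (f x * cnj (g x)) \<le> (cmod (f x))\<^sup>2 + (cmod (g x))\<^sup>2" for x
  proof -
    have "2 * (cmod (f x) * cmod (g x)) \<le> (cmod (f x))\<^sup>2 + (cmod (g x))\<^sup>2"
      using sum_squares_ge_zero[of "cmod (f x) - cmod (g x)" 0]
      by (simp add: power2_eq_square algebra_simps)
    moreover have "0 \<le> cmod (f x) * cmod (g x)" by simp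
    ultimately have "cmod (f x) * cmod (g x) \<le> (cmod (f x))\<^sup>2 + (cmod (g x))\<^sup>2"
      by linarith
    then show ?thesis by (simp add: norm_mult)
  qed
  have "integrable lborel (\<lambda>x. (cmod (f x))\<^sup>2 + (cmod (g x))\<^sup>2)"
    using assms by (auto simp: sq_integrable_def)
  moreover have "(\<lambda>x. f x * cnj (g x)) \<in> borel_measurable lborel"
    by (intro borel_measurable_times measurable_compose[OF _ borel_measurable_continuous_onI[of cnj]])
       (auto intro!: continuous_intros)
  ultimately show ?thesis
    by (rule Bochner_Integration.integrable_bound) (use * in auto)
qed

quotient_type L2 = "real \<Rightarrow> complex" / partial:
  "\<lambda>f g. sq_integrable f \<and> sq_integrable g \<and> (AE x in lborel. f x = g x)"
proof (rule part_equivpI)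
  show "\<exists>f. sq_integrable f \<and> sq_integrable f \<and> (AE x in lborel. f x = f x)"
    using sq_integrable_zero by auto
  show "symp (\<lambda>f g. sq_integrable f \<and> sq_integrable g \<and> (AE x in lborel. f x = g x))"
    by (auto simp: symp_def elim: AE_mp)
  show "transp (\<lambda>f g. sq_integrable f \<and> sq_integrable g \<and> (AE x in lborel. f x = g x))"
    unfolding transp_def by (auto elim!: AE_mp)
qed

text \<open>The inner product is the real part of the complex one; it has the same norm, and the same
  adjoints of complex-linear operators.\<close>

instantiation L2 :: real_inner
begin

lift_definition zero_L2 :: L2 is "\<lambda>x. 0"
  by (simp add: sq_integrable_zero)

lift_definition plus_L2 :: "L2 \<Rightarrow> L2 \<Rightarrow> L2" is "\<lambda>f g x. f x + g x"
  by (auto intro: sq_integrable_add elim!: AE_mp)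

lift_definition uminus_L2 :: "L2 \<Rightarrow> L2" is "\<lambda>f x. - f x"
  by (auto intro: sq_integrable_uminus elim!: AE_mp)

definition minus_L2 :: "L2 \<Rightarrow> L2 \<Rightarrow> L2" where
  "minus_L2 f g = f + - g"

lift_definition scaleR_L2 :: "real \<Rightarrow> L2 \<Rightarrow> L2" is "\<lambda>r f x. r *\<^sub>R f x"
  by (auto intro: sq_integrable_scaleR elim!: AE_mp)

lift_definition inner_L2 :: "L2 \<Rightarrow> L2 \<Rightarrow> real" is
  "\<lambda>f g. Re (LINT x|lborel. f x * cnj (g x))"
proof -
  fix f f' g g' :: "real \<Rightarrow> complex"
  assume f: "sq_integrable f \<and> sq_integrable f' \<and> (AE x in lborel. f x = f' x)"
    and g: "sq_integrable g \<and> sq_integrable g' \<and> (AE x in lborel. g x = g' x)"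
  have "(LINT x|lborel. f x * cnj (g x)) = (LINT x|lborel. f' x * cnj (g' x))"
    using f g sq_integrable_mult[of f g] sq_integrable_mult[of f' g']
    by (intro integral_cong_AE) (auto elim!: AE_mp)
  then show "Re (LINT x|lborel. f x * cnj (g x)) = Re (LINT x|lborel. f' x * cnj (g' x))"
    by simp
qed

definition norm_L2 :: "L2 \<Rightarrow> real" where
  "norm_L2 f = sqrt (inner f f)"

definition dist_L2 :: "L2 \<Rightarrow> L2 \<Rightarrow> real" where
  "dist_L2 f g = norm (f - g)"

definition sgn_L2 :: "L2 \<Rightarrow> L2" where
  "sgn_L2 f = inverse (norm f) *\<^sub>R f"

definition uniformity_L2 :: "(L2 \<times> L2) filter" where
  "uniformity_L2 = (INF e\<in>{0 <..}. principal {(x, y). dist x y < e})"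

definition open_L2 :: "L2 set \<Rightarrow> bool" where
  "open_L2 U \<longleftrightarrow> (\<forall>x\<in>U. eventually (\<lambda>(x', y). x' = x \<longrightarrow> y \<in> U) uniformity)"

instance
proof
  fix f g h :: L2 and r q :: real and U :: "L2 set"
  show "f + g + h = f + (g + h)"
    by transfer (auto intro!: sq_integrable_add simp: add.assoc)
  show "f + g = g + f"
    by transfer (auto intro!: sq_integrable_add simp: add.commute)
  show "0 + f = f" by transfer auto
  show "- f + f = 0" by transfer (auto simp: sq_integrable_zero)
  show "f - g = f + - g" by (simp add: minus_L2_def)
  show "r *\<^sub>R (f + g) = r *\<^sub>R f + r *\<^sub>R g"
    by transfer (auto intro!: sq_integrable_add sq_integrable_scaleR simp: scaleR_add_right
        simp del: scaleR_conv_of_real)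
  show "(r + q) *\<^sub>R f = r *\<^sub>R f + q *\<^sub>R f"
    by transfer (auto intro!: sq_integrable_add sq_integrable_scaleR simp: scaleR_add_left
        simp del: scaleR_conv_of_real)
  show "r *\<^sub>R q *\<^sub>R f = (r * q) *\<^sub>R f"
    by transfer (auto intro!: sq_integrable_scaleR)
  show "1 *\<^sub>R f = f" by transfer auto
  show "dist f g = norm (f - g)" by (simp add: dist_L2_def)
  show "sgn f = inverse (norm f) *\<^sub>R f" by (simp add: sgn_L2_def)
  show "uniformity = (INF e\<in>{0 <..}. principal {(x, y :: L2). dist x y < e})"
    by (simp add: uniformity_L2_def)
  show "open U \<longleftrightarrow> (\<forall>x\<in>U. eventually (\<lambda>(x', y). x' = x \<longrightarrow> y \<in> U) uniformity)"
    by (simp add: open_L2_def)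
  show "inner f g = inner g f"
  proof transfer
    fix f g :: "real \<Rightarrow> complex"
    have "(LINT x|lborel. g x * cnj (f x)) = cnj (LINT x|lborel. f x * cnj (g x))"
      by (simp add: mult.commute flip: Bochner_Integration.integral_cnj)
    then show "Re (LINT x|lborel. f x * cnj (g x)) = Re (LINT x|lborel. g x * cnj (f x))"
      by simp
  qed
  show "inner (f + g) h = inner f h + inner g h"
    by transfer (auto simp: sq_integrable_mult distrib_right)
  show "inner (r *\<^sub>R f) g = r * inner f g"
    by transfer (auto simp: sq_integrable_mult mult.assoc scaleR_conv_of_real)
  have *: "(LINT x|lborel. u x * cnj (u x)) = complex_of_real (LINT x|lborel. (cmod (u x))\<^sup>2)" for u
    by (simp add: complex_mult_cnj cmod_power2 flip: integral_complex_of_real)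
  show "0 \<le> inner f f"
    by transfer (simp add: *)
  show "inner f f = 0 \<longleftrightarrow> f = 0"
    by transfer (auto simp: * sq_integrable_zero sq_integrable_def integral_nonneg_eq_0_iff_AE)
  show "norm f = sqrt (inner f f)" by (simp add: norm_L2_def)
qed

end

text \<open>Pointwise multiplication, meaningful for bounded measurable multipliers.\<close>

definition mult_op :: "(real \<Rightarrow> complex) \<Rightarrow> L2 \<Rightarrow> L2" where
  "mult_op m f = abs_L2 (\<lambda>x. m x * rep_L2 f x)"


section \<open>Schwartz functions, distributions and the Fourier transform\<close>

definition schwartz :: "(real \<Rightarrow> complex) set" where
  "schwartz = {\<phi>. \<exists>D. D 0 = \<phi> \<and>
     (\<forall>n x. (D n has_vector_derivative D (Suc n) x) (at x)) \<and>
     (\<forall>k n. bounded (range (\<lambda>x. complex_of_real (x ^ k) * D n x)))}"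

definition fourier :: "(real \<Rightarrow> complex) \<Rightarrow> real \<Rightarrow> complex" where
  "fourier \<phi> \<xi> = complex_of_real (1 / sqrt (2 * pi)) * (LINT x|lborel. \<phi> x * cis (- (\<xi> * x)))"

text \<open>A distribution is a functional of which only the values on \<^const>\<open>schwartz\<close> matter.\<close>

type_synonym distr = "(real \<Rightarrow> complex) \<Rightarrow> complex"

definition distr_of :: "(real \<Rightarrow> complex) \<Rightarrow> distr" where
  "distr_of f = (\<lambda>\<phi>. LINT x|lborel. f x * \<phi> x)"

text \<open>The distribution \<open>u\<close> has as its Fourier transform the function \<open>v\<close>.\<close>

definition has_fourier :: "distr \<Rightarrow> (real \<Rightarrow> complex) \<Rightarrow> bool" where
  "has_fourier u v \<longleftrightarrow> v \<in> borel_measurable borel \<and>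
     (\<forall>\<phi>\<in>schwartz. integrable lborel (\<lambda>\<xi>. v \<xi> * \<phi> \<xi>) \<and>
        u (fourier \<phi>) = (LINT \<xi>|lborel. v \<xi> * \<phi> \<xi>))"

text \<open>Linearity and continuity of a functional \<open>u\<close> in the Sobolev space need not be demanded: on
  Schwartz functions they follow from the formula for \<open>u (fourier \<phi>)\<close>, since \<^const>\<open>fourier\<close> is an
  automorphism of the Schwartz space. The transform \<open>v\<close> is determined almost everywhere.\<close>

definition Hs :: "real \<Rightarrow> distr set" where
  "Hs s = {u. \<exists>v. has_fourier u v \<and> integrable lborel (\<lambda>\<xi>. (1 + \<xi>\<^sup>2) powr s * (cmod (v \<xi>))\<^sup>2)}"

definition Hs_norm :: "real \<Rightarrow> distr \<Rightarrow> real" where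
  "Hs_norm s u =
     sqrt (LINT \<xi>|lborel. (1 + \<xi>\<^sup>2) powr s * (cmod ((SOME v. has_fourier u v) \<xi>))\<^sup>2)"

text \<open>The space of square-integrable functions on \<open>[a,b]\<close> with values in \<^term>\<open>Hs s\<close>.
  Measurability in time is that of the spatial Fourier transform as a function of both
  variables. As \<open>V\<close> is only controlled for almost every \<open>t\<close>, the norm is an integral over the
  complete measure \<^const>\<open>lebesgue\<close>.\<close>

definition L2Hs :: "real \<Rightarrow> real \<Rightarrow> real \<Rightarrow> (real \<Rightarrow> distr) set" where
  "L2Hs s a b = {V. \<exists>w \<in> borel_measurable borel.
     (AE t in lborel. t \<in> {a..b} \<longrightarrow> V t \<in> Hs s \<and> has_fourier (V t) (\<lambda>\<xi>. w (t, \<xi>))) \<and>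
     set_integrable lborel ({a..b} \<times> UNIV) (\<lambda>(t, \<xi>). (1 + \<xi>\<^sup>2) powr s * (cmod (w (t, \<xi>)))\<^sup>2)}"

definition L2Hs_norm :: "real \<Rightarrow> real \<Rightarrow> real \<Rightarrow> (real \<Rightarrow> distr) \<Rightarrow> real" where
  "L2Hs_norm s a b V = sqrt (LINT t:{a..b}|lebesgue. (Hs_norm s (V t))\<^sup>2)"


section \<open>The free propagator\<close>

definition L2_fourier :: "L2 \<Rightarrow> L2" where
  "L2_fourier f = (THE g. has_fourier (distr_of (rep_L2 f)) (rep_L2 g))"

definition free_prop :: "real \<Rightarrow> L2 \<Rightarrow> L2" where
  "free_prop t f = inv L2_fourier (mult_op (\<lambda>\<xi>. cis (- (t * \<xi>\<^sup>2))) (L2_fourier f))"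


section \<open>The multilinear Dyson operators\<close>

text \<open>Restrictions to \<open>[s,t] \<times> \<real>\<close> of the following functions of time and space make up
  the smooth functions of compact support on that strip.\<close>

definition Cc_infinity :: "(real \<Rightarrow> real \<Rightarrow> complex) set" where
  "Cc_infinity = {v.
     (\<exists>D. D 0 0 = v \<and>
        (\<forall>i j. continuous_on UNIV (\<lambda>(t, x). D i j t x)) \<and>
        (\<forall>i j t x. ((\<lambda>\<tau>. D i j \<tau> x) has_vector_derivative D (Suc i) j t x) (at t)) \<and>
        (\<forall>i j t x. (D i j t has_vector_derivative D i (Suc j) t x) (at x))) \<and>
     (\<exists>R. \<forall>t x. v t x \<noteq> 0 \<longrightarrow> \<bar>t\<bar> \<le> R \<and> \<bar>x\<bar> \<le> R)}"

text \<open>The iterated integral, for smooth potentials. The factors \<open>-i\<close> and the operators depending on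
  the outer time variables stand in front of the inner integrals.\<close>

fun W_smooth :: "(real \<Rightarrow> real \<Rightarrow> complex) list \<Rightarrow> real \<Rightarrow> real \<Rightarrow> L2 \<Rightarrow> L2" where
  "W_smooth [] t s f = f"
| "W_smooth (v # vs) t s f =
     mult_op (\<lambda>x. - \<i>)
       (integral {s..t} (\<lambda>\<tau>.
          adjoint (free_prop \<tau>) (mult_op (v \<tau>) (free_prop \<tau> (W_smooth vs \<tau> s f)))))"

definition represents ::
  "real \<Rightarrow> real \<Rightarrow> (real \<Rightarrow> real \<Rightarrow> complex) list \<Rightarrow> (real \<Rightarrow> distr) list \<Rightarrow> bool" where
  "represents s t vs Vs \<longleftrightarrow>
     list_all2 (\<lambda>v V. v \<in> Cc_infinity \<and>
       (AE \<tau> in lborel. \<tau> \<in> {s..t} \<longrightarrow> (\<forall>\<phi>\<in>schwartz. V \<tau> \<phi> = distr_of (v \<tau>) \<phi>))) vs Vs"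

definition approximates ::
  "real \<Rightarrow> real \<Rightarrow> real \<Rightarrow> (nat \<Rightarrow> (real \<Rightarrow> real \<Rightarrow> complex) list) \<Rightarrow> (real \<Rightarrow> distr) list \<Rightarrow> bool" where
  "approximates r s t X Vs \<longleftrightarrow>
     (\<forall>k. length (X k) = length Vs \<and> set (X k) \<subseteq> Cc_infinity) \<and>
     (\<forall>j<length Vs.
        (\<lambda>k. L2Hs_norm r s t (\<lambda>\<tau> \<phi>. distr_of ((X k ! j) \<tau>) \<phi> - (Vs ! j) \<tau> \<phi>)) \<longlonglongrightarrow> 0)"

text \<open>The extension by continuity of \<^const>\<open>W_smooth\<close> to potentials in
  \<^term>\<open>L2Hs (- 1 / 2 + \<delta>) s t\<close>: the iterated integral for smooth potentials, and otherwise the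
  common limit along all approximating sequences of smooth ones.\<close>

definition W :: "real \<Rightarrow> (real \<Rightarrow> distr) list \<Rightarrow> real \<Rightarrow> real \<Rightarrow> L2 \<Rightarrow> L2" where
  "W \<delta> Vs t s f =
     (if \<exists>vs. represents s t vs Vs
      then W_smooth (SOME vs. represents s t vs Vs) t s f
      else (THE g. \<forall>X. approximates (- 1 / 2 + \<delta>) s t X Vs \<longrightarrow>
                         (\<lambda>k. W_smooth (X k) t s f) \<longlonglongrightarrow> g))"

definition theta :: "real \<Rightarrow> real" where
  "theta \<delta> = min (1 / 4) (\<delta> / 2)"

definition pair_density :: "L2 \<Rightarrow> L2 \<Rightarrow> distr" where
  "pair_density f g = distr_of (\<lambda>x. rep_L2 f x * cnj (rep_L2 g x))"

definition multilinear_estimate :: "real \<Rightarrow> real \<Rightarrow> bool" where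
  "multilinear_estimate \<delta> C \<longleftrightarrow>
     (\<forall>T Vs Vs' f g. 0 < T \<and> T \<le> 1 \<and>
        set Vs \<subseteq> L2Hs (- 1 / 2 + \<delta>) 0 T \<and> set Vs' \<subseteq> L2Hs (- 1 / 2 + \<delta>) 0 T \<longrightarrow>
        (let \<rho> = (\<lambda>t. pair_density (free_prop t (W \<delta> Vs t 0 f)) (free_prop t (W \<delta> Vs' t 0 g)));
             n = length Vs; m = length Vs'
         in \<rho> \<in> L2Hs (1 / 2) 0 T \<and>
            L2Hs_norm (1 / 2) 0 T \<rho> \<le>
              C ^ (n + m) * T powr (real (n + m) * theta \<delta>) *
              (\<Prod>V\<leftarrow>Vs. L2Hs_norm (- 1 / 2 + \<delta>) 0 T V) *
              (\<Prod>V\<leftarrow>Vs'. L2Hs_norm (- 1 / 2 + \<delta>) 0 T V) * norm f * norm g))"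


section \<open>The propagator with a potential\<close>

text \<open>Thresholds \<open>\<epsilon>\<close>, depending on \<open>\<delta>\<close> only, below which the Dyson series converges absolutely in
  operator norm.\<close>

definition dyson_threshold :: "real \<Rightarrow> real \<Rightarrow> bool" where
  "dyson_threshold \<delta> \<epsilon> \<longleftrightarrow> 0 < \<epsilon> \<and>
     (\<forall>a b V. a \<le> b \<and> b - a \<le> 1 \<and> V \<in> L2Hs (- 1 / 2 + \<delta>) a b \<and>
        (b - a) powr theta \<delta> * L2Hs_norm (- 1 / 2 + \<delta>) a b V \<le> \<epsilon> \<longrightarrow>
        (\<forall>s t. a \<le> s \<and> s \<le> t \<and> t \<le> b \<longrightarrow>
           (\<forall>n. bounded_linear (W \<delta> (replicate n V) t s)) \<and>
           summable (\<lambda>n. onorm (W \<delta> (replicate n V) t s))))"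

definition dyson_small :: "real \<Rightarrow> (real \<Rightarrow> distr) \<Rightarrow> real \<Rightarrow> real \<Rightarrow> bool" where
  "dyson_small \<delta> V a b \<longleftrightarrow>
     a \<le> b \<and> b - a \<le> 1 \<and> V \<in> L2Hs (- 1 / 2 + \<delta>) a b \<and>
     (\<exists>\<epsilon>. dyson_threshold \<delta> \<epsilon> \<and>
        (b - a) powr theta \<delta> * L2Hs_norm (- 1 / 2 + \<delta>) a b V \<le> \<epsilon>)"

definition dyson_series :: "real \<Rightarrow> (real \<Rightarrow> distr) \<Rightarrow> real \<Rightarrow> real \<Rightarrow> L2 \<Rightarrow> L2" where
  "dyson_series \<delta> V t s f = free_prop (t - s) f +
     free_prop t (\<Sum>n. W \<delta> (replicate (Suc n) V) t s (adjoint (free_prop s) f))"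

fun dyson_compose :: "real \<Rightarrow> (real \<Rightarrow> distr) \<Rightarrow> real list \<Rightarrow> L2 \<Rightarrow> L2" where
  "dyson_compose \<delta> V (a # b # ts) f = dyson_compose \<delta> V (b # ts) (dyson_series \<delta> V b a f)"
| "dyson_compose \<delta> V _ f = f"

definition small_partition :: "real \<Rightarrow> (real \<Rightarrow> distr) \<Rightarrow> real \<Rightarrow> real \<Rightarrow> real list \<Rightarrow> bool" where
  "small_partition \<delta> V s t ts \<longleftrightarrow> ts \<noteq> [] \<and> hd ts = s \<and> last ts = t \<and>
     (\<forall>i. Suc i < length ts \<longrightarrow> dyson_small \<delta> V (ts ! i) (ts ! Suc i))"

text \<open>The propagator from time \<open>s\<close> to time \<open>t\<close>.\<close>

definition schroedinger_prop :: "real \<Rightarrow> (real \<Rightarrow> distr) \<Rightarrow> real \<Rightarrow> real \<Rightarrow> L2 \<Rightarrow> L2" where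
  "schroedinger_prop \<delta> V t s =
     (if dyson_small \<delta> V s t then dyson_series \<delta> V t s
      else dyson_compose \<delta> V (SOME ts. small_partition \<delta> V s t ts))"

definition position_density :: "L2 \<Rightarrow> distr" where
  "position_density f = distr_of (\<lambda>x. complex_of_real ((cmod (rep_L2 f x))\<^sup>2))"

end

theory Submission
  imports Defs "HOL-Probability.Probability"
begin

text \<open>Under the smallness hypothesis the propagator is given on \<open>[0, T]\<close> by its Dyson series. The
  multilinear estimate bounds the density of the pair formed by the terms of orders \<open>n\<close> and \<open>m\<close> by
  \<open>(1/2)\<^sup>n (1/2)\<^sup>m \<parallel>\<phi>\<parallel>\<^sup>2\<close>, and the double series sums to \<open>4 \<parallel>\<phi>\<parallel>\<^sup>2\<close>. The difference of the densities is that of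
  the pair \<open>(u - u', u)\<close> plus that of \<open>(u', u - u')\<close>. The term of order \<open>n + 1\<close> of \<open>u - u'\<close>
  telescopes into \<open>n + 1\<close> terms with one factor \<open>V - V'\<close>, and \<open>\<Sum>n. (n + 1) (1/2)\<^sup>n = 4\<close>, so that each of
  the two pairs contributes the constant \<open>4 * 2\<close>.

  That the Dyson operators are well defined for rough potentials, multilinear and absolutely summable
  also follows from the multilinear estimate, applied to smooth potentials: by duality it bounds
  the operator norms, and smooth potentials of compact support are dense. Plancherel's theorem makes
  the free propagator a strongly continuous unitary group.\<close>

section \<open>Square-integrable functions over a measure space\<close>

text \<open>The definition of \<open>W\<close> shapes the proof. For rough potentials it is
  \<open>THE\<close> common limit along all approximating sequences, and nothing can be said about
  it before such sequences are known to exist, to converge, and to share their limit. The assumed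
  estimate itself speaks about \<open>W\<close>, but for smooth potentials \<open>W\<close> is
  \<open>W_smooth\<close>, so that the operator bounds behind the convergence can be drawn from it
  without circularity. The estimate covers only intervals that start at time 0, whereas
  \<open>dyson_threshold\<close> asks about every \<open>[s, t]\<close> inside
  \<open>[a, b]\<close>; a translation in time, conjugated by the free group, closes this gap. Two
  notions of convergence then have to be reconciled: the Dyson series converges in \<open>L2\<close>
  at each single time, the estimates hold in \<open>L2Hs\<close>, and the functionals that make up
  \<open>L2Hs\<close> are compared only on transforms of Schwartz functions. Everything is therefore
  carried out for the space-time transforms, as square-integrable functions for a weighted measure
  on a strip, and the two limits are identified at almost every time by testing against Schwartz
  functions.\<close>

definition sqint :: "'a measure \<Rightarrow> ('a \<Rightarrow> complex) \<Rightarrow> bool" where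
  "sqint M f \<longleftrightarrow> f \<in> borel_measurable M \<and> integrable M (\<lambda>x. (cmod (f x))\<^sup>2)"

definition l2norm :: "'a measure \<Rightarrow> ('a \<Rightarrow> complex) \<Rightarrow> real" where
  "l2norm M f = sqrt (LINT x|M. (cmod (f x))\<^sup>2)"

lemma sqint_measurable: "sqint M f \<Longrightarrow> f \<in> borel_measurable M"
  by (simp add: sqint_def)

lemma l2norm_nonneg: "0 \<le> l2norm M f"
  by (simp add: l2norm_def)

lemma l2norm_power2: "(l2norm M f)\<^sup>2 = (LINT x|M. (cmod (f x))\<^sup>2)"
  by (simp add: l2norm_def)

lemma sqint_bound:
  assumes "sqint M g" "f \<in> borel_measurable M" "AE x in M. cmod (f x) \<le> cmod (g x)"
  shows "sqint M f"
proof -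
  have [measurable]: "f \<in> borel_measurable M" by fact
  have "integrable M (\<lambda>x. (cmod (g x))\<^sup>2)" using assms by (simp add: sqint_def)
  then have "integrable M (\<lambda>x. (cmod (f x))\<^sup>2)"
    by (rule Bochner_Integration.integrable_bound)
       (use assms(3) in \<open>auto elim!: AE_mp intro!: AE_I2 power_mono\<close>)
  then show ?thesis by (simp add: sqint_def)
qed

lemma l2norm_mono:
  assumes "sqint M g" "f \<in> borel_measurable M" "AE x in M. cmod (f x) \<le> cmod (g x)"
  shows "l2norm M f \<le> l2norm M g"
  using sqint_bound[OF assms] assms unfolding l2norm_def
  by (intro real_sqrt_le_mono integral_mono_AE) (auto simp: sqint_def elim!: AE_mp intro!: power_mono)

lemma sqint_cong_AE:
  assumes "sqint M g" "f \<in> borel_measurable M" "AE x in M. f x = g x"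
  shows "sqint M f" "l2norm M f = l2norm M g"
proof -
  show "sqint M f" by (rule sqint_bound[OF assms(1,2)]) (use assms(3) in auto)
  show "l2norm M f = l2norm M g"
    unfolding l2norm_def
    using assms by (intro arg_cong[where f = sqrt] integral_cong_AE) (auto simp: sqint_def)
qed

lemma sqint_zero [simp]: "sqint M (\<lambda>x. 0)"
  by (simp add: sqint_def)

lemma l2norm_zero [simp]: "l2norm M (\<lambda>x. 0) = 0"
  by (simp add: l2norm_def)

lemma sqint_add:
  assumes "sqint M f" "sqint M g"
  shows "sqint M (\<lambda>x. f x + g x)"
proof -
  have [measurable]: "f \<in> borel_measurable M" "g \<in> borel_measurable M"
    using assms by (auto simp: sqint_def)
  have *: "(cmod (f x + g x))\<^sup>2 \<le> 2 * (cmod (f x))\<^sup>2 + 2 * (cmod (g x))\<^sup>2" for x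
  proof -
    have "(cmod (f x + g x))\<^sup>2 \<le> (cmod (f x) + cmod (g x))\<^sup>2"
      by (intro power_mono norm_triangle_ineq) auto
    also have "\<dots> \<le> 2 * (cmod (f x))\<^sup>2 + 2 * (cmod (g x))\<^sup>2"
      using sum_squares_ge_zero[of "cmod (f x) - cmod (g x)" 0]
      by (simp add: power2_eq_square algebra_simps)
    finally show ?thesis .
  qed
  have "integrable M (\<lambda>x. 2 * (cmod (f x))\<^sup>2 + 2 * (cmod (g x))\<^sup>2)"
    using assms by (auto simp: sqint_def)
  then have "integrable M (\<lambda>x. (cmod (f x + g x))\<^sup>2)"
    by (rule Bochner_Integration.integrable_bound) (use * in auto)
  then show ?thesis by (simp add: sqint_def)
qed

lemma sqint_cmult: "sqint M f \<Longrightarrow> sqint M (\<lambda>x. c * f x)"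
  by (auto simp: sqint_def norm_mult power_mult_distrib)

lemma l2norm_cmult: "l2norm M (\<lambda>x. c * f x) = cmod c * l2norm M f"
  by (simp add: l2norm_def norm_mult power_mult_distrib real_sqrt_mult)

lemma sqint_diff: "sqint M f \<Longrightarrow> sqint M g \<Longrightarrow> sqint M (\<lambda>x. f x - g x)"
  using sqint_add[of M f "\<lambda>x. -1 * g x"] sqint_cmult[of M g "-1"] by simp

lemma sqint_sum: "(\<And>i. i \<in> I \<Longrightarrow> sqint M (f i)) \<Longrightarrow> sqint M (\<lambda>x. \<Sum>i\<in>I. f i x)"
  by (induction I rule: infinite_finite_induct) (auto intro: sqint_add)

lemma l2norm_minus_commute: "l2norm M (\<lambda>x. f x - g x) = l2norm M (\<lambda>x. g x - f x)"
  by (simp add: l2norm_def norm_minus_commute)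

lemma l2norm_eq_0D:
  assumes "sqint M f" "l2norm M f = 0" shows "AE x in M. f x = 0"
  using assms by (simp add: sqint_def l2norm_def integral_nonneg_eq_0_iff_AE)

lemma sqint_mult_integrable:
  assumes "sqint M f" "sqint M g"
  shows "integrable M (\<lambda>x. cmod (f x) * cmod (g x))" "integrable M (\<lambda>x. f x * g x)"
proof -
  have [measurable]: "f \<in> borel_measurable M" "g \<in> borel_measurable M"
    using assms by (auto simp: sqint_def)
  have *: "cmod (f x) * cmod (g x) \<le> (cmod (f x))\<^sup>2 + (cmod (g x))\<^sup>2" for x
  proof -
    have "2 * (cmod (f x) * cmod (g x)) \<le> (cmod (f x))\<^sup>2 + (cmod (g x))\<^sup>2"
      using sum_squares_ge_zero[of "cmod (f x) - cmod (g x)" 0]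
      by (simp add: power2_eq_square algebra_simps)
    moreover have "0 \<le> cmod (f x) * cmod (g x)" by simp
    ultimately show ?thesis by linarith
  qed
  have i: "integrable M (\<lambda>x. (cmod (f x))\<^sup>2 + (cmod (g x))\<^sup>2)"
    using assms by (auto simp: sqint_def)
  show "integrable M (\<lambda>x. cmod (f x) * cmod (g x))"
    by (rule Bochner_Integration.integrable_bound[OF i]) (use * in auto)
  show "integrable M (\<lambda>x. f x * g x)"
    by (rule Bochner_Integration.integrable_bound[OF i]) (use * in \<open>auto simp: norm_mult\<close>)
qed

text \<open>Integrates the weighted inequality between geometric and arithmetic mean, with weights
  that make each of the two integrals half of the product of the norms. The weights divide by both
  norms, so a vanishing norm is treated apart.\<close>

lemma l2norm_Cauchy_Schwarz:
  assumes f: "sqint M f" and g: "sqint M g"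
  shows "(LINT x|M. cmod (f x) * cmod (g x)) \<le> l2norm M f * l2norm M g"
proof -
  let ?a = "l2norm M f" and ?b = "l2norm M g"
  have [measurable]: "f \<in> borel_measurable M" "g \<in> borel_measurable M"
    using assms by (auto simp: sqint_def)
  show ?thesis
  proof (cases "?a = 0 \<or> ?b = 0")
    case True
    then have "AE x in M. cmod (f x) * cmod (g x) = 0"
      using l2norm_eq_0D[OF f] l2norm_eq_0D[OF g] by (auto elim!: AE_mp)
    then have "(LINT x|M. cmod (f x) * cmod (g x)) = (LINT x|M. 0)"
      by (intro integral_cong_AE) auto
    then show ?thesis using True by auto
  next
    case False
    then have pos: "?a > 0" "?b > 0" using l2norm_nonneg[of M] by (auto simp: less_le)
    have "cmod (f x) * cmod (g x) \<le> ?b / (2 * ?a) * (cmod (f x))\<^sup>2 + ?a / (2 * ?b) * (cmod (g x))\<^sup>2" for x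
    proof -
      have "0 \<le> (?b * cmod (f x) - ?a * cmod (g x))\<^sup>2 / (2 * ?a * ?b)"
        using pos by simp
      also have "\<dots> = ?b / (2 * ?a) * (cmod (f x))\<^sup>2 + ?a / (2 * ?b) * (cmod (g x))\<^sup>2 - cmod (f x) * cmod (g x)"
        using pos by (simp add: power2_eq_square field_simps)
      finally show ?thesis by simp
    qed
    then have "(LINT x|M. cmod (f x) * cmod (g x)) \<le>
       (LINT x|M. ?b / (2 * ?a) * (cmod (f x))\<^sup>2 + ?a / (2 * ?b) * (cmod (g x))\<^sup>2)"
      using f g sqint_mult_integrable[OF f g] by (intro integral_mono) (auto simp: sqint_def)
    also have "\<dots> = ?b / (2 * ?a) * ?a\<^sup>2 + ?a / (2 * ?b) * ?b\<^sup>2"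
      using f g by (simp add: sqint_def l2norm_power2)
    also have "\<dots> = ?a * ?b"
      using pos by (simp add: power2_eq_square field_simps)
    finally show ?thesis .
  qed
qed

lemma l2norm_integral_mult_le:
  assumes f: "sqint M f" and g: "sqint M g"
  shows "cmod (LINT x|M. f x * g x) \<le> l2norm M f * l2norm M g"
proof -
  have "cmod (LINT x|M. f x * g x) \<le> (LINT x|M. cmod (f x * g x))" by simp
  also have "\<dots> \<le> l2norm M f * l2norm M g"
    using l2norm_Cauchy_Schwarz[OF f g] by (simp add: norm_mult)
  finally show ?thesis .
qed

lemma l2norm_triangle:
  assumes f: "sqint M f" and g: "sqint M g"
  shows "l2norm M (\<lambda>x. f x + g x) \<le> l2norm M f + l2norm M g"
proof -
  have "(l2norm M (\<lambda>x. f x + g x))\<^sup>2 = (LINT x|M. (cmod (f x + g x))\<^sup>2)"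
    by (simp add: l2norm_power2)
  also have "\<dots> \<le> (LINT x|M. (cmod (f x))\<^sup>2 + 2 * (cmod (f x) * cmod (g x)) + (cmod (g x))\<^sup>2)"
  proof (intro integral_mono)
    show "integrable M (\<lambda>x. (cmod (f x + g x))\<^sup>2)"
      using sqint_add[OF f g] by (simp add: sqint_def)
    show "integrable M (\<lambda>x. (cmod (f x))\<^sup>2 + 2 * (cmod (f x) * cmod (g x)) + (cmod (g x))\<^sup>2)"
      using f g sqint_mult_integrable(1)[OF f g] by (auto simp: sqint_def)
    fix x
    have "(cmod (f x + g x))\<^sup>2 \<le> (cmod (f x) + cmod (g x))\<^sup>2"
      by (intro power_mono norm_triangle_ineq) auto
    then show "(cmod (f x + g x))\<^sup>2 \<le> (cmod (f x))\<^sup>2 + 2 * (cmod (f x) * cmod (g x)) + (cmod (g x))\<^sup>2"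
      by (simp add: power2_eq_square algebra_simps)
  qed
  also have "\<dots> = (l2norm M f)\<^sup>2 + 2 * (LINT x|M. cmod (f x) * cmod (g x)) + (l2norm M g)\<^sup>2"
    using f g sqint_mult_integrable(1)[OF f g] by (simp add: sqint_def l2norm_power2)
  also have "\<dots> \<le> (l2norm M f + l2norm M g)\<^sup>2"
    using l2norm_Cauchy_Schwarz[OF f g] by (simp add: power2_eq_square algebra_simps)
  finally show ?thesis
    by (rule power2_le_imp_le) (simp add: l2norm_nonneg)
qed

lemma l2norm_triangle_diff:
  assumes f: "sqint M f" and g: "sqint M g"
  shows "l2norm M (\<lambda>x. f x - g x) \<le> l2norm M f + l2norm M g"
  using l2norm_triangle[OF f sqint_cmult[OF g, of "-1"]] by (simp add: l2norm_cmult l2norm_def)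

lemma l2norm_diff_le:
  assumes f: "sqint M f" and g: "sqint M g"
  shows "\<bar>l2norm M f - l2norm M g\<bar> \<le> l2norm M (\<lambda>x. f x - g x)"
  using l2norm_triangle[OF sqint_diff[OF f g] g] l2norm_triangle[OF sqint_diff[OF g f] f]
  by (simp add: l2norm_minus_commute[of M g f])

lemma l2norm_diff_triangle:
  assumes "sqint M f" "sqint M g" "sqint M h"
  shows "l2norm M (\<lambda>x. f x - h x) \<le> l2norm M (\<lambda>x. f x - g x) + l2norm M (\<lambda>x. g x - h x)"
  using l2norm_triangle[OF sqint_diff[of M f g] sqint_diff[of M g h]] assms by simp

lemma l2norm_sum:
  assumes "\<And>i. i \<in> I \<Longrightarrow> sqint M (f i)"
  shows "l2norm M (\<lambda>x. \<Sum>i\<in>I. f i x) \<le> (\<Sum>i\<in>I. l2norm M (f i))"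
  using assms
proof (induction I rule: infinite_finite_induct)
  case (insert i I)
  then have "l2norm M (\<lambda>x. f i x + (\<Sum>i\<in>I. f i x)) \<le> l2norm M (f i) + l2norm M (\<lambda>x. \<Sum>i\<in>I. f i x)"
    by (intro l2norm_triangle sqint_sum) auto
  with insert show ?case by force
qed auto

text \<open>Dominated convergence for the squares. Measurability of \<open>f\<close> is a hypothesis
  because convergence almost everywhere does not transmit it over a measure that need not be
  complete.\<close>

lemma l2norm_dominated:
  assumes F: "\<And>n. F n \<in> borel_measurable M" and f: "f \<in> borel_measurable M" and h: "sqint M h"
    and b: "\<And>n. AE x in M. cmod (F n x) \<le> cmod (h x)"
    and c: "AE x in M. (\<lambda>n. F n x) \<longlonglongrightarrow> f x"
  shows "sqint M f" "(\<lambda>n. l2norm M (\<lambda>x. F n x - f x)) \<longlonglongrightarrow> 0"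
proof -
  note [measurable] = F f
  have b': "AE x in M. \<forall>n. cmod (F n x) \<le> cmod (h x)" using b by (simp add: AE_all_countable)
  have fh: "AE x in M. cmod (f x) \<le> cmod (h x)"
    using b' c
  proof eventually_elim
    case (elim x)
    then show ?case using tendsto_norm[OF elim(2)] by (intro LIMSEQ_le_const2) auto
  qed
  show sf: "sqint M f" by (rule sqint_bound[OF h f fh])
  have "(\<lambda>n. LINT x|M. (cmod (F n x - f x))\<^sup>2) \<longlonglongrightarrow> (LINT x|M. 0)"
  \<comment> \<open>The limit inherits the bound \<open>h\<close>, so the differences are at most
    twice \<open>h\<close>, and 4 is the square of that 2.\<close>
  proof (rule integral_dominated_convergence[where w = "\<lambda>x. 4 * (cmod (h x))\<^sup>2"])
    show "integrable M (\<lambda>x. 4 * (cmod (h x))\<^sup>2)" using h by (simp add: sqint_def)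
    show "AE x in M. (\<lambda>n. (cmod (F n x - f x))\<^sup>2) \<longlonglongrightarrow> 0"
      using c
    proof eventually_elim
      case (elim x)
      then have "(\<lambda>n. (cmod (F n x - f x))\<^sup>2) \<longlonglongrightarrow> (cmod (f x - f x))\<^sup>2" by (intro tendsto_intros)
      then show ?case by simp
    qed
    fix n
    show "AE x in M. norm ((cmod (F n x - f x))\<^sup>2) \<le> 4 * (cmod (h x))\<^sup>2"
      using b' fh
    proof eventually_elim
      case (elim x)
      have "cmod (F n x - f x) \<le> cmod (F n x) + cmod (f x)" by (rule norm_triangle_ineq4)
      also have "\<dots> \<le> 2 * cmod (h x)" using elim(1)[rule_format, of n] elim(2) by linarith
      finally have "(cmod (F n x - f x))\<^sup>2 \<le> (2 * cmod (h x))\<^sup>2" by (intro power_mono) auto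
      then show ?case by (simp add: power_mult_distrib)
    qed
  qed auto
  then show "(\<lambda>n. l2norm M (\<lambda>x. F n x - f x)) \<longlonglongrightarrow> 0"
    unfolding l2norm_def using tendsto_real_sqrt by fastforce
qed

text \<open>Fatou's lemma, for sequences that are bounded in norm but have no square-integrable
  majorant at hand, such as the remainders of a series.\<close>

lemma l2norm_Fatou:
  assumes F: "\<And>n. sqint M (F n)" and f: "f \<in> borel_measurable M" and le: "\<And>n. l2norm M (F n) \<le> c"
    and c: "AE x in M. (\<lambda>n. F n x) \<longlonglongrightarrow> f x"
  shows "sqint M f" "l2norm M f \<le> c"
proof -
  have [measurable]: "\<And>n. F n \<in> borel_measurable M" using F by (simp add: sqint_def)
  note [measurable] = f
  have c0: "0 \<le> c" using le[of 0] l2norm_nonneg[of M "F 0"] by linarith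
  have "(\<integral>\<^sup>+x. ennreal ((cmod (f x))\<^sup>2) \<partial>M) = (\<integral>\<^sup>+x. liminf (\<lambda>n. ennreal ((cmod (F n x))\<^sup>2)) \<partial>M)"
  proof (rule nn_integral_cong_AE, use c in eventually_elim)
    case (elim x)
    then have "(\<lambda>n. ennreal ((cmod (F n x))\<^sup>2)) \<longlonglongrightarrow> ennreal ((cmod (f x))\<^sup>2)"
      by (intro tendsto_intros)
    from lim_imp_Liminf[OF _ this] show ?case by simp
  qed
  also have "\<dots> \<le> liminf (\<lambda>n. \<integral>\<^sup>+x. ennreal ((cmod (F n x))\<^sup>2) \<partial>M)"
    by (rule nn_integral_liminf) auto
  also have "\<dots> \<le> liminf (\<lambda>n::nat. ennreal (c\<^sup>2))"
  proof (rule Liminf_mono, rule always_eventually, rule allI)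
    fix n
    have "(\<integral>\<^sup>+x. ennreal ((cmod (F n x))\<^sup>2) \<partial>M) = ennreal ((l2norm M (F n))\<^sup>2)"
      using F[of n] by (simp add: nn_integral_eq_integral sqint_def l2norm_power2)
    also have "\<dots> \<le> ennreal (c\<^sup>2)"
      using le[of n] by (intro ennreal_leI power_mono l2norm_nonneg) auto
    finally show "(\<integral>\<^sup>+x. ennreal ((cmod (F n x))\<^sup>2) \<partial>M) \<le> ennreal (c\<^sup>2)" .
  qed
  also have "\<dots> = ennreal (c\<^sup>2)" by (simp add: Liminf_const)
  finally have le2: "(\<integral>\<^sup>+x. ennreal ((cmod (f x))\<^sup>2) \<partial>M) \<le> ennreal (c\<^sup>2)" .
  have int: "integrable M (\<lambda>x. (cmod (f x))\<^sup>2)"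
    using le2 by (intro integrableI_nonneg) (auto intro: le_less_trans)
  then show "sqint M f" by (simp add: sqint_def)
  have "ennreal (LINT x|M. (cmod (f x))\<^sup>2) \<le> ennreal (c\<^sup>2)"
    using le2 nn_integral_eq_integral[OF int] by simp
  then have "(LINT x|M. (cmod (f x))\<^sup>2) \<le> c\<^sup>2" by (simp add: c0)
  then show "l2norm M f \<le> c" unfolding l2norm_def using c0 by (simp add: real_le_lsqrt)
qed

text \<open>Pointwise summability comes from \<open>\<bar>d\<^sub>n\<bar> \<le> e\<^sub>n + \<bar>d\<^sub>n\<bar>\<^sup>2 / e\<^sub>n\<close>, where the integral of the last term is at most
  \<open>e\<^sub>n\<close>; the \<open>e\<^sub>n\<close> are first made positive.\<close>

lemma l2norm_summable:
  assumes d: "\<And>n. sqint M (d n)" and le: "\<And>n. l2norm M (d n) \<le> e n" and e: "summable e"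
  obtains g where "sqint M g" "AE x in M. (\<lambda>n. d n x) sums g x"
    "(\<lambda>n. l2norm M (\<lambda>x. (\<Sum>k<n. d k x) - g x)) \<longlonglongrightarrow> 0" "l2norm M g \<le> suminf e"
proof -
  have [measurable]: "\<And>n. d n \<in> borel_measurable M" using d by (simp add: sqint_def)
  define e' where "e' n = e n + (1/2)^n" for n
  have e0: "0 \<le> e n" for n using le[of n] l2norm_nonneg[of M "d n"] by linarith
  then have pos: "0 < e' n" for n by (simp add: e'_def add_nonneg_pos)
  have e's: "summable e'" unfolding e'_def using e by (intro summable_add) (auto intro: summable_geometric)
  have "(\<integral>\<^sup>+x. (\<Sum>n. ennreal ((cmod (d n x))\<^sup>2 / e' n)) \<partial>M) = (\<Sum>n. \<integral>\<^sup>+x. ennreal ((cmod (d n x))\<^sup>2 / e' n) \<partial>M)"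
    by (intro nn_integral_suminf) auto
  also have "\<dots> \<le> (\<Sum>n. ennreal (e' n))"
  proof (intro suminf_le allI)
    fix n
    have "(\<integral>\<^sup>+x. ennreal ((cmod (d n x))\<^sup>2 / e' n) \<partial>M) = ennreal ((l2norm M (d n))\<^sup>2 / e' n)"
      using d[of n] pos[of n] by (subst nn_integral_eq_integral) (auto simp: sqint_def l2norm_power2)
    also have "\<dots> \<le> ennreal (e' n)"
    proof (rule ennreal_leI)
      have "l2norm M (d n) \<le> e' n" using le[of n] by (simp add: e'_def add_increasing2)
      then have "(l2norm M (d n))\<^sup>2 \<le> (e' n)\<^sup>2" by (intro power_mono l2norm_nonneg)
      then show "(l2norm M (d n))\<^sup>2 / e' n \<le> e' n"
        using pos[of n] by (simp add: power2_eq_square divide_le_eq)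
    qed
    finally show "(\<integral>\<^sup>+x. ennreal ((cmod (d n x))\<^sup>2 / e' n) \<partial>M) \<le> ennreal (e' n)" .
  qed auto
  also have "\<dots> = ennreal (suminf e')"
    using e's pos by (intro suminf_ennreal2) (auto intro: less_imp_le)
  also have "\<dots> < \<infinity>" by simp
  finally have fin: "(\<integral>\<^sup>+x. (\<Sum>n. ennreal ((cmod (d n x))\<^sup>2 / e' n)) \<partial>M) \<noteq> \<infinity>" by simp
  have "AE x in M. (\<Sum>n. ennreal ((cmod (d n x))\<^sup>2 / e' n)) \<noteq> \<infinity>"
    by (rule nn_integral_PInf_AE[OF _ fin]) auto
  then have sm: "AE x in M. summable (\<lambda>n. d n x)"
  proof eventually_elim
    case (elim x)
    have s1: "summable (\<lambda>n. (cmod (d n x))\<^sup>2 / e' n)"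
      using elim pos by (intro summable_suminf_not_top) (auto simp: less_imp_le)
    have "norm (d n x) \<le> e' n + (cmod (d n x))\<^sup>2 / e' n" for n
    proof -
      have "0 \<le> (cmod (d n x) - e' n)\<^sup>2 / e' n + cmod (d n x)" using pos[of n] by simp
      also have "(cmod (d n x) - e' n)\<^sup>2 / e' n = (cmod (d n x))\<^sup>2 / e' n + e' n - 2 * cmod (d n x)"
        using pos[of n] by (simp add: power2_eq_square field_simps)
      finally show ?thesis by simp
    qed
    then show ?case
      by (intro summable_comparison_test'[OF summable_add[OF e's s1], of 0]) simp
  qed
  define g where "g x = (\<Sum>n. d n x)" for x
  have [measurable]: "g \<in> borel_measurable M" unfolding g_def by measurable
  have gs: "AE x in M. (\<lambda>n. d n x) sums g x" using sm by (auto simp: g_def summable_sums)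
  \<comment> \<open>Fatou's lemma in \<open>m\<close> bounds the remainder after \<open>n\<close>
    terms by the tail of \<open>e\<close>; the case \<open>n = 0\<close> gives, up to the sign,
    integrability and the norm of \<open>g\<close>.\<close>
  have tail: "sqint M (\<lambda>x. (\<Sum>k<n. d k x) - g x) \<and> l2norm M (\<lambda>x. (\<Sum>k<n. d k x) - g x) \<le> (\<Sum>k. e (k + n))" for n
  proof -
    have "l2norm M (\<lambda>x. (\<Sum>k<n. d k x) - (\<Sum>k<m+n. d k x)) \<le> (\<Sum>k. e (k + n))" for m
    proof -
      have "(\<Sum>k<n. d k x) - (\<Sum>k<m+n. d k x) = - 1 * (\<Sum>k<m. d (k + n) x)" for x
        using sum.nat_group[of _ 1] by (induction m) (auto simp: algebra_simps)
      then have "l2norm M (\<lambda>x. (\<Sum>k<n. d k x) - (\<Sum>k<m+n. d k x)) = l2norm M (\<lambda>x. \<Sum>k<m. d (k + n) x)"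
        by (simp only: l2norm_cmult) simp
      also have "\<dots> \<le> (\<Sum>k<m. l2norm M (d (k + n)))" by (intro l2norm_sum d)
      also have "\<dots> \<le> (\<Sum>k<m. e (k + n))" by (intro sum_mono le)
      also have "\<dots> \<le> (\<Sum>k. e (k + n))"
        using e e0 by (intro sum_le_suminf) (auto simp: summable_iff_shift)
      finally show ?thesis .
    qed
    moreover have "AE x in M. (\<lambda>m. (\<Sum>k<n. d k x) - (\<Sum>k<m+n. d k x)) \<longlonglongrightarrow> (\<Sum>k<n. d k x) - g x"
      using gs
    proof eventually_elim
      case (elim x)
      then show ?case by (intro tendsto_intros LIMSEQ_ignore_initial_segment) (simp add: sums_def)
    qed
    moreover have "sqint M (\<lambda>x. (\<Sum>k<n. d k x) - (\<Sum>k<m+n. d k x))" for m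
      by (intro sqint_diff sqint_sum d)
    moreover have "(\<lambda>x. (\<Sum>k<n. d k x) - g x) \<in> borel_measurable M" by measurable
    ultimately show ?thesis
      using l2norm_Fatou[where F = "\<lambda>m x. (\<Sum>k<n. d k x) - (\<Sum>k<m+n. d k x)" and M = M
        and c = "\<Sum>k. e (k + n)" and f = "\<lambda>x. (\<Sum>k<n. d k x) - g x"] by blast
  qed
  have g: "sqint M g" using tail[of 0] sqint_cmult[of M "\<lambda>x. - g x" "-1"] by simp
  have lim: "(\<lambda>n. l2norm M (\<lambda>x. (\<Sum>k<n. d k x) - g x)) \<longlonglongrightarrow> 0"
  proof (rule tendsto_sandwich[OF always_eventually always_eventually tendsto_const])
    show "(\<lambda>n. \<Sum>k. e (k + n)) \<longlonglongrightarrow> 0" by (rule suminf_exist_split2[OF e])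
  qed (use tail l2norm_nonneg in auto)
  have "l2norm M g \<le> suminf e"
    using tail[of 0] l2norm_cmult[of M "-1" "g"] by simp
  with that g gs lim show ?thesis by blast
qed

section \<open>Approximation of square-integrable functions by indicators of boxes\<close>

lemma sqint_indicator:
  assumes "A \<in> sets M" "emeasure M A < \<infinity>"
  shows "sqint M (indicator A)"
proof -
  have "(\<lambda>x. (cmod (indicator A x))\<^sup>2) = (indicat_real A)" by (auto simp: indicator_def)
  moreover have "indicator A \<in> borel_measurable M" using assms by simp
  ultimately show ?thesis using assms by (simp add: sqint_def integrable_indicator_iff)
qed

text \<open>The boxes form an intersection-stable generator of the Borel sets, so Dynkin's argument
  carries \<open>P\<close> from boxes to all sets \<open>A \<inter> box a b\<close> with
  \<open>A\<close> Borel. A fixed box is kept throughout, since the measure is known to be finite on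
  boxes only. Simple functions and closure under limits do the rest.\<close>

lemma sqint_induct_boxes:
  fixes N :: "'a::euclidean_space measure" and P :: "('a \<Rightarrow> complex) \<Rightarrow> bool"
  assumes sets [measurable_cong]: "sets N = sets borel"
    and fin: "\<And>a b. emeasure N (box a b) < \<infinity>"
    and add: "\<And>f g. sqint N f \<Longrightarrow> sqint N g \<Longrightarrow> P f \<Longrightarrow> P g \<Longrightarrow> P (\<lambda>x. f x + g x)"
    and scale: "\<And>c f. sqint N f \<Longrightarrow> P f \<Longrightarrow> P (\<lambda>x. c * f x)"
    and lim: "\<And>F f. (\<And>n. sqint N (F n)) \<Longrightarrow> (\<And>n::nat. P (F n)) \<Longrightarrow> sqint N f \<Longrightarrow>
      (\<lambda>n. l2norm N (\<lambda>x. F n x - f x)) \<longlonglongrightarrow> 0 \<Longrightarrow> P f"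
    and box: "\<And>a b. P (indicator (box a b))"
    and f: "sqint N f"
  shows "P f"
proof -
  have sp: "space N = UNIV" using sets_eq_imp_space_eq[OF sets] by simp
  have zero: "P (\<lambda>x. 0)"
    using scale[of "indicator (box 0 0)" 0] box[of 0 0] fin[of 0 0] sqint_indicator[of "box 0 0" N] by simp
  have ind_fin: "emeasure N (A \<inter> box a b) < \<infinity>" if "A \<in> sets borel" for A a b
  proof -
    have "emeasure N (A \<inter> box a b) \<le> emeasure N (box a b)" by (intro emeasure_mono) auto
    then show ?thesis using fin[of a b] by (rule le_less_trans)
  qed
  have indI: "sqint N (indicator (A \<inter> box a b))" if "A \<in> sets borel" for A a b
    by (rule sqint_indicator) (use that ind_fin[OF that] in auto)
  have sumP: "sqint N (\<lambda>x. \<Sum>i\<in>I. F i x) \<and> P (\<lambda>x. \<Sum>i\<in>I. F i x)"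
    if "finite I" "\<And>i. i \<in> I \<Longrightarrow> sqint N (F i)" "\<And>i. i \<in> I \<Longrightarrow> P (F i)" for I :: "'i set" and F
    using that
  proof (induction I)
    case (insert i I)
    then show ?case using add[of "F i" "\<lambda>x. \<Sum>i\<in>I. F i x"] by (auto intro!: sqint_add)
  qed (use zero in auto)
  have ind: "P (indicator (A \<inter> box a b))" if A: "A \<in> sets borel" for A a b
  proof -
    let ?G = "range (\<lambda>(a,b). box a b :: 'a set)"
    have AG: "A \<in> sigma_sets UNIV ?G" using A by (simp add: borel_eq_box)
    have IG: "Int_stable ?G"
      unfolding Int_stable_def by (auto simp: box_Int_box)
    note IG
    moreover have "?G \<subseteq> Pow UNIV" by auto
    moreover note AG
    ultimately have "A \<in> sigma_sets UNIV ?G \<and> P (indicator (A \<inter> box a b))"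
    proof (induction rule: sigma_sets_induct_disjoint)
      case (basic B)
      then show ?case using box by (auto simp: box_Int_box)
    next
      case empty
      then show ?case using zero by (auto intro: sigma_sets.Empty)
    next
      case (compl B)
      then have B: "B \<in> sets borel" by (simp add: borel_eq_box)
      have "P (\<lambda>x. indicator (UNIV \<inter> box a b) x + (-1) * indicator (B \<inter> box a b) x)"
        using compl indI[OF B] indI[of UNIV] box[of a b] by (intro add scale sqint_cmult) auto
      moreover have "(\<lambda>x. indicator (UNIV \<inter> box a b) x + (-1) * indicator (B \<inter> box a b) x)
         = (indicator ((UNIV - B) \<inter> box a b) :: 'a \<Rightarrow> complex)"
        by (auto simp: indicator_def fun_eq_iff)
      ultimately show ?case using compl by (auto intro: sigma_sets.Compl)
    next
      case (union B)
      then have B: "B i \<in> sets borel" for i by (auto simp: borel_eq_box)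
      then have U [measurable]: "(\<Union>i. B i) \<in> sets borel" by auto
      have sumP': "sqint N (\<lambda>x. \<Sum>i<n. indicator (B i \<inter> box a b) x) \<and> P (\<lambda>x. \<Sum>i<n. indicator (B i \<inter> box a b) x)" for n
        using union indI[OF B] by (intro sumP) auto
      have eq: "(\<Sum>i<n. indicator (B i \<inter> box a b) x) = (indicator ((\<Union>i<n. B i) \<inter> box a b) x :: complex)" for n x
      proof -
        have "disjoint_family_on (\<lambda>i. B i \<inter> box a b) {..<n}"
          using \<open>disjoint_family B\<close> unfolding disjoint_family_on_def by blast
        then have "(indicator (\<Union>i\<in>{..<n}. B i \<inter> box a b) x :: complex) = (\<Sum>i<n. indicator (B i \<inter> box a b) x)"
          by (intro indicator_UN_disjoint) auto
        moreover have "(\<Union>i\<in>{..<n}. B i \<inter> box a b) = (\<Union>i<n. B i) \<inter> box a b" by blast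
        ultimately show ?thesis by metis
      qed
      have "P (indicator ((\<Union>i. B i) \<inter> box a b))"
      proof (rule lim[OF conjunct1[OF sumP'] conjunct2[OF sumP'] indI[OF U]])
        show "(\<lambda>n. l2norm N (\<lambda>x. (\<Sum>i<n. indicator (B i \<inter> box a b) x) - indicator (\<Union> (range B) \<inter> box a b) x)) \<longlonglongrightarrow> 0"
          unfolding eq
        proof (rule l2norm_dominated(2))
          show "sqint N (indicator ((\<Union>i. B i) \<inter> box a b))" by (rule indI[OF U])
          have "(\<lambda>n. indicator ((\<Union>i<n. B i) \<inter> box a b) x) \<longlonglongrightarrow> (indicator (\<Union> (range B) \<inter> box a b) x :: complex)" for x
          proof (cases "x \<in> \<Union> (range B) \<inter> box a b")
            case True
            then obtain i where "x \<in> B i" by auto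
            then have "indicator ((\<Union>i<n. B i) \<inter> box a b) x = (1 :: complex)" if "n > i" for n
              using True that by (auto simp: indicator_def)
            then show ?thesis using True
              by (intro tendsto_eventually eventually_sequentiallyI[of "Suc i"]) auto
          qed (auto simp: indicator_def)
          then show "AE x in N. (\<lambda>n. indicator ((\<Union>i<n. B i) \<inter> box a b) x) \<longlonglongrightarrow> (indicator (\<Union> (range B) \<inter> box a b) x :: complex)"
            by simp
        qed (use B in \<open>auto simp: indicator_def\<close>)
      qed
      then show ?case using union by (auto intro: sigma_sets.Union)
    qed
    then show ?thesis by simp
  qed
  have [measurable]: "f \<in> borel_measurable N" using f by (simp add: sqint_def)
  have "\<exists>S. \<forall>i. simple_function N (S i) \<and> (\<forall>x. (\<lambda>i. S i x) \<longlonglongrightarrow> f x) \<and> (\<forall>x. norm (S i x) \<le> 2 * norm (f x))"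
    using borel_measurable_implies_sequence_metric[OF sqint_measurable[OF f], of 0]
    by (simp add: sp dist_norm) metis
  then obtain S where
    S: "\<And>i. simple_function N (S i)" "\<And>x. (\<lambda>i. S i x) \<longlonglongrightarrow> f x" "\<And>i x. norm (S i x) \<le> 2 * norm (f x)"
    by blast
  \<comment> \<open>\<open>ind\<close> covers Borel sets inside a box, so the level sets of the
    simple functions are cut off by boxes that exhaust the space.\<close>
  define B where "B n = box (- (real n *\<^sub>R One)) (real n *\<^sub>R One :: 'a)" for n
  define F where "F n x = (\<Sum>y\<in>range (S n). y * indicator ((S n -` {y}) \<inter> B n) x)" for n x
  have finr: "finite (range (S n))" for n using S(1)[of n] by (simp add: simple_function_def sp)
  have Sm [measurable]: "S n \<in> borel_measurable N" for n using S(1) by (rule borel_measurable_simple_function)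
  have vim: "S n -` {y} \<in> sets borel" for n y
    using simple_functionD(2)[OF S(1)[of n], of "{y}"] by (simp add: sp sets)
  have F: "sqint N (F n) \<and> P (F n)" for n
    unfolding F_def
    by (rule sumP[OF finr]) (auto simp: B_def intro!: sqint_cmult scale indI ind vim)
  have Feq: "F n x = S n x * indicator (B n) x" for n x
  proof -
    have "F n x = (\<Sum>y\<in>range (S n). if y = S n x then y * indicator (B n) x else 0)"
      unfolding F_def by (intro sum.cong) (auto simp: indicator_def)
    also have "\<dots> = S n x * indicator (B n) x" using finr by simp
    finally show ?thesis .
  qed
  have conv: "(\<lambda>n. F n x) \<longlonglongrightarrow> f x" for x
  proof -
    obtain m where m: "x \<in> box (- (real m *\<^sub>R One)) (real m *\<^sub>R One)"
    proof -
      obtain m where m: "norm x < real m" using reals_Archimedean2 by blast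
      have "- real m < x \<bullet> i \<and> x \<bullet> i < real m" if "i \<in> Basis" for i
        using Basis_le_norm[OF that, of x] m by auto
      then have "x \<in> box (- (real m *\<^sub>R One)) (real m *\<^sub>R One)" by (auto simp: mem_box)
      then show ?thesis using that by blast
    qed
    have "x \<in> B n" if "n \<ge> m" for n
      using m that by (fastforce simp: B_def mem_box)
    then have "eventually (\<lambda>n. F n x = S n x) sequentially"
      by (intro eventually_sequentiallyI[of m]) (auto simp: Feq)
    then show ?thesis using S(2)[of x] by (simp add: tendsto_cong)
  qed
  show ?thesis
  proof (rule lim[OF conjunct1[OF F] conjunct2[OF F] f])
    show "(\<lambda>n. l2norm N (\<lambda>x. F n x - f x)) \<longlonglongrightarrow> 0"
    proof (rule l2norm_dominated(2)[OF _ _ sqint_cmult[OF f, of 2]])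
      show "F n \<in> borel_measurable N" for n using F by (simp add: sqint_def)
      show "AE x in N. cmod (F n x) \<le> cmod (2 * f x)" for n
        using S(3)[of n] by (auto simp: Feq norm_mult indicator_def)
    qed (use conv in auto)
  qed
qed

section \<open>Schwartz functions\<close>

text \<open>Iterating a choice of derivative inside \<open>K\<close> yields the sequence
  \<open>D\<close> that the definition demands. Closure properties of the Schwartz space thus need
  no formula for the n-th derivative, only a class of functions that is stable under one
  derivative.\<close>

lemma schwartz_coinduct:
  assumes "\<phi> \<in> K"
    and der: "\<And>f. f \<in> K \<Longrightarrow> \<exists>f'\<in>K. \<forall>x. (f has_vector_derivative f' x) (at x)"
    and bd: "\<And>f k. f \<in> K \<Longrightarrow> bounded (range (\<lambda>x. complex_of_real (x ^ k) * f x))"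
  shows "\<phi> \<in> schwartz"
proof -
  define d where "d f = (SOME f'. f' \<in> K \<and> (\<forall>x. (f has_vector_derivative f' x) (at x)))" for f
  have d: "d f \<in> K \<and> (\<forall>x. (f has_vector_derivative d f x) (at x))" if "f \<in> K" for f
    using der[OF that] unfolding d_def Bex_def by (rule someI_ex)
  have K: "(d ^^ n) \<phi> \<in> K" for n
    by (induction n) (use assms(1) d in auto)
  show ?thesis
    unfolding schwartz_def
    by (intro CollectI exI[of _ "\<lambda>n. (d ^^ n) \<phi>"] conjI allI bd K) (use d[OF K] in simp_all)
qed

definition vderiv :: "(real \<Rightarrow> complex) \<Rightarrow> real \<Rightarrow> complex" where
  "vderiv f x = vector_derivative f (at x)"

lemma vderivI: "(\<And>x. (f has_vector_derivative f' x) (at x)) \<Longrightarrow> vderiv f = f'"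
  by (auto simp: vderiv_def fun_eq_iff vector_derivative_at)

lemma schwartz_vderiv:
  assumes "\<phi> \<in> schwartz"
  shows "(\<phi> has_vector_derivative vderiv \<phi> x) (at x)" "vderiv \<phi> \<in> schwartz"
proof -
  from assms obtain D where D: "D 0 = \<phi>" "\<And>n x. (D n has_vector_derivative D (Suc n) x) (at x)"
    "\<And>k n. bounded (range (\<lambda>x. complex_of_real (x ^ k) * D n x))"
    by (auto simp: schwartz_def)
  have eq: "vderiv \<phi> = D 1" using D(2)[of 0] by (intro vderivI) (simp add: D(1))
  show "(\<phi> has_vector_derivative vderiv \<phi> x) (at x)" using D(2)[of 0 x] by (simp add: eq D(1))
  show "vderiv \<phi> \<in> schwartz"
    unfolding schwartz_def eq using D by (auto intro!: exI[of _ "\<lambda>n. D (Suc n)"])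
qed

lemma schwartz_bounded:
  assumes "\<phi> \<in> schwartz"
  shows "bounded (range (\<lambda>x. complex_of_real (x ^ k) * \<phi> x))"
  using assms by (auto simp: schwartz_def)

lemma schwartz_bound:
  assumes "\<phi> \<in> schwartz"
  obtains M where "0 < M" "\<And>x. cmod (complex_of_real (x ^ k) * \<phi> x) \<le> M"
  using schwartz_bounded[OF assms, of k] unfolding bounded_pos by auto

lemma schwartz_continuous: "\<phi> \<in> schwartz \<Longrightarrow> continuous_on A \<phi>"
  using schwartz_vderiv(1) by (intro continuous_at_imp_continuous_on ballI has_vector_derivative_continuous) blast

lemma schwartz_measurable [measurable_dest]: "\<phi> \<in> schwartz \<Longrightarrow> \<phi> \<in> borel_measurable borel"
  using schwartz_continuous[of \<phi> UNIV] by (intro borel_measurable_continuous_onI)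

lemma schwartz_lincomb:
  assumes "f \<in> schwartz" "g \<in> schwartz"
  shows "(\<lambda>x. c * f x + d * g x) \<in> schwartz"
proof (rule schwartz_coinduct)
  let ?K = "{\<lambda>x. c * f x + d * g x | f g. f \<in> schwartz \<and> g \<in> schwartz}"
  show "(\<lambda>x. c * f x + d * g x) \<in> ?K" using assms by blast
  fix h assume "h \<in> ?K"
  then obtain f g where h: "h = (\<lambda>x. c * f x + d * g x)" and fg: "f \<in> schwartz" "g \<in> schwartz" by blast
  have "(h has_vector_derivative (c * vderiv f x + d * vderiv g x)) (at x)" for x
    unfolding h by (intro derivative_intros schwartz_vderiv fg)
  then show "\<exists>f'\<in>?K. \<forall>x. (h has_vector_derivative f' x) (at x)"
    using schwartz_vderiv(2) fg by (intro bexI[of _ "\<lambda>x. c * vderiv f x + d * vderiv g x"]) auto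
  fix k
  obtain M where M: "\<And>x. cmod (complex_of_real (x ^ k) * f x) \<le> M" using schwartz_bound[OF fg(1)] by metis
  obtain N where N: "\<And>x. cmod (complex_of_real (x ^ k) * g x) \<le> N" using schwartz_bound[OF fg(2)] by metis
  have "cmod (complex_of_real (x ^ k) * h x) \<le> cmod c * M + cmod d * N" for x
  proof -
    have "complex_of_real (x ^ k) * h x = c * (complex_of_real (x ^ k) * f x) + d * (complex_of_real (x ^ k) * g x)"
      by (simp add: h algebra_simps)
    also have "cmod \<dots> \<le> cmod (c * (complex_of_real (x ^ k) * f x)) + cmod (d * (complex_of_real (x ^ k) * g x))"
      by (rule norm_triangle_ineq)
    also have "\<dots> \<le> cmod c * M + cmod d * N"
      unfolding norm_mult[of c] norm_mult[of d] by (intro add_mono mult_left_mono M N) auto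
    finally show ?thesis .
  qed
  then show "bounded (range (\<lambda>x. complex_of_real (x ^ k) * h x))" by (auto intro!: boundedI)
qed

lemma schwartz_add: "f \<in> schwartz \<Longrightarrow> g \<in> schwartz \<Longrightarrow> (\<lambda>x. f x + g x) \<in> schwartz"
  using schwartz_lincomb[of f g 1 1] by simp

lemma schwartz_diff: "f \<in> schwartz \<Longrightarrow> g \<in> schwartz \<Longrightarrow> (\<lambda>x. f x - g x) \<in> schwartz"
  using schwartz_lincomb[of f g 1 "-1"] by simp

lemma schwartz_cmult: "f \<in> schwartz \<Longrightarrow> (\<lambda>x. c * f x) \<in> schwartz"
  using schwartz_lincomb[of f f c 0] by simp

lemma schwartz_zero: "(\<lambda>x. 0) \<in> schwartz"
  unfolding schwartz_def by (auto intro!: exI[of _ "\<lambda>n x. 0"])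

text \<open>The derivative of \<open>x f\<close> is \<open>x f' + f\<close>, so the functions
  \<open>x f + g\<close> are a class closed under differentiation.\<close>

lemma schwartz_times_id:
  assumes "f \<in> schwartz"
  shows "(\<lambda>x. complex_of_real x * f x) \<in> schwartz"
proof (rule schwartz_coinduct)
  let ?K = "{\<lambda>x. complex_of_real x * f x + g x | f g. f \<in> schwartz \<and> g \<in> schwartz}"
  show "(\<lambda>x. complex_of_real x * f x) \<in> ?K"
    using assms schwartz_zero by (intro CollectI exI[of _ f] exI[of _ "\<lambda>x. 0"]) simp
  fix h assume "h \<in> ?K"
  then obtain f g where h: "h = (\<lambda>x. complex_of_real x * f x + g x)" and fg: "f \<in> schwartz" "g \<in> schwartz" by blast
  have "(h has_vector_derivative (complex_of_real x * vderiv f x + (f x + vderiv g x))) (at x)" for x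
  proof -
    have "(complex_of_real has_vector_derivative complex_of_real 1) (at x)"
      by (intro has_vector_derivative_of_real derivative_intros)
    from has_vector_derivative_add[OF has_vector_derivative_mult[OF this schwartz_vderiv(1)[OF fg(1)]]
        schwartz_vderiv(1)[OF fg(2)]]
    show ?thesis unfolding h by (simp add: add.assoc)
  qed
  then show "\<exists>f'\<in>?K. \<forall>x. (h has_vector_derivative f' x) (at x)"
    using schwartz_vderiv(2) fg schwartz_add
    by (intro bexI[of _ "\<lambda>x. complex_of_real x * vderiv f x + (f x + vderiv g x)"] CollectI
        exI[of _ "vderiv f"] exI[of _ "\<lambda>x. f x + vderiv g x"]) simp_all
  fix k
  obtain M where M: "\<And>x. cmod (complex_of_real (x ^ Suc k) * f x) \<le> M" using schwartz_bound[OF fg(1)] by metis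
  obtain N where N: "\<And>x. cmod (complex_of_real (x ^ k) * g x) \<le> N" using schwartz_bound[OF fg(2)] by metis
  have "cmod (complex_of_real (x ^ k) * h x) \<le> M + N" for x
  proof -
    have "complex_of_real (x ^ k) * h x = (complex_of_real (x ^ Suc k) * f x) + (complex_of_real (x ^ k) * g x)"
      by (simp add: h algebra_simps)
    then show ?thesis using norm_triangle_mono[OF M N] by metis
  qed
  then show "bounded (range (\<lambda>x. complex_of_real (x ^ k) * h x))" by (auto intro!: boundedI)
qed

lemma schwartz_cnj_reflect:
  assumes "f \<in> schwartz"
  shows "(\<lambda>x. cnj (f (- x))) \<in> schwartz"
proof (rule schwartz_coinduct)
  let ?K = "{\<lambda>x. cnj (f (- x)) | f. f \<in> schwartz}"
  show "(\<lambda>x. cnj (f (- x))) \<in> ?K" using assms by blast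
  fix h assume "h \<in> ?K"
  then obtain f where h: "h = (\<lambda>x. cnj (f (- x)))" and f: "f \<in> schwartz" by blast
  have "(h has_vector_derivative (cnj (- 1 * vderiv f (- x)))) (at x)" for x
  proof -
    have "((\<lambda>x. f (- x)) has_vector_derivative (- 1 *\<^sub>R vderiv f (- x))) (at x)"
      by (rule vector_diff_chain_at[unfolded o_def, where f = uminus and g = f])
         (auto intro!: derivative_eq_intros schwartz_vderiv f)
    then show ?thesis unfolding h by (intro derivative_intros has_vector_derivative_cnj) simp
  qed
  moreover have "(\<lambda>x. - 1 * vderiv f x) \<in> schwartz" by (intro schwartz_cmult schwartz_vderiv f)
  ultimately show "\<exists>f'\<in>?K. \<forall>x. (h has_vector_derivative f' x) (at x)"
    by (intro bexI[of _ "\<lambda>x. cnj (- 1 * vderiv f (- x))"] CollectI exI[of _ "\<lambda>x. - 1 * vderiv f x"]) auto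
  fix k
  obtain M where M: "\<And>x. cmod (complex_of_real (x ^ k) * f x) \<le> M" using schwartz_bound[OF f] by metis
  have "cmod (complex_of_real (x ^ k) * h x) \<le> M" for x
    using M[of "- x"] by (simp add: h norm_mult norm_power)
  then show "bounded (range (\<lambda>x. complex_of_real (x ^ k) * h x))" by (auto intro!: boundedI)
qed

text \<open>Finite sums of products, because the Leibniz rule leads from a product to a sum of
  two.\<close>

inductive_set schwartz_products :: "(real \<Rightarrow> complex) set" where
  prod: "f \<in> schwartz \<Longrightarrow> g \<in> schwartz \<Longrightarrow> (\<lambda>x. f x * g x) \<in> schwartz_products"
| sum: "f \<in> schwartz_products \<Longrightarrow> g \<in> schwartz_products \<Longrightarrow> (\<lambda>x. f x + g x) \<in> schwartz_products"

lemma schwartz_mult: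
  assumes "f \<in> schwartz" "g \<in> schwartz"
  shows "(\<lambda>x. f x * g x) \<in> schwartz"
proof (rule schwartz_coinduct[where K = schwartz_products])
  show "(\<lambda>x. f x * g x) \<in> schwartz_products" using assms by (rule schwartz_products.prod)
  fix h assume h: "h \<in> schwartz_products"
  then show "\<exists>f'\<in>schwartz_products. \<forall>x. (h has_vector_derivative f' x) (at x)"
  proof induction
    case (prod f g)
    then have "((\<lambda>x. f x * g x) has_vector_derivative (f x * vderiv g x + vderiv f x * g x)) (at x)" for x
      by (intro has_vector_derivative_mult schwartz_vderiv)
    moreover have "(\<lambda>x. f x * vderiv g x + vderiv f x * g x) \<in> schwartz_products"
      using prod by (intro schwartz_products.intros schwartz_vderiv)
    ultimately show ?case by (intro bexI allI)
  next
    case (sum f g)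
    then obtain f' g' where "f' \<in> schwartz_products" "g' \<in> schwartz_products"
      "\<And>x. (f has_vector_derivative f' x) (at x)" "\<And>x. (g has_vector_derivative g' x) (at x)" by blast
    then show ?case
      by (intro bexI[of _ "\<lambda>x. f' x + g' x"]) (auto intro!: has_vector_derivative_add schwartz_products.sum)
  qed
  fix k
  have "\<exists>M. \<forall>x. cmod (complex_of_real (x ^ k) * h x) \<le> M"
    using h
  proof induction
    case (prod f g)
    obtain M where M: "\<And>x. cmod (complex_of_real (x ^ k) * f x) \<le> M" using schwartz_bound[OF prod(1)] by metis
    obtain N where N: "0 < N" "\<And>x. cmod (complex_of_real (x ^ 0) * g x) \<le> N" using schwartz_bound[OF prod(2)] by metis
    have "cmod (complex_of_real (x ^ k) * (f x * g x)) \<le> M * N" for x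
    proof -
      have "cmod (complex_of_real (x ^ k) * (f x * g x)) = cmod (complex_of_real (x ^ k) * f x) * cmod (g x)"
        by (simp add: norm_mult)
      also have "\<dots> \<le> M * N" using M[of x] N(2)[of x] by (intro mult_mono order_trans[OF norm_ge_zero M]) auto
      finally show ?thesis .
    qed
    then show ?case by blast
  next
    case (sum f g)
    then obtain M N where MN: "\<And>x. cmod (complex_of_real (x ^ k) * f x) \<le> M" "\<And>x. cmod (complex_of_real (x ^ k) * g x) \<le> N"
      by blast
    have "cmod (complex_of_real (x ^ k) * (f x + g x)) \<le> M + N" for x
      unfolding distrib_left by (intro norm_triangle_mono MN)
    then show ?case by blast
  qed
  then obtain M where "\<And>x. cmod (complex_of_real (x ^ k) * h x) \<le> M" by blast
  then show "bounded (range (\<lambda>x. complex_of_real (x ^ k) * h x))" by (intro boundedI[of _ M]) auto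
qed

lemma integrable_inverse_1_plus_square_lborel: "integrable lborel (\<lambda>x::real. 1 / (1 + x\<^sup>2))"
  using integrable_inverse_1_plus_square
  by (simp add: set_integrable_def inverse_eq_divide einterval_def)

lemma schwartz_decay:
  assumes "f \<in> schwartz"
  obtains M where "0 < M" "\<And>x. cmod (f x) \<le> M * (1 / (1 + x\<^sup>2))"
proof -
  obtain M where M: "0 < M" "\<And>x. cmod (complex_of_real (x ^ 0) * f x) \<le> M" using schwartz_bound[OF assms] by metis
  obtain N where N: "0 < N" "\<And>x. cmod (complex_of_real (x ^ 2) * f x) \<le> N" using schwartz_bound[OF assms] by metis
  have "cmod (f x) \<le> (M + N) * (1 / (1 + x\<^sup>2))" for x
  proof -
    have "0 < 1 + x\<^sup>2" by (simp add: add_pos_nonneg)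
    moreover have "cmod (f x) * (1 + x\<^sup>2) \<le> M + N"
      using M(2)[of x] N(2)[of x] by (simp add: norm_mult norm_power algebra_simps power2_abs)
    ultimately show ?thesis by (simp add: pos_le_divide_eq)
  qed
  with M N that[of "M + N"] show ?thesis by simp
qed

lemma schwartz_integrable:
  assumes "f \<in> schwartz"
  shows "integrable lborel f"
proof -
  obtain M where M: "0 < M" "\<And>x. cmod (f x) \<le> M * (1 / (1 + x\<^sup>2))" using schwartz_decay[OF assms] by blast
  have "integrable lborel (\<lambda>x. M * (1 / (1 + x\<^sup>2)))"
    using integrable_inverse_1_plus_square_lborel by (rule integrable_mult_right)
  then show ?thesis
    by (rule Bochner_Integration.integrable_bound) (use M assms in \<open>auto simp: schwartz_measurable\<close>)
qed

lemma schwartz_sqint: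
  assumes "f \<in> schwartz"
  shows "sqint lborel f"
proof -
  have "integrable lborel (\<lambda>x. f x * f x)" by (intro schwartz_integrable schwartz_mult assms)
  then have "integrable lborel (\<lambda>x. norm (f x * f x))" by (rule integrable_norm)
  then show ?thesis using assms by (simp add: sqint_def norm_mult power2_eq_square schwartz_measurable)
qed

lemma schwartz_tendsto_0:
  assumes "f \<in> schwartz"
  shows "(f \<longlongrightarrow> 0) at_top" "(f \<longlongrightarrow> 0) at_bot"
proof -
  obtain M where M: "0 < M" "\<And>x. cmod (f x) \<le> M * (1 / (1 + x\<^sup>2))" using schwartz_decay[OF assms] by blast
  have *: "(f \<longlongrightarrow> 0) F" if "((\<lambda>x::real. M * (1 / (1 + x\<^sup>2))) \<longlongrightarrow> 0) F" for F
    by (rule Lim_null_comparison[OF _ that]) (intro always_eventually allI M)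
  show "(f \<longlongrightarrow> 0) at_top" by (rule *) real_asymp
  show "(f \<longlongrightarrow> 0) at_bot" by (rule *) real_asymp
qed

section \<open>The Fourier transform on the Schwartz space\<close>

lemma cis_measurable [measurable]: "cis \<in> borel_measurable borel"
  by (intro borel_measurable_continuous_onI continuous_intros)

lemma integrable_cis_mult:
  assumes "integrable M f" "g \<in> borel_measurable M"
  shows "integrable M (\<lambda>x. f x * cis (g x))"
  using assms by (intro Bochner_Integration.integrable_bound[OF assms(1)]) (auto simp: norm_mult)

lemma cis_has_vector_derivative:
  "((\<lambda>x. cis (a * x)) has_vector_derivative (\<i> * of_real a * cis (a * x))) (at x)"
  unfolding has_vector_derivative_def
  by (rule derivative_eq_intros refl | simp add: fun_eq_iff scaleR_conv_of_real)+

text \<open>Integration by parts over the whole line: the derivative of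
  \<open>f x * cis (a * x)\<close> has integral 0, since \<open>f\<close> vanishes at both ends and
  \<open>cis\<close> has modulus 1.\<close>

lemma integral_vderiv_cis:
  assumes f: "f \<in> schwartz"
  shows "(LINT x|lborel. vderiv f x * cis (a * x)) = - \<i> * of_real a * (LINT x|lborel. f x * cis (a * x))"
proof -
  let ?F = "\<lambda>x. f x * cis (a * x)"
  let ?F' = "\<lambda>x. f x * (\<i> * of_real a * cis (a * x)) + vderiv f x * cis (a * x)"
  have d: "(?F has_vector_derivative ?F' x) (at x)" for x
    by (intro has_vector_derivative_mult schwartz_vderiv f cis_has_vector_derivative)
  have i1: "integrable lborel ?F" and i2: "integrable lborel (\<lambda>x. vderiv f x * cis (a * x))"
    by (intro integrable_cis_mult schwartz_integrable f schwartz_vderiv; measurable)+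
  have i3: "integrable lborel (\<lambda>x. f x * (\<i> * of_real a * cis (a * x)))"
    using integrable_mult_right[OF i1, of "\<i> * of_real a"] by (simp add: ac_simps)
  have iF': "integrable lborel ?F'" using i3 i2 by (rule Bochner_Integration.integrable_add)
  have "continuous_on UNIV ?F'"
    by (intro continuous_intros schwartz_continuous f schwartz_vderiv)
  then have cont: "isCont ?F' x" for x by (simp add: continuous_on_eq_continuous_at)
  have lim: "(?F \<longlongrightarrow> 0) at_top" "(?F \<longlongrightarrow> 0) at_bot"
    using schwartz_tendsto_0[OF f, THEN tendsto_norm] 
    by (auto intro!: tendsto_norm_zero_cancel[of ?F] simp: norm_mult)
  have "(LBINT x=-\<infinity>..\<infinity>. ?F' x) = 0 - 0"
  proof (rule interval_integral_FTC_integrable)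
    show "((?F \<circ> real_of_ereal) \<longlongrightarrow> 0) (at_right (- \<infinity>))"
      by (simp only: ereal_tendsto_simps lim)
    show "((?F \<circ> real_of_ereal) \<longlongrightarrow> 0) (at_left \<infinity>)"
      by (simp only: ereal_tendsto_simps lim)
    show "set_integrable lborel (einterval (- \<infinity>) \<infinity>) ?F'"
      using iF' by (simp add: set_integrable_def einterval_def)
  qed (use d cont in auto)
  then have "(LINT x|lborel. ?F' x) = 0"
    by (simp add: interval_lebesgue_integral_def einterval_def set_lebesgue_integral_def)
  then have "(LINT x|lborel. f x * (\<i> * of_real a * cis (a * x))) + (LINT x|lborel. vderiv f x * cis (a * x)) = 0"
    using i3 i2 by simp
  moreover have "(LINT x|lborel. f x * (\<i> * of_real a * cis (a * x))) = \<i> * of_real a * (LINT x|lborel. f x * cis (a * x))"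
    by (subst integral_mult_right_zero[symmetric]) (simp add: ac_simps)
  ultimately show ?thesis by (simp add: add_eq_0_iff2)
qed

lemma fourier_vderiv:
  assumes "f \<in> schwartz"
  shows "fourier (vderiv f) \<xi> = \<i> * of_real \<xi> * fourier f \<xi>"
  using integral_vderiv_cis[OF assms, of "- \<xi>"] by (simp add: fourier_def)

lemma fourier_norm_le:
  "cmod (fourier f \<xi>) \<le> 1 / sqrt (2 * pi) * (LINT x|lborel. cmod (f x))"
proof -
  have "cmod (LINT x|lborel. f x * cis (- (\<xi> * x))) \<le> (LINT x|lborel. cmod (f x * cis (- (\<xi> * x))))"
    by simp
  also have "\<dots> = (LINT x|lborel. cmod (f x))" by (simp add: norm_mult)
  finally show ?thesis by (simp add: fourier_def norm_mult norm_divide divide_right_mono)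
qed

lemma fourier_lincomb:
  assumes "integrable lborel f" "integrable lborel g"
  shows "fourier (\<lambda>x. c * f x + d * g x) \<xi> = c * fourier f \<xi> + d * fourier g \<xi>"
proof -
  have "integrable lborel (\<lambda>x. f x * cis (- (\<xi> * x)))" "integrable lborel (\<lambda>x. g x * cis (- (\<xi> * x)))"
    by (intro integrable_cis_mult assms; measurable)+
  then have "(LINT x|lborel. c * (f x * cis (- (\<xi> * x))) + d * (g x * cis (- (\<xi> * x))))
    = c * (LINT x|lborel. f x * cis (- (\<xi> * x))) + d * (LINT x|lborel. g x * cis (- (\<xi> * x)))"
    by simp
  then show ?thesis by (simp add: fourier_def algebra_simps)
qed

lemma fourier_diff:
  assumes "integrable lborel f" "integrable lborel g"
  shows "fourier (\<lambda>x. f x - g x) \<xi> = fourier f \<xi> - fourier g \<xi>"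
  using fourier_lincomb[OF assms, of 1 "-1"] by simp

lemma fourier_cmult:
  assumes "integrable lborel f"
  shows "fourier (\<lambda>x. c * f x) \<xi> = c * fourier f \<xi>"
  using fourier_lincomb[OF assms assms, of c 0] by simp

text \<open>Differentiation under the integral sign by a quantitative estimate: the Taylor error of
  the exponential is at most \<open>(t * x)\<^sup>2\<close>, and the second moment of
  \<open>f\<close> is finite, so the error of the linearization is quadratic in
  \<open>t\<close>.\<close>

lemma fourier_has_vector_derivative:
  assumes f: "f \<in> schwartz"
  shows "(fourier f has_vector_derivative fourier (\<lambda>x. - \<i> * (of_real x * f x)) \<xi>) (at \<xi>)"
proof -
  let ?g = "\<lambda>x. - \<i> * (of_real x * f x)"
  have g: "?g \<in> schwartz" by (intro schwartz_cmult schwartz_times_id f)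
  have h: "(\<lambda>x. of_real x * (of_real x * f x)) \<in> schwartz" by (intro schwartz_times_id f)
  have hi: "integrable lborel (\<lambda>x. cmod (of_real x * (of_real x * f x)))"
    by (intro integrable_norm schwartz_integrable h)
  let ?C = "1 / sqrt (2 * pi) * (LINT x|lborel. cmod (of_real x * (of_real x * f x)))"
  have bound: "cmod (fourier f (\<xi> + t) - fourier f \<xi> - of_real t * fourier ?g \<xi>) \<le> ?C * t\<^sup>2" for t
  proof -
    let ?R = "\<lambda>x. f x * cis (- ((\<xi> + t) * x)) - f x * cis (- (\<xi> * x)) - of_real t * (?g x * cis (- (\<xi> * x)))"
    have i: "integrable lborel (\<lambda>x. f x * cis (- (a * x)))" for a
      by (intro integrable_cis_mult schwartz_integrable f) measurable
    have ig: "integrable lborel (\<lambda>x. ?g x * cis (- (\<xi> * x)))"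
      by (intro integrable_cis_mult schwartz_integrable g) measurable
    have R: "cmod (?R x) \<le> t\<^sup>2 * cmod (of_real x * (of_real x * f x))" for x
    proof -
      have "?R x = f x * cis (- (\<xi> * x)) * (cis (- (t * x)) - 1 + \<i> * of_real (t * x))"
      proof -
        have "cis (- ((\<xi> + t) * x)) = cis (- (\<xi> * x)) * cis (- (t * x))"
          by (simp add: cis_mult algebra_simps)
        then show ?thesis by (simp only:) (simp add: algebra_simps)
      qed
      also have "cmod \<dots> = cmod (f x) * cmod (cis (- (t * x)) - 1 + \<i> * of_real (t * x))"
        by (simp add: norm_mult)
      also have "\<dots> \<le> cmod (f x) * (t * x)\<^sup>2"
      proof (intro mult_left_mono)
        have "cmod (cis (- (t * x)) - 1 + \<i> * of_real (t * x)) \<le> \<bar>- (t * x)\<bar>^(Suc 1) / fact (Suc 1)"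
          using iexp_approx1[of "- (t * x)" 1] by (simp add: cis_conv_exp algebra_simps)
        also have "\<dots> = (t * x)\<^sup>2 / 2" by (simp add: power2_eq_square)
        also have "\<dots> \<le> (t * x)\<^sup>2" by simp
        finally show "cmod (cis (- (t * x)) - 1 + \<i> * of_real (t * x)) \<le> (t * x)\<^sup>2" .
      qed auto
      also have "\<dots> = t\<^sup>2 * cmod (of_real x * (of_real x * f x))"
        by (simp add: norm_mult power2_eq_square flip: abs_mult)
      finally show ?thesis .
    qed
    have Req: "(LINT x|lborel. ?R x) = (LINT x|lborel. f x * cis (- ((\<xi> + t) * x))) - (LINT x|lborel. f x * cis (- (\<xi> * x)))
       - of_real t * (LINT x|lborel. ?g x * cis (- (\<xi> * x)))"
      using i[of "\<xi> + t"] i[of \<xi>] ig by (simp del: mult_minus_left)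
    then have eq: "fourier f (\<xi> + t) - fourier f \<xi> - of_real t * fourier ?g \<xi> = complex_of_real (1 / sqrt (2 * pi)) * (LINT x|lborel. ?R x)"
      unfolding fourier_def Req by (simp only: right_diff_distrib mult.left_commute mult.assoc)
    have "cmod (LINT x|lborel. ?R x) \<le> (LINT x|lborel. cmod (?R x))" by (rule integral_norm_bound)
    also have "(LINT x|lborel. cmod (?R x)) \<le> (LINT x|lborel. t\<^sup>2 * cmod (of_real x * (of_real x * f x)))"
    proof (rule integral_mono[OF _ _ R])
      show "integrable lborel (\<lambda>x. cmod (?R x))"
        by (rule integrable_norm, rule Bochner_Integration.integrable_diff,
            rule Bochner_Integration.integrable_diff[OF i i], rule integrable_mult_right[OF ig])
      show "integrable lborel (\<lambda>x. t\<^sup>2 * cmod (of_real x * (of_real x * f x)))"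
        by (rule integrable_mult_right[OF hi])
    qed
    also have "\<dots> = t\<^sup>2 * (LINT x|lborel. cmod (of_real x * (of_real x * f x)))" by simp
    finally have "1 / sqrt (2 * pi) * cmod (LINT x|lborel. ?R x) \<le> 1 / sqrt (2 * pi) * (t\<^sup>2 * (LINT x|lborel. cmod (of_real x * (of_real x * f x))))"
      by (intro mult_left_mono) auto
    moreover have "cmod (complex_of_real (1 / sqrt (2 * pi))) = 1 / sqrt (2 * pi)"
      by (simp add: norm_divide)
    ultimately show ?thesis unfolding eq norm_mult by (simp only: ac_simps)
  qed
  have "((\<lambda>t. norm ((fourier f (\<xi> + t) - fourier f \<xi>) - t *\<^sub>R fourier ?g \<xi>) / norm t) \<longlongrightarrow> 0) (at 0)"
  proof (rule Lim_null_comparison)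
    show "\<forall>\<^sub>F t in at 0. norm (norm ((fourier f (\<xi> + t) - fourier f \<xi>) - t *\<^sub>R fourier ?g \<xi>) / norm t) \<le> ?C * \<bar>t\<bar>"
    proof (rule eventually_at_ball'[of 1, THEN eventually_mono])
      fix t :: real assume "t \<in> ball 0 1 \<and> t \<noteq> 0 \<and> t \<in> UNIV"
      then have "0 < \<bar>t\<bar>" by simp
      moreover have "cmod (fourier f (\<xi> + t) - fourier f \<xi> - of_real t * fourier ?g \<xi>) \<le> ?C * \<bar>t\<bar> * \<bar>t\<bar>"
        using bound[of t] by (simp only: mult.assoc abs_mult_self_eq power2_eq_square)
      ultimately show "norm (norm ((fourier f (\<xi> + t) - fourier f \<xi>) - t *\<^sub>R fourier ?g \<xi>) / norm t) \<le> ?C * \<bar>t\<bar>"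
        by (simp add: divide_le_eq scaleR_conv_of_real)
    qed auto
    have "((\<lambda>t::real. ?C * \<bar>t\<bar>) \<longlongrightarrow> ?C * \<bar>0\<bar>) (at 0)" by (intro tendsto_intros)
    then show "((\<lambda>t::real. ?C * \<bar>t\<bar>) \<longlongrightarrow> 0) (at 0)" by simp
  qed
  then show ?thesis
    by (simp add: has_vector_derivative_def has_derivative_at bounded_linear_scaleR_left)
qed

text \<open>The image of the Schwartz space is stable under differentiation, since the derivative of
  a transform is the transform of \<open>- \<i> x f\<close>. Its members decay rapidly because each
  factor \<open>x\<close> is absorbed by a derivative of \<open>f\<close>.\<close>

lemma schwartz_fourier:
  assumes "f \<in> schwartz"
  shows "fourier f \<in> schwartz"
proof (rule schwartz_coinduct)
  show "fourier f \<in> fourier ` schwartz" using assms by blast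
  fix h assume "h \<in> fourier ` schwartz"
  then obtain f where h: "h = fourier f" and f: "f \<in> schwartz" by blast
  have "(\<lambda>x. - \<i> * (of_real x * f x)) \<in> schwartz" by (intro schwartz_cmult schwartz_times_id f)
  then show "\<exists>f'\<in>fourier ` schwartz. \<forall>x. (h has_vector_derivative f' x) (at x)"
    using fourier_has_vector_derivative[OF f] unfolding h by blast
  fix k
  have "\<exists>M. \<forall>x. cmod (complex_of_real (x ^ k) * fourier f x) \<le> M"
    using f
  proof (induction k arbitrary: f)
    case 0
    then show ?case using fourier_norm_le by auto
  next
    case (Suc k)
    obtain M where M: "\<And>x. cmod (complex_of_real (x ^ k) * fourier (vderiv f) x) \<le> M"
      using Suc.IH[OF schwartz_vderiv(2)[OF Suc.prems]] by blast
    have "cmod (complex_of_real (x ^ Suc k) * fourier f x) \<le> M" for x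
      using M[of x] by (simp add: fourier_vderiv[OF Suc.prems] norm_mult ac_simps)
    then show ?case by blast
  qed
  then obtain M where "\<And>x. cmod (complex_of_real (x ^ k) * h x) \<le> M" unfolding h by blast
  then show "bounded (range (\<lambda>x. complex_of_real (x ^ k) * h x))" by (intro boundedI[of _ M]) auto
qed

text \<open>By Fubini both sides are the same double integral, whose kernel is symmetric in the two
  variables.\<close>

lemma fourier_duality:
  assumes f: "integrable lborel f" and g: "integrable lborel g"
  shows "(LINT x|lborel. fourier f x * g x) = (LINT x|lborel. f x * fourier g x)"
proof -
  have [measurable]: "f \<in> borel_measurable borel" "g \<in> borel_measurable borel"
    using borel_measurable_integrable[OF f] borel_measurable_integrable[OF g] by auto
  let ?h = "\<lambda>x y. f x * g y * cis (- (x * y))"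
  have "integrable (lborel \<Otimes>\<^sub>M lborel) (case_prod ?h)"
  proof (rule lborel_pair.Fubini_integrable)
    show "integrable lborel (\<lambda>x. LINT y|lborel. norm (case (x, y) of (x, y) \<Rightarrow> ?h x y))"
      using f g by (simp add: norm_mult)
    show "AE x in lborel. integrable lborel (\<lambda>y. case (x, y) of (x, y) \<Rightarrow> ?h x y)"
      using g by (auto intro!: integrable_cis_mult)
  qed measurable
  from lborel_pair.Fubini_integral[OF this]
  have eq: "(LINT y|lborel. LINT x|lborel. ?h x y) = (LINT x|lborel. LINT y|lborel. ?h x y)" by simp
  have 1: "(LINT x|lborel. ?h x y) = g y * (LINT x|lborel. f x * cis (- (y * x)))" for y
    by (subst integral_mult_right_zero[symmetric]) (simp add: ac_simps)
  have 2: "(LINT y|lborel. ?h x y) = f x * (LINT y|lborel. g y * cis (- (x * y)))" for x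
    by (subst integral_mult_right_zero[symmetric]) (simp add: ac_simps)
  have "(LINT x|lborel. fourier f x * g x) = complex_of_real (1 / sqrt (2 * pi)) * (LINT y|lborel. LINT x|lborel. ?h x y)"
    unfolding 1 fourier_def by (subst integral_mult_right_zero[symmetric]) (simp add: ac_simps)
  also have "\<dots> = (LINT x|lborel. f x * fourier g x)"
    unfolding eq 2 fourier_def by (subst integral_mult_right_zero[symmetric]) (simp add: ac_simps)
  finally show ?thesis .
qed

text \<open>The characteristic function of the standard normal law, after the substitution
  \<open>z = e * \<xi>\<close>; the modulation by \<open>cis\<close> shifts the frequency.\<close>

lemma fourier_gaussian:
  assumes "0 < e"
  shows "fourier (\<lambda>\<xi>. complex_of_real (exp (- (e * \<xi>)\<^sup>2 / 2)) * cis (- (x * \<xi>))) y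
    = complex_of_real (1 / e * exp (- ((x + y) / e)\<^sup>2 / 2))"
proof -
  let ?g = "\<lambda>z. complex_of_real (exp (- z\<^sup>2 / 2)) * cis (- ((x + y) / e) * z)"
  have "(LINT z|lborel. ?g z) = complex_of_real (sqrt (2 * pi)) * char std_normal_distribution (- ((x + y) / e))"
    unfolding char_def
    by (subst integral_density, simp_all add: integral_mult_right_zero[symmetric] del: integral_mult_right_zero)
       (intro Bochner_Integration.integral_cong,
        auto simp: std_normal_density_def scaleR_conv_of_real cis_conv_exp)
  also have "\<dots> = complex_of_real (sqrt (2 * pi) * exp (- ((x + y) / e)\<^sup>2 / 2))"
    by (simp add: char_std_normal_distribution)
  finally have g: "(LINT z|lborel. ?g z) = complex_of_real (sqrt (2 * pi) * exp (- ((x + y) / e)\<^sup>2 / 2))" .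
  have "(LINT z|lborel. ?g z) = \<bar>e\<bar> *\<^sub>R (LINT \<xi>|lborel. ?g (0 + e * \<xi>))"
    by (rule lborel_integral_real_affine) (use assms in simp)
  also have "(LINT \<xi>|lborel. ?g (0 + e * \<xi>)) =
    (LINT \<xi>|lborel. complex_of_real (exp (- (e * \<xi>)\<^sup>2 / 2)) * cis (- (x * \<xi>)) * cis (- (y * \<xi>)))"
  proof (intro Bochner_Integration.integral_cong refl)
    fix \<xi>
    have "- ((x + y) / e) * (0 + e * \<xi>) = - (x * \<xi>) + - (y * \<xi>)" using assms by (simp add: field_simps)
    then show "?g (0 + e * \<xi>) = complex_of_real (exp (- (e * \<xi>)\<^sup>2 / 2)) * cis (- (x * \<xi>)) * cis (- (y * \<xi>))"
      by (simp add: cis_mult mult.assoc)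
  qed
  finally have "(LINT \<xi>|lborel. complex_of_real (exp (- (e * \<xi>)\<^sup>2 / 2)) * cis (- (x * \<xi>)) * cis (- (y * \<xi>)))
     = complex_of_real (sqrt (2 * pi) * exp (- ((x + y) / e)\<^sup>2 / 2)) / complex_of_real e"
    using g assms by (simp add: scaleR_conv_of_real field_simps)
  then show ?thesis by (simp add: fourier_def)
qed

lemma integrable_gaussian:
  assumes "0 < e"
  shows "integrable lborel (\<lambda>\<xi>::real. exp (- (e * \<xi>)\<^sup>2 / 2))"
proof -
  have "integrable lborel (\<lambda>\<xi>. sqrt (2 * pi) * std_normal_density (0 + e * \<xi>))"
    by (intro integrable_mult_right lborel_integrable_real_affine) (use assms in auto)
  then show ?thesis by (simp add: std_normal_density_def)
qed

text \<open>Gaussian regularization: by duality the integral of \<open>fourier f\<close> against a wide modulated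
  Gaussian is that of \<open>f\<close> against a narrow one.\<close>

theorem fourier_inversion:
  assumes f: "f \<in> schwartz"
  shows "fourier (fourier f) x = f (- x)"
proof -
  let ?e = "\<lambda>n. 1 / real (Suc n)"
  let ?G = "\<lambda>n \<xi>. complex_of_real (exp (- (?e n * \<xi>)\<^sup>2 / 2)) * cis (- (x * \<xi>))"
  have [measurable]: "f \<in> borel_measurable borel" "fourier f \<in> borel_measurable borel"
    using f schwartz_fourier[OF f] by (auto simp: schwartz_measurable)
  have iG: "integrable lborel (?G n)" for n
    by (intro integrable_cis_mult integrable_of_real integrable_gaussian) auto
  have gauss: "(LINT z|lborel. exp (- z\<^sup>2 / 2)) = sqrt (2 * pi)"
    using integral_normal_density[of 1 0] by (simp add: std_normal_density_def)
  have lhs: "(\<lambda>n. LINT \<xi>|lborel. fourier f \<xi> * ?G n \<xi>) \<longlonglongrightarrow> (LINT \<xi>|lborel. fourier f \<xi> * cis (- (x * \<xi>)))"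
  proof (rule integral_dominated_convergence[where w = "\<lambda>\<xi>. cmod (fourier f \<xi>)"])
    show "AE \<xi> in lborel. (\<lambda>n. fourier f \<xi> * ?G n \<xi>) \<longlonglongrightarrow> fourier f \<xi> * cis (- (x * \<xi>))"
    proof (rule AE_I2)
      fix \<xi>
      have "(\<lambda>n. fourier f \<xi> * ?G n \<xi>) \<longlonglongrightarrow> fourier f \<xi> * (complex_of_real (exp (- (0 * \<xi>)\<^sup>2 / 2)) * cis (- (x * \<xi>)))"
        by (intro tendsto_intros LIMSEQ_Suc lim_1_over_n)
           (use LIMSEQ_Suc[OF lim_1_over_n] in simp)
      then show "(\<lambda>n. fourier f \<xi> * ?G n \<xi>) \<longlonglongrightarrow> fourier f \<xi> * cis (- (x * \<xi>))" by simp
    qed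
    show "integrable lborel (\<lambda>\<xi>. cmod (fourier f \<xi>))"
      by (intro integrable_norm schwartz_integrable schwartz_fourier f)
    show "AE \<xi> in lborel. norm (fourier f \<xi> * ?G n \<xi>) \<le> cmod (fourier f \<xi>)" for n
      by (auto simp: norm_mult intro!: mult_left_le)
  qed measurable
  \<comment> \<open>The substitution \<open>y = e z - x\<close> turns the narrow Gaussian into a
    fixed one and leaves \<open>e\<close> only in the argument of \<open>f\<close>, where the limit
    is a matter of continuity.\<close>
  have eq: "(LINT \<xi>|lborel. fourier f \<xi> * ?G n \<xi>) = (LINT z|lborel. f (?e n * z - x) * complex_of_real (exp (- z\<^sup>2 / 2)))" for n
  proof -
    let ?h = "\<lambda>y. f y * complex_of_real (1 / ?e n * exp (- ((x + y) / ?e n)\<^sup>2 / 2))"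
    have "(LINT \<xi>|lborel. fourier f \<xi> * ?G n \<xi>) = (LINT y|lborel. f y * fourier (?G n) y)"
      by (rule fourier_duality[OF schwartz_integrable[OF f] iG])
    also have "\<dots> = (LINT y|lborel. ?h y)"
      by (subst fourier_gaussian) auto
    also have "\<dots> = \<bar>?e n\<bar> *\<^sub>R (LINT z|lborel. ?h (- x + ?e n * z))"
      by (rule lborel_integral_real_affine) simp
    also have "\<dots> = (LINT z|lborel. \<bar>?e n\<bar> *\<^sub>R ?h (- x + ?e n * z))" by simp
    also have "\<dots> = (LINT z|lborel. f (?e n * z - x) * complex_of_real (exp (- z\<^sup>2 / 2)))"
    proof (intro Bochner_Integration.integral_cong refl)
      fix z
      have "\<bar>e\<bar> *\<^sub>R (f (- x + e * z) * complex_of_real (1 / e * exp (- ((x + (- x + e * z)) / e)\<^sup>2 / 2)))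
        = f (e * z - x) * complex_of_real (exp (- z\<^sup>2 / 2))" if "0 < e" for e
        using that by (simp add: scaleR_conv_of_real)
      from this[of "?e n"] show "\<bar>?e n\<bar> *\<^sub>R ?h (- x + ?e n * z) = f (?e n * z - x) * complex_of_real (exp (- z\<^sup>2 / 2))"
        by simp
    qed
    finally show ?thesis .
  qed
  obtain M where M: "\<And>x. cmod (complex_of_real (x ^ 0) * f x) \<le> M" using schwartz_bound[OF f] by metis
  have rhs: "(\<lambda>n. LINT z|lborel. f (?e n * z - x) * complex_of_real (exp (- z\<^sup>2 / 2))) \<longlonglongrightarrow>
    (LINT z|lborel. f (- x) * complex_of_real (exp (- z\<^sup>2 / 2)))"
  proof (rule integral_dominated_convergence[where w = "\<lambda>z. M * exp (- z\<^sup>2 / 2)"])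
    show "AE z in lborel. (\<lambda>n. f (?e n * z - x) * complex_of_real (exp (- z\<^sup>2 / 2))) \<longlonglongrightarrow> f (- x) * complex_of_real (exp (- z\<^sup>2 / 2))"
    proof (rule AE_I2)
      fix z
      have "isCont f (0 * z - x)" using schwartz_continuous[OF f, of UNIV] by (simp add: continuous_on_eq_continuous_at)
      moreover have "(\<lambda>n. ?e n * z - x) \<longlonglongrightarrow> 0 * z - x"
        by (intro tendsto_intros LIMSEQ_Suc[OF lim_1_over_n])
      ultimately have "(\<lambda>n. f (?e n * z - x)) \<longlonglongrightarrow> f (0 * z - x)" by (rule isCont_tendsto_compose)
      then show "(\<lambda>n. f (?e n * z - x) * complex_of_real (exp (- z\<^sup>2 / 2))) \<longlonglongrightarrow> f (- x) * complex_of_real (exp (- z\<^sup>2 / 2))"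
        by (intro tendsto_mult tendsto_const) simp
    qed
    show "integrable lborel (\<lambda>z. M * exp (- z\<^sup>2 / 2))"
      using integrable_gaussian[of 1] by (intro integrable_mult_right) simp
    show "AE z in lborel. norm (f (?e n * z - x) * complex_of_real (exp (- z\<^sup>2 / 2))) \<le> M * exp (- z\<^sup>2 / 2)" for n
      using M by (auto simp: norm_mult intro!: mult_right_mono)
  qed measurable
  have "(LINT \<xi>|lborel. fourier f \<xi> * cis (- (x * \<xi>))) = (LINT z|lborel. f (- x) * complex_of_real (exp (- z\<^sup>2 / 2)))"
    using LIMSEQ_unique[OF lhs] rhs unfolding eq by blast
  also have "\<dots> = f (- x) * complex_of_real (LINT z|lborel. exp (- z\<^sup>2 / 2))" by simp
  also have "\<dots> = f (- x) * complex_of_real (sqrt (2 * pi))" by (simp only: gauss)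
  finally show ?thesis by (simp add: fourier_def)
qed

lemma fourier_reflect: "fourier (\<lambda>x. f (- x)) \<xi> = fourier f (- \<xi>)"
proof -
  have "(LINT x|lborel. f x * cis (- (- \<xi> * x))) = \<bar>-1\<bar> *\<^sub>R (LINT x|lborel. f (0 + (-1) * x) * cis (- (- \<xi> * (0 + (-1) * x))))"
    by (rule lborel_integral_real_affine) simp
  then show ?thesis by (simp add: fourier_def)
qed

lemma fourier_cnj: "fourier (\<lambda>x. cnj (f x)) \<xi> = cnj (fourier f (- \<xi>))"
proof -
  have "(LINT x|lborel. cnj (f x) * cis (- (\<xi> * x))) = (LINT x|lborel. cnj (f x * cis (- (- \<xi> * x))))"
    by (simp add: cis_cnj)
  also have "\<dots> = cnj (LINT x|lborel. f x * cis (- (- \<xi> * x)))" by (rule Bochner_Integration.integral_cnj)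
  finally show ?thesis by (simp add: fourier_def)
qed

lemma schwartz_reflect:
  assumes "f \<in> schwartz" shows "(\<lambda>x. f (- x)) \<in> schwartz"
proof -
  have "(\<lambda>x. f (- x)) = fourier (fourier f)" using fourier_inversion[OF assms] by auto
  then show ?thesis using assms by (simp add: schwartz_fourier)
qed

lemma schwartz_cnj: "f \<in> schwartz \<Longrightarrow> (\<lambda>x. cnj (f x)) \<in> schwartz"
  using schwartz_reflect[OF schwartz_cnj_reflect] by simp

lemma fourier_surj:
  assumes "f \<in> schwartz"
  obtains g where "g \<in> schwartz" "fourier g = f" "\<And>x. g x = fourier f (- x)"
proof -
  have "fourier (\<lambda>x. fourier f (- x)) = f"
    using fourier_inversion[OF assms] by (auto simp: fourier_reflect fun_eq_iff)
  then show ?thesis using that schwartz_reflect[OF schwartz_fourier[OF assms]] by blast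
qed

text \<open>The conjugate of \<open>fourier f\<close> is the transform of
  \<open>x \<mapsto> cnj (f (- x))\<close>. Duality moves this transform onto the second factor,
  where inversion undoes it.\<close>

theorem Plancherel_schwartz:
  assumes f: "f \<in> schwartz"
  shows "l2norm lborel (fourier f) = l2norm lborel f"
proof -
  have eq: "cnj (fourier f x) = fourier (\<lambda>x. cnj (f (- x))) x" for x
    using fourier_reflect[of "\<lambda>x. cnj (f x)"] by (simp add: fourier_cnj)
  have sq: "complex_of_real ((cmod z)\<^sup>2) = z * cnj z" for z
    by (rule complex_norm_square)
  have "complex_of_real (LINT x|lborel. (cmod (fourier f x))\<^sup>2) = (LINT x|lborel. fourier f x * cnj (fourier f x))"
    by (subst integral_complex_of_real[symmetric]) (simp only: sq)
  also have "\<dots> = (LINT x|lborel. fourier f x * fourier (\<lambda>x. cnj (f (- x))) x)" by (simp only: eq)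
  also have "\<dots> = (LINT x|lborel. f x * fourier (fourier (\<lambda>x. cnj (f (- x)))) x)"
    by (intro fourier_duality schwartz_integrable schwartz_fourier schwartz_cnj_reflect f)
  also have "\<dots> = (LINT x|lborel. f x * cnj (f x))"
    using fourier_inversion[OF schwartz_cnj_reflect[OF f]] by simp
  also have "\<dots> = complex_of_real (LINT x|lborel. (cmod (f x))\<^sup>2)"
    by (subst integral_complex_of_real[symmetric]) (simp only: sq)
  finally show ?thesis unfolding l2norm_def of_real_eq_iff by simp
qed

section \<open>Smooth bumps of compact support\<close>

text \<open>The functions \<open>x\<^sup>-\<^sup>m exp (- 1 / x)\<close>, extended by \<open>0\<close> to the left; their span is closed under
  differentiation. Dilating the bump built from \<open>m = 0\<close> makes it converge boundedly to the indicator
  of the interval, since \<open>exp (- 1 / x)\<close> tends to \<open>1\<close> at infinity.\<close>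

definition expinv :: "nat \<Rightarrow> real \<Rightarrow> complex" where
  "expinv m x = (if 0 < x then complex_of_real ((1 / x) ^ m * exp (- (1 / x))) else 0)"

lemma expinv_nonpos: "x \<le> 0 \<Longrightarrow> expinv m x = 0"
  by (simp add: expinv_def)

lemma expinv_tendsto_0: "((\<lambda>x. (1 / x) ^ m * exp (- (1 / x))) \<longlongrightarrow> (0::real)) (at_right 0)"
proof -
  have "((\<lambda>x. (inverse x) ^ m / exp (inverse x)) \<longlongrightarrow> (0::real)) (at_right 0)"
    by (rule filterlim_compose[OF tendsto_power_div_exp_0 filterlim_inverse_at_top_right])
  then show ?thesis by (simp add: inverse_eq_divide exp_minus field_simps)
qed

text \<open>Only the origin needs an argument: from the right the difference quotient has modulus
  \<open>(1 / h) ^ (m + 1) * exp (- (1 / h))\<close>, which tends to 0 because the exponential beats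
  every power.\<close>

lemma expinv_has_vector_derivative:
  "(expinv m has_vector_derivative (expinv (m + 2) x - of_nat m * expinv (m + 1) x)) (at x)"
proof -
  consider "0 < x" | "x < 0" | "x = 0" by linarith
  then show ?thesis
  proof cases
    case 1
    let ?f = "\<lambda>x::real. (1 / x) ^ m * exp (- (1 / x))"
    let ?f' = "(1 / x) ^ (m + 2) * exp (- (1 / x)) - real m * ((1 / x) ^ (m + 1) * exp (- (1 / x)))"
    have "(?f has_real_derivative ?f') (at x)"
    proof -
      have 2: "((\<lambda>x::real. 1 / x) has_real_derivative - ((1 / x) * (1 / x))) (at x)"
        using 1 by (auto intro!: derivative_eq_intros simp: field_simps)
      have "((\<lambda>x. exp (- (1 / x))) has_real_derivative exp (- (1 / x)) * - (- ((1 / x) * (1 / x)))) (at x)"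
        by (intro DERIV_fun_exp DERIV_minus 2)
      from DERIV_mult[OF DERIV_power[OF 2, of m] this]
      show ?thesis by (rule DERIV_cong) (cases m; simp add: power2_eq_square algebra_simps)
    qed
    then have "((\<lambda>x. complex_of_real (?f x)) has_vector_derivative complex_of_real ?f') (at x)"
      by (intro has_vector_derivative_of_real) (simp add: has_real_derivative_iff_has_vector_derivative)
    then have "(expinv m has_vector_derivative complex_of_real ?f') (at x)"
      by (rule has_vector_derivative_transform_within_open[of _ _ _ "{0<..}"])
         (use 1 in \<open>auto simp: expinv_def\<close>)
    then show ?thesis using 1 by (simp add: expinv_def)
  next
    case 2
    have "((\<lambda>x. 0) has_vector_derivative (0::complex)) (at x)" by simp
    then have "(expinv m has_vector_derivative 0) (at x)"
      by (rule has_vector_derivative_transform_within_open[of _ _ _ "{..<0}"])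
         (use 2 in \<open>auto simp: expinv_def\<close>)
    then show ?thesis using 2 by (simp add: expinv_def)
  next
    case 3
    have "((\<lambda>h. norm (expinv m (0 + h) - expinv m 0 - h *\<^sub>R 0) / norm h) \<longlongrightarrow> 0) (at 0)"
      unfolding filterlim_at_split
    proof
      have "eventually (\<lambda>h::real. norm (expinv m (0 + h) - expinv m 0 - h *\<^sub>R 0) / norm h = 0) (at_left 0)"
        unfolding eventually_at_filter by (intro always_eventually) (auto simp: expinv_def)
      then show "((\<lambda>h. norm (expinv m (0 + h) - expinv m 0 - h *\<^sub>R 0) / norm h) \<longlongrightarrow> 0) (at_left 0)"
        by (rule tendsto_eventually)
      have "eventually (\<lambda>h::real. (1 / h) ^ (m + 1) * exp (- (1 / h)) = norm (expinv m (0 + h) - expinv m 0 - h *\<^sub>R 0) / norm h) (at_right 0)"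
        unfolding eventually_at_filter
        by (intro always_eventually) (auto simp: expinv_def norm_mult norm_power norm_divide)
      then show "((\<lambda>h. norm (expinv m (0 + h) - expinv m 0 - h *\<^sub>R 0) / norm h) \<longlongrightarrow> 0) (at_right 0)"
        by (rule Lim_transform_eventually[OF expinv_tendsto_0])
    qed
    then have "(expinv m has_vector_derivative 0) (at 0)"
      unfolding has_vector_derivative_def has_derivative_at by (simp add: bounded_linear_zero)
    then show ?thesis using 3 by (simp add: expinv_def)
  qed
qed

text \<open>One factor vanishes to the left of \<open>c\<close>, the other to the right of
  \<open>d\<close>, so that for positive \<open>k\<close> every member is supported in
  \<open>[c, d]\<close>. The coefficient \<open>a\<close> and the two exponents are free because
  differentiation changes them.\<close>

inductive_set bump_algebra :: "real \<Rightarrow> real \<Rightarrow> real \<Rightarrow> (real \<Rightarrow> complex) set" for k c d where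
  prod: "(\<lambda>x. a * (expinv m (k * (x - c)) * expinv l (k * (d - x)))) \<in> bump_algebra k c d"
| sum: "f \<in> bump_algebra k c d \<Longrightarrow> g \<in> bump_algebra k c d \<Longrightarrow> (\<lambda>x. f x + g x) \<in> bump_algebra k c d"

definition bump :: "real \<Rightarrow> real \<Rightarrow> real \<Rightarrow> real \<Rightarrow> complex" where
  "bump k c d x = expinv 0 (k * (x - c)) * expinv 0 (k * (d - x))"

lemma expinv_affine_has_vector_derivative:
  "((\<lambda>x. expinv m (a + k * x)) has_vector_derivative
     of_real k * (expinv (m + 2) (a + k * x) - of_nat m * expinv (m + 1) (a + k * x))) (at x)"
proof -
  have "((\<lambda>x. a + k * x) has_vector_derivative k) (at x)" by (auto intro!: derivative_eq_intros)
  from vector_diff_chain_at[OF this expinv_has_vector_derivative]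
  show ?thesis by (simp add: o_def scaleR_conv_of_real)
qed

lemma bump_algebra_deriv:
  assumes "f \<in> bump_algebra k c d"
  shows "\<exists>f'\<in>bump_algebra k c d. \<forall>x. (f has_vector_derivative f' x) (at x)"
  using assms
proof induction
  case (prod a m l)
  let ?E = "\<lambda>m x. expinv m (k * (x - c))" and ?F = "\<lambda>l x. expinv l (k * (d - x))"
  let ?D = "\<lambda>x. ((a * of_real k) * (?E (m+2) x * ?F l x) + (- a * of_real k * of_nat m) * (?E (m+1) x * ?F l x))
      + ((- a * of_real k) * (?E m x * ?F (l+2) x) + (a * of_real k * of_nat l) * (?E m x * ?F (l+1) x))"
  have E: "(?E m has_vector_derivative of_real k * (?E (m+2) x - of_nat m * ?E (m+1) x)) (at x)" for x
    using expinv_affine_has_vector_derivative[of m "- k * c" k x] by (simp add: algebra_simps)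
  have F: "(?F l has_vector_derivative of_real (- k) * (?F (l+2) x - of_nat l * ?F (l+1) x)) (at x)" for x
    using expinv_affine_has_vector_derivative[of l "k * d" "- k" x] by (simp add: algebra_simps)
  have "((\<lambda>x. a * (?E m x * ?F l x)) has_vector_derivative ?D x) (at x)" for x
    using has_vector_derivative_mult_right[OF has_vector_derivative_mult[OF E[of x] F[of x]], of a]
    by (simp add: algebra_simps)
  moreover have "?D \<in> bump_algebra k c d" by (intro bump_algebra.intros)
  ultimately show ?case by (intro bexI allI)
next
  case (sum f g)
  then obtain f' g' where "f' \<in> bump_algebra k c d" "g' \<in> bump_algebra k c d"
    "\<And>x. (f has_vector_derivative f' x) (at x)" "\<And>x. (g has_vector_derivative g' x) (at x)" by blast
  then show ?case
    by (intro bexI[of _ "\<lambda>x. f' x + g' x"]) (auto intro!: has_vector_derivative_add bump_algebra.sum)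
qed

lemma compact_support_bounded:
  fixes f :: "real \<Rightarrow> complex"
  assumes "continuous_on UNIV f" "\<And>x. x \<notin> {c..d} \<Longrightarrow> f x = 0"
  shows "bounded (range f)"
proof -
  have "bounded (f ` {c..d})"
    by (intro compact_imp_bounded compact_continuous_image continuous_on_subset[OF assms(1)]) auto
  then have "bounded (insert 0 (f ` {c..d}))" by simp
  then show ?thesis
    by (rule bounded_subset) (use assms(2) in \<open>fastforce simp: image_iff\<close>)
qed

lemma bump_algebra_schwartz:
  assumes "0 < k" "f \<in> bump_algebra k c d"
  shows "f \<in> schwartz"
proof (rule schwartz_coinduct[OF assms(2) bump_algebra_deriv])
  fix f j assume f: "f \<in> bump_algebra k c d"
  have "f x = 0" if "x \<notin> {c..d}" for x
    using f that assms(1)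
    by induction (auto simp: expinv_nonpos mult_nonneg_nonpos not_le)
  moreover have "continuous_on UNIV f"
    using bump_algebra_deriv[OF f]
    by (auto intro!: continuous_at_imp_continuous_on has_vector_derivative_continuous)
  ultimately show "bounded (range (\<lambda>x. complex_of_real (x ^ j) * f x))"
    by (intro compact_support_bounded[of _ c d] continuous_intros) auto
qed

lemma bump_schwartz: "0 < k \<Longrightarrow> bump k c d \<in> schwartz"
  using bump_algebra_schwartz[OF _ bump_algebra.prod[of 1 0 k c 0 d]] by (simp add: bump_def[abs_def])

lemma bump_outside: "0 < k \<Longrightarrow> x \<notin> {c<..<d} \<Longrightarrow> bump k c d x = 0"
  by (auto simp: bump_def expinv_nonpos mult_nonneg_nonpos not_less)

lemma bump_nonzero: "0 < k \<Longrightarrow> x \<in> {c<..<d} \<Longrightarrow> bump k c d x \<noteq> 0"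
  by (auto simp: bump_def expinv_def)

lemma cmod_expinv_le_1: "cmod (expinv 0 x) \<le> 1"
  by (simp add: expinv_def)

lemma bump_le_1: "cmod (bump k c d x) \<le> 1"
  unfolding bump_def norm_mult using mult_mono[OF cmod_expinv_le_1 cmod_expinv_le_1] by force

lemma expinv_tendsto_1: "(expinv 0 \<longlongrightarrow> 1) at_top"
proof -
  have "((\<lambda>x::real. complex_of_real (exp (- (1 / x)))) \<longlongrightarrow> complex_of_real 1) at_top"
    by (intro tendsto_of_real) real_asymp
  moreover have "eventually (\<lambda>x::real. complex_of_real (exp (- (1 / x))) = expinv 0 x) at_top"
    using eventually_gt_at_top[of 0] by eventually_elim (simp add: expinv_def)
  ultimately show ?thesis using Lim_transform_eventually by force
qed

lemma bump_tendsto_indicator: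
  "(\<lambda>n. bump (real (Suc n)) c d x) \<longlonglongrightarrow> indicator (box c d) x"
proof (cases "x \<in> {c<..<d}")
  case True
  have "filterlim (\<lambda>n. real (Suc n) * a) at_top sequentially" if "0 < a" for a
    using that by real_asymp
  then have "(\<lambda>n. bump (real (Suc n)) c d x) \<longlonglongrightarrow> 1 * 1"
    unfolding bump_def using True
    by (intro tendsto_mult filterlim_compose[OF expinv_tendsto_1]) auto
  then show ?thesis using True by simp
next
  case False
  then show ?thesis by (simp add: bump_outside)
qed

section \<open>Test functions, density and cutoffs\<close>

lemma AE_zero_of_box_integrals:
  fixes H :: "'a::euclidean_space \<Rightarrow> complex"
  assumes H: "integrable lborel H" and box: "\<And>c d. (LINT x:box c d|lborel. H x) = 0"
  shows "AE x in lborel. H x = 0"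
proof (rule sigma_finite_measure.density_zero[OF sigma_finite_lborel H])
  have [measurable]: "H \<in> borel_measurable borel" using borel_measurable_integrable[OF H] by simp
  have si: "set_integrable lborel A H" if "A \<in> sets borel" for A
    unfolding set_integrable_def by (rule integrable_mult_indicator) (use H that in auto)
  \<comment> \<open>In the Dynkin argument below, complements are taken in the whole space, so the
    total integral has to vanish first; boxes exhaust it.\<close>
  have univ: "(LINT x:UNIV|lborel. H x) = 0"
  proof -
    let ?B = "\<lambda>n. box (- (real n *\<^sub>R One)) (real n *\<^sub>R One :: 'a)"
    have B: "\<exists>m. \<forall>n\<ge>m. x \<in> ?B n" for x
    proof -
      obtain m where m: "norm x < real m" using reals_Archimedean2 by blast
      have "- real n < x \<bullet> i \<and> x \<bullet> i < real n" if "i \<in> Basis" "m \<le> n" for i n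
        using Basis_le_norm[OF that(1), of x] m that(2) by auto
      then show ?thesis by (auto simp: mem_box)
    qed
    have "(\<lambda>n. LINT x|lborel. indicator (?B n) x *\<^sub>R H x) \<longlonglongrightarrow> (LINT x|lborel. H x)"
    proof (rule integral_dominated_convergence[where w = "\<lambda>x. norm (H x)"])
      show "AE x in lborel. (\<lambda>n. indicator (?B n) x *\<^sub>R H x) \<longlonglongrightarrow> H x"
      proof (rule AE_I2)
        fix x
        obtain m where "\<forall>n\<ge>m. x \<in> ?B n" using B by blast
        then show "(\<lambda>n. indicator (?B n) x *\<^sub>R H x) \<longlonglongrightarrow> H x"
          by (intro tendsto_eventually eventually_sequentiallyI[of m]) simp
      qed
    qed (use H in \<open>auto simp: indicator_def\<close>)
    then show ?thesis
      using box by (simp add: set_lebesgue_integral_def LIMSEQ_const_iff)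
  qed
  fix A :: "'a set" assume "A \<in> sets lborel"
  then have AG: "A \<in> sigma_sets UNIV (range (\<lambda>(a,b). box a b :: 'a set))" by (simp add: borel_eq_box)
  have "Int_stable (range (\<lambda>(a,b). box a b :: 'a set))" unfolding Int_stable_def by (auto simp: box_Int_box)
  moreover have "range (\<lambda>(a,b). box a b :: 'a set) \<subseteq> Pow UNIV" by auto
  moreover note AG
  ultimately show "(LINT x:A|lborel. H x) = 0"
  proof (induction rule: sigma_sets_induct_disjoint)
    case (compl A)
    then have "A \<in> sets borel" by (simp add: borel_eq_box)
    then have "(LINT x:A \<union> (UNIV - A)|lborel. H x) = (LINT x:A|lborel. H x) + (LINT x:UNIV - A|lborel. H x)"
      by (intro set_integral_Un si) auto
    then show ?case using compl univ by simp
  next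
    case (union A)
    then have A: "A i \<in> sets borel" for i by (auto simp: borel_eq_box)
    have "(LINT x:(\<Union>i. A i)|lborel. H x) = (\<Sum>i. (LINT x:(A i)|lborel. H x))"
    proof (rule lebesgue_integral_countable_add)
      show "\<And>i j. i \<noteq> j \<Longrightarrow> A i \<inter> A j = {}" using \<open>disjoint_family A\<close> by (auto simp: disjoint_family_on_def)
      show "set_integrable lborel (\<Union>i. A i) H" using A by (intro si) auto
    qed (use A in auto)
    then show ?case using union by simp
  qed (use box in \<open>auto simp: set_lebesgue_integral_def\<close>)
qed

text \<open>\<open>h\<close> itself need not be integrable, but \<open>h\<close> times a bump is.
  The integral of that product over a box is a limit of integrals against products of two bumps,
  which are test functions again; and the bump has no zero inside its interval, so \<open>h\<close>
  vanishes there.\<close>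

lemma schwartz_test_AE_zero:
  assumes h [measurable]: "h \<in> borel_measurable borel"
    and i: "\<And>\<phi>. \<phi> \<in> schwartz \<Longrightarrow> integrable lborel (\<lambda>x. h x * \<phi> x)"
    and 0: "\<And>\<phi>. \<phi> \<in> schwartz \<Longrightarrow> (LINT x|lborel. h x * \<phi> x) = 0"
  shows "AE x in lborel. h x = 0"
proof -
  have "AE x in lborel. h x * bump 1 (- real n) (real n) x = 0" for n
  proof (rule AE_zero_of_box_integrals)
    let ?b = "bump 1 (- real n) (real n)"
    have b: "?b \<in> schwartz" by (rule bump_schwartz) simp
    show ib: "integrable lborel (\<lambda>x. h x * ?b x)" by (rule i[OF b])
    fix c d :: real
    have [measurable]: "bump (real (Suc k)) c d \<in> borel_measurable borel" for k
      by (rule schwartz_measurable[OF bump_schwartz]) simp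
    have [measurable]: "?b \<in> borel_measurable borel" by (rule schwartz_measurable[OF b])
    have "(\<lambda>k. LINT x|lborel. bump (real (Suc k)) c d x * (h x * ?b x)) \<longlonglongrightarrow>
      (LINT x|lborel. indicator (box c d) x * (h x * ?b x))"
    proof (rule integral_dominated_convergence[where w = "\<lambda>x. cmod (h x * ?b x)"])
      show "AE x in lborel. (\<lambda>k. bump (real (Suc k)) c d x * (h x * ?b x)) \<longlonglongrightarrow> indicator (box c d) x * (h x * ?b x)"
        by (intro AE_I2 tendsto_mult tendsto_const bump_tendsto_indicator)
      show "AE x in lborel. cmod (bump (real (Suc k)) c d x * (h x * ?b x)) \<le> cmod (h x * ?b x)" for k
        unfolding norm_mult[of "bump _ _ _ _"] by (intro AE_I2 mult_left_le_one_le bump_le_1) auto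
      show "(\<lambda>x. bump (real (Suc k)) c d x * (h x * ?b x)) \<in> borel_measurable lborel" for k
        by measurable
    qed (use ib in auto)
    moreover have "(LINT x|lborel. bump (real (Suc k)) c d x * (h x * ?b x)) = 0" for k
    proof -
      have "(\<lambda>x. bump (real (Suc k)) c d x * ?b x) \<in> schwartz" by (intro schwartz_mult b bump_schwartz) simp
      from 0[OF this] show ?thesis by (simp add: ac_simps)
    qed
    ultimately have "(LINT x|lborel. indicator (box c d) x * (h x * ?b x)) = 0"
      by (simp add: LIMSEQ_const_iff)
    moreover have "indicator (box c d) x *\<^sub>R z = indicator (box c d) x * z" for x and z :: complex
      by (simp add: indicator_def)
    ultimately show "(LINT x:box c d|lborel. h x * ?b x) = 0"
      by (simp add: set_lebesgue_integral_def)
  qed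
  then have "AE x in lborel. \<forall>n. h x * bump 1 (- real n) (real n) x = 0" unfolding AE_all_countable by blast
  then show ?thesis
  proof eventually_elim
    case (elim x)
    obtain n where "\<bar>x\<bar> < real n" using reals_Archimedean2 by blast
    then have "bump 1 (- real n) (real n) x \<noteq> 0" by (intro bump_nonzero) auto
    then show ?case using elim by auto
  qed
qed

text \<open>The functions that \<open>D\<close> approximates arbitrarily well are closed under sums,
  multiples and limits, so density has to be checked on indicators of boxes only.\<close>

lemma sqint_dense_induct:
  fixes N :: "'a::euclidean_space measure" and D :: "('a \<Rightarrow> complex) set"
  assumes sets: "sets N = sets borel" and fin: "\<And>a b. emeasure N (box a b) < \<infinity>"
    and D: "\<And>f. f \<in> D \<Longrightarrow> sqint N f"
    and add: "\<And>f g. f \<in> D \<Longrightarrow> g \<in> D \<Longrightarrow> (\<lambda>x. f x + g x) \<in> D"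
    and scale: "\<And>c f. f \<in> D \<Longrightarrow> (\<lambda>x. c * f x) \<in> D"
    and box: "\<And>a b e. 0 < e \<Longrightarrow> \<exists>g\<in>D. l2norm N (\<lambda>x. indicator (box a b) x - g x) < e"
    and f: "sqint N f" and e: "0 < e"
  shows "\<exists>g\<in>D. l2norm N (\<lambda>x. f x - g x) < e"
proof -
  have "\<forall>e>0. \<exists>g\<in>D. l2norm N (\<lambda>x. f x - g x) < e"
    using sets fin _ _ _ _ f
  proof (rule sqint_induct_boxes[where P = "\<lambda>f. \<forall>e>0. \<exists>g\<in>D. l2norm N (\<lambda>x. f x - g x) < e"])
    fix f g
    assume fg: "sqint N f" "sqint N g" and f: "\<forall>e>0. \<exists>u\<in>D. l2norm N (\<lambda>x. f x - u x) < e"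
      and g: "\<forall>e>0. \<exists>u\<in>D. l2norm N (\<lambda>x. g x - u x) < e"
    show "\<forall>e>0. \<exists>u\<in>D. l2norm N (\<lambda>x. f x + g x - u x) < e"
    proof (intro allI impI)
      fix e :: real assume "0 < e"
      then obtain u v where uv: "u \<in> D" "v \<in> D" "l2norm N (\<lambda>x. f x - u x) < e / 2" "l2norm N (\<lambda>x. g x - v x) < e / 2"
        using f g half_gt_zero by metis
      have "l2norm N (\<lambda>x. (f x - u x) + (g x - v x)) \<le> l2norm N (\<lambda>x. f x - u x) + l2norm N (\<lambda>x. g x - v x)"
        by (intro l2norm_triangle sqint_diff fg D uv)
      then have "l2norm N (\<lambda>x. f x + g x - (u x + v x)) < e" using uv by (simp add: algebra_simps)
      then show "\<exists>u\<in>D. l2norm N (\<lambda>x. f x + g x - u x) < e" using add[OF uv(1,2)] by (intro bexI)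
    qed
  next
    fix c f
    assume f: "sqint N f" "\<forall>e>0. \<exists>u\<in>D. l2norm N (\<lambda>x. f x - u x) < e"
    show "\<forall>e>0. \<exists>u\<in>D. l2norm N (\<lambda>x. c * f x - u x) < e"
    proof (intro allI impI)
      fix e :: real assume "0 < e"
      \<comment> \<open>The added 1 covers the multiple by 0.\<close>
      then have "0 < e / (cmod c + 1)" by (simp add: add_nonneg_pos)
      then obtain u where u: "u \<in> D" "l2norm N (\<lambda>x. f x - u x) < e / (cmod c + 1)" using f by blast
      have "l2norm N (\<lambda>x. c * f x - c * u x) = cmod c * l2norm N (\<lambda>x. f x - u x)"
        by (simp add: l2norm_cmult flip: right_diff_distrib)
      also have "\<dots> \<le> (cmod c + 1) * l2norm N (\<lambda>x. f x - u x)" by (intro mult_right_mono l2norm_nonneg) auto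
      also have "\<dots> < e" using u(2) by (subst (asm) pos_less_divide_eq) (auto intro: add_nonneg_pos simp: ac_simps add_pos_nonneg)
      finally show "\<exists>u\<in>D. l2norm N (\<lambda>x. c * f x - u x) < e" using scale[OF u(1)] by (intro bexI)
    qed
  next
    fix F f
    assume F: "\<And>n::nat. sqint N (F n)" "\<And>n. \<forall>e>0. \<exists>u\<in>D. l2norm N (\<lambda>x. F n x - u x) < e"
      "sqint N f" "(\<lambda>n. l2norm N (\<lambda>x. F n x - f x)) \<longlonglongrightarrow> 0"
    show "\<forall>e>0. \<exists>u\<in>D. l2norm N (\<lambda>x. f x - u x) < e"
    proof (intro allI impI)
      fix e :: real assume "0 < e"
      then have "eventually (\<lambda>n. l2norm N (\<lambda>x. F n x - f x) < e / 2) sequentially"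
        by (intro order_tendstoD[OF F(4)]) simp
      then obtain n where n: "l2norm N (\<lambda>x. F n x - f x) < e / 2" by (auto simp: eventually_sequentially)
      obtain u where u: "u \<in> D" "l2norm N (\<lambda>x. F n x - u x) < e / 2" using F(2) \<open>0 < e\<close> half_gt_zero by metis
      have "l2norm N (\<lambda>x. f x - u x) \<le> l2norm N (\<lambda>x. f x - F n x) + l2norm N (\<lambda>x. F n x - u x)"
        by (intro l2norm_diff_triangle F D u)
      then have "l2norm N (\<lambda>x. f x - u x) < e" using n u by (simp add: l2norm_minus_commute[of N f])
      then show "\<exists>u\<in>D. l2norm N (\<lambda>x. f x - u x) < e" using u(1) by blast
    qed
  qed (use box in auto)
  then show ?thesis using e by blast
qed

text \<open>Stated for a general Borel measure because it serves twice: for Lebesgue measure and for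
  the weighted measure on the frequency side.\<close>

lemma bump_l2norm_tendsto:
  fixes N :: "real measure"
  assumes sets [measurable_cong]: "sets N = sets borel" and fin: "emeasure N {c<..<d} < \<infinity>"
  shows "(\<lambda>n. l2norm N (\<lambda>x. bump (real (Suc n)) c d x - indicator (box c d) x)) \<longlonglongrightarrow> 0"
proof (rule l2norm_dominated(2))
  show "sqint N (indicator {c<..<d})" by (rule sqint_indicator) (use fin sets in auto)
  show "bump (real (Suc n)) c d \<in> borel_measurable N" for n
    using schwartz_measurable[OF bump_schwartz, of "real (Suc n)" c d] by simp
  show "AE x in N. cmod (bump (real (Suc n)) c d x) \<le> cmod (indicator {c<..<d} x)" for n
    using bump_le_1[of "real (Suc n)" c d] bump_outside[of "real (Suc n)" _ c d]
    by (intro AE_I2) (auto simp: indicator_def)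
qed (use bump_tendsto_indicator in auto)

theorem schwartz_dense:
  assumes "sqint lborel f" "0 < e"
  shows "\<exists>\<phi>\<in>schwartz. l2norm lborel (\<lambda>x. f x - \<phi> x) < e"
proof (rule sqint_dense_induct[OF _ _ _ _ _ _ assms])
  fix c d e :: real assume "0 < e"
  then have "eventually (\<lambda>n. l2norm lborel (\<lambda>x. bump (real (Suc n)) c d x - indicator (box c d) x) < e) sequentially"
    by (intro order_tendstoD[OF bump_l2norm_tendsto]) (use emeasure_lborel_box_finite[of c d] in \<open>auto simp: box_real\<close>)
  then obtain n where "l2norm lborel (\<lambda>x. bump (real (Suc n)) c d x - indicator (box c d) x) < e"
    by (auto simp: eventually_sequentially)
  then show "\<exists>g\<in>schwartz. l2norm lborel (\<lambda>x. indicator (box c d) x - g x) < e"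
    by (intro bexI[of _ "bump (real (Suc n)) c d"] bump_schwartz) (auto simp: l2norm_minus_commute)
qed (rule emeasure_lborel_box_finite | simp add: schwartz_sqint schwartz_add schwartz_cmult)+

text \<open>A cutoff whose values stay below 1 everywhere. It converges to 1 and its derivative to
  0, both pointwise and boundedly, which is enough for truncation in a norm with one
  derivative.\<close>

definition cutoff :: "nat \<Rightarrow> real \<Rightarrow> complex" where
  "cutoff n = bump 1 (- real n) (real n)"

lemma cutoff_schwartz: "cutoff n \<in> schwartz"
  unfolding cutoff_def by (rule bump_schwartz) simp

lemma cutoff_outside: "\<bar>x\<bar> > real n \<Longrightarrow> cutoff n x = 0"
  unfolding cutoff_def by (rule bump_outside) auto

lemma cutoff_vderiv:
  "vderiv (cutoff n) x = expinv 2 (real n + x) * expinv 0 (real n - x) - expinv 0 (real n + x) * expinv 2 (real n - x)"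
proof -
  note d = expinv_affine_has_vector_derivative[of 0, unfolded add_0 of_nat_0 mult_zero_left diff_zero]
  have "(cutoff n has_vector_derivative (expinv 2 (real n + x) * expinv 0 (real n - x) - expinv 0 (real n + x) * expinv 2 (real n - x))) (at x)" for x
    using has_vector_derivative_mult[OF d[of "real n" 1 x] d[of "real n" "-1" x]]
    by (simp add: cutoff_def bump_def[abs_def] add.commute)
  from vderivI[OF this] show ?thesis by simp
qed

text \<open>With \<open>y = 1 / x\<close> this is the inequality between \<open>y\<^sup>2\<close>
  and \<open>2 * exp y\<close>, read off from the quadratic Taylor polynomial.\<close>

lemma cmod_expinv_2_le: "cmod (expinv 2 x) \<le> 2"
proof (cases "0 < x")
  case True
  have "1 + 1 / x + (1 / x)\<^sup>2 / 2 \<le> exp (1 / x)" using True by (intro exp_lower_Taylor_quadratic) simp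
  moreover have "0 < 1 + 1 / x" using True by (simp add: add_pos_pos)
  ultimately have "(1 / x)\<^sup>2 \<le> 2 * exp (1 / x)" by linarith
  then have "(1 / x)\<^sup>2 * exp (- (1 / x)) \<le> 2" by (simp add: exp_minus pos_divide_le_eq divide_inverse[symmetric])
  then show ?thesis using True by (simp add: expinv_def norm_mult norm_power norm_divide del: of_real_exp)
qed (simp add: expinv_def)

lemma cutoff_tendsto:
  "(\<lambda>n. cutoff n x) \<longlonglongrightarrow> 1" "(\<lambda>n. vderiv (cutoff n) x) \<longlonglongrightarrow> 0"
proof -
  have p: "filterlim (\<lambda>n. real n + x) at_top sequentially" and m: "filterlim (\<lambda>n. real n - x) at_top sequentially"
    by real_asymp+
  note e0 = filterlim_compose[OF expinv_tendsto_1 p] filterlim_compose[OF expinv_tendsto_1 m]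
  have "((\<lambda>x::real. complex_of_real ((1 / x) ^ 2 * exp (- (1 / x)))) \<longlongrightarrow> complex_of_real 0) at_top"
    by (intro tendsto_of_real) real_asymp
  moreover have "eventually (\<lambda>x::real. complex_of_real ((1 / x) ^ 2 * exp (- (1 / x))) = expinv 2 x) at_top"
    using eventually_gt_at_top[of 0] by eventually_elim (simp add: expinv_def)
  ultimately have e2: "(expinv 2 \<longlongrightarrow> 0) at_top" using Lim_transform_eventually by force
  note e2 = filterlim_compose[OF e2 p] filterlim_compose[OF e2 m]
  have "(\<lambda>n. expinv 0 (real n + x) * expinv 0 (real n - x)) \<longlonglongrightarrow> 1 * 1" by (intro tendsto_mult e0)
  then show "(\<lambda>n. cutoff n x) \<longlonglongrightarrow> 1" by (simp add: cutoff_def bump_def add.commute)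
  have "(\<lambda>n. expinv 2 (real n + x) * expinv 0 (real n - x) - expinv 0 (real n + x) * expinv 2 (real n - x)) \<longlonglongrightarrow> 0 * 1 - 1 * 0"
    by (intro tendsto_mult tendsto_diff e0 e2)
  then show "(\<lambda>n. vderiv (cutoff n) x) \<longlonglongrightarrow> 0" by (simp add: cutoff_vderiv)
qed

lemma cutoff_bound: "cmod (cutoff n x) \<le> 1" "cmod (vderiv (cutoff n) x) \<le> 4"
proof -
  show "cmod (cutoff n x) \<le> 1" unfolding cutoff_def by (rule bump_le_1)
  have "cmod (expinv 2 (real n + x) * expinv 0 (real n - x)) \<le> 2 * 1" "cmod (expinv 0 (real n + x) * expinv 2 (real n - x)) \<le> 1 * 2"
    unfolding norm_mult by (intro mult_mono cmod_expinv_2_le cmod_expinv_le_1; simp)+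
  then show "cmod (vderiv (cutoff n) x) \<le> 4"
    unfolding cutoff_vderiv using norm_triangle_ineq4[of "expinv 2 (real n + x) * expinv 0 (real n - x)" "expinv 0 (real n + x) * expinv 2 (real n - x)"]
    by linarith
qed

lemma vderiv_mult:
  assumes "f \<in> schwartz" "g \<in> schwartz"
  shows "vderiv (\<lambda>x. f x * g x) = (\<lambda>x. f x * vderiv g x + vderiv f x * g x)"
  by (intro vderivI has_vector_derivative_mult schwartz_vderiv assms)

lemma vderiv_diff:
  assumes "f \<in> schwartz" "g \<in> schwartz"
  shows "vderiv (\<lambda>x. f x - g x) = (\<lambda>x. vderiv f x - vderiv g x)"
  by (intro vderivI derivative_intros schwartz_vderiv assms)

text \<open>By the product rule the derivative of the truncation error is \<open>f\<close> times the
  derivative of the cutoff plus the truncation error of the derivative of \<open>f\<close>; both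
  tend to 0 by dominated convergence.\<close>

lemma cutoff_approx:
  assumes f: "f \<in> schwartz"
  shows "(\<lambda>n. l2norm lborel (\<lambda>x. f x * cutoff n x - f x)) \<longlonglongrightarrow> 0"
    "(\<lambda>n. l2norm lborel (vderiv (\<lambda>x. f x * cutoff n x - f x))) \<longlonglongrightarrow> 0"
proof -
  have f' [measurable]: "f \<in> borel_measurable borel" "vderiv f \<in> borel_measurable borel"
    "cutoff n \<in> borel_measurable borel" "vderiv (cutoff n) \<in> borel_measurable borel" for n
    using f cutoff_schwartz[of n] by (auto intro!: schwartz_measurable schwartz_vderiv)
  have 1: "(\<lambda>n. l2norm lborel (\<lambda>x. f x * cutoff n x - f x)) \<longlonglongrightarrow> 0" if f: "f \<in> schwartz" for f
  proof (rule l2norm_dominated(2)[OF _ _ schwartz_sqint[OF f]])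
    have [measurable]: "f \<in> borel_measurable borel" using f by (rule schwartz_measurable)
    show "(\<lambda>x. f x * cutoff n x) \<in> borel_measurable lborel" for n by simp
    show "f \<in> borel_measurable lborel" by simp
    show "AE x in lborel. cmod (f x * cutoff n x) \<le> cmod (f x)" for n
      unfolding norm_mult by (intro AE_I2 mult_left_le cutoff_bound) auto
    show "AE x in lborel. (\<lambda>n. f x * cutoff n x) \<longlonglongrightarrow> f x"
      using tendsto_mult[OF tendsto_const cutoff_tendsto(1)] by (intro AE_I2) fastforce
  qed
  from 1[OF f] show "(\<lambda>n. l2norm lborel (\<lambda>x. f x * cutoff n x - f x)) \<longlonglongrightarrow> 0" .
  have "(\<lambda>n. l2norm lborel (\<lambda>x. f x * vderiv (cutoff n) x - 0)) \<longlonglongrightarrow> 0"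
  proof (rule l2norm_dominated(2)[OF _ _ sqint_cmult[OF schwartz_sqint[OF f], of 4]])
    show "AE x in lborel. cmod (f x * vderiv (cutoff n) x) \<le> cmod (4 * f x)" for n
    proof (rule AE_I2)
      fix x
      have "cmod (f x) * cmod (vderiv (cutoff n) x) \<le> cmod (f x) * 4" by (intro mult_left_mono cutoff_bound) auto
      then show "cmod (f x * vderiv (cutoff n) x) \<le> cmod (4 * f x)" by (simp add: norm_mult)
    qed
    show "AE x in lborel. (\<lambda>n. f x * vderiv (cutoff n) x) \<longlonglongrightarrow> 0"
      using tendsto_mult[OF tendsto_const cutoff_tendsto(2)] by (intro AE_I2) fastforce
  qed auto
  then have 2: "(\<lambda>n. l2norm lborel (\<lambda>x. f x * vderiv (cutoff n) x)) \<longlonglongrightarrow> 0" by simp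
  show "(\<lambda>n. l2norm lborel (vderiv (\<lambda>x. f x * cutoff n x - f x))) \<longlonglongrightarrow> 0"
  proof (rule tendsto_sandwich[OF always_eventually always_eventually tendsto_const])
    show "(\<lambda>n. l2norm lborel (\<lambda>x. f x * vderiv (cutoff n) x) + l2norm lborel (\<lambda>x. vderiv f x * cutoff n x - vderiv f x)) \<longlonglongrightarrow> 0"
      using tendsto_add[OF 2 1[OF schwartz_vderiv(2)[OF f]]] by simp
    show "\<forall>n. l2norm lborel (vderiv (\<lambda>x. f x * cutoff n x - f x)) \<le>
      l2norm lborel (\<lambda>x. f x * vderiv (cutoff n) x) + l2norm lborel (\<lambda>x. vderiv f x * cutoff n x - vderiv f x)"
    proof
      fix n
      have "vderiv (\<lambda>x. f x * cutoff n x - f x) = (\<lambda>x. (f x * vderiv (cutoff n) x) + (vderiv f x * cutoff n x - vderiv f x))"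
        by (subst vderiv_diff) (auto simp: f schwartz_mult cutoff_schwartz vderiv_mult add_diff_eq)
      then show "l2norm lborel (vderiv (\<lambda>x. f x * cutoff n x - f x)) \<le>
        l2norm lborel (\<lambda>x. f x * vderiv (cutoff n) x) + l2norm lborel (\<lambda>x. vderiv f x * cutoff n x - vderiv f x)"
        by (simp only:) (intro l2norm_triangle schwartz_sqint schwartz_mult schwartz_diff schwartz_vderiv cutoff_schwartz f)
    qed
  qed (simp add: l2norm_nonneg)
qed

section \<open>Plancherel's theorem and the free propagator\<close>

lemma sq_integrable_iff_sqint: "sq_integrable f \<longleftrightarrow> sqint lborel f"
  by (simp add: sq_integrable_def sqint_def)

lemma sqint_rep_L2: "sqint lborel (rep_L2 f)"
  using Quotient3_rep_reflp[OF Quotient3_L2, of f] by (simp add: sq_integrable_iff_sqint)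

lemma rep_L2_measurable [measurable]: "rep_L2 f \<in> borel_measurable borel"
  using sqint_rep_L2[of f] by (simp add: sqint_def)

lemma rep_abs_L2:
  assumes "sqint lborel f" shows "AE x in lborel. rep_L2 (abs_L2 f) x = f x"
  using rep_abs_rsp_left[OF Quotient3_L2, of f f] assms by (simp add: sq_integrable_iff_sqint)

lemma abs_rep_L2: "abs_L2 (rep_L2 f) = f"
  by (rule Quotient3_abs_rep[OF Quotient3_L2])

lemma abs_L2_cong:
  assumes "sqint lborel f" "sqint lborel g" "AE x in lborel. f x = g x"
  shows "abs_L2 f = abs_L2 g"
  using Quotient3_rel_abs[OF Quotient3_L2, of f g] assms by (simp add: sq_integrable_iff_sqint)

lemma L2_eqI:
  assumes "AE x in lborel. rep_L2 f x = rep_L2 g x" shows "f = g"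
  using abs_L2_cong[OF sqint_rep_L2 sqint_rep_L2 assms] by (simp add: abs_rep_L2)

lemma plus_L2_abs: "f + g = abs_L2 (\<lambda>x. rep_L2 f x + rep_L2 g x)"
  by (simp add: plus_L2_def)

lemma scaleR_L2_abs: "r *\<^sub>R f = abs_L2 (\<lambda>x. r *\<^sub>R rep_L2 f x)"
  by (simp add: scaleR_L2_def)

lemma rep_L2_add: "AE x in lborel. rep_L2 (f + g) x = rep_L2 f x + rep_L2 g x"
  unfolding plus_L2_abs by (rule rep_abs_L2) (intro sqint_add sqint_rep_L2)

lemma rep_L2_scaleR: "AE x in lborel. rep_L2 (r *\<^sub>R f) x = r *\<^sub>R rep_L2 f x"
  unfolding scaleR_L2_abs
  by (rule rep_abs_L2) (use sqint_cmult[OF sqint_rep_L2[of f], of "of_real r"] in \<open>simp add: scaleR_conv_of_real\<close>)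

lemma rep_L2_diff: "AE x in lborel. rep_L2 (f - g) x = rep_L2 f x - rep_L2 g x"
proof -
  have "AE x in lborel. rep_L2 (f + (- 1) *\<^sub>R g) x = rep_L2 f x - rep_L2 g x"
    using rep_L2_add[of f "(- 1) *\<^sub>R g"] rep_L2_scaleR[of "-1" g]
    by eventually_elim simp
  then show ?thesis by simp
qed

lemma inner_L2_eq: "inner f g = Re (LINT x|lborel. rep_L2 f x * cnj (rep_L2 g x))"
  by (simp add: inner_L2_def)

lemma norm_L2_eq: "norm f = l2norm lborel (rep_L2 f)"
proof -
  have "(LINT x|lborel. rep_L2 f x * cnj (rep_L2 f x)) = complex_of_real (LINT x|lborel. (cmod (rep_L2 f x))\<^sup>2)"
    by (simp add: complex_norm_square[symmetric] flip: integral_complex_of_real del: of_real_power)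
  then show ?thesis by (simp add: norm_L2_def inner_L2_eq l2norm_def)
qed

lemma norm_abs_L2:
  assumes "sqint lborel f" shows "norm (abs_L2 f) = l2norm lborel f"
  unfolding norm_L2_eq using rep_abs_L2[OF assms] assms by (intro sqint_cong_AE(2)) auto

lemma norm_diff_L2: "norm (f - g) = l2norm lborel (\<lambda>x. rep_L2 f x - rep_L2 g x)"
  unfolding norm_L2_eq using rep_L2_diff by (intro sqint_cong_AE(2) sqint_diff sqint_rep_L2) auto

lemma norm_diff_abs_L2:
  assumes "sqint lborel f" shows "norm (g - abs_L2 f) = l2norm lborel (\<lambda>x. rep_L2 g x - f x)"
  unfolding norm_diff_L2 using rep_abs_L2[OF assms] assms sqint_measurable[OF assms]
  by (intro sqint_cong_AE(2) sqint_diff sqint_rep_L2) (auto elim!: AE_mp)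

lemma abs_L2_diff:
  assumes "sqint lborel f" "sqint lborel g"
  shows "abs_L2 (\<lambda>x. f x - g x) = abs_L2 f - abs_L2 g"
proof (rule L2_eqI)
  show "AE x in lborel. rep_L2 (abs_L2 (\<lambda>x. f x - g x)) x = rep_L2 (abs_L2 f - abs_L2 g) x"
    using rep_abs_L2[OF sqint_diff[OF assms]] rep_L2_diff[of "abs_L2 f" "abs_L2 g"]
      rep_abs_L2[OF assms(1)] rep_abs_L2[OF assms(2)]
    by eventually_elim simp
qed

lemma norm_abs_diff_L2:
  assumes "sqint lborel f" "sqint lborel g"
  shows "norm (abs_L2 f - abs_L2 g) = l2norm lborel (\<lambda>x. f x - g x)"
  using norm_abs_L2[OF sqint_diff[OF assms]] abs_L2_diff[OF assms] by simp

lemma L2_summable: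
  fixes d :: "nat \<Rightarrow> L2"
  assumes "summable (\<lambda>n. norm (d n))"
  shows "convergent (\<lambda>n. \<Sum>k<n. d k)"
proof -
  obtain g where g: "sqint lborel g" and lim: "(\<lambda>n. l2norm lborel (\<lambda>x. (\<Sum>k<n. rep_L2 (d k) x) - g x)) \<longlonglongrightarrow> 0"
    by (rule l2norm_summable[of lborel "\<lambda>n. rep_L2 (d n)" "\<lambda>n. norm (d n)"])
       (use assms sqint_rep_L2 in \<open>auto simp: norm_L2_eq\<close>)
  have "AE x in lborel. rep_L2 (\<Sum>k<n. d k) x = (\<Sum>k<n. rep_L2 (d k) x)" for n
  proof (induction n)
    case 0
    have "(0::L2) = abs_L2 (\<lambda>x. 0)" by (simp add: zero_L2_def)
    then show ?case using rep_abs_L2[OF sqint_zero] by simp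
  next
    case (Suc n)
    then show ?case using rep_L2_add[of "\<Sum>k<n. d k" "d n"] by (auto elim!: AE_mp)
  qed
  then have "norm ((\<Sum>k<n. d k) - abs_L2 g) = l2norm lborel (\<lambda>x. (\<Sum>k<n. rep_L2 (d k) x) - g x)" for n
    unfolding norm_diff_abs_L2[OF g]
    using sqint_measurable[OF g]
    by (intro sqint_cong_AE(2) sqint_diff sqint_sum sqint_rep_L2 g) (auto elim!: AE_mp)
  then have "(\<lambda>n. norm ((\<Sum>k<n. d k) - abs_L2 g)) \<longlonglongrightarrow> 0" using lim by simp
  then have "(\<lambda>n. \<Sum>k<n. d k) \<longlonglongrightarrow> abs_L2 g" using LIM_zero_cancel tendsto_norm_zero_iff by blast
  then show ?thesis by (rule convergentI)
qed

text \<open>A Cauchy sequence has a subsequence with summable increments, which converges by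
  \<open>L2_summable\<close>. Completeness is what gives continuous functions with values in
  \<open>L2\<close> an integral and lets the Dyson operators of approximating potentials
  converge.\<close>

instance L2 :: banach
proof
  fix X :: "nat \<Rightarrow> L2"
  assume X: "Cauchy X"
  obtain r where r: "strict_mono r" "\<And>n. norm (X (r (Suc n)) - X (r n)) < (1/2)^n"
  proof -
    have "\<exists>M. \<forall>m\<ge>M. \<forall>n\<ge>M. norm (X m - X n) < (1/2)^k" for k :: nat
      using X unfolding Cauchy_iff by simp
    then obtain M where M: "\<And>k m n. m \<ge> M k \<Longrightarrow> n \<ge> M k \<Longrightarrow> norm (X m - X n) < (1/2)^k" by metis
    \<comment> \<open>The summand \<open>n\<close> makes \<open>r\<close> strictly increasing; the
      sum of the thresholds keeps both \<open>r n\<close> and \<open>r (Suc n)\<close> above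
      \<open>M n\<close>.\<close>
    define r where "r n = n + (\<Sum>k\<le>n. M k)" for n
    have "strict_mono r" unfolding strict_mono_Suc_iff r_def by simp
    moreover have "M n \<le> r n" "M n \<le> r (Suc n)" for n
      unfolding r_def using member_le_sum[of n "{..n}" M] by auto
    ultimately show ?thesis using that M by blast
  qed
  have "summable (\<lambda>n. norm (X (r (Suc n)) - X (r n)))"
    by (rule summable_comparison_test'[OF summable_geometric[of "1/2::real"], of 0]) (use r(2) less_imp_le in auto)
  from L2_summable[OF this] obtain l where "(\<lambda>n. \<Sum>k<n. X (r (Suc k)) - X (r k)) \<longlonglongrightarrow> l" by (auto simp: convergent_def)
  then have "(\<lambda>n. X (r n) - X (r 0)) \<longlonglongrightarrow> l" by (simp add: sum_lessThan_telescope[of "\<lambda>n. X (r n)"])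
  then have "(\<lambda>n. X (r n) - X (r 0) + X (r 0)) \<longlonglongrightarrow> l + X (r 0)" by (intro tendsto_intros)
  then have "(X \<circ> r) \<longlonglongrightarrow> l + X (r 0)" by (simp add: comp_def)
  then have "X \<longlonglongrightarrow> l + X (r 0)" by (rule Cauchy_converges_subseq[OF X r(1)])
  then show "convergent X" by (rule convergentI)
qed

lemma integral_rep_L2_tendsto:
  assumes "X \<longlonglongrightarrow> f" "sqint lborel \<psi>"
  shows "(\<lambda>n. LINT x|lborel. rep_L2 (X n) x * \<psi> x) \<longlonglongrightarrow> (LINT x|lborel. rep_L2 f x * \<psi> x)"
proof (rule LIM_zero_cancel, rule Lim_null_comparison)
  show "(\<lambda>n. norm (X n - f) * l2norm lborel \<psi>) \<longlonglongrightarrow> 0"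
    using tendsto_mult_left_zero[OF tendsto_norm_zero[OF LIM_zero[OF assms(1)]]] by simp
  show "\<forall>\<^sub>F n in sequentially. norm ((LINT x|lborel. rep_L2 (X n) x * \<psi> x) - (LINT x|lborel. rep_L2 f x * \<psi> x)) \<le> norm (X n - f) * l2norm lborel \<psi>"
  proof (intro always_eventually allI)
    fix n
    have "(LINT x|lborel. rep_L2 (X n) x * \<psi> x) - (LINT x|lborel. rep_L2 f x * \<psi> x) = (LINT x|lborel. (rep_L2 (X n) x - rep_L2 f x) * \<psi> x)"
      using sqint_mult_integrable(2)[OF sqint_rep_L2 assms(2)] by (simp add: left_diff_distrib)
    also have "cmod \<dots> \<le> norm (X n - f) * l2norm lborel \<psi>"
      unfolding norm_diff_L2 by (intro l2norm_integral_mult_le sqint_diff sqint_rep_L2 assms)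
    finally show "norm ((LINT x|lborel. rep_L2 (X n) x * \<psi> x) - (LINT x|lborel. rep_L2 f x * \<psi> x)) \<le> norm (X n - f) * l2norm lborel \<psi>" .
  qed
qed

lemma schwartz_dense_L2:
  obtains S where "\<And>n. S n \<in> schwartz" "(\<lambda>n. abs_L2 (S n)) \<longlonglongrightarrow> f"
proof -
  have "\<exists>\<phi>\<in>schwartz. l2norm lborel (\<lambda>x. rep_L2 f x - \<phi> x) < 1 / real (Suc n)" for n
    by (rule schwartz_dense[OF sqint_rep_L2]) simp
  then obtain S where S: "\<And>n. S n \<in> schwartz" "\<And>n. l2norm lborel (\<lambda>x. rep_L2 f x - S n x) < 1 / real (Suc n)" by metis
  have "(\<lambda>n. abs_L2 (S n) - f) \<longlonglongrightarrow> 0"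
  proof (rule Lim_null_comparison[OF always_eventually LIMSEQ_Suc[OF lim_1_over_n]], rule allI)
    fix n show "norm (abs_L2 (S n) - f) \<le> 1 / real (Suc n)"
      using S(2)[of n] norm_diff_abs_L2[OF schwartz_sqint[OF S(1)], of f n] by (simp add: norm_minus_commute)
  qed
  from that[OF S(1) LIM_zero_cancel[OF this]] show ?thesis .
qed

section \<open>The Fourier transform on square-integrable functions\<close>

lemma has_fourier_measurable: "has_fourier u v \<Longrightarrow> v \<in> borel_measurable borel"
  by (simp add: has_fourier_def)

lemma has_fourierD:
  assumes "has_fourier u v" "\<phi> \<in> schwartz"
  shows "integrable lborel (\<lambda>x. v x * \<phi> x)" "u (fourier \<phi>) = (LINT x|lborel. v x * \<phi> x)"
  using assms by (auto simp: has_fourier_def)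

lemma has_fourier_unique:
  assumes "has_fourier u v" "has_fourier u w"
  shows "AE x in lborel. v x = w x"
proof -
  have "AE x in lborel. v x - w x = 0"
    by (rule schwartz_test_AE_zero)
       (use assms in \<open>auto simp: has_fourier_def left_diff_distrib\<close>)
  then show ?thesis by simp
qed

lemma has_fourier_cong_AE:
  assumes "has_fourier u v" "w \<in> borel_measurable borel" "AE x in lborel. v x = w x"
  shows "has_fourier u w"
  unfolding has_fourier_def
proof (intro conjI ballI assms(2))
  fix \<phi> assume \<phi>: "\<phi> \<in> schwartz"
  note [measurable] = schwartz_measurable[OF \<phi>] assms(2) has_fourier_measurable[OF assms(1)]
  have ae: "AE x in lborel. v x * \<phi> x = w x * \<phi> x" using assms(3) by (auto elim!: AE_mp)
  show "integrable lborel (\<lambda>x. w x * \<phi> x)"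
    using has_fourierD(1)[OF assms(1) \<phi>] by (subst integrable_cong_AE[OF _ _ ae, symmetric]) auto
  show "u (fourier \<phi>) = (LINT x|lborel. w x * \<phi> x)"
    using has_fourierD(2)[OF assms(1) \<phi>] integral_cong_AE[OF _ _ ae] by simp
qed

lemma has_fourier_schwartz: "f \<in> schwartz \<Longrightarrow> has_fourier (distr_of f) (fourier f)"
  unfolding has_fourier_def distr_of_def
  by (auto simp: schwartz_measurable schwartz_fourier schwartz_integrable schwartz_mult fourier_duality)

lemma has_fourier_L2I:
  assumes "\<And>\<phi>. \<phi> \<in> schwartz \<Longrightarrow> (LINT x|lborel. rep_L2 f x * fourier \<phi> x) = (LINT x|lborel. rep_L2 g x * \<phi> x)"
  shows "has_fourier (distr_of (rep_L2 f)) (rep_L2 g)"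
  unfolding has_fourier_def distr_of_def using assms
  by (auto intro: sqint_mult_integrable(2)[OF sqint_rep_L2 schwartz_sqint])

text \<open>Extension by density: the transforms of approximating Schwartz functions are Cauchy by
  Plancherel's identity, and the duality formula passes to the limit because both of its sides are
  continuous in \<open>L2\<close>.\<close>

lemma L2_fourier_exists:
  "\<exists>g. has_fourier (distr_of (rep_L2 f)) (rep_L2 g) \<and> norm g = norm f"
proof -
  obtain S where S: "\<And>n. S n \<in> schwartz" "(\<lambda>n. abs_L2 (S n)) \<longlonglongrightarrow> f" using schwartz_dense_L2[of f] by blast
  let ?X = "\<lambda>n. abs_L2 (fourier (S n))"
  note F = schwartz_fourier[OF S(1)]
  have "norm (?X m - ?X n) = norm (abs_L2 (S m) - abs_L2 (S n))" for m n
  proof -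
    have "(\<lambda>x. fourier (S m) x - fourier (S n) x) = fourier (\<lambda>x. S m x - S n x)"
      using fourier_diff[OF schwartz_integrable schwartz_integrable, OF S(1) S(1)] by auto
    then show ?thesis
      using Plancherel_schwartz[OF schwartz_diff[OF S(1) S(1)], of m n]
      by (simp add: norm_abs_diff_L2 schwartz_sqint F S(1))
  qed
  then have "Cauchy ?X"
    using LIMSEQ_imp_Cauchy[OF S(2)] unfolding Cauchy_def dist_norm by simp
  then obtain g where g: "?X \<longlonglongrightarrow> g" using Cauchy_convergent_iff convergent_def by metis
  have "norm (?X n) = norm (abs_L2 (S n))" for n
    by (simp add: norm_abs_L2 schwartz_sqint F S(1) Plancherel_schwartz)
  then have "norm g = norm f"
    using tendsto_norm[OF g] tendsto_norm[OF S(2)] LIMSEQ_unique by simp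
  moreover have "has_fourier (distr_of (rep_L2 f)) (rep_L2 g)"
  proof (rule has_fourier_L2I)
    fix \<phi> assume \<phi>: "\<phi> \<in> schwartz"
    have "(LINT x|lborel. rep_L2 (abs_L2 (S n)) x * fourier \<phi> x) = (LINT x|lborel. rep_L2 (?X n) x * \<phi> x)" for n
    proof -
      note [measurable] = schwartz_measurable[OF \<phi>] schwartz_measurable[OF schwartz_fourier[OF \<phi>]]
        schwartz_measurable[OF S(1)] schwartz_measurable[OF F]
      have "(LINT x|lborel. rep_L2 (abs_L2 (S n)) x * fourier \<phi> x) = (LINT x|lborel. S n x * fourier \<phi> x)"
        using rep_abs_L2[OF schwartz_sqint[OF S(1)[of n]]] by (intro integral_cong_AE) (auto elim!: AE_mp)
      also have "\<dots> = (LINT x|lborel. fourier (S n) x * \<phi> x)"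
        by (intro fourier_duality[symmetric] schwartz_integrable S \<phi>)
      also have "\<dots> = (LINT x|lborel. rep_L2 (?X n) x * \<phi> x)"
        using rep_abs_L2[OF schwartz_sqint[OF F[of n]]] by (intro integral_cong_AE) (auto elim!: AE_mp)
      finally show ?thesis .
    qed
    then show "(LINT x|lborel. rep_L2 f x * fourier \<phi> x) = (LINT x|lborel. rep_L2 g x * \<phi> x)"
      using integral_rep_L2_tendsto[OF S(2) schwartz_sqint[OF schwartz_fourier[OF \<phi>]]]
        integral_rep_L2_tendsto[OF g schwartz_sqint[OF \<phi>]] LIMSEQ_unique by simp
  qed
  ultimately show ?thesis by blast
qed

lemma L2_fourier_unique:
  "has_fourier (distr_of (rep_L2 f)) (rep_L2 g) \<Longrightarrow> L2_fourier f = g"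
  unfolding L2_fourier_def by (rule the_equality) (auto intro: L2_eqI has_fourier_unique)

lemma L2_fourier_has_fourier: "has_fourier (distr_of (rep_L2 f)) (rep_L2 (L2_fourier f))"
  using L2_fourier_exists[of f] L2_fourier_unique by blast

lemma norm_L2_fourier: "norm (L2_fourier f) = norm f"
  using L2_fourier_exists[of f] L2_fourier_unique by blast

lemma has_fourier_distr_of_cong:
  assumes "has_fourier (distr_of f) v" "f \<in> borel_measurable borel" "g \<in> borel_measurable borel" "AE x in lborel. f x = g x"
  shows "has_fourier (distr_of g) v"
proof -
  have "(LINT x|lborel. f x * fourier \<phi> x) = (LINT x|lborel. g x * fourier \<phi> x)" if "\<phi> \<in> schwartz" for \<phi>
    using schwartz_measurable[OF schwartz_fourier[OF that]] assms(2-4) by (intro integral_cong_AE) (auto elim!: AE_mp)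
  then show ?thesis using assms(1) by (simp add: has_fourier_def distr_of_def)
qed

lemma L2_fourier_schwartz:
  assumes "\<phi> \<in> schwartz" shows "L2_fourier (abs_L2 \<phi>) = abs_L2 (fourier \<phi>)"
proof (rule L2_fourier_unique)
  note s = schwartz_sqint[OF assms] schwartz_sqint[OF schwartz_fourier[OF assms]]
  show "has_fourier (distr_of (rep_L2 (abs_L2 \<phi>))) (rep_L2 (abs_L2 (fourier \<phi>)))"
  proof (rule has_fourier_cong_AE[OF has_fourier_distr_of_cong[OF has_fourier_schwartz[OF assms]]])
    show "AE x in lborel. \<phi> x = rep_L2 (abs_L2 \<phi>) x" using rep_abs_L2[OF s(1)] by (auto elim!: AE_mp)
    show "AE x in lborel. fourier \<phi> x = rep_L2 (abs_L2 (fourier \<phi>)) x" using rep_abs_L2[OF s(2)] by (auto elim!: AE_mp)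
  qed (use schwartz_measurable[OF assms] in auto)
qed

text \<open>The type \<open>L2\<close> carries real scalars only, so complex linearity is expressed
  through representatives. Additivity, real homogeneity and commutation with complex constants are
  all instances.\<close>

lemma L2_fourier_lincomb_rep:
  assumes h: "AE x in lborel. rep_L2 h x = c * rep_L2 f x + d * rep_L2 g x"
    and k: "AE x in lborel. rep_L2 k x = c * rep_L2 (L2_fourier f) x + d * rep_L2 (L2_fourier g) x"
  shows "L2_fourier h = k"
proof (rule L2_fourier_unique, rule has_fourier_L2I)
  fix \<phi> assume \<phi>: "\<phi> \<in> schwartz"
  note F = schwartz_fourier[OF \<phi>]
  note [measurable] = schwartz_measurable[OF \<phi>] schwartz_measurable[OF F]
  note i = sqint_mult_integrable(2)[OF sqint_rep_L2 schwartz_sqint]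
  have "(LINT x|lborel. rep_L2 h x * fourier \<phi> x) =
      (LINT x|lborel. c * (rep_L2 f x * fourier \<phi> x) + d * (rep_L2 g x * fourier \<phi> x))"
    using h by (intro integral_cong_AE) (auto elim!: AE_mp simp: algebra_simps)
  also have "\<dots> = c * (LINT x|lborel. rep_L2 f x * fourier \<phi> x) + d * (LINT x|lborel. rep_L2 g x * fourier \<phi> x)"
    using i[OF F, of f] i[OF F, of g] by simp
  also have "\<dots> = c * (LINT x|lborel. rep_L2 (L2_fourier f) x * \<phi> x) + d * (LINT x|lborel. rep_L2 (L2_fourier g) x * \<phi> x)"
    using has_fourierD(2)[OF L2_fourier_has_fourier \<phi>] by (simp add: distr_of_def)
  also have "\<dots> = (LINT x|lborel. c * (rep_L2 (L2_fourier f) x * \<phi> x) + d * (rep_L2 (L2_fourier g) x * \<phi> x))"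
    using i[OF \<phi>, of "L2_fourier f"] i[OF \<phi>, of "L2_fourier g"] by simp
  also have "\<dots> = (LINT x|lborel. rep_L2 k x * \<phi> x)"
    using k by (intro integral_cong_AE) (auto elim!: AE_mp simp: algebra_simps)
  finally show "(LINT x|lborel. rep_L2 h x * fourier \<phi> x) = (LINT x|lborel. rep_L2 k x * \<phi> x)" .
qed

lemma bounded_linear_L2_fourier: "bounded_linear L2_fourier"
proof (rule bounded_linear_intro[where K = 1])
  fix f g :: L2 and r :: real
  show "L2_fourier (f + g) = L2_fourier f + L2_fourier g"
    using rep_L2_add by (intro L2_fourier_lincomb_rep[where c = 1 and d = 1 and f = f and g = g]) auto
  show "L2_fourier (r *\<^sub>R f) = r *\<^sub>R L2_fourier f"
    using rep_L2_scaleR by (intro L2_fourier_lincomb_rep[where c = "of_real r" and d = 0 and f = f and g = f]) (auto simp: scaleR_conv_of_real)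
qed (simp add: norm_L2_fourier)

text \<open>\<open>free_prop\<close> is defined through \<open>inv L2_fourier\<close>, so
  surjectivity is essential. It follows from the isometry: preimages of approximating Schwartz
  functions exist by inversion and form a Cauchy sequence.\<close>

lemma bij_L2_fourier: "bij L2_fourier"
proof (rule bijI)
  interpret bounded_linear L2_fourier by (rule bounded_linear_L2_fourier)
  show "inj L2_fourier"
    by (rule injI) (metis diff norm_L2_fourier norm_eq_zero right_minus_eq)
  have "\<exists>f. L2_fourier f = g" for g
  proof -
    obtain S where S: "\<And>n. S n \<in> schwartz" "(\<lambda>n. abs_L2 (S n)) \<longlonglongrightarrow> g" using schwartz_dense_L2[of g] by blast
    have "\<exists>T. T \<in> schwartz \<and> fourier T = S n" for n using fourier_surj[OF S(1)] by metis
    then obtain T where T: "\<And>n. T n \<in> schwartz" "\<And>n. fourier (T n) = S n" by metis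
    have FT: "L2_fourier (abs_L2 (T n)) = abs_L2 (S n)" for n using L2_fourier_schwartz[OF T(1)] T(2) by simp
    have "norm (abs_L2 (T m) - abs_L2 (T n)) = norm (abs_L2 (S m) - abs_L2 (S n))" for m n
      by (metis FT diff norm_L2_fourier)
    then have "Cauchy (\<lambda>n. abs_L2 (T n))"
      using LIMSEQ_imp_Cauchy[OF S(2)] unfolding Cauchy_def dist_norm by simp
    then obtain f where "(\<lambda>n. abs_L2 (T n)) \<longlonglongrightarrow> f" using Cauchy_convergent_iff convergent_def by metis
    then have "(\<lambda>n. L2_fourier (abs_L2 (T n))) \<longlonglongrightarrow> L2_fourier f" by (rule tendsto)
    then show ?thesis using S(2) LIMSEQ_unique by (auto simp: FT)
  qed
  then show "surj L2_fourier" unfolding surj_def by metis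
qed

section \<open>Multiplication operators and the free group\<close>

lemma rep_mult_op:
  assumes "m \<in> borel_measurable borel" "\<And>x. cmod (m x) \<le> B"
  shows "AE x in lborel. rep_L2 (mult_op m f) x = m x * rep_L2 f x"
    and "sqint lborel (\<lambda>x. m x * rep_L2 f x)"
proof -
  show "sqint lborel (\<lambda>x. m x * rep_L2 f x)"
  proof (rule sqint_bound[OF sqint_cmult[OF sqint_rep_L2, of "of_real B"]])
    show "AE x in lborel. cmod (m x * rep_L2 f x) \<le> cmod (complex_of_real B * rep_L2 f x)"
      unfolding norm_mult
      by (intro AE_I2 mult_right_mono order_trans[OF assms(2)]) auto
  qed (use assms in measurable)
  then show "AE x in lborel. rep_L2 (mult_op m f) x = m x * rep_L2 f x"
    unfolding mult_op_def by (rule rep_abs_L2)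
qed

lemma norm_mult_op_le:
  assumes "m \<in> borel_measurable borel" "\<And>x. cmod (m x) \<le> B"
  shows "norm (mult_op m f) \<le> B * norm f"
proof -
  have B: "0 \<le> B" using order_trans[OF norm_ge_zero assms(2)] .
  have "norm (mult_op m f) = l2norm lborel (\<lambda>x. m x * rep_L2 f x)"
    unfolding mult_op_def by (rule norm_abs_L2[OF rep_mult_op(2)[OF assms]])
  also have "\<dots> \<le> l2norm lborel (\<lambda>x. of_real B * rep_L2 f x)"
    using assms B by (intro l2norm_mono sqint_cmult sqint_rep_L2) (auto simp: norm_mult intro!: mult_right_mono)
  also have "\<dots> = B * norm f" using B by (simp add: l2norm_cmult norm_L2_eq)
  finally show ?thesis .
qed

lemma bounded_linear_mult_op:
  assumes "m \<in> borel_measurable borel" "\<And>x. cmod (m x) \<le> B"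
  shows "bounded_linear (mult_op m)"
proof (rule bounded_linear_intro[where K = B])
  fix f g :: L2 and r :: real
  show "mult_op m (f + g) = mult_op m f + mult_op m g"
  proof (rule L2_eqI)
    show "AE x in lborel. rep_L2 (mult_op m (f + g)) x = rep_L2 (mult_op m f + mult_op m g) x"
      using rep_mult_op(1)[OF assms, where f = "f + g"] rep_mult_op(1)[OF assms, where f = f] rep_mult_op(1)[OF assms, where f = g]
        rep_L2_add[of f g] rep_L2_add[of "mult_op m f" "mult_op m g"]
      by eventually_elim (simp add: algebra_simps)
  qed
  show "mult_op m (r *\<^sub>R f) = r *\<^sub>R mult_op m f"
  proof (rule L2_eqI)
    show "AE x in lborel. rep_L2 (mult_op m (r *\<^sub>R f)) x = rep_L2 (r *\<^sub>R mult_op m f) x"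
      using rep_mult_op(1)[OF assms, where f = "r *\<^sub>R f"] rep_mult_op(1)[OF assms, where f = f]
        rep_L2_scaleR[of r f] rep_L2_scaleR[of r "mult_op m f"]
      by eventually_elim (simp add: algebra_simps)
  qed
  show "norm (mult_op m f) \<le> norm f * B" using norm_mult_op_le[OF assms, of f] by (simp add: mult.commute)
qed

lemma mult_op_mult_op:
  assumes m: "m \<in> borel_measurable borel" "\<And>x. cmod (m x) \<le> B" and k: "k \<in> borel_measurable borel" "\<And>x. cmod (k x) \<le> C"
  shows "mult_op m (mult_op k f) = mult_op (\<lambda>x. m x * k x) f"
proof (rule L2_eqI)
  have mk: "(\<lambda>x. m x * k x) \<in> borel_measurable borel" using m k by measurable
  have b: "cmod (m x * k x) \<le> B * C" for x
    unfolding norm_mult using order_trans[OF norm_ge_zero m(2)] by (intro mult_mono m k) auto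
  show "AE x in lborel. rep_L2 (mult_op m (mult_op k f)) x = rep_L2 (mult_op (\<lambda>x. m x * k x) f) x"
    using rep_mult_op(1)[OF m, where f = "mult_op k f"] rep_mult_op(1)[OF k, where f = f] rep_mult_op(1)[OF mk b, where f = f]
    by eventually_elim simp
qed

lemma mult_op_1: "mult_op (\<lambda>x. 1) f = f"
  by (simp add: mult_op_def abs_rep_L2)

lemma L2_fourier_mult_op_const: "L2_fourier (mult_op (\<lambda>x. c) f) = mult_op (\<lambda>x. c) (L2_fourier f)"
  using rep_mult_op(1)[of "\<lambda>x. c" "cmod c"]
  by (intro L2_fourier_lincomb_rep[where c = c and d = 0 and f = f and g = f]) auto

abbreviation schr_mult :: "real \<Rightarrow> L2 \<Rightarrow> L2" where
  "schr_mult t \<equiv> mult_op (\<lambda>\<xi>. cis (- (t * \<xi>\<^sup>2)))"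

lemma schr_mult_measurable: "(\<lambda>\<xi>. cis (- (t * \<xi>\<^sup>2))) \<in> borel_measurable borel"
  by measurable

lemma L2_fourier_free_prop: "L2_fourier (free_prop t f) = schr_mult t (L2_fourier f)"
  unfolding free_prop_def using bij_L2_fourier by (simp add: bij_is_surj surj_f_inv_f)

lemma L2_fourier_inject: "L2_fourier f = L2_fourier g \<Longrightarrow> f = g"
  using bij_L2_fourier by (metis bij_pointE)

lemma free_prop_add: "free_prop s (free_prop t f) = free_prop (s + t) f"
proof (rule L2_fourier_inject)
  have "schr_mult s (schr_mult t g) = schr_mult (s + t) g" for g
    by (subst mult_op_mult_op[where B = 1 and C = 1]) (auto simp: cis_mult algebra_simps intro: schr_mult_measurable)
  then show "L2_fourier (free_prop s (free_prop t f)) = L2_fourier (free_prop (s + t) f)"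
    by (simp add: L2_fourier_free_prop)
qed

lemma free_prop_0: "free_prop 0 f = f"
  by (rule L2_fourier_inject) (simp add: L2_fourier_free_prop mult_op_1)

lemma schr_mult_norm: "norm (schr_mult t f) = norm f"
proof -
  have "norm (schr_mult t f) = l2norm lborel (\<lambda>x. cis (- (t * x\<^sup>2)) * rep_L2 f x)"
    unfolding mult_op_def by (rule norm_abs_L2[OF rep_mult_op(2)[of _ 1]]) (auto intro: schr_mult_measurable)
  also have "\<dots> = norm f" by (simp add: l2norm_def norm_mult norm_L2_eq)
  finally show ?thesis .
qed

lemma norm_free_prop: "norm (free_prop t f) = norm f"
  by (metis norm_L2_fourier L2_fourier_free_prop schr_mult_norm)

lemma bounded_linear_free_prop: "bounded_linear (free_prop t)"
proof (rule bounded_linear_intro[where K = 1])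
  interpret F: bounded_linear L2_fourier by (rule bounded_linear_L2_fourier)
  interpret M: bounded_linear "schr_mult t" by (rule bounded_linear_mult_op[of _ 1]) (auto intro: schr_mult_measurable)
  fix f g :: L2 and r :: real
  show "free_prop t (f + g) = free_prop t f + free_prop t g"
    by (rule L2_fourier_inject) (simp add: L2_fourier_free_prop F.add M.add)
  show "free_prop t (r *\<^sub>R f) = r *\<^sub>R free_prop t f"
    by (rule L2_fourier_inject) (simp add: L2_fourier_free_prop F.scaleR M.scaleR)
qed (simp add: norm_free_prop)

lemma free_prop_mult_op_const: "free_prop t (mult_op (\<lambda>x. c) f) = mult_op (\<lambda>x. c) (free_prop t f)"
proof (rule L2_fourier_inject)
  have "schr_mult t (mult_op (\<lambda>x. c) g) = mult_op (\<lambda>x. c) (schr_mult t g)" for g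
    by (subst (1 2) mult_op_mult_op[where B = 1 and C = "cmod c"] mult_op_mult_op[where B = "cmod c" and C = 1])
       (auto simp: mult.commute intro: schr_mult_measurable)
  then show "L2_fourier (free_prop t (mult_op (\<lambda>x. c) f)) = L2_fourier (mult_op (\<lambda>x. c) (free_prop t f))"
    by (simp add: L2_fourier_free_prop L2_fourier_mult_op_const)
qed

text \<open>By polarization a norm-preserving additive map preserves the real inner product; the
  group law then moves the operator to the other side.\<close>

lemma inner_free_prop: "inner (free_prop (- t) x) y = inner x (free_prop t y)"
proof -
  interpret bounded_linear "free_prop t" by (rule bounded_linear_free_prop)
  have pol: "inner u v = ((norm (u + v))\<^sup>2 - (norm u)\<^sup>2 - (norm v)\<^sup>2) / 2" for u v :: L2
    by (simp add: power2_norm_eq_inner inner_add inner_commute)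
  have "inner (free_prop t (free_prop (- t) x)) (free_prop t y) = inner (free_prop (- t) x) y"
    unfolding pol by (simp add: norm_free_prop flip: add)
  then show ?thesis by (simp add: free_prop_add free_prop_0)
qed

lemma adjoint_free_prop: "adjoint (free_prop t) = free_prop (- t)"
  by (rule adjoint_unique) (use inner_free_prop[of "- t"] in simp)

text \<open>Strong continuity, by dominated convergence on the Fourier side, where the propagator is
  a multiplier of modulus 1.\<close>

lemma continuous_free_prop: "continuous_on UNIV (\<lambda>t. free_prop t f)"
  unfolding continuous_on_sequentially
proof (intro allI ballI impI, elim conjE)
  fix T :: "nat \<Rightarrow> real" and t assume T: "T \<longlonglongrightarrow> t"
  let ?g = "rep_L2 (L2_fourier f)"
  have "(\<lambda>n. l2norm lborel (\<lambda>x. cis (- (T n * x\<^sup>2)) * ?g x - cis (- (t * x\<^sup>2)) * ?g x)) \<longlonglongrightarrow> 0"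
  proof (rule l2norm_dominated(2)[OF _ _ sqint_rep_L2[of "L2_fourier f"]])
    have "(\<lambda>n. cis (- (T n * x\<^sup>2)) * ?g x) \<longlonglongrightarrow> cis (- (t * x\<^sup>2)) * ?g x" for x
      by (intro tendsto_intros T)
    then show "AE x in lborel. (\<lambda>n. cis (- (T n * x\<^sup>2)) * ?g x) \<longlonglongrightarrow> cis (- (t * x\<^sup>2)) * ?g x" by simp
  qed (auto simp: norm_mult)
  moreover have "norm (free_prop (T n) f - free_prop t f) = l2norm lborel (\<lambda>x. cis (- (T n * x\<^sup>2)) * ?g x - cis (- (t * x\<^sup>2)) * ?g x)" for n
  proof -
    interpret F: bounded_linear L2_fourier by (rule bounded_linear_L2_fourier)
    have "norm (free_prop (T n) f - free_prop t f) = norm (schr_mult (T n) (L2_fourier f) - schr_mult t (L2_fourier f))"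
      by (metis F.diff norm_L2_fourier L2_fourier_free_prop)
    then show ?thesis
      unfolding mult_op_def
      by (simp add: norm_abs_diff_L2 rep_mult_op(2)[of _ 1] schr_mult_measurable)
  qed
  ultimately have "(\<lambda>n. norm (free_prop (T n) f - free_prop t f)) \<longlonglongrightarrow> 0" by simp
  then have "(\<lambda>n. free_prop (T n) f) \<longlonglongrightarrow> free_prop t f" using LIM_zero_cancel tendsto_norm_zero_iff by blast
  then show "((\<lambda>t. free_prop t f) \<circ> T) \<longlonglongrightarrow> free_prop t f" by (simp add: comp_def)
qed

text \<open>Splits the increment into \<open>B s (g s - g t)\<close>, controlled by the uniform
  bound, and \<open>B s (g t) - B t (g t)\<close>, controlled by strong continuity. The integrands
  of the Dyson terms are built from such families.\<close>

lemma continuous_on_operator_family: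
  fixes B :: "real \<Rightarrow> 'a::real_normed_vector \<Rightarrow> 'b::real_normed_vector"
  assumes lin: "\<And>t. bounded_linear (B t)" and bd: "\<And>t x. norm (B t x) \<le> K * norm x"
    and cont: "\<And>x. continuous_on A (\<lambda>t. B t x)" and g: "continuous_on A g"
  shows "continuous_on A (\<lambda>t. B t (g t))"
  unfolding continuous_on_def
proof
  fix t assume t: "t \<in> A"
  have "((\<lambda>s. B s (g s - g t)) \<longlongrightarrow> 0) (at t within A)"
  proof (rule Lim_null_comparison[OF always_eventually[OF allI[OF bd]]])
    have "((\<lambda>s. g s - g t) \<longlongrightarrow> 0) (at t within A)" using g t by (auto simp: continuous_on_def LIM_zero)
    then show "((\<lambda>s. K * norm (g s - g t)) \<longlongrightarrow> 0) (at t within A)"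
      by (intro tendsto_mult_right_zero tendsto_norm_zero)
  qed
  moreover have "((\<lambda>s. B s (g t)) \<longlongrightarrow> B t (g t)) (at t within A)" using cont t by (simp add: continuous_on_def)
  ultimately have "((\<lambda>s. B s (g s - g t) + B s (g t)) \<longlongrightarrow> 0 + B t (g t)) (at t within A)" by (rule tendsto_add)
  moreover have "B s (g s - g t) + B s (g t) = B s (g s)" for s
    using bounded_linear.linear[OF lin[of s]] by (simp add: linear_diff)
  ultimately show "((\<lambda>s. B s (g s)) \<longlongrightarrow> B t (g t)) (at t within A)" by simp
qed

section \<open>Sobolev norms as weighted square norms of the Fourier transform\<close>

definition freq_measure :: "real \<Rightarrow> real measure" where
  "freq_measure s = density lborel (\<lambda>\<xi>. ennreal ((1 + \<xi>\<^sup>2) powr s))"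

text \<open>The time interval enters through the density, so that functions live on the whole plane
  and Fubini's theorem applies without restricted spaces.\<close>

definition strip_measure :: "real \<Rightarrow> real \<Rightarrow> real \<Rightarrow> (real \<times> real) measure" where
  "strip_measure s a b = density lborel (\<lambda>p. ennreal (indicator {a..b} (fst p) * (1 + (snd p)\<^sup>2) powr s))"

lemma sets_freq_measure [measurable_cong]: "sets (freq_measure s) = sets borel"
  by (simp add: freq_measure_def)

lemma sets_strip_measure [measurable_cong]: "sets (strip_measure s a b) = sets borel"
  by (simp add: strip_measure_def)

lemma one_plus_square_pos: "0 < 1 + (\<xi>::real)\<^sup>2"
  by (simp add: add_pos_nonneg)

lemma sqint_freq_iff:
  "sqint (freq_measure s) v \<longleftrightarrow> v \<in> borel_measurable borel \<and> integrable lborel (\<lambda>\<xi>. (1 + \<xi>\<^sup>2) powr s * (cmod (v \<xi>))\<^sup>2)"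
proof -
  have "integrable (freq_measure s) (\<lambda>\<xi>. (cmod (v \<xi>))\<^sup>2) \<longleftrightarrow> integrable lborel (\<lambda>\<xi>. (1 + \<xi>\<^sup>2) powr s * (cmod (v \<xi>))\<^sup>2)"
    if [measurable]: "v \<in> borel_measurable borel"
    unfolding freq_measure_def by (subst integrable_density) auto
  moreover have "v \<in> borel_measurable (freq_measure s) \<longleftrightarrow> v \<in> borel_measurable borel"
    by (intro arg_cong2[where f = "(\<in>)"] measurable_cong_sets sets_freq_measure refl)
  ultimately show ?thesis by (auto simp: sqint_def)
qed

lemma l2norm_freq:
  assumes [measurable]: "v \<in> borel_measurable borel"
  shows "(l2norm (freq_measure s) v)\<^sup>2 = (LINT \<xi>|lborel. (1 + \<xi>\<^sup>2) powr s * (cmod (v \<xi>))\<^sup>2)"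
  unfolding l2norm_power2 freq_measure_def by (subst integral_density) auto

lemma borel_measurable_strip: "borel_measurable (strip_measure s a b) = borel_measurable borel"
  by (intro measurable_cong_sets sets_strip_measure refl)

lemma strip_weight_measurable [measurable]:
  "(\<lambda>p::real \<times> real. indicator {a..b} (fst p) * (1 + (snd p)\<^sup>2) powr s) \<in> borel_measurable borel"
  unfolding borel_prod[symmetric] by measurable

lemma slice_measurable:
  fixes w :: "'a::topological_space \<times> 'b::topological_space \<Rightarrow> 'c::topological_space"
  assumes "w \<in> borel_measurable borel"
  shows "(\<lambda>\<xi>. w (t, \<xi>)) \<in> borel_measurable borel"
  by (rule measurable_compose[OF borel_measurable_continuous_onI assms]) (intro continuous_intros)

lemma sqint_strip_iff:
  "sqint (strip_measure s a b) w \<longleftrightarrow> w \<in> borel_measurable borel \<and>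
     integrable lborel (\<lambda>p. indicator {a..b} (fst p) * (1 + (snd p)\<^sup>2) powr s * (cmod (w p))\<^sup>2)"
proof -
  have "integrable (strip_measure s a b) (\<lambda>\<xi>. (cmod (w \<xi>))\<^sup>2) \<longleftrightarrow>
      integrable lborel (\<lambda>p. indicator {a..b} (fst p) * (1 + (snd p)\<^sup>2) powr s * (cmod (w p))\<^sup>2)"
    if [measurable]: "w \<in> borel_measurable borel"
    unfolding strip_measure_def by (subst integrable_density) auto
  then show ?thesis by (auto simp: sqint_def borel_measurable_strip)
qed

lemma l2norm_strip:
  assumes [measurable]: "w \<in> borel_measurable borel"
  shows "(l2norm (strip_measure s a b) w)\<^sup>2 = (LINT p|lborel. indicator {a..b} (fst p) * (1 + (snd p)\<^sup>2) powr s * (cmod (w p))\<^sup>2)"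
  unfolding l2norm_power2 strip_measure_def by (subst integral_density) auto

lemma strip_slice:
  assumes w: "sqint (strip_measure s a b) w"
  shows "AE t in lborel. t \<in> {a..b} \<longrightarrow> sqint (freq_measure s) (\<lambda>\<xi>. w (t, \<xi>))"
    and "integrable lborel (\<lambda>t. indicator {a..b} t * (l2norm (freq_measure s) (\<lambda>\<xi>. w (t, \<xi>)))\<^sup>2)"
    and "(LINT t|lborel. indicator {a..b} t * (l2norm (freq_measure s) (\<lambda>\<xi>. w (t, \<xi>)))\<^sup>2) = (l2norm (strip_measure s a b) w)\<^sup>2"
proof -
  let ?f = "\<lambda>p. indicator {a..b} (fst p) * (1 + (snd p)\<^sup>2) powr s * (cmod (w p))\<^sup>2"
  have wm [measurable]: "w \<in> borel_measurable borel" and i: "integrable (lborel \<Otimes>\<^sub>M lborel) ?f"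
    using w by (auto simp: sqint_strip_iff lborel_prod)
  have [measurable]: "(\<lambda>\<xi>. w (t, \<xi>)) \<in> borel_measurable borel" for t
    using wm by (rule slice_measurable)
  have slice: "(LINT \<xi>|lborel. ?f (t, \<xi>)) = indicator {a..b} t * (l2norm (freq_measure s) (\<lambda>\<xi>. w (t, \<xi>)))\<^sup>2" for t
    by (simp add: l2norm_freq indicator_def)
  show "AE t in lborel. t \<in> {a..b} \<longrightarrow> sqint (freq_measure s) (\<lambda>\<xi>. w (t, \<xi>))"
    using lborel_pair.AE_integrable_fst'[OF i] by eventually_elim (auto simp: sqint_freq_iff)
  show "integrable lborel (\<lambda>t. indicator {a..b} t * (l2norm (freq_measure s) (\<lambda>\<xi>. w (t, \<xi>)))\<^sup>2)"
    using lborel_pair.integrable_fst'[OF i] by (simp only: slice)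
  show "(LINT t|lborel. indicator {a..b} t * (l2norm (freq_measure s) (\<lambda>\<xi>. w (t, \<xi>)))\<^sup>2) = (l2norm (strip_measure s a b) w)\<^sup>2"
    using lborel_pair.integral_fst'[OF i] by (simp only: slice l2norm_strip[OF wm] lborel_prod)
qed

lemma sqint_strip_tensor:
  assumes p: "p \<in> borel_measurable borel" "\<And>t. cmod (p t) \<le> B" and q: "sqint (freq_measure s) q"
  shows "sqint (strip_measure s a b) (\<lambda>z. p (fst z) * q (snd z))"
proof -
  have [measurable]: "p \<in> borel_measurable borel" "q \<in> borel_measurable borel" using p q by (auto simp: sqint_freq_iff)
  have "integrable (lborel \<Otimes>\<^sub>M lborel) (\<lambda>z. indicator {a..b} (fst z) * (1 + (snd z)\<^sup>2) powr s * (cmod (p (fst z) * q (snd z)))\<^sup>2)"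
  proof (rule lborel_pair.Fubini_integrable)
    let ?Q = "LINT \<xi>|lborel. (1 + \<xi>\<^sup>2) powr s * (cmod (q \<xi>))\<^sup>2"
    have ip: "integrable lborel (\<lambda>t. indicator {a..b} t * (cmod (p t))\<^sup>2)"
    proof (rule Bochner_Integration.integrable_bound)
      show "integrable lborel (\<lambda>t. indicator {a..b} t * B\<^sup>2)" by (intro integrable_mult_left integrable_real_indicator)
        (auto simp: emeasure_lborel_Icc_eq)
      show "AE t in lborel. norm (indicator {a..b} t * (cmod (p t))\<^sup>2) \<le> norm (indicator {a..b} t * B\<^sup>2)"
        using p(2) by (auto simp: indicator_def intro!: power_mono)
    qed measurable
    have "(LINT y|lborel. norm (indicator {a..b} (fst (t, y)) * (1 + (snd (t, y))\<^sup>2) powr s * (cmod (p (fst (t, y)) * q (snd (t, y))))\<^sup>2))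
      = indicator {a..b} t * (cmod (p t))\<^sup>2 * ?Q" for t
      by (simp add: norm_mult power_mult_distrib mult.left_commute[of _ "(cmod (p t))\<^sup>2"] abs_mult mult.assoc)
    then show "integrable lborel (\<lambda>t. LINT y|lborel. norm (indicator {a..b} (fst (t, y)) * (1 + (snd (t, y))\<^sup>2) powr s * (cmod (p (fst (t, y)) * q (snd (t, y))))\<^sup>2))"
      using integrable_mult_left[OF ip, of ?Q] by simp
    show "AE t in lborel. integrable lborel (\<lambda>y. indicator {a..b} (fst (t, y)) * (1 + (snd (t, y))\<^sup>2) powr s * (cmod (p (fst (t, y)) * q (snd (t, y))))\<^sup>2)"
    proof (rule AE_I2)
      fix t
      have "integrable lborel (\<lambda>\<xi>. (indicator {a..b} t * (cmod (p t))\<^sup>2) * ((1 + \<xi>\<^sup>2) powr s * (cmod (q \<xi>))\<^sup>2))"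
        using q by (intro integrable_mult_right) (simp add: sqint_freq_iff)
      then show "integrable lborel (\<lambda>y. indicator {a..b} (fst (t, y)) * (1 + (snd (t, y))\<^sup>2) powr s * (cmod (p (fst (t, y)) * q (snd (t, y))))\<^sup>2)"
        by (simp add: norm_mult power_mult_distrib ac_simps)
    qed
  qed measurable
  moreover have "(\<lambda>z. p (fst z) * q (snd z)) \<in> borel_measurable borel"
    unfolding borel_prod[symmetric] by measurable
  ultimately show ?thesis by (simp add: sqint_strip_iff lborel_prod)
qed

definition time_l2 :: "real \<Rightarrow> real \<Rightarrow> (real \<Rightarrow> complex) \<Rightarrow> real" where
  "time_l2 a b p = l2norm lborel (\<lambda>t. indicator {a..b} t * p t)"

lemma l2norm_strip_tensor:
  assumes p: "p \<in> borel_measurable borel" "\<And>t. cmod (p t) \<le> B" and q: "sqint (freq_measure s) q"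
  shows "l2norm (strip_measure s a b) (\<lambda>z. p (fst z) * q (snd z)) = time_l2 a b p * l2norm (freq_measure s) q"
proof -
  have "(l2norm (strip_measure s a b) (\<lambda>z. p (fst z) * q (snd z)))\<^sup>2
    = (LINT t|lborel. indicator {a..b} t * (l2norm (freq_measure s) (\<lambda>\<xi>. p t * q \<xi>))\<^sup>2)"
    using strip_slice(3)[OF sqint_strip_tensor[OF assms, of a b]] by simp
  also have "\<dots> = (LINT t|lborel. (cmod (indicator {a..b} t * p t))\<^sup>2 * (l2norm (freq_measure s) q)\<^sup>2)"
    by (intro Bochner_Integration.integral_cong) (auto simp: l2norm_cmult power_mult_distrib norm_mult indicator_def)
  also have "\<dots> = (time_l2 a b p * l2norm (freq_measure s) q)\<^sup>2"
    by (simp add: time_l2_def power_mult_distrib l2norm_power2)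
  finally show ?thesis
    by (rule power2_eq_imp_eq) (simp_all add: l2norm_nonneg time_l2_def)
qed

lemma freq_weight:
  assumes v: "sqint (freq_measure s) v"
  shows "sqint lborel (\<lambda>\<xi>. complex_of_real ((1 + \<xi>\<^sup>2) powr (s / 2)) * v \<xi>)"
    "l2norm lborel (\<lambda>\<xi>. complex_of_real ((1 + \<xi>\<^sup>2) powr (s / 2)) * v \<xi>) = l2norm (freq_measure s) v"
proof -
  have vm [measurable]: "v \<in> borel_measurable borel" and i: "integrable lborel (\<lambda>\<xi>. (1 + \<xi>\<^sup>2) powr s * (cmod (v \<xi>))\<^sup>2)"
    using v by (auto simp: sqint_freq_iff)
  have "((1 + \<xi>\<^sup>2) powr (s / 2))\<^sup>2 = (1 + \<xi>\<^sup>2) powr s" for \<xi> :: real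
    using one_plus_square_pos[of \<xi>] by (simp add: power2_eq_square powr_add[symmetric])
  then have eq: "(cmod (complex_of_real ((1 + \<xi>\<^sup>2) powr (s / 2)) * v \<xi>))\<^sup>2 = (1 + \<xi>\<^sup>2) powr s * (cmod (v \<xi>))\<^sup>2" for \<xi>
    by (simp add: norm_mult power_mult_distrib)
  show "sqint lborel (\<lambda>\<xi>. complex_of_real ((1 + \<xi>\<^sup>2) powr (s / 2)) * v \<xi>)"
    unfolding sqint_def eq using i by auto
  show "l2norm lborel (\<lambda>\<xi>. complex_of_real ((1 + \<xi>\<^sup>2) powr (s / 2)) * v \<xi>) = l2norm (freq_measure s) v"
    by (rule power2_eq_imp_eq[OF _ l2norm_nonneg l2norm_nonneg]) (simp only: l2norm_freq[OF vm], simp only: l2norm_power2 eq)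
qed

text \<open>The weights with exponents \<open>s / 2\<close> and \<open>- s / 2\<close> cancel in the
  product, which leaves the Cauchy-Schwarz inequality for Lebesgue measure.\<close>

lemma freq_pairing:
  assumes v: "sqint (freq_measure s) v" and w: "sqint (freq_measure (- s)) w"
  shows "integrable lborel (\<lambda>\<xi>. v \<xi> * w \<xi>)"
    "(LINT \<xi>|lborel. cmod (v \<xi>) * cmod (w \<xi>)) \<le> l2norm (freq_measure s) v * l2norm (freq_measure (- s)) w"
    "cmod (LINT \<xi>|lborel. v \<xi> * w \<xi>) \<le> l2norm (freq_measure s) v * l2norm (freq_measure (- s)) w"
proof -
  have [measurable]: "v \<in> borel_measurable borel" "w \<in> borel_measurable borel"
    using v w by (auto simp: sqint_freq_iff)
  let ?v = "\<lambda>\<xi>. complex_of_real ((1 + \<xi>\<^sup>2) powr (s / 2)) * v \<xi>"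
  let ?w = "\<lambda>\<xi>. complex_of_real ((1 + \<xi>\<^sup>2) powr (- s / 2)) * w \<xi>"
  note sv = freq_weight(1)[OF v] and sw = freq_weight(1)[OF w] and nv = freq_weight(2)[OF v] and nw = freq_weight(2)[OF w]
  have "(1 + \<xi>\<^sup>2) powr (s / 2) * (1 + \<xi>\<^sup>2) powr (- s / 2) = 1" for \<xi> :: real
    using one_plus_square_pos[of \<xi>] by (subst powr_add[symmetric]) simp
  then have *: "complex_of_real ((1 + \<xi>\<^sup>2) powr (s / 2)) * complex_of_real ((1 + \<xi>\<^sup>2) powr (- s / 2)) = 1" for \<xi>
    unfolding of_real_mult[symmetric] by simp
  then have eq: "?v \<xi> * ?w \<xi> = v \<xi> * w \<xi>" for \<xi>
  proof -
    have "?v \<xi> * ?w \<xi> = (complex_of_real ((1 + \<xi>\<^sup>2) powr (s / 2)) * complex_of_real ((1 + \<xi>\<^sup>2) powr (- s / 2))) * (v \<xi> * w \<xi>)"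
      by (simp only: mult_ac)
    then show ?thesis by (simp only: * mult_1)
  qed
  show "integrable lborel (\<lambda>\<xi>. v \<xi> * w \<xi>)"
    using sqint_mult_integrable(2)[OF sv sw] by (simp only: eq)
  show "cmod (LINT \<xi>|lborel. v \<xi> * w \<xi>) \<le> l2norm (freq_measure s) v * l2norm (freq_measure (- s)) w"
    using l2norm_integral_mult_le[OF sv sw] by (simp only: eq nv nw)
  show "(LINT \<xi>|lborel. cmod (v \<xi>) * cmod (w \<xi>)) \<le> l2norm (freq_measure s) v * l2norm (freq_measure (- s)) w"
    using l2norm_Cauchy_Schwarz[OF sv sw] by (simp only: eq nv nw norm_mult[symmetric])
qed

lemma powr_le_one_plus_square:
  fixes \<xi> :: real
  assumes "s \<le> 1" shows "(1 + \<xi>\<^sup>2) powr s \<le> 1 + \<xi>\<^sup>2"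
  using powr_mono[OF assms, of "1 + \<xi>\<^sup>2"] one_plus_square_pos[of \<xi>] by simp

text \<open>For \<open>s \<le> 1\<close> the weight is at most \<open>1 + \<xi>\<^sup>2\<close>. All
  regularities that occur, and their negatives where a dual norm is taken, lie below 1.\<close>

lemma schwartz_freq:
  assumes f: "f \<in> schwartz" and s: "s \<le> 1"
  shows "sqint (freq_measure s) f"
    "l2norm (freq_measure s) f \<le> l2norm lborel f + l2norm lborel (\<lambda>\<xi>. of_real \<xi> * f \<xi>)"
proof -
  have [measurable]: "f \<in> borel_measurable borel" using f by (rule schwartz_measurable)
  let ?g = "\<lambda>\<xi>. of_real \<xi> * f \<xi>"
  have i: "integrable lborel (\<lambda>\<xi>. (cmod (f \<xi>))\<^sup>2)" "integrable lborel (\<lambda>\<xi>. (cmod (?g \<xi>))\<^sup>2)"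
    using schwartz_sqint[OF f] schwartz_sqint[OF schwartz_times_id[OF f]] by (auto simp: sqint_def)
  have le: "(1 + \<xi>\<^sup>2) powr s * (cmod (f \<xi>))\<^sup>2 \<le> (cmod (f \<xi>))\<^sup>2 + (cmod (?g \<xi>))\<^sup>2" for \<xi>
    using mult_right_mono[OF powr_le_one_plus_square[OF s, of \<xi>], of "(cmod (f \<xi>))\<^sup>2"]
    by (simp add: norm_mult power_mult_distrib algebra_simps)
  have i3: "integrable lborel (\<lambda>\<xi>. (1 + \<xi>\<^sup>2) powr s * (cmod (f \<xi>))\<^sup>2)"
    by (rule Bochner_Integration.integrable_bound[OF Bochner_Integration.integrable_add[OF i]])
       (use le in \<open>auto intro!: AE_I2 order_trans[OF le]\<close>)
  then show "sqint (freq_measure s) f" by (simp add: sqint_freq_iff)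
  have "(l2norm (freq_measure s) f)\<^sup>2 \<le> (LINT \<xi>|lborel. (cmod (f \<xi>))\<^sup>2 + (cmod (?g \<xi>))\<^sup>2)"
    unfolding l2norm_freq[OF \<open>f \<in> borel_measurable borel\<close>] using i i3 le by (intro integral_mono) auto
  also have "\<dots> = (l2norm lborel f)\<^sup>2 + (l2norm lborel ?g)\<^sup>2" using i by (simp add: l2norm_power2)
  also have "\<dots> \<le> (l2norm lborel f + l2norm lborel ?g)\<^sup>2"
    using l2norm_nonneg[of lborel f] l2norm_nonneg[of lborel ?g] by (simp add: power2_sum)
  finally show "l2norm (freq_measure s) f \<le> l2norm lborel f + l2norm lborel ?g"
    by (rule power2_le_imp_le) (simp add: l2norm_nonneg)
qed

text \<open>Plancherel's identity for \<open>f\<close> and for its derivative bounds the Sobolev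
  norm by norms in physical space, where truncations and compact supports are visible.\<close>

lemma fourier_freq_le:
  assumes f: "f \<in> schwartz" and s: "s \<le> 1"
  shows "l2norm (freq_measure s) (fourier f) \<le> l2norm lborel f + l2norm lborel (vderiv f)"
proof -
  have "l2norm lborel (\<lambda>\<xi>. of_real \<xi> * fourier f \<xi>) = l2norm lborel (fourier (vderiv f))"
    by (simp add: fourier_vderiv[OF f] l2norm_def norm_mult)
  then show ?thesis
    using schwartz_freq(2)[OF schwartz_fourier[OF f] s] Plancherel_schwartz[OF f] Plancherel_schwartz[OF schwartz_vderiv(2)[OF f]]
    by simp
qed

text \<open>Names the jointly measurable transform that \<open>L2Hs\<close> hides behind a
  quantifier; Fubini's theorem supplies membership of almost every slice in
  \<open>Hs s\<close>.\<close>

definition strip_fourier :: "real \<Rightarrow> real \<Rightarrow> real \<Rightarrow> (real \<Rightarrow> distr) \<Rightarrow> (real \<times> real \<Rightarrow> complex) \<Rightarrow> bool" where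
  "strip_fourier s a b V w \<longleftrightarrow> sqint (strip_measure s a b) w \<and>
     (AE t in lborel. t \<in> {a..b} \<longrightarrow> has_fourier (V t) (\<lambda>\<xi>. w (t, \<xi>)))"

lemma L2Hs_iff: "V \<in> L2Hs s a b \<longleftrightarrow> (\<exists>w. strip_fourier s a b V w)"
proof -
  have eq: "set_integrable lborel ({a..b} \<times> UNIV) (\<lambda>(t, \<xi>). (1 + \<xi>\<^sup>2) powr s * (cmod (w (t, \<xi>)))\<^sup>2) \<longleftrightarrow>
    integrable lborel (\<lambda>p. indicator {a..b} (fst p) * (1 + (snd p)\<^sup>2) powr s * (cmod (w p))\<^sup>2)" for w
    unfolding set_integrable_def
    by (intro Bochner_Integration.integrable_cong refl) (auto simp: indicator_def)
  show ?thesis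
  proof
    assume "V \<in> L2Hs s a b"
    then show "\<exists>w. strip_fourier s a b V w"
      unfolding L2Hs_def strip_fourier_def sqint_strip_iff eq by (auto elim!: AE_mp)
  next
    assume "\<exists>w. strip_fourier s a b V w"
    then obtain w where w: "sqint (strip_measure s a b) w"
      "AE t in lborel. t \<in> {a..b} \<longrightarrow> has_fourier (V t) (\<lambda>\<xi>. w (t, \<xi>))" by (auto simp: strip_fourier_def)
    have "AE t in lborel. t \<in> {a..b} \<longrightarrow> V t \<in> Hs s \<and> has_fourier (V t) (\<lambda>\<xi>. w (t, \<xi>))"
      using w(2) strip_slice(1)[OF w(1)] by eventually_elim (auto simp: Hs_def sqint_freq_iff)
    then show "V \<in> L2Hs s a b" using w(1) unfolding L2Hs_def sqint_strip_iff eq by blast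
  qed
qed

lemma Hs_norm_eq:
  assumes "has_fourier u v"
  shows "Hs_norm s u = l2norm (freq_measure s) v"
proof -
  let ?v = "SOME v. has_fourier u v"
  have v: "has_fourier u ?v" using assms by (rule someI[where P = "has_fourier u"])
  note [measurable] = has_fourier_measurable[OF v] has_fourier_measurable[OF assms]
  have "(LINT \<xi>|lborel. (1 + \<xi>\<^sup>2) powr s * (cmod (?v \<xi>))\<^sup>2) = (LINT \<xi>|lborel. (1 + \<xi>\<^sup>2) powr s * (cmod (v \<xi>))\<^sup>2)"
    using has_fourier_unique[OF v assms] by (intro integral_cong_AE) (auto elim!: AE_mp)
  then show ?thesis
    unfolding Hs_norm_def l2norm_freq[OF has_fourier_measurable[OF assms], symmetric] by (simp add: l2norm_nonneg)
qed

text \<open>The integrand of the norm agrees only almost everywhere with a Borel function of time.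
  Over \<open>lebesgue\<close> this makes it measurable, and completion leaves the integral of the
  Borel function unchanged.\<close>

lemma L2Hs_norm_eq:
  assumes "strip_fourier s a b V w"
  shows "L2Hs_norm s a b V = l2norm (strip_measure s a b) w"
proof -
  have w: "sqint (strip_measure s a b) w"
    and hf: "AE t in lborel. t \<in> {a..b} \<longrightarrow> has_fourier (V t) (\<lambda>\<xi>. w (t, \<xi>))"
    using assms by (auto simp: strip_fourier_def)
  let ?h = "\<lambda>t. indicator {a..b} t * (l2norm (freq_measure s) (\<lambda>\<xi>. w (t, \<xi>)))\<^sup>2"
  have hm: "?h \<in> borel_measurable lborel" using strip_slice(2)[OF w] by (rule borel_measurable_integrable)
  have ae: "AE t in lebesgue. ?h t = indicator {a..b} t *\<^sub>R (Hs_norm s (V t))\<^sup>2"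
    by (rule AE_completion) (use hf in eventually_elim, auto simp: indicator_def Hs_norm_eq)
  have hm': "?h \<in> borel_measurable lebesgue" using measurable_completion[OF hm] .
  have "(LINT t:{a..b}|lebesgue. (Hs_norm s (V t))\<^sup>2) = (LINT t|lebesgue. ?h t)"
    unfolding set_lebesgue_integral_def
    using hm' borel_measurable_AE[OF hm' ae] ae by (intro integral_cong_AE) (auto elim!: AE_mp)
  also have "\<dots> = (LINT t|lborel. ?h t)" by (rule integral_completion[OF hm])
  also have "\<dots> = (l2norm (strip_measure s a b) w)\<^sup>2" by (rule strip_slice(3)[OF w])
  finally show ?thesis unfolding L2Hs_norm_def by (simp add: l2norm_nonneg)
qed

lemma L2Hs_norm_nonneg: "V \<in> L2Hs s a b \<Longrightarrow> 0 \<le> L2Hs_norm s a b V"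
  using L2Hs_norm_eq by (auto simp: L2Hs_iff l2norm_nonneg)

lemma has_fourier_cong:
  assumes "\<And>\<phi>. \<phi> \<in> schwartz \<Longrightarrow> u (fourier \<phi>) = u' (fourier \<phi>)"
  shows "has_fourier u v \<longleftrightarrow> has_fourier u' v"
  using assms by (simp add: has_fourier_def)

lemma strip_fourier_cong:
  assumes "AE t in lborel. t \<in> {a..b} \<longrightarrow> (\<forall>\<phi>\<in>schwartz. V t (fourier \<phi>) = V' t (fourier \<phi>))"
    and "strip_fourier s a b V w"
  shows "strip_fourier s a b V' w"
proof -
  have "AE t in lborel. t \<in> {a..b} \<longrightarrow> has_fourier (V t) (\<lambda>\<xi>. w (t, \<xi>))"
    using assms(2) by (simp add: strip_fourier_def)
  with assms(1) have "AE t in lborel. t \<in> {a..b} \<longrightarrow> has_fourier (V' t) (\<lambda>\<xi>. w (t, \<xi>))"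
    by eventually_elim (auto simp: has_fourier_cong[of "V _" "V' _"])
  then show ?thesis using assms(2) by (simp add: strip_fourier_def)
qed

text \<open>Distributions are raw functionals, and their values off the Schwartz space are
  arbitrary. Identities between densities are proved on Schwartz functions and transported to
  membership and norm by this lemma.\<close>

lemma L2Hs_cong:
  assumes "AE t in lborel. t \<in> {a..b} \<longrightarrow> (\<forall>\<phi>\<in>schwartz. V t (fourier \<phi>) = V' t (fourier \<phi>))" "V \<in> L2Hs s a b"
  shows "V' \<in> L2Hs s a b" "L2Hs_norm s a b V' = L2Hs_norm s a b V"
proof -
  obtain w where w: "strip_fourier s a b V w" using assms(2) by (auto simp: L2Hs_iff)
  note w' = strip_fourier_cong[OF assms(1) w]
  show "V' \<in> L2Hs s a b" using w' by (auto simp: L2Hs_iff)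
  show "L2Hs_norm s a b V' = L2Hs_norm s a b V" by (simp add: L2Hs_norm_eq[OF w] L2Hs_norm_eq[OF w'])
qed

lemma has_fourier_lincomb:
  assumes "has_fourier u v" "has_fourier u' v'"
  shows "has_fourier (\<lambda>\<phi>. c * u \<phi> + d * u' \<phi>) (\<lambda>\<xi>. c * v \<xi> + d * v' \<xi>)"
  unfolding has_fourier_def
proof (intro conjI ballI)
  show "(\<lambda>\<xi>. c * v \<xi> + d * v' \<xi>) \<in> borel_measurable borel"
    using assms by (auto simp: has_fourier_def)
  fix \<phi> assume \<phi>: "\<phi> \<in> schwartz"
  have eq: "(c * v \<xi> + d * v' \<xi>) * \<phi> \<xi> = c * (v \<xi> * \<phi> \<xi>) + d * (v' \<xi> * \<phi> \<xi>)" for \<xi>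
    by (simp add: algebra_simps)
  show "integrable lborel (\<lambda>\<xi>. (c * v \<xi> + d * v' \<xi>) * \<phi> \<xi>)"
    unfolding eq using has_fourierD(1)[OF assms(1) \<phi>] has_fourierD(1)[OF assms(2) \<phi>] by simp
  show "c * u (fourier \<phi>) + d * u' (fourier \<phi>) = (LINT \<xi>|lborel. (c * v \<xi> + d * v' \<xi>) * \<phi> \<xi>)"
    unfolding eq using has_fourierD[OF assms(1) \<phi>] has_fourierD[OF assms(2) \<phi>] by simp
qed

lemma strip_fourier_lincomb:
  assumes "strip_fourier s a b V w" "strip_fourier s a b V' w'"
  shows "strip_fourier s a b (\<lambda>t \<phi>. c * V t \<phi> + d * V' t \<phi>) (\<lambda>p. c * w p + d * w' p)"
proof -
  have "AE t in lborel. t \<in> {a..b} \<longrightarrow> has_fourier (V t) (\<lambda>\<xi>. w (t, \<xi>))"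
    "AE t in lborel. t \<in> {a..b} \<longrightarrow> has_fourier (V' t) (\<lambda>\<xi>. w' (t, \<xi>))"
    using assms by (auto simp: strip_fourier_def)
  then have "AE t in lborel. t \<in> {a..b} \<longrightarrow> has_fourier (\<lambda>\<phi>. c * V t \<phi> + d * V' t \<phi>) (\<lambda>\<xi>. c * w (t, \<xi>) + d * w' (t, \<xi>))"
    by eventually_elim (auto intro: has_fourier_lincomb)
  then show ?thesis using assms by (auto simp: strip_fourier_def intro!: sqint_add sqint_cmult)
qed

lemma strip_fourier_diff:
  assumes "strip_fourier s a b V w" "strip_fourier s a b V' w'"
  shows "strip_fourier s a b (\<lambda>t \<phi>. V t \<phi> - V' t \<phi>) (\<lambda>p. w p - w' p)"
  using strip_fourier_lincomb[OF assms, of 1 "-1"] by simp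

lemma strip_fourier_add:
  assumes "strip_fourier s a b V w" "strip_fourier s a b V' w'"
  shows "strip_fourier s a b (\<lambda>t \<phi>. V t \<phi> + V' t \<phi>) (\<lambda>p. w p + w' p)"
  using strip_fourier_lincomb[OF assms, of 1 1] by simp

lemma L2Hs_diff:
  assumes "V \<in> L2Hs s a b" "V' \<in> L2Hs s a b"
  shows "(\<lambda>t \<phi>. V t \<phi> - V' t \<phi>) \<in> L2Hs s a b"
    "L2Hs_norm s a b (\<lambda>t \<phi>. V t \<phi> - V' t \<phi>) \<le> L2Hs_norm s a b V + L2Hs_norm s a b V'"
proof -
  obtain w w' where w: "strip_fourier s a b V w" "strip_fourier s a b V' w'" using assms by (auto simp: L2Hs_iff)
  note d = strip_fourier_diff[OF w]
  show "(\<lambda>t \<phi>. V t \<phi> - V' t \<phi>) \<in> L2Hs s a b" using d by (auto simp: L2Hs_iff)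
  show "L2Hs_norm s a b (\<lambda>t \<phi>. V t \<phi> - V' t \<phi>) \<le> L2Hs_norm s a b V + L2Hs_norm s a b V'"
    unfolding L2Hs_norm_eq[OF d] L2Hs_norm_eq[OF w(1)] L2Hs_norm_eq[OF w(2)]
    using w by (intro l2norm_triangle_diff) (auto simp: strip_fourier_def)
qed

lemma L2Hs_add:
  assumes "V \<in> L2Hs s a b" "V' \<in> L2Hs s a b"
  shows "(\<lambda>t \<phi>. V t \<phi> + V' t \<phi>) \<in> L2Hs s a b"
    "L2Hs_norm s a b (\<lambda>t \<phi>. V t \<phi> + V' t \<phi>) \<le> L2Hs_norm s a b V + L2Hs_norm s a b V'"
proof -
  obtain w w' where w: "strip_fourier s a b V w" "strip_fourier s a b V' w'" using assms by (auto simp: L2Hs_iff)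
  note d = strip_fourier_add[OF w]
  show "(\<lambda>t \<phi>. V t \<phi> + V' t \<phi>) \<in> L2Hs s a b" using d by (auto simp: L2Hs_iff)
  show "L2Hs_norm s a b (\<lambda>t \<phi>. V t \<phi> + V' t \<phi>) \<le> L2Hs_norm s a b V + L2Hs_norm s a b V'"
    unfolding L2Hs_norm_eq[OF d] L2Hs_norm_eq[OF w(1)] L2Hs_norm_eq[OF w(2)]
    using w by (intro l2norm_triangle) (auto simp: strip_fourier_def)
qed

lemma strip_fourier_subinterval:
  assumes "strip_fourier s a b V w" "a \<le> c" "d \<le> b"
  shows "strip_fourier s c d V w" "l2norm (strip_measure s c d) w \<le> l2norm (strip_measure s a b) w"
proof -
  have wm [measurable]: "w \<in> borel_measurable borel"
    and i: "integrable lborel (\<lambda>p. indicator {a..b} (fst p) * (1 + (snd p)\<^sup>2) powr s * (cmod (w p))\<^sup>2)"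
    using assms(1) by (auto simp: strip_fourier_def sqint_strip_iff)
  have le: "indicator {c..d} (fst p) * (1 + (snd p)\<^sup>2) powr s * (cmod (w p))\<^sup>2 \<le>
    indicator {a..b} (fst p) * (1 + (snd p)\<^sup>2) powr s * (cmod (w p))\<^sup>2" for p
    using assms(2,3) by (auto simp: indicator_def)
  have i': "integrable lborel (\<lambda>p. indicator {c..d} (fst p) * (1 + (snd p)\<^sup>2) powr s * (cmod (w p))\<^sup>2)"
    by (rule Bochner_Integration.integrable_bound[OF i])
       (use le in \<open>auto simp: abs_mult\<close>)
  show "strip_fourier s c d V w"
    using assms i' by (auto simp: strip_fourier_def sqint_strip_iff elim!: AE_mp)
  have "(l2norm (strip_measure s c d) w)\<^sup>2 \<le> (l2norm (strip_measure s a b) w)\<^sup>2"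
    unfolding l2norm_strip[OF wm] using i i' le by (intro integral_mono) auto
  then show "l2norm (strip_measure s c d) w \<le> l2norm (strip_measure s a b) w"
    by (rule power2_le_imp_le) (rule l2norm_nonneg)
qed

lemma L2Hs_subinterval:
  assumes "V \<in> L2Hs s a b" "a \<le> c" "d \<le> b"
  shows "V \<in> L2Hs s c d" "L2Hs_norm s c d V \<le> L2Hs_norm s a b V"
proof -
  obtain w where w: "strip_fourier s a b V w" using assms(1) by (auto simp: L2Hs_iff)
  note w' = strip_fourier_subinterval[OF w assms(2,3)]
  show "V \<in> L2Hs s c d" using w'(1) by (auto simp: L2Hs_iff)
  show "L2Hs_norm s c d V \<le> L2Hs_norm s a b V" unfolding L2Hs_norm_eq[OF w] L2Hs_norm_eq[OF w'(1)] by (rule w')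
qed

text \<open>Completeness in the form that the Dyson series needs: the sum \<open>S\<close> is given
  in advance, at each time and on each test function, and has to be recognized as the limit in norm.
  The transforms sum to some \<open>g\<close> in the weighted space; at almost every time, pairing
  with Schwartz functions shows that the slice of \<open>g\<close> is the transform of
  \<open>S t\<close>. The bound \<open>- 1 \<le> s\<close> places Schwartz functions in the dual
  space.\<close>

theorem L2Hs_suminf:
  assumes R: "\<And>k. R k \<in> L2Hs s a b" and le: "\<And>k. L2Hs_norm s a b (R k) \<le> e k" and e: "summable e"
    and s: "- 1 \<le> s"
    and sums: "AE t in lborel. t \<in> {a..b} \<longrightarrow> (\<forall>\<phi>\<in>schwartz. (\<lambda>k. R k t (fourier \<phi>)) sums S t (fourier \<phi>))"
  shows "S \<in> L2Hs s a b" "L2Hs_norm s a b S \<le> suminf e"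
proof -
  let ?M = "strip_measure s a b"
  have "\<exists>w. strip_fourier s a b (R k) w" for k using R[of k] by (simp add: L2Hs_iff)
  then obtain w where w: "\<And>k. strip_fourier s a b (R k) (w k)" by metis
  have wi: "sqint ?M (w k)" for k using w[of k] by (simp add: strip_fourier_def)
  have wl: "l2norm ?M (w k) \<le> e k" for k using le[of k] L2Hs_norm_eq[OF w[of k]] by simp
  obtain g where g: "sqint ?M g" and lim: "(\<lambda>n. l2norm ?M (\<lambda>x. (\<Sum>k<n. w k x) - g x)) \<longlonglongrightarrow> 0"
    and gle: "l2norm ?M g \<le> suminf e"
    using l2norm_summable[OF wi wl e] by blast
  let ?D = "\<lambda>n p. (\<Sum>k<n. w k p) - g p"
  have D: "sqint ?M (?D n)" for n by (intro sqint_diff sqint_sum wi g)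
  let ?N = "\<lambda>n t. l2norm (freq_measure s) (\<lambda>\<xi>. ?D n (t, \<xi>))"
  \<comment> \<open>Convergence in the mean of the squared slice norms yields convergence at almost
    every time along a subsequence. That suffices to identify the limit, because the full sequence
    of partial sums converges on test functions by \<open>sums\<close>.\<close>
  have "\<exists>r::nat\<Rightarrow>nat. strict_mono r \<and> (AE t in lborel. (\<lambda>n. indicator {a..b} t * (?N (r n) t)\<^sup>2) \<longlonglongrightarrow> 0)"
  proof (rule tendsto_L1_AE_subseq)
    show "integrable lborel (\<lambda>t. indicator {a..b} t * (?N n t)\<^sup>2)" for n by (rule strip_slice(2)[OF D])
    have "(LINT t|lborel. norm (indicator {a..b} t * (?N n t)\<^sup>2)) = (l2norm ?M (?D n))\<^sup>2" for n
      unfolding strip_slice(3)[OF D, symmetric] by simp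
    then show "(\<lambda>n. LINT t|lborel. norm (indicator {a..b} t * (?N n t)\<^sup>2)) \<longlonglongrightarrow> 0"
      using tendsto_power[OF lim, of 2] by simp
  qed
  then obtain r :: "nat \<Rightarrow> nat" where r: "strict_mono r" "AE t in lborel. (\<lambda>n. indicator {a..b} t * (?N (r n) t)\<^sup>2) \<longlonglongrightarrow> 0" by blast
  have "AE t in lborel. \<forall>k. t \<in> {a..b} \<longrightarrow> has_fourier (R k t) (\<lambda>\<xi>. w k (t, \<xi>))"
    unfolding AE_all_countable using w by (auto simp: strip_fourier_def)
  moreover have "AE t in lborel. \<forall>n. t \<in> {a..b} \<longrightarrow> sqint (freq_measure s) (\<lambda>\<xi>. ?D n (t, \<xi>))"
    unfolding AE_all_countable using strip_slice(1)[OF D] by blast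
  moreover note strip_slice(1)[OF g] r(2) sums
  ultimately have "AE t in lborel. t \<in> {a..b} \<longrightarrow> has_fourier (S t) (\<lambda>\<xi>. g (t, \<xi>))"
  proof eventually_elim
    case (elim t)
    show ?case
      unfolding has_fourier_def
    proof (intro impI conjI ballI)
      assume t: "t \<in> {a..b}"
      show "(\<lambda>\<xi>. g (t, \<xi>)) \<in> borel_measurable borel" using elim(3) t by (simp add: sqint_freq_iff)
      fix \<phi> assume \<phi>: "\<phi> \<in> schwartz"
      have \<phi>': "sqint (freq_measure (- s)) \<phi>" using schwartz_freq(1)[OF \<phi>, of "- s"] s by simp
      show ig: "integrable lborel (\<lambda>\<xi>. g (t, \<xi>) * \<phi> \<xi>)"
        by (rule freq_pairing(1)[OF _ \<phi>']) (use elim(3) t in blast)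
      let ?J = "\<lambda>n. LINT \<xi>|lborel. ?D n (t, \<xi>) * \<phi> \<xi>"
      have Deq: "?J n = (\<Sum>k<n. R k t (fourier \<phi>)) - (LINT \<xi>|lborel. g (t, \<xi>) * \<phi> \<xi>)" for n
      proof -
        have i: "integrable lborel (\<lambda>\<xi>. w k (t, \<xi>) * \<phi> \<xi>)" and v: "R k t (fourier \<phi>) = (LINT \<xi>|lborel. w k (t, \<xi>) * \<phi> \<xi>)" for k
          using elim(1) t has_fourierD[OF _ \<phi>] by blast+
        have "?J n = (LINT \<xi>|lborel. (\<Sum>k<n. w k (t, \<xi>) * \<phi> \<xi>) - g (t, \<xi>) * \<phi> \<xi>)"
          by (simp add: left_diff_distrib sum_distrib_right)
        also have "\<dots> = (\<Sum>k<n. LINT \<xi>|lborel. w k (t, \<xi>) * \<phi> \<xi>) - (LINT \<xi>|lborel. g (t, \<xi>) * \<phi> \<xi>)"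
          using i ig by (simp add: Bochner_Integration.integral_sum)
        finally show ?thesis by (simp add: v)
      qed
      have "(\<lambda>n. ?N (r n) t * l2norm (freq_measure (- s)) \<phi>) \<longlonglongrightarrow> 0"
      proof (rule tendsto_mult_left_zero)
        have "(\<lambda>n. (?N (r n) t)\<^sup>2) \<longlonglongrightarrow> 0" using elim(4) t by simp
        from tendsto_real_sqrt[OF this] show "(\<lambda>n. ?N (r n) t) \<longlonglongrightarrow> 0" by (simp add: l2norm_nonneg)
      qed
      then have "(\<lambda>n. ?J (r n)) \<longlonglongrightarrow> 0"
      proof (rule Lim_null_comparison[OF always_eventually, rotated], intro allI)
        fix n
        have "sqint (freq_measure s) (\<lambda>\<xi>. ?D (r n) (t, \<xi>))" using elim(2) t by blast
        from freq_pairing(3)[OF this \<phi>'] show "norm (?J (r n)) \<le> ?N (r n) t * l2norm (freq_measure (- s)) \<phi>" .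
      qed
      then have "(\<lambda>n. \<Sum>k<r n. R k t (fourier \<phi>)) \<longlonglongrightarrow> (LINT \<xi>|lborel. g (t, \<xi>) * \<phi> \<xi>)"
        unfolding Deq by (rule LIM_zero_cancel)
      moreover have "(\<lambda>n. \<Sum>k<r n. R k t (fourier \<phi>)) \<longlonglongrightarrow> S t (fourier \<phi>)"
        using LIMSEQ_subseq_LIMSEQ[OF _ r(1)] elim(5) t \<phi> by (force simp: sums_def comp_def)
      ultimately show "S t (fourier \<phi>) = (LINT \<xi>|lborel. g (t, \<xi>) * \<phi> \<xi>)" by (rule LIMSEQ_unique[symmetric])
    qed
  qed
  then have "strip_fourier s a b S g" using g by (simp add: strip_fourier_def)
  then show "S \<in> L2Hs s a b" "L2Hs_norm s a b S \<le> suminf e"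
    using gle by (auto simp: L2Hs_iff L2Hs_norm_eq)
qed

section \<open>Density of smooth potentials\<close>

lemma vector_derivative_zero_open:
  fixes f :: "real \<Rightarrow> complex"
  assumes "(f has_vector_derivative d) (at x)" "open U" "x \<in> U" "\<And>y. y \<in> U \<Longrightarrow> f y = 0"
  shows "d = 0"
proof -
  have "((\<lambda>x. 0) has_vector_derivative d) (at x)"
    by (rule has_vector_derivative_transform_within_open[OF assms(1-3)]) (use assms(4) in auto)
  then show ?thesis using vector_derivative_unique_at[OF _ has_vector_derivative_const] by blast
qed

text \<open>The support condition of \<open>Cc_infinity\<close> concerns \<open>v\<close> alone. It
  spreads to the spatial derivatives because the region where a coordinate exceeds \<open>R\<close>
  in absolute value is open; compactness then gives the uniform bounds.\<close>

lemma Cc_infinity_D: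
  assumes "v \<in> Cc_infinity"
  obtains R M where "0 \<le> M" "\<And>t. v t \<in> schwartz" "continuous_on UNIV (\<lambda>p. v (fst p) (snd p))"
    "\<And>t x. cmod (v t x) \<le> M" "\<And>t x. cmod (vderiv (v t) x) \<le> M"
    "\<And>t x. \<bar>t\<bar> > R \<or> \<bar>x\<bar> > R \<Longrightarrow> v t x = 0 \<and> vderiv (v t) x = 0"
proof -
  from assms obtain D :: "nat \<Rightarrow> nat \<Rightarrow> real \<Rightarrow> real \<Rightarrow> complex" and R where D: "D 0 0 = v" "\<And>i j. continuous_on UNIV (\<lambda>(t, x). D i j t x)"
     "\<And>i j t x. (D i j t has_vector_derivative D i (Suc j) t x) (at x)"
    and R: "\<And>t x. v t x \<noteq> 0 \<Longrightarrow> \<bar>t\<bar> \<le> R \<and> \<bar>x\<bar> \<le> R"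
    unfolding Cc_infinity_def by blast
  have z: "D 0 j t x = 0" if "\<bar>t\<bar> > R \<or> \<bar>x\<bar> > R" for j t x
    using that
  proof (induction j arbitrary: x)
    case 0
    then show ?case using R[of t x] D(1) by fastforce
  next
    case (Suc j)
    show ?case
    proof (cases "\<bar>t\<bar> > R")
      case True
      then show ?thesis using Suc.IH by (intro vector_derivative_zero_open[OF D(3), of UNIV]) auto
    next
      case False
      have "open {x. \<bar>x\<bar> > R}" by (intro open_Collect_less continuous_intros)
      then show ?thesis using Suc False by (intro vector_derivative_zero_open[OF D(3)]) auto
    qed
  qed
  have vd: "vderiv (v t) = D 0 1 t" for t
    using D(3)[of 0 0 t] by (intro vderivI) (simp add: D(1))
  have "v t \<in> schwartz" for t
    unfolding schwartz_def
  proof (intro CollectI exI[of _ "\<lambda>n. D 0 n t"] conjI allI D(3))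
    show "D 0 0 t = v t" by (simp add: D)
    fix k n
    have "continuous_on UNIV (D 0 n t)"
      using D(3) by (intro continuous_at_imp_continuous_on ballI has_vector_derivative_continuous) blast
    then show "bounded (range (\<lambda>x. complex_of_real (x ^ k) * D 0 n t x))"
      using z[of t _ n] by (intro compact_support_bounded[of _ "- R" R] continuous_intros) force+
  qed
  moreover have cont: "continuous_on UNIV (\<lambda>p. D 0 j (fst p) (snd p))" for j
    using D(2)[of 0 j] by (simp add: split_beta')
  moreover have "\<exists>M. \<forall>t x. cmod (D 0 j t x) \<le> M" for j
  proof -
    have "bounded ((\<lambda>p. D 0 j (fst p) (snd p)) ` ({- R..R} \<times> {- R..R}))"
      by (intro compact_imp_bounded compact_continuous_image continuous_on_subset[OF cont] compact_Times) auto
    then obtain M where M: "\<And>t x. \<bar>t\<bar> \<le> R \<Longrightarrow> \<bar>x\<bar> \<le> R \<Longrightarrow> cmod (D 0 j t x) \<le> M"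
      by (force simp: bounded_iff abs_le_iff)
    have "cmod (D 0 j t x) \<le> max M 0" for t x
      using M[of t x] z[of t x j] by (cases "\<bar>t\<bar> \<le> R \<and> \<bar>x\<bar> \<le> R") auto
    then show ?thesis by blast
  qed
  then obtain M0 M1 where "\<And>t x. cmod (D 0 0 t x) \<le> M0" "\<And>t x. cmod (D 0 1 t x) \<le> M1" by metis
  then have "\<And>t x. cmod (v t x) \<le> max M0 M1" "\<And>t x. cmod (vderiv (v t) x) \<le> max M0 M1"
    by (auto simp: vd D(1) intro: max.coboundedI1 max.coboundedI2)
  moreover from this have "0 \<le> max M0 M1" using norm_ge_zero order_trans by blast
  moreover have "v t x = 0 \<and> vderiv (v t) x = 0" if "\<bar>t\<bar> > R \<or> \<bar>x\<bar> > R" for t x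
    using z[OF that, of 0] z[OF that, of 1] by (simp add: vd D(1))
  ultimately show ?thesis using that[of "max M0 M1" R] cont[of 0] by (simp add: D(1))
qed

lemma Cc_infinity_schwartz: "v \<in> Cc_infinity \<Longrightarrow> v t \<in> schwartz"
  using Cc_infinity_D by metis

lemma Cc_infinity_lincomb:
  assumes "v \<in> Cc_infinity" "w \<in> Cc_infinity"
  shows "(\<lambda>t x. c * v t x + d * w t x) \<in> Cc_infinity"
proof -
  obtain D R where D: "D 0 0 = v" "\<And>i j. continuous_on UNIV (\<lambda>(t, x). D i j t x)"
     "\<And>i j t x. ((\<lambda>\<tau>. D i j \<tau> x) has_vector_derivative D (Suc i) j t x) (at t)"
     "\<And>i j t x. (D i j t has_vector_derivative D i (Suc j) t x) (at x)"
    and R: "\<And>t x. v t x \<noteq> 0 \<Longrightarrow> \<bar>t\<bar> \<le> R \<and> \<bar>x\<bar> \<le> R"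
    using assms(1) unfolding Cc_infinity_def by blast
  obtain E Q where E: "E 0 0 = w" "\<And>i j. continuous_on UNIV (\<lambda>(t, x). E i j t x)"
     "\<And>i j t x. ((\<lambda>\<tau>. E i j \<tau> x) has_vector_derivative E (Suc i) j t x) (at t)"
     "\<And>i j t x. (E i j t has_vector_derivative E i (Suc j) t x) (at x)"
    and Q: "\<And>t x. w t x \<noteq> 0 \<Longrightarrow> \<bar>t\<bar> \<le> Q \<and> \<bar>x\<bar> \<le> Q"
    using assms(2) unfolding Cc_infinity_def by blast
  show ?thesis
    unfolding Cc_infinity_def
  proof (intro CollectI conjI exI[of _ "\<lambda>i j t x. c * D i j t x + d * E i j t x"] exI[of _ "max R Q"] allI impI)
    fix i j t x
    show "continuous_on UNIV (\<lambda>(t, x). c * D i j t x + d * E i j t x)"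
      using D(2)[of i j] E(2)[of i j] unfolding split_beta' by (intro continuous_intros)
    show "((\<lambda>\<tau>. c * D i j \<tau> x + d * E i j \<tau> x) has_vector_derivative c * D (Suc i) j t x + d * E (Suc i) j t x) (at t)"
      by (intro derivative_intros D E)
    show "((\<lambda>x. c * D i j t x + d * E i j t x) has_vector_derivative c * D i (Suc j) t x + d * E i (Suc j) t x) (at x)"
      by (intro derivative_intros D E)
  next
    fix t x assume "c * v t x + d * w t x \<noteq> 0"
    then have "v t x \<noteq> 0 \<or> w t x \<noteq> 0" by auto
    then show "\<bar>t\<bar> \<le> max R Q" "\<bar>x\<bar> \<le> max R Q" using R[of t x] Q[of t x] by auto
  qed (simp add: D E)
qed

lemma Cc_infinity_tensor:
  assumes p: "p \<in> schwartz" "\<And>t. p t \<noteq> 0 \<Longrightarrow> \<bar>t\<bar> \<le> R" and q: "q \<in> schwartz" "\<And>x. q x \<noteq> 0 \<Longrightarrow> \<bar>x\<bar> \<le> Q"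
  shows "(\<lambda>t x. p t * q x) \<in> Cc_infinity"
proof -
  have S: "(vderiv ^^ i) f \<in> schwartz" if "f \<in> schwartz" for f i
    by (induction i) (auto simp: that intro: schwartz_vderiv)
  have d: "((vderiv ^^ i) f has_vector_derivative (vderiv ^^ Suc i) f x) (at x)" if "f \<in> schwartz" for f i x
    using schwartz_vderiv(1)[OF S[OF that, of i]] by simp
  show ?thesis
    unfolding Cc_infinity_def
  proof (intro CollectI conjI exI[of _ "\<lambda>i j t x. (vderiv ^^ i) p t * (vderiv ^^ j) q x"] exI[of _ "max R Q"] allI impI)
    fix i j t x
    show "continuous_on UNIV (\<lambda>(t, x). (vderiv ^^ i) p t * (vderiv ^^ j) q x)"
      unfolding split_beta'
      by (intro continuous_on_mult continuous_on_compose2[OF schwartz_continuous[OF S[OF p(1)], of UNIV]]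
          continuous_on_compose2[OF schwartz_continuous[OF S[OF q(1)], of UNIV]] continuous_intros) auto
    show "((\<lambda>\<tau>. (vderiv ^^ i) p \<tau> * (vderiv ^^ j) q x) has_vector_derivative (vderiv ^^ Suc i) p t * (vderiv ^^ j) q x) (at t)"
      by (intro has_vector_derivative_mult_left d p)
    show "((\<lambda>x. (vderiv ^^ i) p t * (vderiv ^^ j) q x) has_vector_derivative (vderiv ^^ i) p t * (vderiv ^^ Suc j) q x) (at x)"
      by (intro has_vector_derivative_mult_right d q)
  next
    fix t x assume "p t * q x \<noteq> 0"
    then show "\<bar>t\<bar> \<le> max R Q" "\<bar>x\<bar> \<le> max R Q" using p(2)[of t] q(2)[of x] by auto
  qed simp
qed

lemma Cc_infinity_shift:
  assumes "v \<in> Cc_infinity"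
  shows "(\<lambda>t. v (t + s)) \<in> Cc_infinity"
proof -
  obtain D R where D: "D 0 0 = v" "\<And>i j. continuous_on UNIV (\<lambda>(t, x). D i j t x)"
     "\<And>i j t x. ((\<lambda>\<tau>. D i j \<tau> x) has_vector_derivative D (Suc i) j t x) (at t)"
     "\<And>i j t x. (D i j t has_vector_derivative D i (Suc j) t x) (at x)"
    and R: "\<And>t x. v t x \<noteq> 0 \<Longrightarrow> \<bar>t\<bar> \<le> R \<and> \<bar>x\<bar> \<le> R"
    using assms(1) unfolding Cc_infinity_def by blast
  show ?thesis
    unfolding Cc_infinity_def
  proof (intro CollectI conjI exI[of _ "\<lambda>i j t x. D i j (t + s) x"] exI[of _ "R + \<bar>s\<bar>"] allI impI)
    fix i j t x
    have "continuous_on UNIV ((\<lambda>(t, x). D i j t x) \<circ> (\<lambda>p. (fst p + s, snd p)))"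
      by (intro continuous_on_compose continuous_intros continuous_on_subset[OF D(2)]) auto
    then show "continuous_on UNIV (\<lambda>(t, x). D i j (t + s) x)" by (simp add: comp_def split_beta')
    have "((\<lambda>\<tau>. \<tau> + s) has_vector_derivative 1) (at t)" by (auto intro!: derivative_eq_intros)
    from vector_diff_chain_at[OF this D(3)]
    show "((\<lambda>\<tau>. D i j (\<tau> + s) x) has_vector_derivative D (Suc i) j (t + s) x) (at t)" by (simp add: comp_def)
    show "(D i j (t + s) has_vector_derivative D i (Suc j) (t + s) x) (at x)" by (rule D)
  next
    fix t x assume "v (t + s) x \<noteq> 0"
    then show "\<bar>t\<bar> \<le> R + \<bar>s\<bar>" "\<bar>x\<bar> \<le> R + \<bar>s\<bar>" using R[of "t + s" x] by auto
  qed (simp add: D)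
qed

lemma Cc_fourier_measurable:
  assumes "v \<in> Cc_infinity"
  shows "(\<lambda>p. fourier (v (fst p)) (snd p)) \<in> borel_measurable borel"
proof -
  have "continuous_on UNIV (\<lambda>p. v (fst p) (snd p))" using Cc_infinity_D[OF assms] by metis
  then have vm: "(\<lambda>p. v (fst p) (snd p)) \<in> borel_measurable borel" by (rule borel_measurable_continuous_onI)
  have "(\<lambda>z. (fst (fst z), snd z)) \<in> (borel :: (real \<times> real) measure) \<Otimes>\<^sub>M lborel \<rightarrow>\<^sub>M (borel :: (real \<times> real) measure)"
    unfolding borel_prod[symmetric] by measurable
  from measurable_compose[OF this vm]
  have [measurable]: "(\<lambda>z. v (fst (fst z)) (snd z)) \<in> borel_measurable ((borel :: (real \<times> real) measure) \<Otimes>\<^sub>M lborel)" by simp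
  have [measurable]: "snd \<in> borel_measurable (borel :: (real \<times> real) measure)"
    by (intro borel_measurable_continuous_onI continuous_intros)
  have "(\<lambda>p. LINT x|lborel. v (fst p) x * cis (- (snd p * x))) \<in> borel_measurable (borel :: (real \<times> real) measure)"
    by (rule lborel.borel_measurable_lebesgue_integral) (simp add: split_beta')
  then show ?thesis unfolding fourier_def by measurable
qed

text \<open>The constant \<open>M\<close> on \<open>[- R, R]\<close> dominates every slice of
  \<open>v\<close> and its spatial derivative, so the slices have a common bound in the Sobolev
  norm, and the time interval has finite length.\<close>

lemma Cc_strip_fourier:
  assumes v: "v \<in> Cc_infinity" and s: "s \<le> 1"
  shows "strip_fourier s a b (\<lambda>t. distr_of (v t)) (\<lambda>p. fourier (v (fst p)) (snd p))"
proof -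
  let ?w = "\<lambda>p. fourier (v (fst p)) (snd p)"
  have [measurable]: "?w \<in> borel_measurable borel" by (rule Cc_fourier_measurable[OF v])
  obtain M R where M: "0 \<le> M" "\<And>t x. cmod (v t x) \<le> M" "\<And>t x. cmod (vderiv (v t) x) \<le> M"
    and R: "\<And>t x. \<bar>t\<bar> > R \<or> \<bar>x\<bar> > R \<Longrightarrow> v t x = 0 \<and> vderiv (v t) x = 0" using Cc_infinity_D[OF v] by metis
  note S = Cc_infinity_schwartz[OF v]
  let ?B = "\<lambda>x::real. complex_of_real M * indicator {- R..R} x"
  have B: "sqint lborel ?B" by (intro sqint_cmult sqint_indicator) (auto simp: emeasure_lborel_Icc_eq)
  define K where "K = 2 * l2norm lborel ?B"
  have le: "l2norm lborel h \<le> l2norm lborel ?B"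
    if "h \<in> schwartz" "\<And>x. cmod (h x) \<le> M" "\<And>x. \<bar>x\<bar> > R \<Longrightarrow> h x = 0" for h
  proof (rule l2norm_mono[OF B], use schwartz_measurable[OF that(1)] in simp, rule AE_I2)
    fix x show "cmod (h x) \<le> cmod (?B x)"
      using that(2)[of x] that(3)[of x] M(1) by (cases "\<bar>x\<bar> > R") (auto simp: indicator_def norm_mult)
  qed
  have le: "l2norm lborel (v t) \<le> l2norm lborel ?B" "l2norm lborel (vderiv (v t)) \<le> l2norm lborel ?B" for t
    using M R[of t] by (auto intro!: le S schwartz_vderiv)
  have slice: "l2norm (freq_measure s) (fourier (v t)) \<le> K" for t
    using fourier_freq_le[OF S s, of t] le[of t] unfolding K_def by linarith
  let ?f = "\<lambda>p. indicator {a..b} (fst p) * (1 + (snd p)\<^sup>2) powr s * (cmod (?w p))\<^sup>2"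
  have fm: "?f \<in> borel_measurable borel" by measurable
  have "integrable (lborel \<Otimes>\<^sub>M lborel) ?f"
  proof (rule lborel_pair.Fubini_integrable)
    show fm': "?f \<in> borel_measurable (lborel \<Otimes>\<^sub>M lborel)" using fm by (simp add: borel_prod[symmetric] cong: measurable_cong_sets)
    have eq: "(LINT y|lborel. norm (?f (t, y))) = indicator {a..b} t * (l2norm (freq_measure s) (fourier (v t)))\<^sup>2" for t
      using schwartz_measurable[OF schwartz_fourier[OF S[of t]]]
      by (simp add: l2norm_freq indicator_def)
    show "integrable lborel (\<lambda>t. LINT y|lborel. norm (?f (t, y)))"
    proof (rule Bochner_Integration.integrable_bound)
      show "integrable lborel (\<lambda>t. indicator {a..b} t * K\<^sup>2)"
        by (intro integrable_mult_left integrable_real_indicator) (auto simp: emeasure_lborel_Icc_eq)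
      show "(\<lambda>t. LINT y|lborel. norm (?f (t, y))) \<in> borel_measurable lborel"
        by (rule lborel.borel_measurable_lebesgue_integral) (use fm' in simp)
      show "AE t in lborel. norm (LINT y|lborel. norm (?f (t, y))) \<le> norm (indicator {a..b} t * K\<^sup>2)"
        unfolding eq using slice by (auto simp: indicator_def intro!: power_mono l2norm_nonneg)
    qed
    show "AE t in lborel. integrable lborel (\<lambda>y. ?f (t, y))"
      using schwartz_freq(1)[OF schwartz_fourier[OF S] s] by (auto simp: sqint_freq_iff mult.assoc)
  qed
  then have "sqint (strip_measure s a b) ?w" by (simp add: sqint_strip_iff lborel_prod)
  then show ?thesis using has_fourier_schwartz[OF S] by (simp add: strip_fourier_def)
qed

lemma emeasure_freq_interval_finite:
  assumes s: "s \<le> 1"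
  shows "emeasure (freq_measure s) {c<..<d} < \<infinity>"
proof -
  let ?K = "1 + (\<bar>c\<bar> + \<bar>d\<bar>)\<^sup>2"
  have "emeasure (freq_measure s) {c<..<d} = (\<integral>\<^sup>+\<xi>. ennreal ((1 + \<xi>\<^sup>2) powr s) * indicator {c<..<d} \<xi> \<partial>lborel)"
    unfolding freq_measure_def by (rule emeasure_density) auto
  also have "\<dots> \<le> (\<integral>\<^sup>+\<xi>. ennreal ?K * indicator {c..d} \<xi> \<partial>lborel)"
  proof (intro nn_integral_mono)
    fix \<xi> :: real
    have "(1 + \<xi>\<^sup>2) powr s \<le> ?K" if "c < \<xi>" "\<xi> < d"
    proof -
      have "\<bar>\<xi>\<bar> \<le> \<bar>c\<bar> + \<bar>d\<bar>" using that by linarith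
      then have "\<xi>\<^sup>2 \<le> (\<bar>c\<bar> + \<bar>d\<bar>)\<^sup>2" by (metis abs_ge_zero power2_abs power_mono)
      then show ?thesis using powr_le_one_plus_square[OF s, of \<xi>] by linarith
    qed
    then show "ennreal ((1 + \<xi>\<^sup>2) powr s) * indicator {c<..<d} \<xi> \<le> ennreal ?K * indicator {c..d} \<xi>"
      by (cases "c < \<xi> \<and> \<xi> < d") (auto simp: indicator_def ennreal_leI simp del: ennreal_plus)
  qed
  also have "\<dots> = ennreal ?K * emeasure lborel {c..d}" by (rule nn_integral_cmult_indicator) simp
  also have "\<dots> < \<infinity>" by (auto simp: ennreal_mult_less_top emeasure_lborel_Icc_eq)
  finally show ?thesis .
qed

text \<open>A bump in frequency approximates the indicator, but its inverse transform
  \<open>\<psi>\<close> need not have compact support. Truncating \<open>\<psi>\<close> by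
  \<open>cutoff\<close> restores that at a small cost in the norms of function and derivative, hence
  in the weighted norm of the transform.\<close>

lemma indicator_fourier_approx:
  assumes s: "s \<le> 1" and e: "0 < e"
  obtains q Q where "q \<in> schwartz" "\<And>x. q x \<noteq> 0 \<Longrightarrow> \<bar>x\<bar> \<le> Q"
    "l2norm (freq_measure s) (\<lambda>\<xi>. indicator (box c d) \<xi> - fourier q \<xi>) < e"
proof -
  note fin = emeasure_freq_interval_finite[OF s, of c d]
  let ?M = "freq_measure s"
  have I: "sqint ?M (indicator (box c d))" using fin by (intro sqint_indicator) (auto simp: sets_freq_measure)
  have "eventually (\<lambda>n. l2norm ?M (\<lambda>x. bump (real (Suc n)) c d x - indicator (box c d) x) < e / 2) sequentially"
    using e by (intro order_tendstoD[OF bump_l2norm_tendsto] sets_freq_measure fin) auto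
  then obtain n where n: "l2norm ?M (\<lambda>x. bump (real (Suc n)) c d x - indicator (box c d) x) < e / 2"
    by (auto simp: eventually_sequentially)
  have b: "bump (real (Suc n)) c d \<in> schwartz" by (rule bump_schwartz) simp
  then obtain \<psi> where \<psi>: "\<psi> \<in> schwartz" "fourier \<psi> = bump (real (Suc n)) c d" using fourier_surj by metis
  have "(\<lambda>m. l2norm lborel (\<lambda>x. \<psi> x * cutoff m x - \<psi> x) + l2norm lborel (vderiv (\<lambda>x. \<psi> x * cutoff m x - \<psi> x))) \<longlonglongrightarrow> 0 + 0"
    by (intro tendsto_add cutoff_approx \<psi>)
  then have "eventually (\<lambda>m. l2norm lborel (\<lambda>x. \<psi> x * cutoff m x - \<psi> x) + l2norm lborel (vderiv (\<lambda>x. \<psi> x * cutoff m x - \<psi> x)) < e / 2) sequentially"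
    by (rule order_tendstoD) (use e in auto)
  then obtain m where m: "l2norm lborel (\<lambda>x. \<psi> x * cutoff m x - \<psi> x) + l2norm lborel (vderiv (\<lambda>x. \<psi> x * cutoff m x - \<psi> x)) < e / 2"
    by (auto simp: eventually_sequentially)
  let ?q = "\<lambda>x. \<psi> x * cutoff m x"
  have q: "?q \<in> schwartz" by (intro schwartz_mult \<psi> cutoff_schwartz)
  have "l2norm ?M (fourier (\<lambda>x. ?q x - \<psi> x)) < e / 2"
    using fourier_freq_le[OF schwartz_diff[OF q \<psi>(1)] s] m by linarith
  moreover have "fourier (\<lambda>x. ?q x - \<psi> x) = (\<lambda>\<xi>. fourier ?q \<xi> - fourier \<psi> \<xi>)"
    using fourier_diff[OF schwartz_integrable[OF q] schwartz_integrable[OF \<psi>(1)]] by auto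
  ultimately have 2: "l2norm ?M (\<lambda>\<xi>. fourier \<psi> \<xi> - fourier ?q \<xi>) < e / 2" by (simp add: l2norm_minus_commute[of ?M "fourier \<psi>"])
  have "l2norm ?M (\<lambda>\<xi>. indicator (box c d) \<xi> - fourier ?q \<xi>) \<le>
     l2norm ?M (\<lambda>\<xi>. indicator (box c d) \<xi> - fourier \<psi> \<xi>) + l2norm ?M (\<lambda>\<xi>. fourier \<psi> \<xi> - fourier ?q \<xi>)"
    by (intro l2norm_diff_triangle I schwartz_freq(1)[OF _ s] schwartz_fourier q \<psi>)
  also have "\<dots> < e" using n 2 by (simp add: \<psi>(2) l2norm_minus_commute[of ?M "indicator _"])
  finally have lt: "l2norm ?M (\<lambda>\<xi>. indicator (box c d) \<xi> - fourier ?q \<xi>) < e" .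
  have "\<bar>x\<bar> \<le> real m" if "?q x \<noteq> 0" for x
    using that cutoff_outside[of m x] by (cases "\<bar>x\<bar> \<le> real m") auto
  from that[OF q this lt] show ?thesis .
qed

lemma time_l2_le: "sqint lborel p \<Longrightarrow> time_l2 a b p \<le> l2norm lborel p"
  unfolding time_l2_def
  by (intro l2norm_mono) (auto simp: sqint_def norm_mult indicator_def)

lemma fourier_Cc_lincomb:
  assumes "v \<in> Cc_infinity" "w \<in> Cc_infinity"
  shows "fourier (\<lambda>x. c * v t x + d * w t x) \<xi> = c * fourier (v t) \<xi> + d * fourier (w t) \<xi>"
  by (intro fourier_lincomb schwartz_integrable Cc_infinity_schwartz assms)

text \<open>On the Fourier side it is enough to approximate the indicator of a rectangle. A bump in
  time handles one edge, the transform of a compactly supported \<open>q\<close> the other, and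
  their product is the transform of a tensor product in \<open>Cc_infinity\<close>.\<close>

theorem Cc_infinity_dense:
  assumes V: "V \<in> L2Hs s a b" and s: "s \<le> 1"
  obtains X where "\<And>k. X k \<in> Cc_infinity"
    "(\<lambda>k. L2Hs_norm s a b (\<lambda>\<tau> \<phi>. distr_of (X k \<tau>) \<phi> - V \<tau> \<phi>)) \<longlonglongrightarrow> 0"
proof -
  let ?M = "strip_measure s a b"
  let ?F = "\<lambda>v p. fourier (v (fst p)) (snd p)"
  let ?D = "?F ` Cc_infinity"
  obtain w where w: "strip_fourier s a b V w" using V by (auto simp: L2Hs_iff)
  have indf: "sqint (freq_measure s) (indicator (box c d))" for c d
    using emeasure_freq_interval_finite[OF s, of c d] by (intro sqint_indicator) (auto simp: sets_freq_measure)
  have split: "indicator (box c d) p = (indicator (box (fst c) (fst d)) (fst p) * indicator (box (snd c) (snd d)) (snd p) :: complex)"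
    for c d p :: "real \<times> real"
    by (cases c; cases d; cases p) (auto simp: indicator_def mem_box Basis_prod_def)
  have indM: "sqint ?M (indicator (box c d))" for c d
    unfolding split[abs_def] by (rule sqint_strip_tensor[where B = 1, OF _ _ indf]) (auto simp: indicator_def)
  have app: "\<exists>g\<in>?D. l2norm ?M (\<lambda>p. w p - g p) < e" if "0 < e" for e
  proof (rule sqint_dense_induct[OF sets_strip_measure])
    fix c d :: "real \<times> real"
    have "integrable ?M (\<lambda>p. (cmod (indicator (box c d) p))\<^sup>2)" using indM by (simp add: sqint_def)
    moreover have "(\<lambda>p. (cmod (indicator (box c d) p))\<^sup>2) = indicat_real (box c d)" by (auto simp: indicator_def)
    ultimately have "emeasure ?M (box c d \<inter> space ?M) < \<infinity>" by (simp add: integrable_indicator_iff)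
    then show "emeasure ?M (box c d) < \<infinity>"
      using sets_eq_imp_space_eq[OF sets_strip_measure, of s a b] by simp
  next
    fix f assume "f \<in> ?D"
    then show "sqint ?M f" using Cc_strip_fourier[OF _ s] by (auto simp: strip_fourier_def)
  next
    fix f g assume "f \<in> ?D" "g \<in> ?D"
    then obtain v u where vu: "v \<in> Cc_infinity" "u \<in> Cc_infinity" "f = ?F v" "g = ?F u" by blast
    then have "(\<lambda>x. f x + g x) = ?F (\<lambda>t x. 1 * v t x + 1 * u t x)" using fourier_Cc_lincomb[OF vu(1,2), of 1 _ 1] by simp
    then show "(\<lambda>x. f x + g x) \<in> ?D" by (rule image_eqI[OF _ Cc_infinity_lincomb[OF vu(1,2)]])
  next
    fix f c assume "f \<in> ?D"
    then obtain v where v: "v \<in> Cc_infinity" "f = ?F v" by blast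
    then have "(\<lambda>x. c * f x) = ?F (\<lambda>t x. c * v t x + 0 * v t x)" using fourier_Cc_lincomb[OF v(1) v(1), of c _ 0] by simp
    then show "(\<lambda>x. c * f x) \<in> ?D" by (rule image_eqI[OF _ Cc_infinity_lincomb[OF v(1) v(1)]])
  next
    fix c d :: "real \<times> real" and e :: real
    assume e: "0 < e"
    let ?I = "indicator (box (fst c) (fst d)) :: real \<Rightarrow> complex" and ?J = "indicator (box (snd c) (snd d)) :: real \<Rightarrow> complex"
    let ?j = "l2norm (freq_measure s) ?J"
    have I: "sqint lborel ?I" by (rule sqint_indicator[OF _ emeasure_lborel_box_finite]) simp
    \<comment> \<open>The time bump is chosen against the norm of \<open>?J\<close>; its own norm
      then sets the tolerance for \<open>q\<close>. The added 1 in both tolerances guards against a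
      vanishing norm.\<close>
    have e1: "0 < e / (2 * (?j + 1))" using e l2norm_nonneg[of "freq_measure s" ?J] by (simp add: add_nonneg_pos)
    have "eventually (\<lambda>n. l2norm lborel (\<lambda>x. bump (real (Suc n)) (fst c) (fst d) x - ?I x) < e / (2 * (?j + 1))) sequentially"
      by (rule order_tendstoD[OF bump_l2norm_tendsto _])
         (use e1 emeasure_lborel_box_finite[of "fst c" "fst d"] in \<open>auto simp: box_real\<close>)
    then obtain n where n: "l2norm lborel (\<lambda>x. bump (real (Suc n)) (fst c) (fst d) x - ?I x) < e / (2 * (?j + 1))"
      by (auto simp: eventually_sequentially)
    let ?b = "bump (real (Suc n)) (fst c) (fst d)"
    have b: "?b \<in> schwartz" by (rule bump_schwartz) simp
    have t0: "0 \<le> time_l2 a b ?b" by (simp only: time_l2_def l2norm_nonneg)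
    then have e2: "0 < e / (2 * (time_l2 a b ?b + 1))"
      using e by (intro divide_pos_pos mult_pos_pos add_nonneg_pos) auto
    obtain q Q where q: "q \<in> schwartz" "\<And>x. q x \<noteq> 0 \<Longrightarrow> \<bar>x\<bar> \<le> Q"
      "l2norm (freq_measure s) (\<lambda>\<xi>. ?J \<xi> - fourier q \<xi>) < e / (2 * (time_l2 a b ?b + 1))"
      using indicator_fourier_approx[OF s e2] by metis
    let ?v = "\<lambda>t x. ?b t * q x"
    have v: "?v \<in> Cc_infinity"
    proof (rule Cc_infinity_tensor[OF b _ q(1,2)])
      fix t assume "?b t \<noteq> 0"
      then have "t \<in> {fst c<..<fst d}" using bump_outside[of "real (Suc n)" t "fst c" "fst d"] by fastforce
      then show "\<bar>t\<bar> \<le> \<bar>fst c\<bar> + \<bar>fst d\<bar>" by auto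
    qed
    have Fv: "fourier (\<lambda>x. ?b t * q x) \<xi> = ?b t * fourier q \<xi>" for t \<xi>
      by (rule fourier_cmult[OF schwartz_integrable[OF q(1)]])
    note bm = schwartz_measurable[OF b]
    have sJ: "sqint (freq_measure s) (\<lambda>\<xi>. ?J \<xi> - fourier q \<xi>)"
      by (intro sqint_diff indf schwartz_freq(1)[OF _ s] schwartz_fourier q)
    have im: "(\<lambda>t. ?I t - ?b t) \<in> borel_measurable borel" using bm by measurable
    have ib: "cmod (?I t - ?b t) \<le> 2" for t
      using norm_triangle_ineq4[of "?I t" "?b t"] bump_le_1[of "real (Suc n)" "fst c" "fst d" t] by (auto simp: indicator_def)
    \<comment> \<open>The error of a product of two approximations is split as
      \<open>(I - b) J + b (J - q')\<close>, with \<open>q'\<close> the transform of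
      \<open>q\<close>; each part is a tensor product whose norm factorizes.\<close>
    have "l2norm ?M (\<lambda>p. indicator (box c d) p - ?F ?v p) =
      l2norm ?M (\<lambda>p. (?I (fst p) - ?b (fst p)) * ?J (snd p) + ?b (fst p) * (?J (snd p) - fourier q (snd p)))"
      by (simp only: Fv split) (simp add: algebra_simps)
    also have "\<dots> \<le> l2norm ?M (\<lambda>p. (?I (fst p) - ?b (fst p)) * ?J (snd p)) + l2norm ?M (\<lambda>p. ?b (fst p) * (?J (snd p) - fourier q (snd p)))"
      by (intro l2norm_triangle sqint_strip_tensor[OF im ib indf] sqint_strip_tensor[OF bm bump_le_1 sJ])
    also have "\<dots> = time_l2 a b (\<lambda>t. ?I t - ?b t) * ?j + time_l2 a b ?b * l2norm (freq_measure s) (\<lambda>\<xi>. ?J \<xi> - fourier q \<xi>)"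
      by (simp only: l2norm_strip_tensor[OF im ib indf] l2norm_strip_tensor[OF bm bump_le_1 sJ])
    also have "\<dots> < e"
    proof -
      have "time_l2 a b (\<lambda>t. ?I t - ?b t) \<le> l2norm lborel (\<lambda>t. ?I t - ?b t)"
        by (intro time_l2_le sqint_diff I schwartz_sqint b)
      also have "\<dots> < e / (2 * (?j + 1))" using n by (subst l2norm_minus_commute)
      finally have "time_l2 a b (\<lambda>t. ?I t - ?b t) * (2 * (?j + 1)) < e"
        using l2norm_nonneg[of "freq_measure s" ?J] by (simp add: pos_less_divide_eq add_nonneg_pos)
      moreover have "0 \<le> time_l2 a b (\<lambda>t. ?I t - ?b t)" "0 \<le> time_l2 a b ?b" by (simp_all add: time_l2_def l2norm_nonneg)
      moreover have "l2norm (freq_measure s) (\<lambda>\<xi>. ?J \<xi> - fourier q \<xi>) * (2 * (time_l2 a b ?b + 1)) < e"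
        using q(3) calculation by (simp add: pos_less_divide_eq add_nonneg_pos)
      moreover have "0 \<le> l2norm (freq_measure s) (\<lambda>\<xi>. ?J \<xi> - fourier q \<xi>)" by (rule l2norm_nonneg)
      ultimately show ?thesis by (simp add: algebra_simps)
    qed
    finally show "\<exists>g\<in>?D. l2norm ?M (\<lambda>p. indicator (box c d) p - g p) < e"
      using v by (intro bexI[of _ "?F ?v"] imageI)
  next
    show "sqint ?M w" using w by (simp add: strip_fourier_def)
  qed fact
  have "\<exists>v\<in>Cc_infinity. l2norm ?M (\<lambda>p. w p - ?F v p) < 1 / real (Suc k)" for k
    using app[of "1 / real (Suc k)"] by auto
  then obtain X where X: "\<And>k. X k \<in> Cc_infinity" "\<And>k. l2norm ?M (\<lambda>p. w p - ?F (X k) p) < 1 / real (Suc k)" by metis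
  have eq: "L2Hs_norm s a b (\<lambda>\<tau> \<phi>. distr_of (X k \<tau>) \<phi> - V \<tau> \<phi>) = l2norm ?M (\<lambda>p. w p - ?F (X k) p)" for k
    using L2Hs_norm_eq[OF strip_fourier_diff[OF Cc_strip_fourier[OF X(1) s] w]] by (simp add: l2norm_minus_commute[of ?M w])
  have "(\<lambda>k. L2Hs_norm s a b (\<lambda>\<tau> \<phi>. distr_of (X k \<tau>) \<phi> - V \<tau> \<phi>)) \<longlonglongrightarrow> 0"
  proof (rule Lim_null_comparison[OF always_eventually LIMSEQ_Suc[OF lim_1_over_n]], intro allI)
    fix k
    show "norm (L2Hs_norm s a b (\<lambda>\<tau> \<phi>. distr_of (X k \<tau>) \<phi> - V \<tau> \<phi>)) \<le> 1 / real (Suc k)"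
      unfolding eq using X(2)[of k] by (simp add: l2norm_nonneg)
  qed
  with X(1) that show ?thesis by blast
qed

section \<open>The Dyson operators\<close>

text \<open>The potential in the interaction picture, with the adjoint of the free propagator
  written as its inverse.\<close>

definition dyson_op :: "(real \<Rightarrow> real \<Rightarrow> complex) \<Rightarrow> real \<Rightarrow> L2 \<Rightarrow> L2" where
  "dyson_op v \<tau> g = free_prop (- \<tau>) (mult_op (v \<tau>) (free_prop \<tau> g))"

lemma W_smooth_Cons:
  "W_smooth (v # vs) t s f = mult_op (\<lambda>x. - \<i>) (integral {s..t} (\<lambda>\<tau>. dyson_op v \<tau> (W_smooth vs \<tau> s f)))"
  by (simp add: dyson_op_def adjoint_free_prop)

declare W_smooth.simps(2) [simp del]

lemma bounded_linear_mult_op_const: "bounded_linear (mult_op (\<lambda>x. c))"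
  by (rule bounded_linear_mult_op[of _ "cmod c"]) auto

lemma Cc_infinity_bound:
  assumes "v \<in> Cc_infinity"
  obtains M where "\<And>t x. cmod (v t x) \<le> M"
  using Cc_infinity_D[OF assms] by metis

lemma Cc_infinity_measurable: "v \<in> Cc_infinity \<Longrightarrow> v t \<in> borel_measurable borel"
  by (rule schwartz_measurable[OF Cc_infinity_schwartz])

lemma bounded_linear_mult_op_Cc:
  assumes "v \<in> Cc_infinity" shows "bounded_linear (mult_op (v t))"
proof -
  obtain M where "\<And>t x. cmod (v t x) \<le> M" using Cc_infinity_bound[OF assms] by metis
  then show ?thesis using Cc_infinity_measurable[OF assms] by (intro bounded_linear_mult_op[of _ M])
qed

lemma bounded_linear_dyson_op:
  assumes "v \<in> Cc_infinity" shows "bounded_linear (dyson_op v t)"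
  unfolding dyson_op_def
  by (intro bounded_linear_compose[OF bounded_linear_free_prop]
      bounded_linear_compose[OF bounded_linear_mult_op_Cc[OF assms]] bounded_linear_free_prop)

lemma continuous_mult_op_Cc:
  assumes v: "v \<in> Cc_infinity" shows "continuous_on UNIV (\<lambda>t. mult_op (v t) f)"
  unfolding continuous_on_sequentially
proof (intro allI ballI impI, elim conjE)
  fix T :: "nat \<Rightarrow> real" and t assume T: "T \<longlonglongrightarrow> t"
  obtain M where M: "\<And>t x. cmod (v t x) \<le> M" using Cc_infinity_bound[OF v] by metis
  have cont: "continuous_on UNIV (\<lambda>p. v (fst p) (snd p))" using Cc_infinity_D[OF v] by metis
  have [measurable]: "v t \<in> borel_measurable borel" for t by (rule Cc_infinity_measurable[OF v])
  have "(\<lambda>n. l2norm lborel (\<lambda>x. v (T n) x * rep_L2 f x - v t x * rep_L2 f x)) \<longlonglongrightarrow> 0"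
  proof (rule l2norm_dominated(2)[OF _ _ sqint_cmult[OF sqint_rep_L2[of f], of "of_real M"]])
    show "AE x in lborel. cmod (v (T n) x * rep_L2 f x) \<le> cmod (complex_of_real M * rep_L2 f x)" for n
      unfolding norm_mult by (intro AE_I2 mult_right_mono order_trans[OF M]) auto
    have "(\<lambda>n. v (T n) x) \<longlonglongrightarrow> v t x" for x
    proof -
      have "isCont (\<lambda>p. v (fst p) (snd p)) (t, x)" using cont by (simp add: continuous_on_eq_continuous_at)
      moreover have "(\<lambda>n. (T n, x)) \<longlonglongrightarrow> (t, x)" by (intro tendsto_intros T)
      ultimately show ?thesis using isCont_tendsto_compose by fastforce
    qed
    then show "AE x in lborel. (\<lambda>n. v (T n) x * rep_L2 f x) \<longlonglongrightarrow> v t x * rep_L2 f x"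
      by (intro AE_I2 tendsto_mult tendsto_const)
  qed measurable
  moreover have "norm (mult_op (v (T n)) f - mult_op (v t) f) = l2norm lborel (\<lambda>x. v (T n) x * rep_L2 f x - v t x * rep_L2 f x)" for n
    unfolding mult_op_def by (rule norm_abs_diff_L2) (rule rep_mult_op(2)[OF _ M]; measurable)+
  ultimately have "(\<lambda>n. norm (mult_op (v (T n)) f - mult_op (v t) f)) \<longlonglongrightarrow> 0" by simp
  then have "(\<lambda>n. mult_op (v (T n)) f) \<longlonglongrightarrow> mult_op (v t) f" using LIM_zero_cancel tendsto_norm_zero_iff by blast
  then show "((\<lambda>t. mult_op (v t) f) \<circ> T) \<longlonglongrightarrow> mult_op (v t) f" by (simp add: comp_def)
qed

lemma continuous_dyson_op:
  assumes v: "v \<in> Cc_infinity" and g: "continuous_on A g"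
  shows "continuous_on A (\<lambda>t. dyson_op v t (g t))"
proof -
  obtain M where M: "\<And>t x. cmod (v t x) \<le> M" using Cc_infinity_bound[OF v] by metis
  have fp: "continuous_on A (\<lambda>t. free_prop t (h t))" if "continuous_on A h" for h :: "real \<Rightarrow> L2" and A
    by (rule continuous_on_operator_family[where K = 1, OF bounded_linear_free_prop _ _ that])
       (auto simp: norm_free_prop intro: continuous_on_subset[OF continuous_free_prop])
  have mo: "continuous_on A (\<lambda>t. mult_op (v t) (free_prop t (g t)))"
    by (rule continuous_on_operator_family[where K = M, OF bounded_linear_mult_op_Cc[OF v] _ _ fp[OF g]])
       (auto intro: norm_mult_op_le M Cc_infinity_measurable[OF v] continuous_on_subset[OF continuous_mult_op_Cc[OF v]])
  have neg: "continuous_on A (\<lambda>t. free_prop (- t) x)" for x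
    by (rule continuous_on_compose2[OF continuous_free_prop]) (auto intro: continuous_intros)
  show ?thesis
    unfolding dyson_op_def
    by (rule continuous_on_operator_family[where K = 1, OF bounded_linear_free_prop _ neg mo]) (simp add: norm_free_prop)
qed

text \<open>Continuity in the upper time limit is what the induction carries along: it makes the
  next integrand continuous, hence integrable.\<close>

lemma continuous_W_smooth:
  assumes "set vs \<subseteq> Cc_infinity"
  shows "continuous_on {s..t} (\<lambda>\<tau>. W_smooth vs \<tau> s f)"
  using assms
proof (induction vs)
  case (Cons v vs)
  then have "continuous_on {s..t} (\<lambda>\<tau>. dyson_op v \<tau> (W_smooth vs \<tau> s f))" by (intro continuous_dyson_op) auto
  then have "continuous_on {s..t} (\<lambda>t. integral {s..t} (\<lambda>\<tau>. dyson_op v \<tau> (W_smooth vs \<tau> s f)))"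
    by (intro indefinite_integral_continuous_1 integrable_continuous_real)
  then show ?case
    unfolding W_smooth_Cons by (rule bounded_linear.continuous_on[OF bounded_linear_mult_op_const])
qed simp

lemma dyson_integrable:
  assumes "v \<in> Cc_infinity" "set vs \<subseteq> Cc_infinity"
  shows "(\<lambda>\<tau>. dyson_op v \<tau> (W_smooth vs \<tau> s f)) integrable_on {s..t}"
  by (intro integrable_continuous_real continuous_dyson_op continuous_W_smooth assms)

lemma W_smooth_linear:
  assumes "set vs \<subseteq> Cc_infinity"
  shows "W_smooth vs t s (f + g) = W_smooth vs t s f + W_smooth vs t s g"
    "W_smooth vs t s (c *\<^sub>R f) = c *\<^sub>R W_smooth vs t s f"
proof -
  interpret M: bounded_linear "mult_op (\<lambda>x. - \<i>)" by (rule bounded_linear_mult_op_const)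
  show "W_smooth vs t s (f + g) = W_smooth vs t s f + W_smooth vs t s g"
    using assms
  proof (induction vs arbitrary: t)
    case (Cons v vs)
    then have v: "v \<in> Cc_infinity" "set vs \<subseteq> Cc_infinity" by auto
    have "W_smooth vs \<tau> s (f + g) = W_smooth vs \<tau> s f + W_smooth vs \<tau> s g" for \<tau> by (rule Cons.IH[OF v(2)])
    then show ?case
      unfolding W_smooth_Cons
      by (simp add: bounded_linear.linear[OF bounded_linear_dyson_op[OF v(1)]] linear_add
          Henstock_Kurzweil_Integration.integral_add[OF dyson_integrable[OF v] dyson_integrable[OF v]] M.add)
  qed simp
  show "W_smooth vs t s (c *\<^sub>R f) = c *\<^sub>R W_smooth vs t s f"
    using assms
  proof (induction vs arbitrary: t)
    case (Cons v vs)
    then have v: "v \<in> Cc_infinity" "set vs \<subseteq> Cc_infinity" by auto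
    have "W_smooth vs \<tau> s (c *\<^sub>R f) = c *\<^sub>R W_smooth vs \<tau> s f" for \<tau> by (rule Cons.IH[OF v(2)])
    then show ?case
      unfolding W_smooth_Cons
      by (simp add: bounded_linear.linear[OF bounded_linear_dyson_op[OF v(1)]] linear_scale M.scaleR)
  qed simp
qed

lemma Cc_infinity_diff:
  "v \<in> Cc_infinity \<Longrightarrow> w \<in> Cc_infinity \<Longrightarrow> (\<lambda>t x. v t x - w t x) \<in> Cc_infinity"
  using Cc_infinity_lincomb[of v w 1 "-1"] by simp

lemma mult_op_diff:
  assumes "v \<in> Cc_infinity" "w \<in> Cc_infinity"
  shows "mult_op (\<lambda>x. v t x - w t x) g = mult_op (v t) g - mult_op (w t) g"
proof -
  obtain M where M: "\<And>t x. cmod (v t x) \<le> M" using Cc_infinity_bound[OF assms(1)] by metis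
  obtain N where N: "\<And>t x. cmod (w t x) \<le> N" using Cc_infinity_bound[OF assms(2)] by metis
  show ?thesis
    unfolding mult_op_def left_diff_distrib
    by (intro abs_L2_diff rep_mult_op(2)[OF _ M] rep_mult_op(2)[OF _ N] Cc_infinity_measurable assms)
qed

lemma W_smooth_diff:
  assumes "set xs \<subseteq> Cc_infinity" "set ys \<subseteq> Cc_infinity" "v \<in> Cc_infinity" "w \<in> Cc_infinity"
  shows "W_smooth (xs @ (\<lambda>t x. v t x - w t x) # ys) t s f = W_smooth (xs @ v # ys) t s f - W_smooth (xs @ w # ys) t s f"
  using assms(1)
proof (induction xs arbitrary: t)
  case Nil
  interpret M: bounded_linear "mult_op (\<lambda>x. - \<i>)" by (rule bounded_linear_mult_op_const)
  have "dyson_op (\<lambda>t x. v t x - w t x) \<tau> g = dyson_op v \<tau> g - dyson_op w \<tau> g" for \<tau> g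
    unfolding dyson_op_def mult_op_diff[OF assms(3,4)]
    by (simp add: bounded_linear.linear[OF bounded_linear_free_prop] linear_diff)
  then show ?case
    using assms
    by (simp add: W_smooth_Cons Henstock_Kurzweil_Integration.integral_diff dyson_integrable M.diff)
next
  case (Cons z xs)
  interpret M: bounded_linear "mult_op (\<lambda>x. - \<i>)" by (rule bounded_linear_mult_op_const)
  from Cons have z: "z \<in> Cc_infinity" "set xs \<subseteq> Cc_infinity" by auto
  have i: "(\<lambda>\<tau>. dyson_op z \<tau> (W_smooth (xs @ u # ys) \<tau> s f)) integrable_on {s..t}" if "u \<in> Cc_infinity" for u
    using z assms that by (intro dyson_integrable) auto
  show ?case
    by (simp add: W_smooth_Cons Cons.IH[OF z(2)] bounded_linear.linear[OF bounded_linear_dyson_op[OF z(1)]] linear_diff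
        Henstock_Kurzweil_Integration.integral_diff[OF i[OF assms(3)] i[OF assms(4)]] M.diff)
qed

lemma dyson_op_shift:
  "dyson_op v t (free_prop (- s) h) = free_prop (- s) (dyson_op (\<lambda>t. v (t + s)) (t - s) h)"
  by (simp add: dyson_op_def free_prop_add)

text \<open>A translation by \<open>s\<close> conjugates the Dyson operators by the free group. It
  reduces a general initial time to 0, the only one covered by the multilinear estimate.\<close>

lemma W_smooth_shift:
  assumes "set vs \<subseteq> Cc_infinity" "s \<le> t"
  shows "W_smooth vs t s f = free_prop (- s) (W_smooth (map (\<lambda>v t. v (t + s)) vs) (t - s) 0 (free_prop s f))"
  using assms
proof (induction vs arbitrary: t)
  case Nil
  then show ?case by (simp add: free_prop_add free_prop_0)
next
  case (Cons v vs)
  then have v: "v \<in> Cc_infinity" "set vs \<subseteq> Cc_infinity" by auto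
  let ?v = "\<lambda>t. v (t + s)" and ?vs = "map (\<lambda>v t. v (t + s)) vs"
  have v': "?v \<in> Cc_infinity" "set ?vs \<subseteq> Cc_infinity" using v Cc_infinity_shift by auto
  let ?G = "\<lambda>\<tau>. dyson_op ?v \<tau> (W_smooth ?vs \<tau> 0 (free_prop s f))"
  have "integral {s..t} (\<lambda>\<tau>. dyson_op v \<tau> (W_smooth vs \<tau> s f)) = integral {s..t} (\<lambda>\<tau>. free_prop (- s) (?G (\<tau> - s)))"
    using Cons.IH[OF v(2)] by (intro integral_cong) (simp add: dyson_op_shift)
  also have "\<dots> = integral {0..t - s} (\<lambda>\<tau>. free_prop (- s) (?G \<tau>))"
    using integral_shift_real_ivl[of s s t "\<lambda>\<tau>. free_prop (- s) (?G (\<tau> - s))"] by simp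
  also have "\<dots> = free_prop (- s) (integral {0..t - s} ?G)"
    using integral_linear[OF dyson_integrable[OF v'] bounded_linear_free_prop] by (simp add: comp_def)
  finally show ?case by (simp add: W_smooth_Cons free_prop_mult_op_const)
qed

lemma schwartz_eq_if_distr_eq:
  assumes "f \<in> schwartz" "g \<in> schwartz" "\<And>\<phi>. \<phi> \<in> schwartz \<Longrightarrow> distr_of f \<phi> = distr_of g \<phi>"
  shows "AE x in lborel. f x = g x"
proof -
  have "AE x in lborel. f x - g x = 0"
  proof (rule schwartz_test_AE_zero)
    fix \<phi> assume \<phi>: "\<phi> \<in> schwartz"
    have i: "integrable lborel (\<lambda>x. f x * \<phi> x)" "integrable lborel (\<lambda>x. g x * \<phi> x)"
      by (intro schwartz_integrable schwartz_mult assms \<phi>)+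
    then show "integrable lborel (\<lambda>x. (f x - g x) * \<phi> x)" by (simp add: left_diff_distrib)
    show "(LINT x|lborel. (f x - g x) * \<phi> x) = 0"
      using assms(3)[OF \<phi>] i by (simp add: left_diff_distrib distr_of_def)
  qed (use assms in \<open>auto intro!: schwartz_measurable schwartz_diff\<close>)
  then show ?thesis by simp
qed

text \<open>\<open>W\<close> takes its smooth representatives from \<open>SOME\<close>, so
  independence of the choice is needed. Two representatives give the same multiplication operator at
  almost every time, and the integral ignores the exceptional null set.\<close>

lemma W_smooth_represents_unique:
  assumes "represents s t vs Vs" "represents s t vs' Vs"
  shows "W_smooth vs t s f = W_smooth vs' t s f"
  using assms
proof (induction Vs arbitrary: vs vs' t)
  case Nil
  then show ?case by (simp add: represents_def)
next
  case (Cons V Vs)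
  obtain v us where vs: "vs = v # us" and v: "v \<in> Cc_infinity"
      "AE \<tau> in lborel. \<tau> \<in> {s..t} \<longrightarrow> (\<forall>\<phi>\<in>schwartz. V \<tau> \<phi> = distr_of (v \<tau>) \<phi>)" "represents s t us Vs"
    using Cons.prems(1) by (auto simp: represents_def list_all2_Cons2)
  obtain v' us' where vs': "vs' = v' # us'" and v': "v' \<in> Cc_infinity"
      "AE \<tau> in lborel. \<tau> \<in> {s..t} \<longrightarrow> (\<forall>\<phi>\<in>schwartz. V \<tau> \<phi> = distr_of (v' \<tau>) \<phi>)" "represents s t us' Vs"
    using Cons.prems(2) by (auto simp: represents_def list_all2_Cons2)
  have sub: "represents s \<tau> ws Vs" if "represents s t ws Vs" "\<tau> \<in> {s..t}" for \<tau> ws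
    using that unfolding represents_def by (elim list_all2_mono) (auto elim!: AE_mp)
  have IH: "W_smooth us \<tau> s f = W_smooth us' \<tau> s f" if "\<tau> \<in> {s..t}" for \<tau>
    by (rule Cons.IH[OF sub[OF v(3) that] sub[OF v'(3) that]])
  have "AE \<tau> in lborel. \<tau> \<in> {s..t} \<longrightarrow> (\<forall>g. mult_op (v \<tau>) g = mult_op (v' \<tau>) g)"
    using v(2) v'(2)
  proof eventually_elim
    case (elim \<tau>)
    show ?case
    proof (intro impI allI)
      fix g assume "\<tau> \<in> {s..t}"
      then have ae: "AE x in lborel. v \<tau> x = v' \<tau> x"
        using elim by (intro schwartz_eq_if_distr_eq Cc_infinity_schwartz v v') auto
      obtain M where M: "\<And>t x. cmod (v t x) \<le> M" using Cc_infinity_bound[OF v(1)] by metis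
      obtain N where N: "\<And>t x. cmod (v' t x) \<le> N" using Cc_infinity_bound[OF v'(1)] by metis
      show "mult_op (v \<tau>) g = mult_op (v' \<tau>) g"
        unfolding mult_op_def using ae
        by (intro abs_L2_cong rep_mult_op(2)[OF _ M] rep_mult_op(2)[OF _ N] Cc_infinity_measurable v v') auto
    qed
  qed
  then obtain N where N: "N \<in> null_sets lborel"
    "\<And>\<tau>. \<tau> \<in> {s..t} - N \<Longrightarrow> (\<forall>g. mult_op (v \<tau>) g = mult_op (v' \<tau>) g)"
    by (auto elim!: AE_E3)
  have "integral {s..t} (\<lambda>\<tau>. dyson_op v \<tau> (W_smooth us \<tau> s f)) = integral {s..t} (\<lambda>\<tau>. dyson_op v' \<tau> (W_smooth us' \<tau> s f))"
  proof (rule integral_spike)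
    show "negligible N" using N(1) by (simp add: negligible_iff_null_sets null_sets_completionI)
    show "dyson_op v' \<tau> (W_smooth us' \<tau> s f) = dyson_op v \<tau> (W_smooth us \<tau> s f)" if "\<tau> \<in> {s..t} - N" for \<tau>
      using N(2)[OF that] IH[of \<tau>] that by (simp add: dyson_op_def)
  qed
  then show ?case by (simp add: vs vs' W_smooth_Cons)
qed

lemma W_represents:
  assumes "represents s t vs Vs"
  shows "W \<delta> Vs t s f = W_smooth vs t s f"
proof -
  have ex: "\<exists>vs. represents s t vs Vs" using assms by blast
  then have "represents s t (SOME vs. represents s t vs Vs) Vs" by (rule someI_ex)
  from W_smooth_represents_unique[OF this assms] ex show ?thesis by (simp add: W_def)
qed

lemma represents_Cc:
  assumes "set vs \<subseteq> Cc_infinity"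
  shows "represents s t vs (map (\<lambda>v \<tau>. distr_of (v \<tau>)) vs)"
  using assms unfolding represents_def by (auto simp: list_all2_conv_all_nth)

lemma W_Cc:
  "set vs \<subseteq> Cc_infinity \<Longrightarrow> W \<delta> (map (\<lambda>v \<tau>. distr_of (v \<tau>)) vs) t s f = W_smooth vs t s f"
  by (rule W_represents[OF represents_Cc])

lemma W_Nil: "W \<delta> [] t s f = f"
  using W_Cc[of "[]"] by simp

section \<open>Sobolev duality and densities of pairs\<close>

lemma freq_mono:
  assumes f: "sqint (freq_measure s') f" and s: "s \<le> s'"
  shows "sqint (freq_measure s) f" "l2norm (freq_measure s) f \<le> l2norm (freq_measure s') f"
proof -
  have fm: "f \<in> borel_measurable borel" and i: "integrable lborel (\<lambda>\<xi>. (1 + \<xi>\<^sup>2) powr s' * (cmod (f \<xi>))\<^sup>2)"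
    using f by (auto simp: sqint_freq_iff)
  have le: "(1 + \<xi>\<^sup>2) powr s * (cmod (f \<xi>))\<^sup>2 \<le> (1 + \<xi>\<^sup>2) powr s' * (cmod (f \<xi>))\<^sup>2" for \<xi> :: real
    using s by (intro mult_right_mono powr_mono) auto
  have i': "integrable lborel (\<lambda>\<xi>. (1 + \<xi>\<^sup>2) powr s * (cmod (f \<xi>))\<^sup>2)"
    by (rule Bochner_Integration.integrable_bound[OF i]) (use fm le in auto)
  then show "sqint (freq_measure s) f" using fm by (simp add: sqint_freq_iff)
  have "(l2norm (freq_measure s) f)\<^sup>2 \<le> (l2norm (freq_measure s') f)\<^sup>2"
    unfolding l2norm_freq[OF fm] using i i' le by (intro integral_mono) auto
  then show "l2norm (freq_measure s) f \<le> l2norm (freq_measure s') f"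
    by (rule power2_le_imp_le) (rule l2norm_nonneg)
qed

lemma l2norm_freq_reflect:
  assumes "f \<in> borel_measurable borel"
  shows "l2norm (freq_measure s) (\<lambda>\<xi>. f (- \<xi>)) = l2norm (freq_measure s) f"
proof (rule power2_eq_imp_eq[OF _ l2norm_nonneg l2norm_nonneg])
  have "(LINT \<xi>|lborel. (1 + \<xi>\<^sup>2) powr s * (cmod (f \<xi>))\<^sup>2) = \<bar>-1\<bar> *\<^sub>R (LINT \<xi>|lborel. (1 + (0 + (-1) * \<xi>)\<^sup>2) powr s * (cmod (f (0 + (-1) * \<xi>)))\<^sup>2)"
    by (rule lborel_integral_real_affine) simp
  moreover have "(\<lambda>\<xi>. f (- \<xi>)) \<in> borel_measurable borel" using assms by measurable
  ultimately show "(l2norm (freq_measure s) (\<lambda>\<xi>. f (- \<xi>)))\<^sup>2 = (l2norm (freq_measure s) f)\<^sup>2"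
    using assms by (simp add: l2norm_freq)
qed

lemma strip_slice_l2:
  assumes w: "sqint (strip_measure s a b) w"
  shows "sqint lborel (\<lambda>t. complex_of_real (indicator {a..b} t * l2norm (freq_measure s) (\<lambda>\<xi>. w (t, \<xi>))))"
    "l2norm lborel (\<lambda>t. complex_of_real (indicator {a..b} t * l2norm (freq_measure s) (\<lambda>\<xi>. w (t, \<xi>)))) = l2norm (strip_measure s a b) w"
proof -
  let ?a = "\<lambda>t. l2norm (freq_measure s) (\<lambda>\<xi>. w (t, \<xi>))"
  have i: "integrable lborel (\<lambda>t. indicator {a..b} t * (?a t)\<^sup>2)" by (rule strip_slice(2)[OF w])
  have eq: "(cmod (complex_of_real (indicator {a..b} t * ?a t)))\<^sup>2 = indicator {a..b} t * (?a t)\<^sup>2" for t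
    by (simp add: indicator_def)
  have "(\<lambda>t. sqrt (indicator {a..b} t * (?a t)\<^sup>2)) \<in> borel_measurable lborel"
    using borel_measurable_integrable[OF i] by measurable
  moreover have "sqrt (indicator {a..b} t * (?a t)\<^sup>2) = indicator {a..b} t * ?a t" for t
    by (simp add: indicator_def l2norm_nonneg)
  ultimately have m: "(\<lambda>t. indicator {a..b} t * ?a t) \<in> borel_measurable lborel" by (simp only:)
  have "complex_of_real \<in> borel_measurable borel" by (intro borel_measurable_continuous_onI continuous_intros)
  from measurable_compose[OF m this]
  show "sqint lborel (\<lambda>t. complex_of_real (indicator {a..b} t * ?a t))"
    unfolding sqint_def eq using i by blast
  show "l2norm lborel (\<lambda>t. complex_of_real (indicator {a..b} t * ?a t)) = l2norm (strip_measure s a b) w"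
    by (rule power2_eq_imp_eq[OF _ l2norm_nonneg l2norm_nonneg])
       (simp only: l2norm_power2[of lborel] eq strip_slice(3)[OF w])
qed

text \<open>An inequality only, since the inner product of \<open>L2\<close> is the real part of the
  complex pairing that \<open>pair_density\<close> records.\<close>

lemma inner_mult_op_le:
  assumes v: "v \<in> Cc_infinity"
  shows "\<bar>inner (mult_op (\<lambda>x. - \<i>) (mult_op (v t) f)) g\<bar> \<le> cmod (pair_density f g (v t))"
proof -
  obtain M where M: "\<And>t x. cmod (v t x) \<le> M" using Cc_infinity_bound[OF v] by metis
  have vm: "v t \<in> borel_measurable borel" by (rule Cc_infinity_measurable[OF v])
  have cm: "cnj \<in> borel_measurable borel" by (intro borel_measurable_continuous_onI continuous_intros)
  have [measurable]: "(\<lambda>x. cnj (rep_L2 g x)) \<in> borel_measurable borel"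
    using measurable_compose[OF rep_L2_measurable cm] .
  have "(LINT x|lborel. rep_L2 (mult_op (\<lambda>x. - \<i>) (mult_op (v t) f)) x * cnj (rep_L2 g x))
    = (LINT x|lborel. - \<i> * (rep_L2 f x * cnj (rep_L2 g x) * v t x))"
    using rep_mult_op(1)[OF vm M, where f = f] rep_mult_op(1)[of "\<lambda>x. - \<i>" 1, where f = "mult_op (v t) f"] vm
    by (intro integral_cong_AE) (auto elim!: AE_mp)
  also have "\<dots> = - \<i> * pair_density f g (v t)"
    unfolding pair_density_def distr_of_def by (rule integral_mult_right_zero)
  finally have "\<bar>inner (mult_op (\<lambda>x. - \<i>) (mult_op (v t) f)) g\<bar> = \<bar>Re (- \<i> * pair_density f g (v t))\<bar>"
    by (simp only: inner_L2_eq)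
  also have "\<dots> \<le> cmod (- \<i> * pair_density f g (v t))" by (rule abs_Re_le_cmod)
  finally show ?thesis by (simp add: norm_mult)
qed

text \<open>Inversion presents \<open>v\<close> as the transform of its own reflected transform,
  which turns \<open>u v\<close> into a pairing on the frequency side. The space dual to regularity
  1/2 has regularity -1/2, and the norm of exponent \<open>s\<close> dominates it because
  \<open>- 1 / 2 \<le> s\<close>.\<close>

lemma Sobolev_duality:
  assumes v: "v \<in> schwartz" and hf: "has_fourier u w" and w: "sqint (freq_measure (1 / 2)) w"
    and s: "- 1 / 2 \<le> s" "s \<le> 1"
  shows "cmod (u v) \<le> l2norm (freq_measure (1 / 2)) w * l2norm (freq_measure s) (fourier v)"
proof -
  obtain \<psi> where \<psi>: "\<psi> \<in> schwartz" "fourier \<psi> = v" "\<And>x. \<psi> x = fourier v (- x)" using fourier_surj[OF v] by metis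
  have "u v = (LINT \<xi>|lborel. w \<xi> * \<psi> \<xi>)" using has_fourierD(2)[OF hf \<psi>(1)] \<psi>(2) by simp
  also have "cmod \<dots> \<le> l2norm (freq_measure (1 / 2)) w * l2norm (freq_measure (- (1 / 2))) \<psi>"
    by (intro freq_pairing(3) w schwartz_freq(1)[OF \<psi>(1)]) simp
  also have "\<dots> \<le> l2norm (freq_measure (1 / 2)) w * l2norm (freq_measure s) \<psi>"
    using s by (intro mult_left_mono freq_mono(2) schwartz_freq(1)[OF \<psi>(1)] l2norm_nonneg) auto
  also have "\<psi> = (\<lambda>\<xi>. fourier v (- \<xi>))" using \<psi>(3) by auto
  also have "l2norm (freq_measure s) (\<lambda>\<xi>. fourier v (- \<xi>)) = l2norm (freq_measure s) (fourier v)"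
    by (intro l2norm_freq_reflect schwartz_measurable schwartz_fourier v)
  finally show ?thesis .
qed

lemma prod_list_map_nonneg:
  fixes g :: "'a \<Rightarrow> real"
  assumes "\<And>x. x \<in> set xs \<Longrightarrow> 0 \<le> g x" shows "0 \<le> prod_list (map g xs)"
  using assms by (induction xs) auto

lemma prod_list_map_le_power:
  fixes g :: "'a \<Rightarrow> real"
  assumes "\<And>x. x \<in> set xs \<Longrightarrow> 0 \<le> g x \<and> g x \<le> M" "0 \<le> M" shows "prod_list (map g xs) \<le> M ^ length xs"
  using assms
proof (induction xs)
  case (Cons x xs)
  then show ?case by (auto intro!: mult_mono prod_list_map_nonneg)
qed simp

lemma prod_list_map_tendsto:
  fixes g :: "'a \<Rightarrow> nat \<Rightarrow> real"
  assumes "\<And>x. x \<in> set xs \<Longrightarrow> g x \<longlonglongrightarrow> l x"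
  shows "(\<lambda>k. prod_list (map (\<lambda>x. g x k) xs)) \<longlonglongrightarrow> prod_list (map l xs)"
  using assms by (induction xs) (auto intro: tendsto_mult)

lemma norm_le_inner:
  fixes x :: "'a::real_inner"
  assumes "\<And>y. \<bar>inner x y\<bar> \<le> B * norm y" "0 \<le> B" shows "norm x \<le> B"
proof (cases "x = 0")
  case False
  have "norm x * norm x \<le> B * norm x" using assms(1)[of x] by (simp flip: power2_norm_eq_inner power2_eq_square)
  then show ?thesis using False by simp
qed (use assms in simp)

lemma L2Hs_sum:
  assumes "finite I" "\<And>i. i \<in> I \<Longrightarrow> R i \<in> L2Hs s a b"
  shows "(\<lambda>t \<phi>. \<Sum>i\<in>I. R i t \<phi>) \<in> L2Hs s a b \<and>
    L2Hs_norm s a b (\<lambda>t \<phi>. \<Sum>i\<in>I. R i t \<phi>) \<le> (\<Sum>i\<in>I. L2Hs_norm s a b (R i))"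
  using assms
proof (induction I)
  case empty
  have "strip_fourier s a b (\<lambda>t \<phi>. 0) (\<lambda>p. 0)" by (auto simp: strip_fourier_def has_fourier_def)
  then show ?case using L2Hs_norm_eq[of s a b "\<lambda>t \<phi>. 0" "\<lambda>p. 0"] by (auto simp: L2Hs_iff)
next
  case (insert i I)
  then have i: "R i \<in> L2Hs s a b" and I: "(\<lambda>t \<phi>. \<Sum>i\<in>I. R i t \<phi>) \<in> L2Hs s a b"
    "L2Hs_norm s a b (\<lambda>t \<phi>. \<Sum>i\<in>I. R i t \<phi>) \<le> (\<Sum>i\<in>I. L2Hs_norm s a b (R i))" by auto
  have "(\<lambda>t \<phi>. \<Sum>i\<in>insert i I. R i t \<phi>) = (\<lambda>t \<phi>. R i t \<phi> + (\<Sum>i\<in>I. R i t \<phi>))"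
    using insert.hyps by (simp add: fun_eq_iff)
  then show ?case using L2Hs_add[OF i I(1)] I(2) insert.hyps by simp
qed

lemma sqint_cnj_mult_schwartz:
  assumes "\<psi> \<in> schwartz"
  shows "sqint lborel (\<lambda>x. cnj (rep_L2 g x) * \<psi> x)"
proof -
  obtain M where M: "0 < M" "\<And>x. cmod (complex_of_real (x ^ 0) * \<psi> x) \<le> M" using schwartz_bound[OF assms] by metis
  have cm: "cnj \<in> borel_measurable borel" by (intro borel_measurable_continuous_onI continuous_intros)
  note [measurable] = measurable_compose[OF rep_L2_measurable[of g] cm] schwartz_measurable[OF assms]
  show ?thesis
  proof (rule sqint_bound[OF sqint_cmult[OF sqint_rep_L2[of g], of "of_real M"]])
    show "AE x in lborel. cmod (cnj (rep_L2 g x) * \<psi> x) \<le> cmod (complex_of_real M * rep_L2 g x)"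
      using M by (auto simp: norm_mult mult.commute[of M] intro!: mult_left_mono)
  qed measurable
qed

text \<open>Against a fixed Schwartz function the density is continuous in each argument, so that
  series converging in \<open>L2\<close> at a fixed time can be summed inside it.\<close>

lemma bounded_linear_pair_left:
  assumes \<psi>: "\<psi> \<in> schwartz"
  shows "bounded_linear (\<lambda>f. pair_density f g \<psi>)"
proof -
  let ?h = "\<lambda>x. cnj (rep_L2 g x) * \<psi> x"
  have h: "sqint lborel ?h" by (rule sqint_cnj_mult_schwartz[OF \<psi>])
  have cm: "cnj \<in> borel_measurable borel" by (intro borel_measurable_continuous_onI continuous_intros)
  note [measurable] = measurable_compose[OF rep_L2_measurable[of g] cm] schwartz_measurable[OF \<psi>]
  have eq: "pair_density f g \<psi> = (LINT x|lborel. rep_L2 f x * ?h x)" for f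
    by (simp add: pair_density_def distr_of_def mult.assoc)
  note i = sqint_mult_integrable(2)[OF sqint_rep_L2 h]
  show ?thesis
    unfolding eq
  proof (rule bounded_linear_intro[where K = "l2norm lborel ?h"])
    fix f k :: L2 and r :: real
    have "(LINT x|lborel. rep_L2 (f + k) x * ?h x) = (LINT x|lborel. rep_L2 f x * ?h x + rep_L2 k x * ?h x)"
      using rep_L2_add[of f k] by (intro integral_cong_AE) (auto elim!: AE_mp simp: algebra_simps)
    then show "(LINT x|lborel. rep_L2 (f + k) x * ?h x) = (LINT x|lborel. rep_L2 f x * ?h x) + (LINT x|lborel. rep_L2 k x * ?h x)"
      using i[of f] i[of k] by simp
    have "(LINT x|lborel. rep_L2 (r *\<^sub>R f) x * ?h x) = (LINT x|lborel. r *\<^sub>R (rep_L2 f x * ?h x))"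
      using rep_L2_scaleR[of r f] by (intro integral_cong_AE) (auto elim!: AE_mp)
    then show "(LINT x|lborel. rep_L2 (r *\<^sub>R f) x * ?h x) = r *\<^sub>R (LINT x|lborel. rep_L2 f x * ?h x)"
      by simp
    show "norm (LINT x|lborel. rep_L2 f x * ?h x) \<le> norm f * l2norm lborel ?h"
      unfolding norm_L2_eq by (rule l2norm_integral_mult_le[OF sqint_rep_L2 h])
  qed
qed

lemma pair_density_cnj: "pair_density f g \<psi> = cnj (pair_density g f (\<lambda>x. cnj (\<psi> x)))"
  unfolding pair_density_def distr_of_def
  by (subst Bochner_Integration.integral_cnj[symmetric]) (simp add: mult.commute)

lemma bounded_linear_pair_right:
  assumes \<psi>: "\<psi> \<in> schwartz"
  shows "bounded_linear (\<lambda>g. pair_density f g \<psi>)"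
  using bounded_linear_compose[OF bounded_linear_cnj bounded_linear_pair_left[OF schwartz_cnj[OF \<psi>], of f]]
  by (simp add: pair_density_cnj[of f])

lemma pair_density_self: "pair_density f f = position_density f"
  unfolding pair_density_def position_density_def by (simp add: complex_norm_square[symmetric])

section \<open>Dyson operators under the multilinear estimate\<close>

context
  fixes \<delta> C :: real
  assumes \<delta>: "0 < \<delta>" "\<delta> < 1" and C: "0 < C" and est: "multilinear_estimate \<delta> C"
begin

abbreviation pspace :: "real \<Rightarrow> real \<Rightarrow> (real \<Rightarrow> distr) set" where
  "pspace \<equiv> L2Hs (- 1 / 2 + \<delta>)"

abbreviation pnorm :: "real \<Rightarrow> real \<Rightarrow> (real \<Rightarrow> distr) \<Rightarrow> real" where
  "pnorm \<equiv> L2Hs_norm (- 1 / 2 + \<delta>)"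

abbreviation potnorm :: "real \<Rightarrow> real \<Rightarrow> (real \<Rightarrow> real \<Rightarrow> complex) \<Rightarrow> real" where
  "potnorm s t v \<equiv> pnorm s t (\<lambda>\<tau>. distr_of (v \<tau>))"

text \<open>What each potential contributes to the multilinear estimate besides its norm, on an
  interval of length \<open>t - s\<close>.\<close>

definition gain :: "real \<Rightarrow> real \<Rightarrow> real" where
  "gain s t = C * (t - s) powr theta \<delta>"

lemma gain_nonneg: "0 \<le> gain s t"
  using C by (simp add: gain_def)

lemma Cc_L2Hs: "v \<in> Cc_infinity \<Longrightarrow> (\<lambda>\<tau>. distr_of (v \<tau>)) \<in> pspace s t"
  using Cc_strip_fourier[of v "- 1 / 2 + \<delta>"] \<delta> by (auto simp: L2Hs_iff)

lemma potnorm_nonneg: "v \<in> Cc_infinity \<Longrightarrow> 0 \<le> potnorm s t v"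
  by (intro L2Hs_norm_nonneg Cc_L2Hs)

lemma pair_estimate:
  assumes "0 < T" "T \<le> 1" "set Vs \<subseteq> pspace 0 T" "set Vs' \<subseteq> pspace 0 T"
  shows "(\<lambda>t. pair_density (free_prop t (W \<delta> Vs t 0 f)) (free_prop t (W \<delta> Vs' t 0 g))) \<in> L2Hs (1 / 2) 0 T"
    "L2Hs_norm (1 / 2) 0 T (\<lambda>t. pair_density (free_prop t (W \<delta> Vs t 0 f)) (free_prop t (W \<delta> Vs' t 0 g))) \<le>
       gain 0 T ^ (length Vs + length Vs') * (\<Prod>V\<leftarrow>Vs. pnorm 0 T V) *
              (\<Prod>V\<leftarrow>Vs'. pnorm 0 T V) * norm f * norm g"
proof -
  have "T powr (real k * theta \<delta>) = (T powr theta \<delta>) ^ k" for k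
    using assms(1) by (simp add: powr_power mult.commute)
  then have *: "C ^ k * T powr (real k * theta \<delta>) = gain 0 T ^ k" for k
    by (simp add: gain_def power_mult_distrib)
  show "(\<lambda>t. pair_density (free_prop t (W \<delta> Vs t 0 f)) (free_prop t (W \<delta> Vs' t 0 g))) \<in> L2Hs (1 / 2) 0 T"
    "L2Hs_norm (1 / 2) 0 T (\<lambda>t. pair_density (free_prop t (W \<delta> Vs t 0 f)) (free_prop t (W \<delta> Vs' t 0 g))) \<le>
       gain 0 T ^ (length Vs + length Vs') * (\<Prod>V\<leftarrow>Vs. pnorm 0 T V) *
              (\<Prod>V\<leftarrow>Vs'. pnorm 0 T V) * norm f * norm g"
    using est assms unfolding multilinear_estimate_def Let_def *[symmetric] by blast+
qed

text \<open>The multilinear estimate controls the density of the pair formed by the inner terms \<open>W_smooth vs\<close>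
  and a free wave; pairing it with the outermost potential \<open>v\<close> in the Sobolev duality bounds
  \<open>W_smooth (v # vs)\<close> as an operator.\<close>

lemma W_smooth_bound_0:
  assumes v: "v \<in> Cc_infinity" "set vs \<subseteq> Cc_infinity" and t: "0 < t" "t \<le> 1"
  shows "norm (W_smooth (v # vs) t 0 f) \<le> potnorm 0 t v * (gain 0 t ^ length vs * (\<Prod>v\<leftarrow>vs. potnorm 0 t v) * norm f)"
proof (rule norm_le_inner)
  let ?K = "gain 0 t ^ length vs * (\<Prod>v\<leftarrow>vs. potnorm 0 t v) * norm f"
  have "0 \<le> (\<Prod>v\<leftarrow>vs. potnorm 0 t v)" using v(2) by (intro prod_list_map_nonneg potnorm_nonneg) auto
  then show K: "0 \<le> potnorm 0 t v * ?K"
    using potnorm_nonneg[OF v(1)] gain_nonneg by simp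
  fix g
  let ?U = "\<lambda>\<tau>. free_prop \<tau> (W_smooth vs \<tau> 0 f)" and ?G = "\<lambda>\<tau>. free_prop \<tau> g"
  let ?\<rho> = "\<lambda>\<tau>. pair_density (?U \<tau>) (?G \<tau>)"
  let ?Vs = "map (\<lambda>v \<tau>. distr_of (v \<tau>)) vs"
  have Vs: "set ?Vs \<subseteq> pspace 0 t" using v(2) Cc_L2Hs by auto
  have \<rho>: "?\<rho> \<in> L2Hs (1 / 2) 0 t" "L2Hs_norm (1 / 2) 0 t ?\<rho> \<le> ?K * norm g"
    using pair_estimate[OF t Vs, of "[]" f g] by (simp_all add: W_Cc[OF v(2)] W_Nil comp_def)
  obtain w where w: "strip_fourier (1 / 2) 0 t ?\<rho> w" using \<rho>(1) by (auto simp: L2Hs_iff)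
  have ws: "sqint (strip_measure (1 / 2) 0 t) w"
    and wf: "AE \<tau> in lborel. \<tau> \<in> {0..t} \<longrightarrow> has_fourier (?\<rho> \<tau>) (\<lambda>\<xi>. w (\<tau>, \<xi>))"
    using w by (auto simp: strip_fourier_def)
  let ?vh = "\<lambda>p. fourier (v (fst p)) (snd p)"
  have vh: "strip_fourier (- 1 / 2 + \<delta>) 0 t (\<lambda>\<tau>. distr_of (v \<tau>)) ?vh" using \<delta> by (intro Cc_strip_fourier v) simp
  then have vs: "sqint (strip_measure (- 1 / 2 + \<delta>) 0 t) ?vh" by (simp add: strip_fourier_def)
  let ?a = "\<lambda>\<tau>. indicator {0..t} \<tau> * l2norm (freq_measure (1 / 2)) (\<lambda>\<xi>. w (\<tau>, \<xi>))"
  let ?b = "\<lambda>\<tau>. indicator {0..t} \<tau> * l2norm (freq_measure (- 1 / 2 + \<delta>)) (\<lambda>\<xi>. ?vh (\<tau>, \<xi>))"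
  let ?J = "\<lambda>\<tau>. dyson_op v \<tau> (W_smooth vs \<tau> 0 f)"
  let ?L = "\<lambda>u. inner (mult_op (\<lambda>x. - \<i>) u) g"
  let ?h = "\<lambda>\<tau>. ?L (?J \<tau>)"
  have L: "bounded_linear ?L"
    by (rule bounded_linear_compose[OF bounded_linear_inner_left bounded_linear_mult_op_const])
  have "continuous_on {0..t} ?J" by (intro continuous_dyson_op continuous_W_smooth v)
  then have hc: "continuous_on {0..t} ?h" by (rule bounded_linear.continuous_on[OF L])
  note hi = borel_integrable_atLeastAtMost'[OF hc]
  have "inner (W_smooth (v # vs) t 0 f) g = integral {0..t} ?h"
    unfolding W_smooth_Cons using integral_linear[OF dyson_integrable[OF v] L] by (simp add: comp_def)
  also have "\<dots> = (LINT \<tau>|lborel. indicator {0..t} \<tau> *\<^sub>R ?h \<tau>)"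
    using set_borel_integral_eq_integral(2)[OF hi] by (simp add: set_lebesgue_integral_def)
  also have "\<bar>\<dots>\<bar> \<le> (LINT \<tau>|lborel. \<bar>indicator {0..t} \<tau> *\<^sub>R ?h \<tau>\<bar>)" by (rule integral_abs_bound)
  also have "\<dots> \<le> (LINT \<tau>|lborel. cmod (complex_of_real (?a \<tau>)) * cmod (complex_of_real (?b \<tau>)))"
  proof (rule integral_mono_AE)
    show "integrable lborel (\<lambda>\<tau>. \<bar>indicator {0..t} \<tau> *\<^sub>R ?h \<tau>\<bar>)"
      using hi unfolding set_integrable_def by (rule integrable_abs)
    show "integrable lborel (\<lambda>\<tau>. cmod (complex_of_real (?a \<tau>)) * cmod (complex_of_real (?b \<tau>)))"
      by (rule sqint_mult_integrable(1)[OF strip_slice_l2(1)[OF ws] strip_slice_l2(1)[OF vs]])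
    show "AE \<tau> in lborel. \<bar>indicator {0..t} \<tau> *\<^sub>R ?h \<tau>\<bar> \<le> cmod (complex_of_real (?a \<tau>)) * cmod (complex_of_real (?b \<tau>))"
      using wf strip_slice(1)[OF ws]
    proof eventually_elim
      case (elim \<tau>)
      show ?case
      proof (cases "\<tau> \<in> {0..t}")
        case True
        \<comment> \<open>Multiplication by \<open>- \<i>\<close> commutes with the free propagator,
          whose inverse then passes to \<open>g\<close>; this exhibits the pair of waves whose
          density is \<open>?\<rho>\<close>.\<close>
        have "?h \<tau> = inner (mult_op (\<lambda>x. - \<i>) (mult_op (v \<tau>) (?U \<tau>))) (?G \<tau>)"
          by (simp add: dyson_op_def inner_free_prop flip: free_prop_mult_op_const)
        then have "\<bar>?h \<tau>\<bar> \<le> cmod (?\<rho> \<tau> (v \<tau>))" using inner_mult_op_le[OF v(1)] by simp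
        also have "\<dots> \<le> l2norm (freq_measure (1 / 2)) (\<lambda>\<xi>. w (\<tau>, \<xi>)) * l2norm (freq_measure (- 1 / 2 + \<delta>)) (fourier (v \<tau>))"
          using elim True \<delta> by (intro Sobolev_duality Cc_infinity_schwartz v) auto
        finally show ?thesis using True by (simp add: l2norm_nonneg)
      qed simp
    qed
  qed
  also have "\<dots> \<le> l2norm (strip_measure (1 / 2) 0 t) w * l2norm (strip_measure (- 1 / 2 + \<delta>) 0 t) ?vh"
    using l2norm_Cauchy_Schwarz[OF strip_slice_l2(1)[OF ws] strip_slice_l2(1)[OF vs]]
    by (simp only: strip_slice_l2(2)[OF ws] strip_slice_l2(2)[OF vs])
  also have "\<dots> = L2Hs_norm (1 / 2) 0 t ?\<rho> * potnorm 0 t v"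
    by (simp only: L2Hs_norm_eq[OF w] L2Hs_norm_eq[OF vh])
  also have "\<dots> \<le> (?K * norm g) * potnorm 0 t v" by (intro mult_right_mono \<rho> potnorm_nonneg v)
  finally show "\<bar>inner (W_smooth (v # vs) t 0 f) g\<bar> \<le> potnorm 0 t v * ?K * norm g" by (simp add: ac_simps)
qed

lemma potnorm_shift:
  assumes v: "v \<in> Cc_infinity"
  shows "potnorm 0 (t - s) (\<lambda>\<tau>. v (\<tau> + s)) = potnorm s t v"
proof (rule power2_eq_imp_eq)
  have r: "- 1 / 2 + \<delta> \<le> 1" using \<delta> by simp
  let ?b = "\<lambda>\<tau>. (l2norm (freq_measure (- 1 / 2 + \<delta>)) (fourier (v \<tau>)))\<^sup>2"
  have *: "(potnorm a b u)\<^sup>2 = (LINT \<tau>|lborel. indicator {a..b} \<tau> * (l2norm (freq_measure (- 1 / 2 + \<delta>)) (fourier (u \<tau>)))\<^sup>2)"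
    if "u \<in> Cc_infinity" for a b u
  proof -
    note sf = Cc_strip_fourier[OF that r, of a b]
    have "sqint (strip_measure (- 1 / 2 + \<delta>) a b) (\<lambda>p. fourier (u (fst p)) (snd p))" using sf by (simp add: strip_fourier_def)
    from strip_slice(3)[OF this] show ?thesis unfolding L2Hs_norm_eq[OF sf] by simp
  qed
  have "(LINT \<tau>|lborel. indicator {s..t} \<tau> * ?b \<tau>) = \<bar>1\<bar> *\<^sub>R (LINT \<tau>|lborel. indicator {s..t} (s + 1 * \<tau>) * ?b (s + 1 * \<tau>))"
    by (rule lborel_integral_real_affine) simp
  also have "\<dots> = (LINT \<tau>|lborel. indicator {0..t - s} \<tau> * ?b (\<tau> + s))"
  proof -
    have "indicator {s..t} (s + 1 * \<tau>) * ?b (s + 1 * \<tau>) = indicator {0..t - s} \<tau> * ?b (\<tau> + s)" for \<tau>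
      by (auto simp: indicator_def add.commute)
    then show ?thesis by simp
  qed
  finally show "(potnorm 0 (t - s) (\<lambda>\<tau>. v (\<tau> + s)))\<^sup>2 = (potnorm s t v)\<^sup>2"
    unfolding *[OF v] *[OF Cc_infinity_shift[OF v]] by simp
qed (intro potnorm_nonneg v Cc_infinity_shift)+

text \<open>The exponent \<open>length xs - 1\<close> is truncated, so that the empty list is covered; \<open>gain s s = 0\<close>, and
  then a list of length one has the exponent \<open>0\<close> as well.\<close>

lemma W_smooth_bound:
  assumes xs: "set xs \<subseteq> Cc_infinity" and t: "s \<le> t" "t \<le> s + 1"
  shows "norm (W_smooth xs t s f) \<le> gain s t ^ (length xs - 1) * (\<Prod>v\<leftarrow>xs. potnorm s t v) * norm f"
proof (cases xs)
  case (Cons v vs)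
  then have v: "v \<in> Cc_infinity" "set vs \<subseteq> Cc_infinity" using xs by auto
  show ?thesis
  proof (cases "s = t")
    case True
    have "W_smooth xs t s f = 0"
      using True Cons bounded_linear.linear[OF bounded_linear_mult_op_const, of "- \<i>"] by (simp add: W_smooth_Cons linear_0)
    moreover have "0 \<le> gain s t ^ (length xs - 1) * (\<Prod>v\<leftarrow>xs. potnorm s t v) * norm f"
      using xs gain_nonneg by (intro mult_nonneg_nonneg prod_list_map_nonneg potnorm_nonneg) auto
    ultimately show ?thesis by simp
  next
    case False
    let ?sh = "\<lambda>v \<tau>. v (\<tau> + s)"
    have sh: "?sh v \<in> Cc_infinity" "set (map ?sh vs) \<subseteq> Cc_infinity" using v Cc_infinity_shift by auto
    have "norm (W_smooth xs t s f) = norm (W_smooth (?sh v # map ?sh vs) (t - s) 0 (free_prop s f))"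
      using W_smooth_shift[of xs s t f] xs t by (simp add: Cons norm_free_prop)
    also have "\<dots> \<le> potnorm 0 (t - s) (?sh v) * (gain 0 (t - s) ^ length (map ?sh vs) * (\<Prod>v\<leftarrow>map ?sh vs. potnorm 0 (t - s) v) * norm (free_prop s f))"
      using False t by (intro W_smooth_bound_0[OF sh]) auto
    also have "(\<Prod>v\<leftarrow>map ?sh vs. potnorm 0 (t - s) v) = (\<Prod>v\<leftarrow>vs. potnorm s t v)"
    proof -
      have "map (potnorm 0 (t - s)) (map ?sh vs) = map (potnorm s t) vs"
        using v(2) potnorm_shift by auto
      then show ?thesis by (simp only:)
    qed
    also have "potnorm 0 (t - s) (?sh v) = potnorm s t v" by (rule potnorm_shift[OF v(1)])
    also have "gain 0 (t - s) = gain s t" by (simp add: gain_def)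
    finally show ?thesis by (simp add: Cons norm_free_prop ac_simps)
  qed
qed simp

text \<open>Entries are exchanged one at a time from the left; \<open>zs\<close> collects those
  already exchanged and varies in the induction. In each step one entry is a difference, and the
  remaining ones are bounded by \<open>M\<close>, whence the exponent one below the length.\<close>

lemma W_smooth_telescope:
  assumes "length xs = length ys" and t: "s \<le> t" "t \<le> s + 1" and M: "0 \<le> M"
    and "set zs \<subseteq> Cc_infinity" "set xs \<subseteq> Cc_infinity" "set ys \<subseteq> Cc_infinity"
    and "\<And>v. v \<in> set zs \<union> set xs \<union> set ys \<Longrightarrow> potnorm s t v \<le> M"
  shows "norm (W_smooth (zs @ xs) t s f - W_smooth (zs @ ys) t s f) \<le>
    gain s t ^ (length (zs @ xs) - 1) * M ^ (length (zs @ xs) - 1) *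
      (\<Sum>(x, y)\<leftarrow>zip xs ys. potnorm s t (\<lambda>\<tau> z. x \<tau> z - y \<tau> z)) * norm f"
  using assms(1) assms(5-)
proof (induction xs ys arbitrary: zs rule: list_induct2)
  case (Cons x xs y ys)
  let ?d = "\<lambda>\<tau> z. x \<tau> z - y \<tau> z" and ?L = "length zs + length xs"
  have d: "?d \<in> Cc_infinity" using Cons.prems by (intro Cc_infinity_diff) auto
  have e1: "W_smooth (zs @ x # xs) t s f - W_smooth (zs @ y # xs) t s f = W_smooth (zs @ ?d # xs) t s f"
    using Cons.prems by (intro W_smooth_diff[symmetric]) auto
  have "norm (W_smooth (zs @ ?d # xs) t s f) \<le> gain s t ^ (length (zs @ ?d # xs) - 1) * (\<Prod>v\<leftarrow>zs @ ?d # xs. potnorm s t v) * norm f"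
    using Cons.prems d t by (intro W_smooth_bound) auto
  also have "length (zs @ ?d # xs) - 1 = ?L" by simp
  also have "gain s t ^ ?L * (\<Prod>v\<leftarrow>zs @ ?d # xs. potnorm s t v) * norm f \<le> gain s t ^ ?L * (M ^ ?L * potnorm s t ?d) * norm f"
  proof -
    have nn: "0 \<le> potnorm s t v" if "v \<in> set zs \<union> set xs" for v
      using that Cons.prems by (intro potnorm_nonneg) auto
    have "(\<Prod>v\<leftarrow>zs. potnorm s t v) * (\<Prod>v\<leftarrow>xs. potnorm s t v) \<le> M ^ length zs * M ^ length xs"
      using Cons.prems M nn by (intro mult_mono prod_list_map_le_power prod_list_map_nonneg zero_le_power) auto
    then have "(\<Prod>v\<leftarrow>zs. potnorm s t v) * (\<Prod>v\<leftarrow>xs. potnorm s t v) * potnorm s t ?d \<le> M ^ length zs * M ^ length xs * potnorm s t ?d"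
      by (intro mult_right_mono potnorm_nonneg d)
    then have "(\<Prod>v\<leftarrow>zs @ ?d # xs. potnorm s t v) \<le> M ^ ?L * potnorm s t ?d"
      by (simp add: power_add ac_simps)
    then show ?thesis by (intro mult_right_mono mult_left_mono zero_le_power gain_nonneg norm_ge_zero)
  qed
  finally have 1: "norm (W_smooth (zs @ x # xs) t s f - W_smooth (zs @ y # xs) t s f) \<le> gain s t ^ ?L * M ^ ?L * potnorm s t ?d * norm f"
    unfolding e1 by (simp add: mult.assoc)
  have 2: "norm (W_smooth ((zs @ [y]) @ xs) t s f - W_smooth ((zs @ [y]) @ ys) t s f) \<le>
    gain s t ^ (length ((zs @ [y]) @ xs) - 1) * M ^ (length ((zs @ [y]) @ xs) - 1) *
      (\<Sum>(x, y)\<leftarrow>zip xs ys. potnorm s t (\<lambda>\<tau> z. x \<tau> z - y \<tau> z)) * norm f"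
    using Cons.prems by (intro Cons.IH) auto
  have "norm (W_smooth (zs @ x # xs) t s f - W_smooth (zs @ y # ys) t s f) \<le>
    norm (W_smooth (zs @ x # xs) t s f - W_smooth (zs @ y # xs) t s f) + norm (W_smooth (zs @ y # xs) t s f - W_smooth (zs @ y # ys) t s f)"
    by (rule norm_diff_triangle_le[OF order_refl order_refl])
  moreover have L: "length ((zs @ [y]) @ xs) - 1 = ?L" "length (zs @ x # xs) - 1 = ?L" by simp_all
  ultimately have "norm (W_smooth (zs @ x # xs) t s f - W_smooth (zs @ y # ys) t s f) \<le>
    gain s t ^ ?L * M ^ ?L * potnorm s t ?d * norm f +
    gain s t ^ ?L * M ^ ?L * (\<Sum>(x, y)\<leftarrow>zip xs ys. potnorm s t (\<lambda>\<tau> z. x \<tau> z - y \<tau> z)) * norm f"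
    using 1 2[unfolded L, unfolded append_assoc append_Cons append_Nil] by linarith
  then show ?case unfolding L by (simp add: distrib_left distrib_right)
qed simp

lemma potnorm_approx:
  assumes V: "V \<in> pspace s t" and x: "x \<in> Cc_infinity" and y: "y \<in> Cc_infinity"
  shows "potnorm s t (\<lambda>\<tau> z. x \<tau> z - y \<tau> z) \<le>
      pnorm s t (\<lambda>\<tau> \<phi>. distr_of (x \<tau>) \<phi> - V \<tau> \<phi>) + pnorm s t (\<lambda>\<tau> \<phi>. distr_of (y \<tau>) \<phi> - V \<tau> \<phi>)"
    "\<bar>potnorm s t x - pnorm s t V\<bar> \<le> pnorm s t (\<lambda>\<tau> \<phi>. distr_of (x \<tau>) \<phi> - V \<tau> \<phi>)"
proof -
  have r: "- 1 / 2 + \<delta> \<le> 1" using \<delta> by simp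
  obtain w where w: "strip_fourier (- 1 / 2 + \<delta>) s t V w" using V by (auto simp: L2Hs_iff)
  note X = Cc_strip_fourier[OF x r, of s t] and Y = Cc_strip_fourier[OF y r, of s t]
  note D = Cc_strip_fourier[OF Cc_infinity_diff[OF x y] r, of s t]
  have sq: "sqint (strip_measure (- 1 / 2 + \<delta>) s t) u" if "strip_fourier (- 1 / 2 + \<delta>) s t U u" for U u
    using that by (simp add: strip_fourier_def)
  have "fourier (\<lambda>z. x \<tau> z - y \<tau> z) \<xi> = fourier (x \<tau>) \<xi> - fourier (y \<tau>) \<xi>" for \<tau> \<xi>
    by (intro fourier_diff schwartz_integrable Cc_infinity_schwartz x y)
  then show "potnorm s t (\<lambda>\<tau> z. x \<tau> z - y \<tau> z) \<le>
      pnorm s t (\<lambda>\<tau> \<phi>. distr_of (x \<tau>) \<phi> - V \<tau> \<phi>) + pnorm s t (\<lambda>\<tau> \<phi>. distr_of (y \<tau>) \<phi> - V \<tau> \<phi>)"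
    unfolding L2Hs_norm_eq[OF D] L2Hs_norm_eq[OF strip_fourier_diff[OF X w]] L2Hs_norm_eq[OF strip_fourier_diff[OF Y w]]
    using l2norm_diff_triangle[OF sq[OF X] sq[OF w] sq[OF Y]]
    by (simp add: l2norm_minus_commute[of _ w])
  show "\<bar>potnorm s t x - pnorm s t V\<bar> \<le> pnorm s t (\<lambda>\<tau> \<phi>. distr_of (x \<tau>) \<phi> - V \<tau> \<phi>)"
    unfolding L2Hs_norm_eq[OF X] L2Hs_norm_eq[OF w] L2Hs_norm_eq[OF strip_fourier_diff[OF X w]]
    by (rule l2norm_diff_le[OF sq[OF X] sq[OF w]])
qed

section \<open>Extension to rough potentials\<close>

definition approx_err :: "real \<Rightarrow> real \<Rightarrow> (nat \<Rightarrow> (real \<Rightarrow> real \<Rightarrow> complex) list) \<Rightarrow> (real \<Rightarrow> distr) list \<Rightarrow> nat \<Rightarrow> real" where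
  "approx_err s t X Vs k = (\<Sum>j<length Vs. pnorm s t (\<lambda>\<tau> \<phi>. distr_of ((X k ! j) \<tau>) \<phi> - (Vs ! j) \<tau> \<phi>))"

lemma approx_err_tendsto: "approximates (- 1 / 2 + \<delta>) s t X Vs \<Longrightarrow> approx_err s t X Vs \<longlonglongrightarrow> 0"
  unfolding approx_err_def[abs_def] approximates_def by (intro tendsto_null_sum) auto

text \<open>Two sequences at two independent indices: with equal sequences this is a Cauchy
  estimate, with equal indices it shows that different sequences share their limit. Errors of at
  most 1 keep all approximating potentials below the common bound \<open>M\<close>, the sum of the
  limiting norms plus 1.\<close>

lemma approx_compare:
  assumes X: "approximates (- 1 / 2 + \<delta>) s t X Vs" and Y: "approximates (- 1 / 2 + \<delta>) s t Y Vs"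
    and Vs: "set Vs \<subseteq> pspace s t" and t: "s \<le> t" "t \<le> s + 1"
  obtains K where "0 \<le> K" "\<And>k l. approx_err s t X Vs k \<le> 1 \<Longrightarrow> approx_err s t Y Vs l \<le> 1 \<Longrightarrow>
    norm (W_smooth (X k) t s f - W_smooth (Y l) t s f) \<le> K * (approx_err s t X Vs k + approx_err s t Y Vs l)"
proof -
  let ?n = "length Vs" and ?N = "pnorm s t"
  define M where "M = (\<Sum>j<?n. ?N (Vs ! j)) + 1"
  have Vn: "0 \<le> ?N (Vs ! j)" if "j < ?n" for j using that Vs by (intro L2Hs_norm_nonneg) auto
  have M: "0 \<le> M" unfolding M_def using Vn by (intro add_nonneg_nonneg sum_nonneg) auto
  define K where "K = gain s t ^ (?n - 1) * M ^ (?n - 1) * norm f"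
  have K: "0 \<le> K" unfolding K_def using M gain_nonneg by simp
  have pot: "potnorm s t v \<le> M" if Z: "approximates (- 1 / 2 + \<delta>) s t Z Vs" and e: "approx_err s t Z Vs k \<le> 1" and v: "v \<in> set (Z k)" for Z k v
  proof -
    have Zk: "length (Z k) = ?n" "set (Z k) \<subseteq> Cc_infinity" using Z by (auto simp: approximates_def)
    obtain j where j: "j < ?n" "v = Z k ! j" using v Zk by (auto simp: in_set_conv_nth)
    let ?e = "\<lambda>j. ?N (\<lambda>\<tau> \<phi>. distr_of ((Z k ! j) \<tau>) \<phi> - (Vs ! j) \<tau> \<phi>)"
    have en: "0 \<le> ?e i" if "i < ?n" for i
      using that Vs Zk by (intro L2Hs_norm_nonneg L2Hs_diff Cc_L2Hs) auto
    have "?e j \<le> approx_err s t Z Vs k" unfolding approx_err_def using j en by (intro member_le_sum) auto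
    moreover have "?N (Vs ! j) \<le> (\<Sum>j<?n. ?N (Vs ! j))" using j Vn by (intro member_le_sum) auto
    moreover have "potnorm s t v \<le> ?N (Vs ! j) + ?e j"
    proof -
      have "Vs ! j \<in> pspace s t" "v \<in> Cc_infinity" using j Vs Zk v by auto
      from potnorm_approx(2)[OF this(1,2,2)] show ?thesis using j(2) by simp
    qed
    ultimately show ?thesis using e by (simp add: M_def)
  qed
  have "norm (W_smooth (X k) t s f - W_smooth (Y l) t s f) \<le> K * (approx_err s t X Vs k + approx_err s t Y Vs l)"
    if e: "approx_err s t X Vs k \<le> 1" "approx_err s t Y Vs l \<le> 1" for k l
  proof -
    have Xk: "length (X k) = ?n" "set (X k) \<subseteq> Cc_infinity" and Yl: "length (Y l) = ?n" "set (Y l) \<subseteq> Cc_infinity"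
      using X Y by (auto simp: approximates_def)
    let ?S = "\<Sum>(x, y)\<leftarrow>zip (X k) (Y l). potnorm s t (\<lambda>\<tau> z. x \<tau> z - y \<tau> z)"
    have "norm (W_smooth ([] @ X k) t s f - W_smooth ([] @ Y l) t s f) \<le>
      gain s t ^ (length ([] @ X k) - 1) * M ^ (length ([] @ X k) - 1) * ?S * norm f"
      using pot[OF X e(1)] pot[OF Y e(2)] Xk Yl t M by (intro W_smooth_telescope) auto
    then have "norm (W_smooth (X k) t s f - W_smooth (Y l) t s f) \<le> K * ?S" by (simp add: K_def Xk ac_simps)
    also have "?S = (\<Sum>j<?n. potnorm s t (\<lambda>\<tau> z. (X k ! j) \<tau> z - (Y l ! j) \<tau> z))"
      by (simp add: sum_list_sum_nth Xk Yl atLeast0LessThan)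
    also have "\<dots> \<le> approx_err s t X Vs k + approx_err s t Y Vs l"
      unfolding approx_err_def sum.distrib[symmetric]
      using Vs Xk Yl by (intro sum_mono potnorm_approx(1)) auto
    finally show ?thesis using K by (simp add: mult_left_mono)
  qed
  with K that show ?thesis by blast
qed

lemma W_smooth_approx_convergent:
  assumes X: "approximates (- 1 / 2 + \<delta>) s t X Vs"
    and Vs: "set Vs \<subseteq> pspace s t" and t: "s \<le> t" "t \<le> s + 1"
  obtains g where "\<And>Y. approximates (- 1 / 2 + \<delta>) s t Y Vs \<Longrightarrow> (\<lambda>k. W_smooth (Y k) t s f) \<longlonglongrightarrow> g"
proof -
  have ev: "eventually (\<lambda>k. approx_err s t Z Vs k < d) sequentially" if "approximates (- 1 / 2 + \<delta>) s t Z Vs" "0 < d" for Z d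
    using order_tendstoD(2)[OF approx_err_tendsto[OF that(1)] that(2)] .
  obtain K where K: "0 \<le> K" "\<And>k l. approx_err s t X Vs k \<le> 1 \<Longrightarrow> approx_err s t X Vs l \<le> 1 \<Longrightarrow>
    norm (W_smooth (X k) t s f - W_smooth (X l) t s f) \<le> K * (approx_err s t X Vs k + approx_err s t X Vs l)"
    using approx_compare[OF X X Vs t] by metis
  have "Cauchy (\<lambda>k. W_smooth (X k) t s f)"
  proof (rule CauchyI)
    fix e :: real assume e: "0 < e"
    \<comment> \<open>The minimum with 1 makes \<open>approx_compare\<close> applicable, and
      \<open>K + 1\<close> keeps the quotient defined when \<open>K\<close> is 0.\<close>
    define d where "d = min 1 (e / (2 * (K + 1)))"
    have d: "0 < d" using e K(1) by (simp add: d_def add_nonneg_pos)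
    obtain k0 where k0: "\<And>k. k \<ge> k0 \<Longrightarrow> approx_err s t X Vs k < d" using ev[OF X d] by (auto simp: eventually_sequentially)
    have "norm (W_smooth (X k) t s f - W_smooth (X l) t s f) < e" if kl: "k \<ge> k0" "l \<ge> k0" for k l
    proof -
      have "d \<le> 1" by (simp add: d_def)
      then have "norm (W_smooth (X k) t s f - W_smooth (X l) t s f) \<le> K * (approx_err s t X Vs k + approx_err s t X Vs l)"
        using k0[OF kl(1)] k0[OF kl(2)] by (intro K(2)) auto
      also have "\<dots> \<le> K * (2 * d)" using k0[OF kl(1)] k0[OF kl(2)] K(1) by (intro mult_left_mono) auto
      also have "\<dots> < (K + 1) * (2 * d)" using d by simp
      also have "\<dots> \<le> (K + 1) * (2 * (e / (2 * (K + 1))))" using K(1) by (intro mult_left_mono) (auto simp: d_def)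
      also have "\<dots> = e" using K(1) by (simp add: field_simps add_nonneg_eq_0_iff)
      finally show ?thesis .
    qed
    then show "\<exists>M. \<forall>m\<ge>M. \<forall>n\<ge>M. norm (W_smooth (X m) t s f - W_smooth (X n) t s f) < e" by blast
  qed
  then obtain g where g: "(\<lambda>k. W_smooth (X k) t s f) \<longlonglongrightarrow> g" using Cauchy_convergent_iff convergent_def by metis
  have "(\<lambda>k. W_smooth (Y k) t s f) \<longlonglongrightarrow> g" if Y: "approximates (- 1 / 2 + \<delta>) s t Y Vs" for Y
  proof -
    obtain L where L: "\<And>k l. approx_err s t Y Vs k \<le> 1 \<Longrightarrow> approx_err s t X Vs l \<le> 1 \<Longrightarrow>
      norm (W_smooth (Y k) t s f - W_smooth (X l) t s f) \<le> L * (approx_err s t Y Vs k + approx_err s t X Vs l)"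
      using approx_compare[OF Y X Vs t] by metis
    have "(\<lambda>k. W_smooth (Y k) t s f - W_smooth (X k) t s f) \<longlonglongrightarrow> 0"
    proof (rule Lim_null_comparison)
      show "\<forall>\<^sub>F k in sequentially. norm (W_smooth (Y k) t s f - W_smooth (X k) t s f) \<le> L * (approx_err s t Y Vs k + approx_err s t X Vs k)"
        using ev[OF X zero_less_one] ev[OF Y zero_less_one] by eventually_elim (intro L, auto)
      show "(\<lambda>k. L * (approx_err s t Y Vs k + approx_err s t X Vs k)) \<longlonglongrightarrow> 0"
        using tendsto_mult_right_zero[OF tendsto_add_zero[OF approx_err_tendsto[OF Y] approx_err_tendsto[OF X]]] .
    qed
    from tendsto_add[OF this g] show ?thesis by simp
  qed
  with that show ?thesis by blast
qed

text \<open>One choice of approximations for all potentials at once, so that the approximating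
  sequence of a list is a plain \<open>map\<close> over it.\<close>

lemma Cc_approx_family:
  "\<exists>A. \<forall>V. V \<in> pspace s t \<longrightarrow> (\<forall>k. A V k \<in> Cc_infinity) \<and>
      (\<lambda>k. pnorm s t (\<lambda>\<tau> \<phi>. distr_of (A V k \<tau>) \<phi> - V \<tau> \<phi>)) \<longlonglongrightarrow> 0"
proof -
  let ?P = "\<lambda>V X. V \<in> pspace s t \<longrightarrow> (\<forall>k. X k \<in> Cc_infinity) \<and>
      (\<lambda>k. pnorm s t (\<lambda>\<tau> \<phi>. distr_of (X k \<tau>) \<phi> - V \<tau> \<phi>)) \<longlonglongrightarrow> 0"
  have "\<exists>X. ?P V X" for V
  proof (cases "V \<in> pspace s t")
    case True
    have "- 1 / 2 + \<delta> \<le> 1" using \<delta> by simp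
    show ?thesis
    proof (rule Cc_infinity_dense[OF True \<open>- 1 / 2 + \<delta> \<le> 1\<close>])
      fix X assume "\<And>k. X k \<in> Cc_infinity"
        "(\<lambda>k. pnorm s t (\<lambda>\<tau> \<phi>. distr_of (X k \<tau>) \<phi> - V \<tau> \<phi>)) \<longlonglongrightarrow> 0"
      then show "\<exists>X. ?P V X" by (intro exI[of _ X]) simp
    qed
  qed simp
  then show ?thesis by (intro choice allI)
qed

lemma approximates_append:
  assumes "approximates r s t X Vs" "approximates r s t Y Us"
  shows "approximates r s t (\<lambda>k. X k @ Y k) (Vs @ Us)"
  using assms unfolding approximates_def by (auto simp: nth_append)

lemma approximates_single:
  assumes "\<And>k. F k \<in> Cc_infinity" "(\<lambda>k. L2Hs_norm r s t (\<lambda>\<tau> \<phi>. distr_of (F k \<tau>) \<phi> - V \<tau> \<phi>)) \<longlonglongrightarrow> 0"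
  shows "approximates r s t (\<lambda>k. [F k]) [V]"
  using assms unfolding approximates_def by auto

lemma approximates_map:
  assumes "\<And>V k. V \<in> set Vs \<Longrightarrow> A V k \<in> Cc_infinity"
    "\<And>V. V \<in> set Vs \<Longrightarrow> (\<lambda>k. L2Hs_norm r s t (\<lambda>\<tau> \<phi>. distr_of (A V k \<tau>) \<phi> - V \<tau> \<phi>)) \<longlonglongrightarrow> 0"
  shows "approximates r s t (\<lambda>k. map (\<lambda>V. A V k) Vs) Vs"
  using assms unfolding approximates_def by auto

text \<open>Reconciles the two branches in the definition of \<open>W\<close>. Smooth
  representatives form a constant approximating sequence, so the first branch has the same limit as
  all other sequences; in the second branch the given \<open>X\<close> makes the limit unique, and
  \<open>THE\<close> is well defined.\<close>

theorem W_tendsto: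
  assumes X: "approximates (- 1 / 2 + \<delta>) s t X Vs"
    and Vs: "set Vs \<subseteq> pspace s t" and t: "s \<le> t" "t \<le> s + 1"
  shows "(\<lambda>k. W_smooth (X k) t s f) \<longlonglongrightarrow> W \<delta> Vs t s f"
proof -
  obtain g where g: "\<And>Y. approximates (- 1 / 2 + \<delta>) s t Y Vs \<Longrightarrow> (\<lambda>k. W_smooth (Y k) t s f) \<longlonglongrightarrow> g"
    using W_smooth_approx_convergent[OF assms] by metis
  have "W \<delta> Vs t s f = g"
  proof (cases "\<exists>vs. represents s t vs Vs")
    case True
    then obtain vs where vs: "represents s t vs Vs" by blast
    have len: "length vs = length Vs" and Cc: "set vs \<subseteq> Cc_infinity"
      using vs by (auto simp: represents_def list_all2_conv_all_nth in_set_conv_nth)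
    have "pnorm s t (\<lambda>\<tau> \<phi>. distr_of ((vs ! j) \<tau>) \<phi> - (Vs ! j) \<tau> \<phi>) = 0" if j: "j < length Vs" for j
    proof -
      let ?Z = "\<lambda>(\<tau>::real) (\<phi>::real \<Rightarrow> complex). 0::complex"
      have Z: "strip_fourier (- 1 / 2 + \<delta>) s t ?Z (\<lambda>p. 0)"
        by (auto simp: strip_fourier_def has_fourier_def)
      have "AE \<tau> in lborel. \<tau> \<in> {s..t} \<longrightarrow> (\<forall>\<phi>\<in>schwartz. (Vs ! j) \<tau> \<phi> = distr_of ((vs ! j) \<tau>) \<phi>)"
        using vs j len by (auto simp: represents_def list_all2_conv_all_nth)
      then have "AE \<tau> in lborel. \<tau> \<in> {s..t} \<longrightarrow> (\<forall>\<phi>\<in>schwartz. ?Z \<tau> (fourier \<phi>) = distr_of ((vs ! j) \<tau>) (fourier \<phi>) - (Vs ! j) \<tau> (fourier \<phi>))"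
        by eventually_elim (auto simp: schwartz_fourier)
      from strip_fourier_cong[OF this Z] show ?thesis by (simp add: L2Hs_norm_eq)
    qed
    then have "approximates (- 1 / 2 + \<delta>) s t (\<lambda>k. vs) Vs"
      using len Cc by (simp add: approximates_def)
    from g[OF this] have "W_smooth vs t s f = g" by (simp add: LIMSEQ_const_iff)
    then show ?thesis using W_represents[OF vs] by simp
  next
    case False
    then have "W \<delta> Vs t s f = (THE g. \<forall>X. approximates (- 1 / 2 + \<delta>) s t X Vs \<longrightarrow> (\<lambda>k. W_smooth (X k) t s f) \<longlonglongrightarrow> g)"
      by (simp add: W_def)
    also have "\<dots> = g"
      by (rule the_equality) (use g X LIMSEQ_unique in blast)+
    finally show ?thesis .
  qed
  then show ?thesis using g[OF X] by simp
qed

lemma W_bound: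
  assumes Vs: "set Vs \<subseteq> pspace s t" and t: "s \<le> t" "t \<le> s + 1"
  shows "norm (W \<delta> Vs t s f) \<le> gain s t ^ (length Vs - 1) * (\<Prod>V\<leftarrow>Vs. pnorm s t V) * norm f"
proof -
  from Cc_approx_family[of s t] obtain A where A0: "\<forall>V. V \<in> pspace s t \<longrightarrow> (\<forall>k. A V k \<in> Cc_infinity) \<and>
      (\<lambda>k. pnorm s t (\<lambda>\<tau> \<phi>. distr_of (A V k \<tau>) \<phi> - V \<tau> \<phi>)) \<longlonglongrightarrow> 0" ..
  have A: "\<And>V k. V \<in> pspace s t \<Longrightarrow> A V k \<in> Cc_infinity"
    "\<And>V. V \<in> pspace s t \<Longrightarrow>
      (\<lambda>k. pnorm s t (\<lambda>\<tau> \<phi>. distr_of (A V k \<tau>) \<phi> - V \<tau> \<phi>)) \<longlonglongrightarrow> 0"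
    using A0 by simp_all
  let ?X = "\<lambda>k. map (\<lambda>V. A V k) Vs"
  have X: "approximates (- 1 / 2 + \<delta>) s t ?X Vs" using A Vs by (intro approximates_map) auto
  have "(\<lambda>k. potnorm s t (A V k)) \<longlonglongrightarrow> pnorm s t V" if V: "V \<in> set Vs" for V
  proof (rule LIM_zero_cancel, rule Lim_null_comparison[OF always_eventually A(2)], intro allI)
    show "V \<in> pspace s t" using V Vs by auto
    then show "norm (potnorm s t (A V k) - pnorm s t V) \<le> pnorm s t (\<lambda>\<tau> \<phi>. distr_of (A V k \<tau>) \<phi> - V \<tau> \<phi>)" for k
      using potnorm_approx(2)[of V s t "A V k" "A V k"] A(1) by simp
  qed
  then have "(\<lambda>k. \<Prod>V\<leftarrow>Vs. potnorm s t (A V k)) \<longlonglongrightarrow> (\<Prod>V\<leftarrow>Vs. pnorm s t V)"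
    by (rule prod_list_map_tendsto)
  then have lim: "(\<lambda>k. gain s t ^ (length Vs - 1) * (\<Prod>V\<leftarrow>Vs. potnorm s t (A V k)) * norm f) \<longlonglongrightarrow>
      gain s t ^ (length Vs - 1) * (\<Prod>V\<leftarrow>Vs. pnorm s t V) * norm f"
    by (intro tendsto_mult tendsto_const)
  have "norm (W_smooth (?X k) t s f) \<le> gain s t ^ (length Vs - 1) * (\<Prod>V\<leftarrow>Vs. potnorm s t (A V k)) * norm f" for k
  proof -
    have "set (?X k) \<subseteq> Cc_infinity" using A(1) Vs by auto
    from W_smooth_bound[OF this t, of f] show ?thesis by (simp add: comp_def)
  qed
  then show ?thesis
    by (intro LIMSEQ_le[OF tendsto_norm[OF W_tendsto[OF X Vs t]] lim]) auto
qed

lemma W_linear: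
  assumes Vs: "set Vs \<subseteq> pspace s t" and t: "s \<le> t" "t \<le> s + 1"
  shows "bounded_linear (W \<delta> Vs t s)"
proof -
  from Cc_approx_family[of s t] obtain A where A0: "\<forall>V. V \<in> pspace s t \<longrightarrow> (\<forall>k. A V k \<in> Cc_infinity) \<and>
      (\<lambda>k. pnorm s t (\<lambda>\<tau> \<phi>. distr_of (A V k \<tau>) \<phi> - V \<tau> \<phi>)) \<longlonglongrightarrow> 0" ..
  have A: "\<And>V k. V \<in> pspace s t \<Longrightarrow> A V k \<in> Cc_infinity"
    "\<And>V. V \<in> pspace s t \<Longrightarrow>
      (\<lambda>k. pnorm s t (\<lambda>\<tau> \<phi>. distr_of (A V k \<tau>) \<phi> - V \<tau> \<phi>)) \<longlonglongrightarrow> 0"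
    using A0 by simp_all
  let ?X = "\<lambda>k. map (\<lambda>V. A V k) Vs"
  have X: "approximates (- 1 / 2 + \<delta>) s t ?X Vs" using A Vs by (intro approximates_map) auto
  have Cc: "set (?X k) \<subseteq> Cc_infinity" for k using A(1) Vs by auto
  note lim = W_tendsto[OF X Vs t]
  show ?thesis
  proof (rule bounded_linear_intro)
    fix f g :: L2 and c :: real
    show "W \<delta> Vs t s (f + g) = W \<delta> Vs t s f + W \<delta> Vs t s g"
      using LIMSEQ_unique[OF lim[of "f + g"]] tendsto_add[OF lim[of f] lim[of g]] by (simp add: W_smooth_linear[OF Cc])
    show "W \<delta> Vs t s (c *\<^sub>R f) = c *\<^sub>R W \<delta> Vs t s f"
      using LIMSEQ_unique[OF lim[of "c *\<^sub>R f"]] tendsto_scaleR[OF tendsto_const lim[of f], of c] by (simp add: W_smooth_linear[OF Cc])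
    show "norm (W \<delta> Vs t s f) \<le> norm f * (gain s t ^ (length Vs - 1) * (\<Prod>V\<leftarrow>Vs. pnorm s t V))"
      using W_bound[OF Vs t, of f] by (simp add: ac_simps)
  qed
qed

text \<open>Differences of approximations of \<open>P\<close> and \<open>Q\<close> approximate the
  difference, and the identity for smooth potentials passes to the limit. As
  \<open>W_tendsto\<close> holds in both branches of \<open>W\<close>, it makes no difference that
  \<open>P - Q\<close> may be smooth while \<open>P\<close> and \<open>Q\<close> are rough.\<close>

lemma W_diff:
  assumes Vs: "set Vs \<subseteq> pspace s t" and Us: "set Us \<subseteq> pspace s t"
    and P: "P \<in> pspace s t" and Q: "Q \<in> pspace s t" and t: "s \<le> t" "t \<le> s + 1"
  shows "W \<delta> (Vs @ (\<lambda>\<tau> \<phi>. P \<tau> \<phi> - Q \<tau> \<phi>) # Us) t s f = W \<delta> (Vs @ P # Us) t s f - W \<delta> (Vs @ Q # Us) t s f"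
proof -
  let ?N = "pnorm s t" and ?D = "\<lambda>\<tau> \<phi>. P \<tau> \<phi> - Q \<tau> \<phi>"
  have r: "- 1 / 2 + \<delta> \<le> 1" using \<delta> by simp
  from Cc_approx_family[of s t] obtain A where A0: "\<forall>V. V \<in> pspace s t \<longrightarrow> (\<forall>k. A V k \<in> Cc_infinity) \<and>
      (\<lambda>k. pnorm s t (\<lambda>\<tau> \<phi>. distr_of (A V k \<tau>) \<phi> - V \<tau> \<phi>)) \<longlonglongrightarrow> 0" ..
  have A: "\<And>V k. V \<in> pspace s t \<Longrightarrow> A V k \<in> Cc_infinity"
    "\<And>V. V \<in> pspace s t \<Longrightarrow>
      (\<lambda>k. pnorm s t (\<lambda>\<tau> \<phi>. distr_of (A V k \<tau>) \<phi> - V \<tau> \<phi>)) \<longlonglongrightarrow> 0"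
    using A0 by simp_all
  let ?X = "\<lambda>k. map (\<lambda>V. A V k) Vs" and ?Y = "\<lambda>k. map (\<lambda>V. A V k) Us"
  have X: "approximates (- 1 / 2 + \<delta>) s t ?X Vs" and Y: "approximates (- 1 / 2 + \<delta>) s t ?Y Us"
    using A Vs Us by (auto intro!: approximates_map)
  have Cc: "set (?X k) \<subseteq> Cc_infinity" "set (?Y k) \<subseteq> Cc_infinity" "A P k \<in> Cc_infinity" "A Q k \<in> Cc_infinity" for k
    using A(1) Vs Us P Q by auto
  let ?d = "\<lambda>k \<tau> x. A P k \<tau> x - A Q k \<tau> x"
  have "(\<lambda>k. ?N (\<lambda>\<tau> \<phi>. distr_of (?d k \<tau>) \<phi> - ?D \<tau> \<phi>)) \<longlonglongrightarrow> 0"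
  proof (rule Lim_null_comparison[OF always_eventually tendsto_add_zero[OF A(2)[OF P] A(2)[OF Q]]], intro allI)
    fix k
    let ?E = "\<lambda>R \<tau> \<phi>. distr_of (A R k \<tau>) \<phi> - R \<tau> \<phi>"
    have E: "?E P \<in> pspace s t" "?E Q \<in> pspace s t" by (intro L2Hs_diff Cc_L2Hs Cc P Q)+
    have "distr_of (A P k \<tau>) \<psi> - distr_of (A Q k \<tau>) \<psi> = distr_of (?d k \<tau>) \<psi>" if "\<psi> \<in> schwartz" for \<tau> \<psi>
    proof -
      have "integrable lborel (\<lambda>x. A P k \<tau> x * \<psi> x)" "integrable lborel (\<lambda>x. A Q k \<tau> x * \<psi> x)"
        by (intro schwartz_integrable schwartz_mult Cc_infinity_schwartz Cc that)+
      then show ?thesis by (simp add: distr_of_def left_diff_distrib)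
    qed
    \<comment> \<open>\<open>distr_of\<close> is additive only where its integrals converge, hence
      the restriction to Schwartz functions and the passage through
      \<open>L2Hs_cong\<close>.\<close>
    then have ae: "AE \<tau> in lborel. \<tau> \<in> {s..t} \<longrightarrow> (\<forall>\<phi>\<in>schwartz. ?E P \<tau> (fourier \<phi>) - ?E Q \<tau> (fourier \<phi>) = distr_of (?d k \<tau>) (fourier \<phi>) - ?D \<tau> (fourier \<phi>))"
      by (auto simp: schwartz_fourier algebra_simps)
    have "?N (\<lambda>\<tau> \<phi>. distr_of (?d k \<tau>) \<phi> - ?D \<tau> \<phi>) = ?N (\<lambda>\<tau> \<phi>. ?E P \<tau> \<phi> - ?E Q \<tau> \<phi>)"
      by (rule L2Hs_cong(2)[OF ae L2Hs_diff(1)[OF E]])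
    moreover have "0 \<le> ?N (\<lambda>\<tau> \<phi>. ?E P \<tau> \<phi> - ?E Q \<tau> \<phi>)" by (rule L2Hs_norm_nonneg[OF L2Hs_diff(1)[OF E]])
    ultimately show "norm (?N (\<lambda>\<tau> \<phi>. distr_of (?d k \<tau>) \<phi> - ?D \<tau> \<phi>)) \<le> ?N (?E P) + ?N (?E Q)"
      using L2Hs_diff(2)[OF E] by simp
  qed
  from approximates_append[OF X approximates_append[OF approximates_single[OF Cc_infinity_diff[OF Cc(3) Cc(4)] this] Y]]
  have 1: "approximates (- 1 / 2 + \<delta>) s t (\<lambda>k. ?X k @ ?d k # ?Y k) (Vs @ ?D # Us)" by simp
  have 2: "approximates (- 1 / 2 + \<delta>) s t (\<lambda>k. ?X k @ A R k # ?Y k) (Vs @ R # Us)" if "R \<in> pspace s t" for R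
    using approximates_append[OF X approximates_append[OF approximates_single[OF A(1)[OF that] A(2)[OF that]] Y]] by simp
  have "(\<lambda>k. W_smooth (?X k @ ?d k # ?Y k) t s f) \<longlonglongrightarrow> W \<delta> (Vs @ ?D # Us) t s f"
    using Vs Us L2Hs_diff(1)[OF P Q] by (intro W_tendsto[OF 1 _ t]) auto
  moreover have "(\<lambda>k. W_smooth (?X k @ ?d k # ?Y k) t s f) \<longlonglongrightarrow> W \<delta> (Vs @ P # Us) t s f - W \<delta> (Vs @ Q # Us) t s f"
    unfolding W_smooth_diff[OF Cc]
    using Vs Us P Q by (intro tendsto_diff W_tendsto[OF 2[OF P] _ t] W_tendsto[OF 2[OF Q] _ t]) auto
  ultimately show ?thesis by (rule LIMSEQ_unique)
qed

text \<open>The operator bound supplies one factor \<open>gain\<close> fewer than there are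
  potentials, so one norm of \<open>V\<close> remains outside the geometric factor.\<close>

lemma W_replicate_bound:
  assumes V: "V \<in> pspace s t" and t: "s \<le> t" "t \<le> s + 1"
    and small: "gain s t * pnorm s t V \<le> 1 / 2"
  shows "norm (W \<delta> (replicate (Suc n) V) t s f) \<le> (1 / 2) ^ n * pnorm s t V * norm f"
proof -
  let ?N = "pnorm s t V"
  have N: "0 \<le> ?N" by (rule L2Hs_norm_nonneg[OF V])
  have "norm (W \<delta> (replicate (Suc n) V) t s f) \<le> gain s t ^ n * (?N * ?N ^ n) * norm f"
    using W_bound[of "replicate (Suc n) V" s t f] V t by (simp add: set_replicate_conv_if)
  also have "gain s t ^ n * (?N * ?N ^ n) = (gain s t * ?N) ^ n * ?N" by (simp add: power_mult_distrib)
  also have "(gain s t * ?N) ^ n * ?N * norm f \<le> (1 / 2) ^ n * ?N * norm f"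
    using N gain_nonneg small by (intro mult_right_mono power_mono) auto
  finally show ?thesis .
qed

lemma gain_norm_mono:
  assumes V: "V \<in> pspace a b" and t: "a \<le> s" "s \<le> t" "t \<le> b"
  shows "gain s t * pnorm s t V \<le> gain a b * pnorm a b V"
proof (rule mult_mono[OF _ L2Hs_subinterval(2)[OF V t(1,3)] gain_nonneg L2Hs_norm_nonneg[OF L2Hs_subinterval(1)[OF V t(1,3)]]])
  have "0 \<le> theta \<delta>" using \<delta> by (simp add: theta_def)
  then show "gain s t \<le> gain a b"
    unfolding gain_def using C t by (intro mult_left_mono powr_mono2) auto
qed

text \<open>With this threshold \<open>[0, T]\<close> itself is short enough under the smallness hypothesis of the theorem:
  the propagator is the Dyson series, and no composition along a partition is involved.\<close>

lemma dyson_threshold: "dyson_threshold \<delta> (1 / (2 * C))"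
  unfolding dyson_threshold_def
proof (intro conjI allI impI)
  show "0 < 1 / (2 * C)" using C by simp
  fix a b V s t
  assume "a \<le> b \<and> b - a \<le> 1 \<and> V \<in> pspace a b \<and>
    (b - a) powr theta \<delta> * pnorm a b V \<le> 1 / (2 * C)" and st: "a \<le> s \<and> s \<le> t \<and> t \<le> b"
  then have V: "V \<in> pspace a b" and t: "s \<le> t" "t \<le> s + 1"
    and le: "(b - a) powr theta \<delta> * pnorm a b V \<le> 1 / (2 * C)" by auto
  have V': "V \<in> pspace s t" using L2Hs_subinterval(1)[OF V] st by auto
  \<comment> \<open>The threshold \<open>1 / (2 * C)\<close> is chosen so that \<open>C\<close>
    cancels: it says that gain times norm is at most 1/2 on \<open>[a, b]\<close>, and monotonicity
    hands this on to every subinterval.\<close>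
  have "gain a b * pnorm a b V \<le> C * (1 / (2 * C))"
    unfolding gain_def mult.assoc using C le by (intro mult_left_mono) auto
  then have small: "gain s t * pnorm s t V \<le> 1 / 2"
    using gain_norm_mono[OF V, of s t] st C by simp
  show lin: "bounded_linear (W \<delta> (replicate n V) t s)" for n
    using V' t by (intro W_linear) (auto simp: set_replicate_conv_if)
  have "summable (\<lambda>n. onorm (W \<delta> (replicate (Suc n) V) t s))"
  proof (rule summable_comparison_test'[where N = 0])
    show "summable (\<lambda>n. (1 / 2) ^ n * pnorm s t V)"
      by (intro summable_mult2 summable_geometric) simp
    show "norm (onorm (W \<delta> (replicate (Suc n) V) t s)) \<le> (1 / 2) ^ n * pnorm s t V" for n
    proof -
      have "onorm (W \<delta> (replicate (Suc n) V) t s) \<le> (1 / 2) ^ n * pnorm s t V"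
        using L2Hs_norm_nonneg[OF V'] by (intro onorm_bound W_replicate_bound[OF V' t small]) simp
      then show ?thesis using onorm_pos_le[OF lin[of "Suc n"]] by (simp only: real_norm_def abs_of_nonneg)
    qed
  qed
  then show "summable (\<lambda>n. onorm (W \<delta> (replicate n V) t s))"
    by (subst summable_Suc_iff[symmetric])
qed

section \<open>The Dyson series and its densities\<close>

definition wave :: "L2 \<Rightarrow> (real \<Rightarrow> distr) list \<Rightarrow> real \<Rightarrow> L2" where
  "wave \<phi> Vs t = free_prop t (W \<delta> Vs t 0 \<phi>)"

lemma wave_sums:
  assumes T: "T \<le> 1" and V: "V \<in> pspace 0 T"
    and small: "gain 0 T * pnorm 0 T V \<le> 1 / 2" and t: "t \<in> {0..T}"
  shows "(\<lambda>n. wave \<phi> (replicate n V) t) sums schroedinger_prop \<delta> V t 0 \<phi>"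
proof -
  have V': "V \<in> pspace 0 t" using L2Hs_subinterval(1)[OF V] t by auto
  have small': "gain 0 t * pnorm 0 t V \<le> 1 / 2"
    using gain_norm_mono[OF V, of 0 t] t small by auto
  then have "(t - 0) powr theta \<delta> * pnorm 0 t V \<le> 1 / (2 * C)"
    using C by (simp add: gain_def field_simps)
  then have "dyson_small \<delta> V 0 t"
    unfolding dyson_small_def using dyson_threshold V' t T by auto
  then have eq: "schroedinger_prop \<delta> V t 0 \<phi> = free_prop t (\<Sum>n. W \<delta> (replicate (Suc n) V) t 0 \<phi>) + free_prop t \<phi>"
    by (simp add: schroedinger_prop_def dyson_series_def adjoint_free_prop free_prop_0)
  have "summable (\<lambda>n. W \<delta> (replicate (Suc n) V) t 0 \<phi>)"
  proof (rule summable_norm_cancel, rule summable_comparison_test'[where N = 0])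
    show "summable (\<lambda>n. (1 / 2) ^ n * pnorm 0 t V * norm \<phi>)"
      by (intro summable_mult2 summable_geometric) simp
    show "norm (norm (W \<delta> (replicate (Suc n) V) t 0 \<phi>)) \<le> (1 / 2) ^ n * pnorm 0 t V * norm \<phi>" for n
      using W_replicate_bound[OF V' _ _ small', of n \<phi>] t T by simp
  qed
  then have "(\<lambda>n. free_prop t (W \<delta> (replicate (Suc n) V) t 0 \<phi>)) sums free_prop t (\<Sum>n. W \<delta> (replicate (Suc n) V) t 0 \<phi>)"
    by (intro bounded_linear.sums[OF bounded_linear_free_prop] summable_sums)
  then have "(\<lambda>n. wave \<phi> (replicate (Suc n) V) t) sums free_prop t (\<Sum>n. W \<delta> (replicate (Suc n) V) t 0 \<phi>)"
    by (simp only: wave_def)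
  \<comment> \<open>\<open>dyson_series\<close> keeps the free evolution apart from the sum; here it
    returns as the term of order 0, the wave of the empty list.\<close>
  from sums_Suc[OF this] show ?thesis by (simp add: eq wave_def W_Nil)
qed

definition weight :: "real \<Rightarrow> (real \<Rightarrow> distr) list \<Rightarrow> real" where
  "weight T Vs = (\<Prod>V\<leftarrow>Vs. gain 0 T * pnorm 0 T V)"

lemma weight_eq: "weight T Vs = gain 0 T ^ length Vs * (\<Prod>V\<leftarrow>Vs. pnorm 0 T V)"
  by (induction Vs) (simp_all add: weight_def)

lemma wave_pair_estimate:
  assumes "0 < T" "T \<le> 1" "set Vs \<subseteq> pspace 0 T" "set Us \<subseteq> pspace 0 T"
  shows "(\<lambda>t. pair_density (wave \<phi> Vs t) (wave \<phi> Us t)) \<in> L2Hs (1 / 2) 0 T"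
    "L2Hs_norm (1 / 2) 0 T (\<lambda>t. pair_density (wave \<phi> Vs t) (wave \<phi> Us t)) \<le> (weight T Vs * norm \<phi>) * (weight T Us * norm \<phi>)"
  using pair_estimate[OF assms, of \<phi> \<phi>] by (simp_all add: wave_def weight_eq power_add ac_simps)

text \<open>Finite sums of waves are needed for the telescoped differences; singleton index sets
  cover a single wave. The triangle inequality over \<open>J \<times> I\<close> factorizes because
  the multilinear bound of a pair is a product.\<close>

lemma wave_sum_pair_estimate:
  assumes T: "0 < T" "T \<le> 1" and J: "finite J" and I: "finite I"
    and P: "\<And>j. j \<in> J \<Longrightarrow> set (P j) \<subseteq> pspace 0 T" and Q: "\<And>i. i \<in> I \<Longrightarrow> set (Q i) \<subseteq> pspace 0 T"
    and X: "\<And>t. t \<in> {0..T} \<Longrightarrow> X t = (\<Sum>j\<in>J. wave \<phi> (P j) t)" and Y: "\<And>t. t \<in> {0..T} \<Longrightarrow> Y t = (\<Sum>i\<in>I. wave \<phi> (Q i) t)"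
  shows "(\<lambda>t. pair_density (X t) (Y t)) \<in> L2Hs (1 / 2) 0 T"
    "L2Hs_norm (1 / 2) 0 T (\<lambda>t. pair_density (X t) (Y t)) \<le> (\<Sum>j\<in>J. weight T (P j) * norm \<phi>) * (\<Sum>i\<in>I. weight T (Q i) * norm \<phi>)"
proof -
  let ?R = "\<lambda>p t. pair_density (wave \<phi> (P (fst p)) t) (wave \<phi> (Q (snd p)) t)"
  have R: "?R p \<in> L2Hs (1 / 2) 0 T" "L2Hs_norm (1 / 2) 0 T (?R p) \<le> (weight T (P (fst p)) * norm \<phi>) * (weight T (Q (snd p)) * norm \<phi>)"
    if "p \<in> J \<times> I" for p
  proof -
    have p: "fst p \<in> J" "snd p \<in> I" using that by auto
    show "?R p \<in> L2Hs (1 / 2) 0 T" "L2Hs_norm (1 / 2) 0 T (?R p) \<le> (weight T (P (fst p)) * norm \<phi>) * (weight T (Q (snd p)) * norm \<phi>)"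
      by (rule wave_pair_estimate[OF T P[OF p(1)] Q[OF p(2)]])+
  qed
  have S: "(\<lambda>t \<psi>. \<Sum>p\<in>J \<times> I. ?R p t \<psi>) \<in> L2Hs (1 / 2) 0 T"
    "L2Hs_norm (1 / 2) 0 T (\<lambda>t \<psi>. \<Sum>p\<in>J \<times> I. ?R p t \<psi>) \<le> (\<Sum>p\<in>J \<times> I. L2Hs_norm (1 / 2) 0 T (?R p))"
    using L2Hs_sum[of "J \<times> I" ?R "1 / 2" 0 T] R(1) J I by auto
  have "pair_density (X t) (Y t) \<psi> = (\<Sum>p\<in>J \<times> I. ?R p t \<psi>)" if "\<psi> \<in> schwartz" "t \<in> {0..T}" for t \<psi>
  proof -
    have "pair_density (X t) (Y t) \<psi> = (\<Sum>j\<in>J. pair_density (wave \<phi> (P j) t) (Y t) \<psi>)"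
      unfolding X[OF that(2)]
      by (rule linear_sum[OF bounded_linear.linear[OF bounded_linear_pair_left[OF that(1)]]])
    also have "\<dots> = (\<Sum>j\<in>J. \<Sum>i\<in>I. pair_density (wave \<phi> (P j) t) (wave \<phi> (Q i) t) \<psi>)"
      unfolding Y[OF that(2)]
      by (intro sum.cong refl linear_sum[OF bounded_linear.linear[OF bounded_linear_pair_right[OF that(1)]]])
    also have "\<dots> = (\<Sum>p\<in>J \<times> I. ?R p t \<psi>)" by (simp add: sum.cartesian_product split_beta')
    finally show ?thesis .
  qed
  then have "AE t in lborel. t \<in> {0..T} \<longrightarrow> (\<forall>\<psi>\<in>schwartz. (\<Sum>p\<in>J \<times> I. ?R p t (fourier \<psi>)) = pair_density (X t) (Y t) (fourier \<psi>))"
    by (auto simp: schwartz_fourier)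
  note c = L2Hs_cong[OF this S(1)]
  show "(\<lambda>t. pair_density (X t) (Y t)) \<in> L2Hs (1 / 2) 0 T" by (rule c(1))
  have "L2Hs_norm (1 / 2) 0 T (\<lambda>t. pair_density (X t) (Y t)) \<le> (\<Sum>p\<in>J \<times> I. L2Hs_norm (1 / 2) 0 T (?R p))"
    using S(2) by (simp only: c(2))
  also have "\<dots> \<le> (\<Sum>p\<in>J \<times> I. (weight T (P (fst p)) * norm \<phi>) * (weight T (Q (snd p)) * norm \<phi>))"
    by (intro sum_mono R)
  also have "\<dots> = (\<Sum>j\<in>J. weight T (P j) * norm \<phi>) * (\<Sum>i\<in>I. weight T (Q i) * norm \<phi>)"
    by (simp add: sum_product sum.cartesian_product split_beta')
  finally show "L2Hs_norm (1 / 2) 0 T (\<lambda>t. pair_density (X t) (Y t)) \<le> (\<Sum>j\<in>J. weight T (P j) * norm \<phi>) * (\<Sum>i\<in>I. weight T (Q i) * norm \<phi>)" .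
qed

end

text \<open>The double series is summed in one argument at a time. The product form of the bounds
  lets the first summation leave \<open>A * b m\<close>, which is again summable.\<close>

lemma pair_density_sums:
  assumes XY: "\<And>n m. (\<lambda>t. pair_density (X n t) (Y m t)) \<in> L2Hs (1 / 2) 0 T"
    and le: "\<And>n m. L2Hs_norm (1 / 2) 0 T (\<lambda>t. pair_density (X n t) (Y m t)) \<le> a n * b m"
    and a: "a sums A" and b: "b sums B"
    and X: "\<And>t. t \<in> {0..T} \<Longrightarrow> (\<lambda>n. X n t) sums F t" and Y: "\<And>t. t \<in> {0..T} \<Longrightarrow> (\<lambda>m. Y m t) sums G t"
  shows "(\<lambda>t. pair_density (F t) (G t)) \<in> L2Hs (1 / 2) 0 T"
    "L2Hs_norm (1 / 2) 0 T (\<lambda>t. pair_density (F t) (G t)) \<le> A * B"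
proof -
  have s: "- 1 \<le> (1 / 2 :: real)" by simp
  have 1: "(\<lambda>t. pair_density (F t) (Y m t)) \<in> L2Hs (1 / 2) 0 T" "L2Hs_norm (1 / 2) 0 T (\<lambda>t. pair_density (F t) (Y m t)) \<le> A * b m" for m
  proof -
    have e: "(\<lambda>n. a n * b m) sums (A * b m)" using a by (rule sums_mult2)
    have "AE t in lborel. t \<in> {0..T} \<longrightarrow> (\<forall>\<psi>\<in>schwartz. (\<lambda>n. pair_density (X n t) (Y m t) (fourier \<psi>)) sums pair_density (F t) (Y m t) (fourier \<psi>))"
      using bounded_linear.sums[OF bounded_linear_pair_left X] schwartz_fourier by auto
    from L2Hs_suminf[OF XY le sums_summable[OF e] s this]
    show "(\<lambda>t. pair_density (F t) (Y m t)) \<in> L2Hs (1 / 2) 0 T" "L2Hs_norm (1 / 2) 0 T (\<lambda>t. pair_density (F t) (Y m t)) \<le> A * b m"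
      using sums_unique[OF e] by auto
  qed
  have e: "(\<lambda>m. A * b m) sums (A * B)" using b by (rule sums_mult)
  have "AE t in lborel. t \<in> {0..T} \<longrightarrow> (\<forall>\<psi>\<in>schwartz. (\<lambda>m. pair_density (F t) (Y m t) (fourier \<psi>)) sums pair_density (F t) (G t) (fourier \<psi>))"
    using bounded_linear.sums[OF bounded_linear_pair_right Y] schwartz_fourier by auto
  from L2Hs_suminf[OF 1 sums_summable[OF e] s this]
  show "(\<lambda>t. pair_density (F t) (G t)) \<in> L2Hs (1 / 2) 0 T" "L2Hs_norm (1 / 2) 0 T (\<lambda>t. pair_density (F t) (G t)) \<le> A * B"
    using sums_unique[OF e] by auto
qed

theorem proposition3p3:
  fixes \<delta> T C :: real and V V' :: "real \<Rightarrow> distr" and \<phi> :: L2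
  assumes "0 < \<delta>" "\<delta> < 1" "0 < T" "T \<le> 1"
    and "0 < C" "multilinear_estimate \<delta> C"
    and "V \<in> L2Hs (- 1 / 2 + \<delta>) 0 T" "V' \<in> L2Hs (- 1 / 2 + \<delta>) 0 T"
    and "C * T powr theta \<delta> *
           max (L2Hs_norm (- 1 / 2 + \<delta>) 0 T V) (L2Hs_norm (- 1 / 2 + \<delta>) 0 T V') \<le> 1 / 2"
  shows "let \<rho> = (\<lambda>t. position_density (schroedinger_prop \<delta> V t 0 \<phi>));
             \<rho>' = (\<lambda>t. position_density (schroedinger_prop \<delta> V' t 0 \<phi>))
         in \<rho> \<in> L2Hs (1 / 2) 0 T \<and>
            L2Hs_norm (1 / 2) 0 T \<rho> \<le> 4 * (norm \<phi>)\<^sup>2 \<and>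
            (\<lambda>t \<eta>. \<rho> t \<eta> - \<rho>' t \<eta>) \<in> L2Hs (1 / 2) 0 T \<and>
            L2Hs_norm (1 / 2) 0 T (\<lambda>t \<eta>. \<rho> t \<eta> - \<rho>' t \<eta>)
              \<le> 16 * C * T powr theta \<delta> *
                 L2Hs_norm (- 1 / 2 + \<delta>) 0 T (\<lambda>t \<eta>. V t \<eta> - V' t \<eta>) * (norm \<phi>)\<^sup>2"
proof -
  note est = assms(1,2,5,6)
  let ?N = "L2Hs_norm (- 1 / 2 + \<delta>) 0 T" and ?L = "L2Hs (- 1 / 2 + \<delta>) 0 T"
  let ?\<Delta> = "\<lambda>t \<eta>. V t \<eta> - V' t \<eta>"
  define g where "g = gain \<delta> C 0 T"
  have g: "g = C * T powr theta \<delta>" by (simp add: g_def gain_def[OF est])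
  have g0: "0 \<le> g" using gain_nonneg[OF est] by (simp add: g_def)
  note V = assms(7) and V' = assms(8)
  have \<Delta>: "?\<Delta> \<in> ?L" by (rule L2Hs_diff(1)[OF V V'])
  have N0: "0 \<le> ?N U" if "U \<in> ?L" for U by (rule L2Hs_norm_nonneg[OF that])
  have small: "g * ?N V \<le> 1 / 2" "g * ?N V' \<le> 1 / 2"
    using assms(9) mult_left_mono[OF max.cobounded1[of "?N V" "?N V'"] g0] mult_left_mono[OF max.cobounded2[of "?N V'" "?N V"] g0]
    unfolding g by linarith+
  let ?u = "\<lambda>U n t. wave \<delta> \<phi> (replicate n U) t" and ?S = "\<lambda>U t. schroedinger_prop \<delta> U t 0 \<phi>"
  \<comment> \<open>The list of length \<open>n + 1\<close> with the difference at position
    \<open>j\<close>, copies of \<open>V\<close> before it and of \<open>V'\<close> after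
    it.\<close>
  let ?P = "\<lambda>n j. replicate j V @ ?\<Delta> # replicate (n - j) V'"
  let ?d = "\<lambda>n t. ?u V (Suc n) t - ?u V' (Suc n) t"
  \<comment> \<open>\<open>?b\<close> bounds a single wave of order \<open>n\<close>.
    \<open>?a\<close> bounds the difference of order \<open>n + 1\<close>: it telescopes into
    \<open>n + 1\<close> waves, each with \<open>n\<close> factors of at most 1/2 and one factor
    from the difference of the potentials.\<close>
  let ?b = "\<lambda>n. (1 / 2) ^ n * norm \<phi>" and ?a = "\<lambda>n. real (Suc n) * (1 / 2) ^ n * (g * ?N ?\<Delta> * norm \<phi>)"
  have Ssums: "(\<lambda>n. ?u U n t) sums ?S U t" if "U \<in> {V, V'}" "t \<in> {0..T}" for U t
  proof -
    have "U \<in> ?L" "gain \<delta> C 0 T * ?N U \<le> 1 / 2" using that(1) V V' small by (auto simp: g_def)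
    from wave_sums[OF est assms(4) this that(2)] show ?thesis .
  qed
  \<comment> \<open>The terms of order 0 are the same free evolution and cancel, so the series of
    differences starts at order 1.\<close>
  have dsums: "(\<lambda>n. ?d n t) sums (?S V t - ?S V' t)" if "t \<in> {0..T}" for t
  proof -
    have "(\<lambda>n. ?u V n t - ?u V' n t) sums (?S V t - ?S V' t)" using that by (intro sums_diff Ssums) auto
    then show ?thesis
      by (intro iffD2[OF sums_Suc_iff[of "\<lambda>n. ?u V n t - ?u V' n t"]]) simp
  qed
  \<comment> \<open>The sum over a singleton matches the shape of
    \<open>wave_sum_pair_estimate\<close>.\<close>
  have wu: "(\<Sum>j\<in>{0::nat}. weight \<delta> C T (replicate n U) * norm \<phi>) \<le> ?b n" if "U \<in> {V, V'}" for U n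
  proof -
    have "weight \<delta> C T (replicate n U) = (g * ?N U) ^ n" by (simp add: weight_def[OF est] g_def)
    also have "\<dots> \<le> (1 / 2) ^ n" using that small g0 N0 V V' by (intro power_mono) auto
    finally show ?thesis by (simp add: mult_right_mono)
  qed
  have wd: "(\<Sum>j\<le>n. weight \<delta> C T (?P n j) * norm \<phi>) \<le> ?a n" for n
  proof -
    have "weight \<delta> C T (?P n j) * norm \<phi> \<le> (1 / 2) ^ n * (g * ?N ?\<Delta> * norm \<phi>)" if "j \<le> n" for j
    proof -
      have "weight \<delta> C T (?P n j) = ((g * ?N V) ^ j * (g * ?N V') ^ (n - j)) * (g * ?N ?\<Delta>)"
        by (simp add: weight_def[OF est] g_def ac_simps)
      also have "\<dots> \<le> ((1 / 2) ^ j * (1 / 2) ^ (n - j)) * (g * ?N ?\<Delta>)"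
        using small g0 N0[OF V] N0[OF V'] N0[OF \<Delta>] by (intro mult_right_mono mult_mono power_mono) auto
      also have "(1 / 2 :: real) ^ j * (1 / 2) ^ (n - j) = (1 / 2) ^ n" using that by (simp flip: power_add)
      finally have "weight \<delta> C T (?P n j) \<le> (1 / 2) ^ n * (g * ?N ?\<Delta>)" .
      from mult_right_mono[OF this norm_ge_zero[of \<phi>]] show ?thesis by (simp only: mult.assoc)
    qed
    then have "(\<Sum>j\<le>n. weight \<delta> C T (?P n j) * norm \<phi>) \<le> (\<Sum>j\<le>n. (1 / 2) ^ n * (g * ?N ?\<Delta> * norm \<phi>))"
      by (intro sum_mono) simp
    then show ?thesis by (simp add: mult.assoc)
  qed
  \<comment> \<open>\<open>?A j\<close> has \<open>j\<close> copies of \<open>V\<close> followed by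
    \<open>n + 1 - j\<close> copies of \<open>V'\<close>; passing from \<open>?A j\<close> to
    \<open>?A (Suc j)\<close> changes the entry at position \<open>j\<close> alone, which
    \<open>W_diff\<close> turns into \<open>?\<Delta>\<close>.\<close>
  have deq: "?d n t = (\<Sum>j\<le>n. wave \<delta> \<phi> (?P n j) t)" if t: "t \<in> {0..T}" for n t
  proof -
    let ?A = "\<lambda>j. wave \<delta> \<phi> (replicate j V @ replicate (Suc n - j) V') t"
    interpret F: bounded_linear "free_prop t" by (rule bounded_linear_free_prop)
    have L: "V \<in> L2Hs (- 1 / 2 + \<delta>) 0 t" "V' \<in> L2Hs (- 1 / 2 + \<delta>) 0 t" using t V V' L2Hs_subinterval(1) by auto
    have "wave \<delta> \<phi> (?P n j) t = ?A (Suc j) - ?A j" if "j \<le> n" for j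
    proof -
      have "W \<delta> (?P n j) t 0 \<phi> = W \<delta> (replicate j V @ V # replicate (n - j) V') t 0 \<phi> - W \<delta> (replicate j V @ V' # replicate (n - j) V') t 0 \<phi>"
        using t assms(4) L by (intro W_diff[OF est]) (auto simp: set_replicate_conv_if)
      moreover have "replicate (Suc j) V @ replicate (Suc n - Suc j) V' = replicate j V @ V # replicate (n - j) V'"
        by (simp add: replicate_app_Cons_same)
      moreover have "replicate j V @ replicate (Suc n - j) V' = replicate j V @ V' # replicate (n - j) V'"
        using that by (simp add: Suc_diff_le)
      ultimately show ?thesis by (simp only: wave_def[OF est] F.diff)
    qed
    then have "(\<Sum>j\<le>n. wave \<delta> \<phi> (?P n j) t) = (\<Sum>j\<le>n. ?A (Suc j) - ?A j)" by (intro sum.cong) auto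
    also have "\<dots> = (\<Sum>j<Suc n. ?A (Suc j) - ?A j)" by (simp only: lessThan_Suc_atMost)
    also have "\<dots> = ?A (Suc n) - ?A 0" by (rule sum_lessThan_telescope)
    finally show ?thesis by simp
  qed
  have sub: "set (replicate n U) \<subseteq> ?L" if "U \<in> {V, V'}" for n U using that V V' by (auto simp: set_replicate_conv_if)
  have subP: "set (?P n j) \<subseteq> ?L" for n j using V V' \<Delta> by (auto simp: set_replicate_conv_if)
  have wn: "0 \<le> weight \<delta> C T Us * norm \<phi>" if "set Us \<subseteq> ?L" for Us
    unfolding weight_def[OF est] using that g0 N0 by (intro mult_nonneg_nonneg prod_list_map_nonneg) (auto simp: g_def)
  note E = wave_sum_pair_estimate[OF est assms(3,4)]
  have uu: "(\<lambda>t. pair_density (?u U n t) (?u U' m t)) \<in> L2Hs (1 / 2) 0 T"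
      "L2Hs_norm (1 / 2) 0 T (\<lambda>t. pair_density (?u U n t) (?u U' m t)) \<le> ?b n * ?b m"
    if "U \<in> {V, V'}" "U' \<in> {V, V'}" for U U' n m
  proof -
    have e: "?u U n t = (\<Sum>j\<in>{0::nat}. ?u U n t)" for U n t by simp
    note E' = E[of "{0::nat}" "{0::nat}" "\<lambda>j. replicate n U" "\<lambda>j. replicate m U'" "?u U n" \<phi> "?u U' m", OF _ _ sub[OF that(1)] sub[OF that(2)] e e]
    show "(\<lambda>t. pair_density (?u U n t) (?u U' m t)) \<in> L2Hs (1 / 2) 0 T" by (rule E'(1)) auto
    have "L2Hs_norm (1 / 2) 0 T (\<lambda>t. pair_density (?u U n t) (?u U' m t)) \<le>
      (\<Sum>j\<in>{0::nat}. weight \<delta> C T (replicate n U) * norm \<phi>) * (\<Sum>j\<in>{0::nat}. weight \<delta> C T (replicate m U') * norm \<phi>)"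
      by (rule E'(2)) auto
    also have "\<dots> \<le> ?b n * ?b m" using that by (intro mult_mono wu sum_nonneg wn sub) auto
    finally show "L2Hs_norm (1 / 2) 0 T (\<lambda>t. pair_density (?u U n t) (?u U' m t)) \<le> ?b n * ?b m" .
  qed
  have a0: "0 \<le> ?a n" for n using g0 N0[OF \<Delta>] by simp
  have du: "(\<lambda>t. pair_density (?d n t) (?u V m t)) \<in> L2Hs (1 / 2) 0 T"
      "L2Hs_norm (1 / 2) 0 T (\<lambda>t. pair_density (?d n t) (?u V m t)) \<le> ?a n * ?b m" for n m
  proof -
    have e: "?u V m t = (\<Sum>j\<in>{0::nat}. ?u V m t)" for t by simp
    note E' = E[of "{..n}" "{0::nat}" "?P n" "\<lambda>j. replicate m V" "?d n" \<phi> "?u V m", OF _ _ subP sub deq e]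
    show "(\<lambda>t. pair_density (?d n t) (?u V m t)) \<in> L2Hs (1 / 2) 0 T" by (rule E'(1)) auto
    have "L2Hs_norm (1 / 2) 0 T (\<lambda>t. pair_density (?d n t) (?u V m t)) \<le>
      (\<Sum>j\<le>n. weight \<delta> C T (?P n j) * norm \<phi>) * (\<Sum>j\<in>{0::nat}. weight \<delta> C T (replicate m V) * norm \<phi>)"
      by (rule E'(2)) auto
    also have "\<dots> \<le> ?a n * ?b m" by (intro mult_mono wu wd sum_nonneg wn sub a0) auto
    finally show "L2Hs_norm (1 / 2) 0 T (\<lambda>t. pair_density (?d n t) (?u V m t)) \<le> ?a n * ?b m" .
  qed
  have ud: "(\<lambda>t. pair_density (?u V' n t) (?d m t)) \<in> L2Hs (1 / 2) 0 T"
      "L2Hs_norm (1 / 2) 0 T (\<lambda>t. pair_density (?u V' n t) (?d m t)) \<le> ?b n * ?a m" for n m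
  proof -
    have e: "?u V' n t = (\<Sum>j\<in>{0::nat}. ?u V' n t)" for t by simp
    note E' = E[of "{0::nat}" "{..m}" "\<lambda>j. replicate n V'" "?P m" "?u V' n" \<phi> "?d m", OF _ _ sub subP e deq]
    show "(\<lambda>t. pair_density (?u V' n t) (?d m t)) \<in> L2Hs (1 / 2) 0 T" by (rule E'(1)) auto
    have "L2Hs_norm (1 / 2) 0 T (\<lambda>t. pair_density (?u V' n t) (?d m t)) \<le>
      (\<Sum>j\<in>{0::nat}. weight \<delta> C T (replicate n V') * norm \<phi>) * (\<Sum>j\<le>m. weight \<delta> C T (?P m j) * norm \<phi>)"
      by (rule E'(2)) auto
    also have "\<dots> \<le> ?b n * ?a m" by (intro mult_mono wu wd sum_nonneg wn subP) auto
    finally show "L2Hs_norm (1 / 2) 0 T (\<lambda>t. pair_density (?u V' n t) (?d m t)) \<le> ?b n * ?a m" .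
  qed
  have bs: "?b sums (2 * norm \<phi>)"
    using sums_mult2[OF geometric_sums[of "1 / 2 :: real"], of "norm \<phi>"] by simp
  \<comment> \<open>The derivative of the geometric series at 1/2, that is,
    \<open>1 / (1 - 1 / 2)\<^sup>2\<close>.\<close>
  have as: "?a sums (4 * (g * ?N ?\<Delta> * norm \<phi>))"
    using sums_mult2[OF geometric_deriv_sums[of "1 / 2 :: real"], of "g * ?N ?\<Delta> * norm \<phi>"] by (simp add: power2_eq_square)
  have 1: "(\<lambda>t. pair_density (?S V t) (?S V t)) \<in> L2Hs (1 / 2) 0 T"
      "L2Hs_norm (1 / 2) 0 T (\<lambda>t. pair_density (?S V t) (?S V t)) \<le> (2 * norm \<phi>) * (2 * norm \<phi>)"
    by (rule pair_density_sums[OF uu bs bs Ssums Ssums]; simp)+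
  have 2: "(\<lambda>t. pair_density (?S V t - ?S V' t) (?S V t)) \<in> L2Hs (1 / 2) 0 T"
      "L2Hs_norm (1 / 2) 0 T (\<lambda>t. pair_density (?S V t - ?S V' t) (?S V t)) \<le> (4 * (g * ?N ?\<Delta> * norm \<phi>)) * (2 * norm \<phi>)"
    by (rule pair_density_sums[OF du as bs dsums Ssums]; simp)+
  have 3: "(\<lambda>t. pair_density (?S V' t) (?S V t - ?S V' t)) \<in> L2Hs (1 / 2) 0 T"
      "L2Hs_norm (1 / 2) 0 T (\<lambda>t. pair_density (?S V' t) (?S V t - ?S V' t)) \<le> (2 * norm \<phi>) * (4 * (g * ?N ?\<Delta> * norm \<phi>))"
    by (rule pair_density_sums[OF ud bs as Ssums dsums]; simp)+
  let ?D = "\<lambda>t \<eta>. position_density (?S V t) \<eta> - position_density (?S V' t) \<eta>"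
  \<comment> \<open>The mixed term, the density of the pair \<open>(u', u)\<close>, cancels in this
    sum. As functionals the two sides agree on Schwartz functions, where the density is additive in
    each argument; \<open>L2Hs_cong\<close> asks for no more.\<close>
  let ?E = "\<lambda>t \<eta>. pair_density (?S V t - ?S V' t) (?S V t) \<eta> + pair_density (?S V' t) (?S V t - ?S V' t) \<eta>"
  have "?E t \<psi> = ?D t \<psi>" if "\<psi> \<in> schwartz" for t \<psi>
    using linear_diff[OF bounded_linear.linear[OF bounded_linear_pair_left[OF that]]]
      linear_diff[OF bounded_linear.linear[OF bounded_linear_pair_right[OF that]]]
    by (simp flip: pair_density_self)
  then have "AE t in lborel. t \<in> {0..T} \<longrightarrow> (\<forall>\<psi>\<in>schwartz. ?E t (fourier \<psi>) = ?D t (fourier \<psi>))"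
    by (auto simp: schwartz_fourier)
  note D = L2Hs_cong[OF this L2Hs_add(1)[OF 2(1) 3(1)]]
  have "L2Hs_norm (1 / 2) 0 T ?D \<le> 16 * g * ?N ?\<Delta> * (norm \<phi>)\<^sup>2"
    using D(2) L2Hs_add(2)[OF 2(1) 3(1)] 2(2) 3(2) by (simp add: power2_eq_square ac_simps)
  then show ?thesis
    unfolding Let_def using 1 D(1) by (simp add: pair_density_self g power2_eq_square ac_simps)
qed

end
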